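(* Let $f$ be the planar Bargmann-Fock field, let $p>0$, and let $\mathcal{D}_p=f^{-1}([-p,+\infty[)$. Then, for each $\rho>0$ there exists a constant $c=c(p,\rho)>0$ such that for each $R>0$, the probability that there is a continuous path in $\mathcal{D}_p\cap\big([0,\rho R]\times[0,R]\big)$ joining the left side of $[0,\rho R]\times[0,R]$ to its right side is at least $1-e^{-cR}$.
   Context: The planar Bargmann-Fock field is the random real-analytic function on $\mathbb{R}^2$ defined by $f(x)=e^{-\frac12|x|^2}\sum_{i,j\in\mathbb{N}}a_{i,j}\frac{x_1^i x_2^j}{\sqrt{i!\,j!}}$ for $x=(x_1,x_2)\in\mathbb{R}^2$, where $(a_{i,j})_{i,j\in\mathbb{N}}$ are independent centered Gaussian random variables of variance $1$ (the series converges a.s. in $C^\infty(\mathbb{R}^2)$). Equivalently, it is the a.s. continuous centered Gaussian field on $\mathbb{R}^2$ with covariance $\mathbb{E}[f(x)f(y)]=\exp(-\frac12|x-y|^2)$. Here $|\cdot|$ is the Euclidean norm. The left (right) side of $[0,a]\times[0,b]$ is $\{0\}\times[0,b]$ (resp. $\{a\}\times[0,b]$). *)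

theory Defs
  imports "HOL-Probability.Probability"
begin

definition iid_std_normal :: "'w measure \<Rightarrow> (nat \<times> nat \<Rightarrow> 'w \<Rightarrow> real) \<Rightarrow> bool" where
  "iid_std_normal M a \<longleftrightarrow>
     prob_space M \<and>
     prob_space.indep_vars M (\<lambda>_. borel) a UNIV \<and>
     (\<forall>ij. distributed M lborel (a ij) std_normal_density)"

text \<open>
  The plane is \<^typ>\<open>real \<times> real\<close>, whose norm is the Euclidean one. Almost surely the
  series below converges absolutely at every point, so the unordered sum is the sum of
  the series; \<^const>\<open>infsum\<close> takes the value 0 where it diverges, which happens only
  on a null event.
\<close>

definition bargmann_fock ::
    "(nat \<times> nat \<Rightarrow> 'w \<Rightarrow> real) \<Rightarrow> 'w \<Rightarrow> real \<times> real \<Rightarrow> real" where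
  "bargmann_fock a \<omega> x =
     exp (- (norm x)\<^sup>2 / 2) *
     (\<Sum>\<^sub>\<infinity>(i, j)\<in>UNIV. a (i, j) \<omega> * (fst x ^ i * snd x ^ j / sqrt (fact i * fact j)))"

definition crossed_left_right :: "(real \<times> real) set \<Rightarrow> real \<Rightarrow> real \<Rightarrow> bool" where
  "crossed_left_right D w h \<longleftrightarrow>
     (\<exists>g. path g \<and> path_image g \<subseteq> D \<inter> ({0..w} \<times> {0..h}) \<and>
          pathstart g \<in> {0} \<times> {0..h} \<and> pathfinish g \<in> {w} \<times> {0..h})"

text \<open>
  The probability space underlying the coefficients is arbitrary, so path crossing events
  need only be measurable up to null sets; their probability is taken in the completion.
  Since \<^const>\<open>measure\<close> is 0 on non-measurable sets, a positive lower bound for this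
  probability includes the measurability of the event in the completion.
\<close>

definition crossing_prob ::
    "'w measure \<Rightarrow> ('w \<Rightarrow> real \<times> real \<Rightarrow> real) \<Rightarrow> real \<Rightarrow> real \<Rightarrow> real \<Rightarrow> real" where
  "crossing_prob M f p w h =
     measure (completion M) {\<omega> \<in> space M. crossed_left_right (f \<omega> -` {- p..}) w h}"

end

theory Submission imports Defs begin

text \<open>
 Crossing events are written as \<open>l < T f\<close> for functionals \<open>T\<close> that are limits of maxima of minima of finitely
 many values of the field; softened versions are smooth, with a nonnegative gradient of total mass at most 1.
 Gaussian interpolation of covariances then gives positive association (Pitt) and an exponential concentration
 of \<open>T f\<close>, while hypercontractivity makes an average of \<open>T\<close> over vertical translates have small variance.

 By duality (Poincare-Miranda) and symmetry, squares are crossed with probability at least 1/2 at every negative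
 level, so Tassion's argument, using only positive association and symmetries, crosses long rectangles at
 arbitrarily large scales with a probability bounded below. At one large such scale, averaging over translates shows
 that the mean of the ring functional almost reaches the level. If the rectangle is not crossed at a lower
 level, its dual vertical crossing meets about \<open>R\<close> well-spaced cells along a self-avoiding walk of cells, and the
 minimum over nested rings around each of them falls below that level; by concentration this has a probability
 that beats the number of walks.
\<close>

section \<open>Convergence in distribution with weights\<close>

text \<open>Statements about events are replaced by statements about one random level
  \<open>T f\<close>. The functional \<open>T\<close> is monotone and moves by at most
  \<open>c\<close> when the field moves by at most \<open>c\<close>, so that its mean and its
  fluctuations can be compared with a given level. The level \<open>p\<close> is spent in four equal
  steps. At level \<open>- p / 4\<close> long rectangles are crossed with a probability bounded
  below; averaging over translates costs \<open>p / 4\<close> and puts the means of the ring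
  functionals above \<open>- p / 2\<close>; concentration costs \<open>p / 4\<close>; the last
  quarter is the gap that duality needs between its two levels. The obstacle is that a probability
  bounded below does not beat the \<open>9 ^ n\<close> walks in a union bound. It is overcome by
  placing \<open>K\<close> nested rings around each cell: the sum of covariances that enters the
  concentration bound does not depend on \<open>K\<close>, so the exponent grows in proportion to
  \<open>K\<close>. Since the claim concerns every \<open>R > 0\<close>, bounded values of
  \<open>R\<close> are treated apart, by crossings that run along the bottom side.\<close>

type_synonym plane = "real \<times> real"

abbreviation rv where "rv M == borel_measurable M"

abbreviation tends (infix "---->" 60) where "X ----> L == X \<longlonglongrightarrow> L"

abbreviation (in prob_space) mean where "mean == expectation"

text \<open>The law of \<open>Z\<close> under the reweighted measure \<open>V / E V\<close>. Joint
  laws are handled by the one-dimensional theorems of Levy: one variable plays the part of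
  \<open>Z\<close>, and the others enter through the weight.\<close>

definition weighted_distr :: "'c measure => ('c => real) => ('c => real) => real measure" where
 "weighted_distr N V Z = distr (density N (%w. ennreal (V w / (LINT w|N. V w)))) borel Z"

lemma weighted_distr:
 fixes N :: "'c measure" and Z V :: "'c => real" and \<phi> :: "real => real"
 assumes N: "prob_space N" and Z[measurable]: "Z \<in> rv N" and V[measurable]: "V \<in> rv N"
  and VC: "!!w. 1 <= V w" "!!w. V w <= C" and [measurable]: "\<phi> \<in> rv borel"
 shows "1 <= (LINT w|N. V w)" "real_distribution (weighted_distr N V Z)"
  "char (weighted_distr N V Z) t = (CLINT w|N. of_real (V w) * iexp (t * Z w)) / of_real (LINT w|N. V w)"
  "(LINT w|N. V w * \<phi> (Z w)) = (LINT w|N. V w) * (LINT x|(weighted_distr N V Z). \<phi> x)"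
proof -
 interpret N: prob_space N by fact
 have V0: "0 <= V w" for w using VC(1)[of w] by simp
 have iV: "integrable N V" by (rule N.integrable_const_bound[of _ C]) (use VC V0 in auto)
 define m where "m = (LINT w|N. V w)"
 have "(LINT w|N. 1) <= m" unfolding m_def by (intro integral_mono iV VC) simp
 hence m1: "1 <= m" by (simp add: N.prob_space)
 define Q where "Q = density N (%w. ennreal (V w / m))"
 have "emeasure Q (space Q) = ennreal (LINT w|N. V w / m)"
  unfolding Q_def using iV V0 m1 by (simp add: emeasure_density nn_integral_eq_integral cong: nn_integral_cong_simp)
 also have "... = 1" using m1 by (simp add: m_def)
 finally have pQ: "prob_space Q" by (rule prob_spaceI)
 interpret Q: prob_space Q by fact
 have mZ[measurable]: "Z \<in> rv Q" unfolding Q_def by simp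
 define P where "P = weighted_distr N V Z"
 have P_eq: "P = distr Q borel Z" unfolding P_def weighted_distr_def Q_def m_def ..
 have P: "real_distribution P" unfolding P_eq by (rule Q.real_distribution_distr) simp
 have ch: "char P t = (CLINT w|N. of_real (V w) * iexp (t * Z w)) / of_real m" for t
 proof -
  have "char P t = (CLINT w|Q. iexp (t * Z w))"
   unfolding char_def P_eq by (subst integral_distr) auto
  also have "... = (CLINT w|N. (V w / m) *\<^sub>R iexp (t * Z w))"
   unfolding Q_def using V0 m1 by (subst integral_density) auto
  also have "... = (CLINT w|N. (of_real (V w) * iexp (t * Z w)) / of_real m)"
   by (rule Bochner_Integration.integral_cong[OF refl]) (simp only: scaleR_conv_of_real of_real_divide times_divide_eq_left)
  also have "... = (CLINT w|N. of_real (V w) * iexp (t * Z w)) / of_real m" by (rule integral_divide_zero)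
  finally show ?thesis .
 qed
 have "(LINT x|P. \<phi> x) = (LINT w|Q. \<phi> (Z w))" unfolding P_eq by (subst integral_distr) auto
 also have "... = (LINT w|N. (V w / m) *\<^sub>R \<phi> (Z w))"
  unfolding Q_def using V0 m1 by (subst integral_density) auto
 finally have "(LINT w|N. V w * \<phi> (Z w)) = m * (LINT x|P. \<phi> x)" using m1 by simp
 thus "(LINT w|N. V w * \<phi> (Z w)) = (LINT w|N. V w) * (LINT x|(weighted_distr N V Z). \<phi> x)"
  unfolding P_def m_def .
 show "1 <= (LINT w|N. V w)" using m1 unfolding m_def .
 show "real_distribution (weighted_distr N V Z)" using P unfolding P_def .
 show "char (weighted_distr N V Z) t = (CLINT w|N. of_real (V w) * iexp (t * Z w)) / of_real (LINT w|N. V w)"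
  using ch unfolding P_def m_def .
qed

text \<open>The case \<open>t = 0\<close> of \<open>eq\<close> equates the normalizing constants;
  after division the two reweighted laws have the same characteristic function.\<close>

lemma weighted_distr_eq:
 assumes M: "prob_space M" and N: "prob_space N" and X: "X \<in> rv M" and Y: "Y \<in> rv N"
  and U: "U \<in> rv M" "!!w. 1 <= U w" "!!w. U w <= C" and V: "V \<in> rv N" "!!w. 1 <= V w" "!!w. V w <= C"
  and eq: "!!t. (CLINT w|M. of_real (U w) * iexp (t * X w)) = (CLINT w|N. of_real (V w) * iexp (t * Y w))"
  and \<phi>: "\<phi> \<in> rv borel"
 shows "(LINT w|M. U w * \<phi> (X w)) = (LINT w|N. V w * \<phi> (Y w))"
proof -
 note A = weighted_distr[OF M X U \<phi>] and B = weighted_distr[OF N Y V \<phi>]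
 have m: "(LINT w|M. U w) = (LINT w|N. V w)" using eq[of 0] by simp
 have "weighted_distr M U X = weighted_distr N V Y"
  by (intro Levy_uniqueness A(2) B(2) ext) (simp only: A(3) B(3) eq m)
 thus ?thesis unfolding A(4) B(4) m by simp
qed

text \<open>Here too \<open>t = 0\<close> controls the normalizing constants. They are at least 1,
  so dividing by them is harmless in the limit.\<close>

lemma weighted_levy_continuity:
 fixes X :: "nat => 'a => real" and X' :: "'b => real" and \<phi> :: "real => real"
 assumes M: "!!n. prob_space (M n)" and M': "prob_space M'"
  and X: "!!n. X n \<in> rv (M n)" and X': "X' \<in> rv M'"
  and U: "!!n. U n \<in> rv (M n)" and U': "U' \<in> rv M'"
  and UC: "!!n w. 1 <= U n w" "!!n w. U n w <= C" and UC': "!!w. 1 <= U' w" "!!w. U' w <= C"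
  and conv: "!!t. (%n. CLINT w|M n. of_real (U n w) * iexp (t * X n w)) ----> (CLINT w|M'. of_real (U' w) * iexp (t * X' w))"
  and \<phi>: "continuous_on UNIV \<phi>" "!!x. \<bar>\<phi> x\<bar> <= B"
 shows "(%n. (LINT w|(M n). U n w * \<phi> (X n w))) ----> (LINT w|M'. U' w * \<phi> (X' w))"
proof -
 have m\<phi>: "\<phi> \<in> rv borel" using \<phi>(1) by (rule borel_measurable_continuous_onI)
 define m where "m n = (LINT w|(M n). U n w)" for n
 define P where "P n = weighted_distr (M n) (U n) (X n)" for n
 define m' where "m' = (LINT w|M'. U' w)"
 define P' where "P' = weighted_distr M' U' X'"
 note mP = m_def weighted_distr[OF M X U UC m\<phi>, folded m_def P_def]
 note mP' = m'_def weighted_distr[OF M' X' U' UC' m\<phi>, folded m'_def P'_def]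
 have "(%n. complex_of_real (m n)) ----> complex_of_real m'"
  using conv[of 0] by (simp add: mP(1) mP'(1))
 hence mc: "m ----> m'" by (simp add: tendsto_of_real_iff)
 have "(%n. char (P n) t) ----> char P' t" for t
  unfolding mP(4) mP'(4) using mP'(2) by (intro tendsto_divide conv tendsto_of_real mc) auto
 hence "weak_conv_m P P'" by (intro levy_continuity mP(3) mP'(3))
 hence "(%n. (LINT x|(P n). \<phi> x)) ----> (LINT x|P'. \<phi> x)"
  by (intro weak_conv_imp_integral_bdd_continuous_conv[OF mP(3) mP'(3), where B=B])
   (use \<phi> in \<open>auto simp: continuous_on_eq_continuous_at\<close>)
 thus ?thesis unfolding mP(5) mP'(5) by (intro tendsto_mult mc)
qed

text \<open>
 A complex weight \<open>W\<close> of modulus at most 1 is reduced to the weights \<open>2 + Re W\<close>, \<open>2 + Im W\<close> and 1,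
 which are bounded away from 0.
\<close>

lemma complex_weight:
 fixes W :: "'c => complex"
 assumes N: "prob_space N" and Z [measurable]: "Z \<in> rv N" and W [measurable]: "W \<in> rv N" and W1: "!!w. norm (W w) <= 1"
 defines "C \<equiv> %t. CLINT w|N. iexp (t * Z w)" and "D \<equiv> %t. CLINT w|N. W w * iexp (t * Z w)"
 shows "(CLINT w|N. of_real (2 + Re (W w)) * iexp (t * Z w)) = 2 * C t + (D t + cnj (D (- t))) / 2"
  "(CLINT w|N. of_real (2 + Im (W w)) * iexp (t * Z w)) = 2 * C t - \<i> * (D t - cnj (D (- t))) / 2"
  "\<phi> \<in> rv borel ==> (!!x. \<bar>\<phi> x\<bar> <= B) ==> (CLINT w|N. W w * of_real (\<phi> (Z w))) =
    of_real ((LINT w|N. (2 + Re (W w)) * \<phi> (Z w)) - 2 * (LINT w|N. 1 * \<phi> (Z w))) +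
    \<i> * of_real ((LINT w|N. (2 + Im (W w)) * \<phi> (Z w)) - 2 * (LINT w|N. 1 * \<phi> (Z w)))"
proof -
 interpret N: prob_space N by fact
 have i: "complex_integrable N (%w. iexp (t * Z w))" "complex_integrable N (%w. W w * iexp (t * Z w))" for t
  by (rule N.integrable_const_bound[of _ 1]; use W1 in \<open>simp add: norm_mult\<close>)+
 have ic: "complex_integrable N (%w. cnj (W w * iexp (- t * Z w)))" for t using i(2)[of "- t"] by (subst complex_integrable_cnj) simp
 have c: "cnj (D (- t)) = (CLINT w|N. cnj (W w * iexp (- t * Z w)))" for t unfolding D_def Bochner_Integration.integral_cnj ..
 have e1: "of_real (2 + Re z) * iexp (t * x) = 2 * iexp (t * x) + (z * iexp (t * x) + cnj (z * iexp (- t * x))) / 2" for x and z :: complex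
  by (simp add: complex_eq_iff Re_exp Im_exp algebra_simps)
 have e2: "of_real (2 + Im z) * iexp (t * x) = 2 * iexp (t * x) - \<i> * (z * iexp (t * x) - cnj (z * iexp (- t * x))) / 2" for x and z :: complex
  by (simp add: complex_eq_iff Re_exp Im_exp algebra_simps)
 show "(CLINT w|N. of_real (2 + Re (W w)) * iexp (t * Z w)) = 2 * C t + (D t + cnj (D (- t))) / 2"
  unfolding e1 c C_def using i[of t] ic[of t] by (simp add: D_def)
 show "(CLINT w|N. of_real (2 + Im (W w)) * iexp (t * Z w)) = 2 * C t - \<i> * (D t - cnj (D (- t))) / 2"
  unfolding e2 c C_def using i[of t] ic[of t] by (simp add: D_def)
 assume \<phi>: "\<phi> \<in> rv borel" "!!x. \<bar>\<phi> x\<bar> <= B"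
 note [measurable] = \<phi>(1)
 have Wr: "\<bar>Re (W w)\<bar> <= 1" "\<bar>Im (W w)\<bar> <= 1" for w using W1[of w] abs_Re_le_cmod[of "W w"] abs_Im_le_cmod[of "W w"] by linarith+
 have j: "integrable N (%w. \<phi> (Z w))" by (rule N.integrable_const_bound[of _ B]) (use \<phi> in auto)
 have jc: "complex_integrable N (%w. W w * of_real (\<phi> (Z w)))"
  by (rule Bochner_Integration.integrable_bound[OF j]) (use W1 in \<open>auto simp: norm_mult intro!: mult_left_le_one_le\<close>)
 have jR: "integrable N (%w. Re (W w) * \<phi> (Z w))" "integrable N (%w. Im (W w) * \<phi> (Z w))"
  by (rule Bochner_Integration.integrable_bound[OF j]; use Wr in \<open>auto simp: abs_mult intro!: mult_left_le_one_le\<close>)+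
 show "(CLINT w|N. W w * of_real (\<phi> (Z w))) =
    of_real ((LINT w|N. (2 + Re (W w)) * \<phi> (Z w)) - 2 * (LINT w|N. 1 * \<phi> (Z w))) +
    \<i> * of_real ((LINT w|N. (2 + Im (W w)) * \<phi> (Z w)) - 2 * (LINT w|N. 1 * \<phi> (Z w)))"
  using j jR integral_Re[OF jc] integral_Im[OF jc] by (simp add: complex_eq_iff distrib_right)
qed

lemma complex_weight_eq:
 assumes M: "prob_space M" and X: "X \<in> rv M" and W: "W \<in> rv M" "!!w. norm (W w) <= (1::real)"
  and N: "prob_space N" and Y: "Y \<in> rv N" and V: "V \<in> rv N" "!!w. norm (V w) <= (1::real)"
  and eq: "!!t. (CLINT w|M. iexp (t * X w)) = (CLINT w|N. iexp (t * Y w))"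
   "!!t. (CLINT w|M. W w * iexp (t * X w)) = (CLINT w|N. V w * iexp (t * Y w))"
  and \<phi>: "\<phi> \<in> rv borel" "!!x. \<bar>\<phi> x\<bar> <= (B::real)"
 shows "(CLINT w|M. W w * of_real (\<phi> (X w))) = (CLINT w|N. V w * of_real (\<phi> (Y w)))"
proof -
 have b: "1 <= 2 + Re z" "2 + Re z <= 3" "1 <= 2 + Im z" "2 + Im z <= 3" if "norm z <= 1" for z
  using that abs_Re_le_cmod[of z] abs_Im_le_cmod[of z] by linarith+
 note [measurable] = X Y W(1) V(1) and e = weighted_distr_eq[where C=3, OF M N X Y _ _ _ _ _ _ _ \<phi>(1)]
 note cW = complex_weight[OF M X W] and cV = complex_weight[OF N Y V]
 have "(LINT w|M. (2 + Re (W w)) * \<phi> (X w)) = (LINT w|N. (2 + Re (V w)) * \<phi> (Y w))"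
  by (rule e[OF _ b(1)[OF W(2)] b(2)[OF W(2)] _ b(1)[OF V(2)] b(2)[OF V(2)]]) (measurable, measurable, simp only: cW(1) cV(1) eq)
 moreover have "(LINT w|M. (2 + Im (W w)) * \<phi> (X w)) = (LINT w|N. (2 + Im (V w)) * \<phi> (Y w))"
  by (rule e[OF _ b(3)[OF W(2)] b(4)[OF W(2)] _ b(3)[OF V(2)] b(4)[OF V(2)]]) (measurable, measurable, simp only: cW(2) cV(2) eq)
 moreover have "(LINT w|M. 1 * \<phi> (X w)) = (LINT w|N. 1 * \<phi> (Y w))" by (rule e) (simp_all only: of_real_1 mult_1_left eq(1) borel_measurable_const order_refl one_le_numeral)
 ultimately show ?thesis unfolding cW(3)[OF \<phi>] cV(3)[OF \<phi>] by simp
qed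

lemma complex_weight_levy:
 assumes M: "!!n. prob_space (M n)" and X: "!!n. X n \<in> rv (M n)" and W: "!!n. W n \<in> rv (M n)" "!!n w. norm (W n w) <= (1::real)"
  and N: "prob_space N" and Y: "Y \<in> rv N" and V: "V \<in> rv N" "!!w. norm (V w) <= (1::real)"
  and conv: "!!t. (%n. CLINT w|M n. iexp (t * X n w)) ----> (CLINT w|N. iexp (t * Y w))"
   "!!t. (%n. CLINT w|M n. W n w * iexp (t * X n w)) ----> (CLINT w|N. V w * iexp (t * Y w))"
  and \<phi>: "continuous_on UNIV \<phi>" "!!x. \<bar>\<phi> x\<bar> <= (B::real)"
 shows "(%n. CLINT w|M n. W n w * of_real (\<phi> (X n w))) ----> (CLINT w|N. V w * of_real (\<phi> (Y w)))"
proof -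
 have b: "1 <= 2 + Re z" "2 + Re z <= 3" "1 <= 2 + Im z" "2 + Im z <= 3" if "norm z <= 1" for z
  using that abs_Re_le_cmod[of z] abs_Im_le_cmod[of z] by linarith+
 note [measurable] = X Y W(1) V(1) and l = weighted_levy_continuity[where C=3, OF M N X Y _ _ _ _ _ _ _ \<phi>]
 have \<phi>m: "\<phi> \<in> rv borel" by (rule borel_measurable_continuous_onI[OF \<phi>(1)])
 note cW = complex_weight[OF M X W] and cV = complex_weight[OF N Y V]
 have m: "(%w. 2 + Re (W n w)) \<in> rv (M n)" "(%w. 2 + Im (W n w)) \<in> rv (M n)" "(%w. 2 + Re (V w)) \<in> rv N" "(%w. 2 + Im (V w)) \<in> rv N" for n by measurable
 have 1: "(%n. LINT w|(M n). (2 + Re (W n w)) * \<phi> (X n w)) ----> (LINT w|N. (2 + Re (V w)) * \<phi> (Y w))"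
  by (rule l[OF m(1,3) b(1)[OF W(2)] b(2)[OF W(2)] b(1)[OF V(2)] b(2)[OF V(2)]]) (unfold cW(1) cV(1), intro tendsto_intros conv; simp)
 have 2: "(%n. LINT w|(M n). (2 + Im (W n w)) * \<phi> (X n w)) ----> (LINT w|N. (2 + Im (V w)) * \<phi> (Y w))"
  by (rule l[OF m(2,4) b(3)[OF W(2)] b(4)[OF W(2)] b(3)[OF V(2)] b(4)[OF V(2)]]) (unfold cW(2) cV(2), intro tendsto_intros conv; simp)
 have 3: "(%n. LINT w|(M n). 1 * \<phi> (X n w)) ----> (LINT w|N. 1 * \<phi> (Y w))"
  by (rule l) (use conv(1) in auto)
 show ?thesis unfolding cW(3)[OF \<phi>m \<phi>(2)] cV(3)[OF \<phi>m \<phi>(2)] by (intro tendsto_intros 1 2 3)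
qed

lemma emeasure_distr_PiE:
 assumes Q: "prob_space Q" and V: "finite V" and Z [measurable]: "!!v. v \<in> V ==> Z v \<in> rv Q"
  and A [measurable]: "!!v. v \<in> V ==> A v \<in> sets borel"
 shows "emeasure (distr Q (\<Pi>\<^sub>M v\<in>V. borel) (%u. \<lambda>v\<in>V. Z v u)) (PiE V A) = ennreal (LINT u|Q. (\<Prod>v\<in>V. indicator (A v) (Z v u)))"
proof -
 interpret Q: prob_space Q by fact
 let ?E = "{u \<in> space Q. \<forall>v\<in>V. Z v u \<in> A v}"
 have E: "?E \<in> sets Q" using V by measurable
 have "(LINT u|Q. (\<Prod>v\<in>V. indicator (A v) (Z v u) :: real)) = (LINT u|Q. indicator ?E u)"
  by (rule Bochner_Integration.integral_cong) (auto simp: indicator_def prod_zero_iff V)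
 moreover have "emeasure (distr Q (\<Pi>\<^sub>M v\<in>V. borel) (%u. \<lambda>v\<in>V. Z v u)) (PiE V A) = emeasure Q ?E"
  by (subst emeasure_distr) (auto simp: restrict_PiE_iff intro!: sets_PiM_I_finite V A arg_cong[where f="emeasure Q"])
 ultimately show ?thesis using E by (simp add: Q.emeasure_eq_measure)
qed

text \<open>One coordinate is treated at a time. In the auxiliary claim the coordinates in
  \<open>J\<close> already carry indicators of Borel sets, while the others still carry
  exponentials. Moving \<open>w\<close> into \<open>J\<close> is one-dimensional uniqueness for
  \<open>X w\<close> with everything else as a complex weight; for \<open>J = V\<close> only product
  sets remain.\<close>

lemma distr_eq_if_char_eq:
 fixes X :: "'v => 'a => real" and Y :: "'v => 'b => real"
 assumes M: "prob_space M" and N: "prob_space N" and V: "finite V"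
  and X [measurable]: "!!v. v \<in> V ==> X v \<in> rv M"
  and Y [measurable]: "!!v. v \<in> V ==> Y v \<in> rv N"
  and eq: "!!c. (CLINT u|M. iexp (\<Sum>v\<in>V. c v * X v u)) = (CLINT u|N. iexp (\<Sum>v\<in>V. c v * Y v u))"
 shows "distr M (\<Pi>\<^sub>M v\<in>V. borel) (%u. \<lambda>v\<in>V. X v u) = distr N (\<Pi>\<^sub>M v\<in>V. borel) (%u. \<lambda>v\<in>V. Y v u)"
proof -
 interpret M: prob_space M by fact
 interpret N: prob_space N by fact
 have *: "(CLINT u|M. of_real (\<Prod>v\<in>J. indicator (B v) (X v u)) * iexp (\<Sum>v\<in>V-J. c v * X v u)) =
   (CLINT u|N. of_real (\<Prod>v\<in>J. indicator (B v) (Y v u)) * iexp (\<Sum>v\<in>V-J. c v * Y v u))"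
  if "finite J" "J \<subseteq> V" "!!v. v \<in> V ==> B v \<in> sets borel" for J B c
  using that(1,2)
 proof (induction J arbitrary: c rule: finite_subset_induct')
  case empty
  then show ?case using eq by (simp only: prod.empty Diff_empty of_real_1 mult_1_left)
 next
  case (insert w J)
  let ?W = "%X u. complex_of_real (\<Prod>v\<in>J. indicator (B v) (X v u)) * iexp (\<Sum>v\<in>V - insert w J. c v * X v u)"
  have J: "v \<in> V" if "v \<in> J" for v using insert.hyps that by auto
  have n: "norm (complex_of_real (\<Prod>v\<in>J. indicator (B v) (x v)) * iexp s) <= 1" for x :: "'v => real" and s
  proof -
   have "0 <= (\<Prod>v\<in>J. indicator (B v) (x v) :: real)" "(\<Prod>v\<in>J. indicator (B v) (x v) :: real) <= 1" by (auto intro!: prod_nonneg prod_le_1)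
   thus ?thesis by (simp only: norm_mult norm_of_real norm_exp_i_times abs_of_nonneg mult_1_right)
  qed
  have [measurable]: "(%u. \<Prod>v\<in>J. indicator (B v) (X v u) :: real) \<in> rv M" "(%u. \<Prod>v\<in>J. indicator (B v) (Y v u) :: real) \<in> rv N"
   using that(3) J by (auto intro!: borel_measurable_prod borel_measurable_indicator' X Y)
  have Wm: "?W X \<in> rv M" "?W Y \<in> rv N" by measurable
  have Vw: "V - J = insert w (V - insert w J)" using insert.hyps by auto
  have sw: "(\<Sum>v\<in>V-J. (if v = w then t else c v) * x v) = t * x w + (\<Sum>v\<in>V - insert w J. c v * x v)" for t and x :: "'v => real"
   unfolding Vw using V by (subst sum.insert) (auto intro!: sum.cong)
  have e: "?W Z u * iexp (t * Z w u) = of_real (\<Prod>v\<in>J. indicator (B v) (Z v u)) * iexp (\<Sum>v\<in>V-J. (if v = w then t else c v) * Z v u)" for Z :: "'v => 'c => real" and u t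
   unfolding sw by (simp add: exp_add distrib_left)
  have d: "(\<Sum>v\<in>V. (if v = w then t else 0) * x v) = t * x w" for t and x :: "'v => real" using V insert.hyps by (simp add: if_distrib[of "%x. x * _"] cong: if_cong)
  have "(CLINT u|M. ?W X u * of_real (indicator (B w) (X w u))) = (CLINT u|N. ?W Y u * of_real (indicator (B w) (Y w u)))"
  proof (rule complex_weight_eq[where \<phi>="indicator (B w)" and X="X w" and Y="Y w" and B=1, OF M _ Wm(1) n N _ Wm(2) n])
   show "(CLINT u|M. ?W X u * iexp (t * X w u)) = (CLINT u|N. ?W Y u * iexp (t * Y w u))" for t unfolding e by (rule insert.IH)
   show "(CLINT u|M. iexp (t * X w u)) = (CLINT u|N. iexp (t * Y w u))" for t using eq[of "%v. if v = w then t else 0"] unfolding d .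
  qed (use insert.hyps that(3) in \<open>auto simp: indicator_def\<close>)
  thus ?case using insert.hyps by (simp add: mult_ac)
 qed
 let ?B = "\<Pi>\<^sub>M v\<in>V. borel :: real measure"
 interpret d: prob_space "distr M ?B (%u. \<lambda>v\<in>V. X v u)" by (rule M.prob_space_distr) simp
 show ?thesis
 proof (rule measure_eqI_PiM_finite[OF V])
  fix A :: "'v => real set" assume A: "!!i. i \<in> V ==> A i \<in> sets borel"
  have "complex_of_real (LINT u|M. (\<Prod>v\<in>V. indicator (A v) (X v u))) = of_real (LINT u|N. (\<Prod>v\<in>V. indicator (A v) (Y v u)))"
   using *[OF V order_refl, of A "%_. 0"] A by (simp flip: integral_complex_of_real)
  thus "emeasure (distr M ?B (%u. \<lambda>v\<in>V. X v u)) (PiE V A) = emeasure (distr N ?B (%u. \<lambda>v\<in>V. Y v u)) (PiE V A)"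
   using emeasure_distr_PiE[OF M V X A] emeasure_distr_PiE[OF N V Y A] unfolding of_real_eq_iff by simp
 next
  show "range (%_::nat. space ?B) \<subseteq> prod_algebra V (%_. borel)"
   by (auto simp: space_PiM intro!: prod_algebraI_finite V)
  show "(\<Union>i::nat. space ?B) = space ?B" by auto
  show "emeasure (distr M ?B (%u. \<lambda>v\<in>V. X v u)) (space ?B) \<noteq> \<infinity>" for i :: nat
   using d.emeasure_finite by (metis infinity_ennreal_def)
 qed simp_all
qed

section \<open>Gaussian families and interpolation\<close>

text \<open>Centred Gaussian vectors are given by their characteristic function, so that degenerate
  covariances, such as those of linear images and of residuals, are included.\<close>

definition gauss_family ::
 "'w measure => 'v set => ('v => 'w => real) => ('v => 'v => real) => bool" where
 "gauss_family M V X Q \<longleftrightarrow> prob_space M \<and> finite V \<and> (\<forall>v\<in>V. X v \<in> rv M) \<and>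
   (\<forall>c. (CLINT z|M. iexp (\<Sum>v\<in>V. c v * X v z)) =
     of_real (exp (- (\<Sum>v\<in>V. \<Sum>w\<in>V. c v * c w * Q v w) / 2)))"

lemma gauss_familyD:
 assumes "gauss_family M V X Q"
 shows "prob_space M" "finite V" "!!v. v \<in> V ==> X v \<in> rv M"
  "(CLINT z|M. iexp (\<Sum>v\<in>V. c v * X v z)) = of_real (exp (- (\<Sum>v\<in>V. \<Sum>w\<in>V. c v * c w * Q v w) / 2))"
 using assms unfolding gauss_family_def by auto

lemma gauss_family_cong:
 assumes "gauss_family M V X Q" "!!v z. v \<in> V ==> X v z = Y v z" "!!v w. v \<in> V ==> w \<in> V ==> Q v w = Q' v w"
 shows "gauss_family M V Y Q'"
proof -
 have "X v = Y v" if "v \<in> V" for v using assms(2) that by auto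
 moreover have "(\<Sum>v\<in>V. \<Sum>w\<in>V. c v * c w * Q v w) = (\<Sum>v\<in>V. \<Sum>w\<in>V. c v * c w * Q' v w)" for c
  using assms(3) by (intro sum.cong) auto
 moreover have "(\<Sum>v\<in>V. c v * X v z) = (\<Sum>v\<in>V. c v * Y v z)" for c z
  using assms(2) by (intro sum.cong) auto
 ultimately show ?thesis using assms(1) unfolding gauss_family_def by simp
qed

lemma gauss_family_distr_eq:
 assumes 1: "gauss_family M V X Q" and 2: "gauss_family N V Y Q'" and Q: "!!v w. v \<in> V ==> w \<in> V ==> Q v w = Q' v w"
 shows "distr M (\<Pi>\<^sub>M v\<in>V. borel) (%z. \<lambda>v\<in>V. X v z) = distr N (\<Pi>\<^sub>M v\<in>V. borel) (%z. \<lambda>v\<in>V. Y v z)"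
proof (rule distr_eq_if_char_eq)
 fix c
 have "(\<Sum>v\<in>V. \<Sum>w\<in>V. c v * c w * Q v w) = (\<Sum>v\<in>V. \<Sum>w\<in>V. c v * c w * Q' v w)"
  using Q by (intro sum.cong) auto
 thus "(CLINT z|M. iexp (\<Sum>v\<in>V. c v * X v z)) = (CLINT z|N. iexp (\<Sum>v\<in>V. c v * Y v z))"
  by (simp only: gauss_familyD(4)[OF 1] gauss_familyD(4)[OF 2])
qed (use gauss_familyD[OF 1] gauss_familyD[OF 2] in auto)

lemma gauss_transfer:
 fixes \<Phi> :: "('v => real) => real"
 assumes 1: "gauss_family M V X Q" and 2: "gauss_family N V Y Q'" and Q: "!!v w. v \<in> V ==> w \<in> V ==> Q v w = Q' v w"
  and [measurable]: "\<Phi> \<in> rv (\<Pi>\<^sub>M v\<in>V. borel)"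
 shows "(LINT z|M. \<Phi> (\<lambda>v\<in>V. X v z)) = (LINT z|N. \<Phi> (\<lambda>v\<in>V. Y v z))"
proof -
 have [measurable]: "X v \<in> rv M" "Y v \<in> rv N" if "v \<in> V" for v
  using gauss_familyD(3)[OF 1] gauss_familyD(3)[OF 2] that by auto
 have "(LINT z|M. \<Phi> (\<lambda>v\<in>V. X v z)) = (LINT x|(distr M (\<Pi>\<^sub>M v\<in>V. borel) (%z. \<lambda>v\<in>V. X v z)). \<Phi> x)"
  by (subst integral_distr) auto
 also have "... = (LINT x|(distr N (\<Pi>\<^sub>M v\<in>V. borel) (%z. \<lambda>v\<in>V. Y v z)). \<Phi> x)"
  using gauss_family_distr_eq[OF 1 2 Q] by simp
 also have "... = (LINT z|N. \<Phi> (\<lambda>v\<in>V. Y v z))"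
  by (subst integral_distr) auto
 finally show ?thesis .
qed

lemma gauss_family_linear:
 fixes A :: "'j => 'v => real"
 assumes 1: "gauss_family M V X Q" and J: "finite J"
 shows "gauss_family M J (%j z. \<Sum>v\<in>V. A j v * X v z) (%j k. \<Sum>v\<in>V. \<Sum>w\<in>V. A j v * A k w * Q v w)"
 unfolding gauss_family_def
proof (intro conjI allI ballI)
 show "prob_space M" "finite J" using gauss_familyD[OF 1] J by auto
 show "(%z. \<Sum>v\<in>V. A j v * X v z) \<in> rv M" for j
  using gauss_familyD(3)[OF 1] by auto
 fix c :: "'j => real"
 define d where "d v = (\<Sum>j\<in>J. c j * A j v)" for v
 have a: "(\<Sum>j\<in>J. c j * (\<Sum>v\<in>V. A j v * X v z)) = (\<Sum>v\<in>V. d v * X v z)" for z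
 proof -
  have "(\<Sum>j\<in>J. c j * (\<Sum>v\<in>V. A j v * X v z)) = (\<Sum>j\<in>J. \<Sum>v\<in>V. c j * A j v * X v z)"
   by (simp add: sum_distrib_left mult.assoc)
  also have "... = (\<Sum>v\<in>V. \<Sum>j\<in>J. c j * A j v * X v z)" by (rule sum.swap)
  also have "... = (\<Sum>v\<in>V. d v * X v z)" by (simp add: d_def sum_distrib_right)
  finally show ?thesis .
 qed
 have "(\<Sum>j\<in>J. \<Sum>k\<in>J. c j * c k * (\<Sum>v\<in>V. \<Sum>w\<in>V. A j v * A k w * Q v w))
   = (\<Sum>j\<in>J. \<Sum>k\<in>J. \<Sum>v\<in>V. \<Sum>w\<in>V. (c j * A j v) * (c k * A k w) * Q v w)"
  by (simp add: sum_distrib_left mult_ac)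
 also have "... = (\<Sum>v\<in>V. \<Sum>w\<in>V. \<Sum>j\<in>J. \<Sum>k\<in>J. (c j * A j v) * (c k * A k w) * Q v w)"
  by (simp only: sum.swap[of _ J V])
 also have "... = (\<Sum>v\<in>V. \<Sum>w\<in>V. d v * d w * Q v w)"
 proof (intro sum.cong refl)
  fix v w
  show "(\<Sum>j\<in>J. \<Sum>k\<in>J. (c j * A j v) * (c k * A k w) * Q v w) = d v * d w * Q v w"
   unfolding d_def sum_product by (simp add: sum_distrib_right)
 qed
 finally have b: "(\<Sum>j\<in>J. \<Sum>k\<in>J. c j * c k * (\<Sum>v\<in>V. \<Sum>w\<in>V. A j v * A k w * Q v w)) = (\<Sum>v\<in>V. \<Sum>w\<in>V. d v * d w * Q v w)" .
 show "(CLINT z|M. iexp (\<Sum>j\<in>J. c j * (\<Sum>v\<in>V. A j v * X v z))) =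
   of_real (exp (- (\<Sum>j\<in>J. \<Sum>k\<in>J. c j * c k * (\<Sum>v\<in>V. \<Sum>w\<in>V. A j v * A k w * Q v w)) / 2))"
  unfolding a b by (rule gauss_familyD(4)[OF 1])
qed

lemma gauss_family_reindex:
 assumes 1: "gauss_family M V X Q" and J: "finite J" and v: "!!j. j \<in> J ==> p j \<in> V"
 shows "gauss_family M J (%j z. \<alpha> j * X (p j) z) (%j k. \<alpha> j * \<alpha> k * Q (p j) (p k))"
proof (rule gauss_family_cong[OF gauss_family_linear[OF 1 J, of "%j v. if v = p j then \<alpha> j else 0"]])
 note V = gauss_familyD(2)[OF 1]
 show "(\<Sum>v\<in>V. (if v = p j then \<alpha> j else 0) * X v z) = \<alpha> j * X (p j) z" if "j \<in> J" for j z
  using V v[OF that] by (simp add: if_distrib[where f="%x. x * _"] cong: if_cong)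
 show "(\<Sum>v\<in>V. \<Sum>w\<in>V. (if v = p j then \<alpha> j else 0) * (if w = p k then \<alpha> k else 0) * Q v w) = \<alpha> j * \<alpha> k * Q (p j) (p k)"
  if "j \<in> J" "k \<in> J" for j k
  using V v[OF that(1)] v[OF that(2)] by (simp add: if_distrib[where f="%x. x * _"] if_distrib[where f="%x. _ * x"] sum.If_cases cong: if_cong)
qed

lemma gauss_family_pair:
 fixes J :: "'j set"
 assumes 1: "gauss_family M J X Q" and 2: "gauss_family N J Y Q'"
 shows "gauss_family (M \<Otimes>\<^sub>M N) J (%j z. X j (fst z) + Y j (snd z)) (%j k. Q j k + Q' j k)"
proof -
 interpret M: prob_space M by (rule gauss_familyD[OF 1])
 interpret N: prob_space N by (rule gauss_familyD[OF 2])
 interpret MN: pair_prob_space M N ..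
 have [measurable]: "X j \<in> rv M" "Y j \<in> rv N" if "j \<in> J" for j
  using gauss_familyD(3)[OF 1] gauss_familyD(3)[OF 2] that by auto
 show ?thesis
  unfolding gauss_family_def
 proof (intro conjI allI ballI)
  show "prob_space (M \<Otimes>\<^sub>M N)" by unfold_locales
  show "finite J" by (rule gauss_familyD[OF 1])
  show "(%z. X j (fst z) + Y j (snd z)) \<in> rv (M \<Otimes>\<^sub>M N)" if "j \<in> J" for j
   using that by measurable
  fix c :: "'j => real"
  let ?a = "%z. iexp (\<Sum>j\<in>J. c j * X j z)" and ?b = "%z. iexp (\<Sum>j\<in>J. c j * Y j z)"
  have "(CLINT z|M \<Otimes>\<^sub>M N. iexp (\<Sum>j\<in>J. c j * (X j (fst z) + Y j (snd z)))) = (CLINT z|M \<Otimes>\<^sub>M N. ?a (fst z) * ?b (snd z))"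
   by (simp add: algebra_simps sum.distrib exp_add[symmetric] del: of_real_sum)
  also have "... = (CLINT x|M. CLINT y|N. ?a x * ?b y)"
  proof (subst MN.integral_fst'[symmetric])
   show "complex_integrable (M \<Otimes>\<^sub>M N) (%z. ?a (fst z) * ?b (snd z))"
    by (rule MN.P.integrable_const_bound[of _ 1]) (auto simp: norm_mult simp del: of_real_sum)
  qed simp
  also have "... = (CLINT x|M. ?a x) * (CLINT y|N. ?b y)"
   by (simp only: integral_mult_right_zero integral_mult_left_zero)
  also have "... = of_real (exp (- (\<Sum>v\<in>J. \<Sum>w\<in>J. c v * c w * (Q v w + Q' v w)) / 2))"
   by (simp only: gauss_familyD(4)[OF 1] gauss_familyD(4)[OF 2] distrib_left sum.distrib of_real_mult[symmetric] exp_add[symmetric]) (simp add: field_simps)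
  finally show "(CLINT z|M \<Otimes>\<^sub>M N. iexp (\<Sum>j\<in>J. c j * (X j (fst z) + Y j (snd z)))) =
   of_real (exp (- (\<Sum>v\<in>J. \<Sum>w\<in>J. c v * c w * (Q v w + Q' v w)) / 2))" .
 qed
qed

lemma gauss_std_normal:
 assumes 1: "gauss_family M V X Q" and v: "v \<in> V" "Q v v = 1"
 shows "distr M borel (X v) = std_normal_distribution"
proof (rule Levy_uniqueness)
 interpret M: prob_space M by (rule gauss_familyD[OF 1])
 have [measurable]: "X v \<in> rv M" using gauss_familyD(3)[OF 1] v by auto
 show "real_distribution (distr M borel (X v))" by (rule M.real_distribution_distr) simp
 show "real_distribution std_normal_distribution" by (rule real_dist_normal_dist)
 show "char (distr M borel (X v)) = char std_normal_distribution"
 proof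
  fix t
  have V: "finite V" by (rule gauss_familyD[OF 1])
  have "char (distr M borel (X v)) t = (CLINT z|M. iexp (\<Sum>w\<in>V. (if w = v then t else 0) * X w z))"
   unfolding char_def using V v by (subst integral_distr) (auto simp: if_distrib[where f="%x. x * _"] cong: if_cong)
  also have "... = of_real (exp (- (\<Sum>u\<in>V. \<Sum>w\<in>V. (if u = v then t else 0) * (if w = v then t else 0) * Q u w) / 2))"
   by (rule gauss_familyD(4)[OF 1])
  also have "(\<Sum>u\<in>V. \<Sum>w\<in>V. (if u = v then t else 0) * (if w = v then t else 0) * Q u w) = t^2"
   using V v by (simp add: if_distrib[where f="%x. x * _"] if_distrib[where f="%x. _ * x"] sum.If_cases power2_eq_square cong: if_cong)
  finally show "char (distr M borel (X v)) t = char std_normal_distribution t"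
   by (simp add: char_std_normal_distribution)
 qed
qed

lemma gauss_integrable:
 assumes 1: "gauss_family M V X Q" and v: "v \<in> V" "Q v v = 1"
 shows "integrable M (X v)"
proof -
 have [measurable]: "X v \<in> rv M" using gauss_familyD(3)[OF 1] v by auto
 have "integrable std_normal_distribution (%x::real. x)"
  using std_normal_moment_odd[of 0] by (subst integrable_density) (auto simp: has_bochner_integral_iff)
 hence "integrable (distr M borel (X v)) (%x. x)" using gauss_std_normal[OF 1 v] by simp
 thus ?thesis by (subst (asm) integrable_distr_eq) auto
qed

text \<open>Stein's identity: \<open>h\<close> times the density vanishes at infinity, and the
  derivative of this product is \<open>h' x - x * h x\<close> times the density.\<close>

lemma std_normal_ibp:
 fixes h h' :: "real => real"
 assumes h: "!!x. (h has_real_derivative h' x) (at x)" and c: "!!x. isCont h' x"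
  and B: "!!x. \<bar>h x\<bar> <= B" "!!x. \<bar>h' x\<bar> <= B"
 shows "(LINT x|std_normal_distribution. x * h x) = (LINT x|std_normal_distribution. h' x)"
proof -
 have B0: "B \<ge> 0" using B(1)[of 0] by linarith
 have hc: "continuous_on UNIV h" using h by (meson DERIV_isCont continuous_at_imp_continuous_on)
 have h'c: "continuous_on UNIV h'" using c by (simp add: continuous_at_imp_continuous_on)
 have [measurable]: "h \<in> rv borel" "h' \<in> rv borel"
  using hc h'c by (auto intro: borel_measurable_continuous_onI)
 define \<phi> where "\<phi> = std_normal_density"
 have \<phi>: "(\<phi> has_real_derivative (- x * \<phi> x)) (at x)" for x
  unfolding \<phi>_def std_normal_density_def by (auto intro!: derivative_eq_intros simp: field_simps power2_eq_square)
 have \<phi>c: "continuous_on UNIV \<phi>" using \<phi> by (meson DERIV_isCont continuous_at_imp_continuous_on)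
 have [measurable]: "\<phi> \<in> rv borel" using \<phi>c by (auto intro: borel_measurable_continuous_onI)
 have \<phi>0: "\<phi> x \<ge> 0" for x by (simp add: \<phi>_def)
 have i1: "integrable lborel \<phi>" unfolding \<phi>_def by (intro integrable_normal_density) auto
 have i2: "integrable lborel (%x. \<phi> x * x)" unfolding \<phi>_def
  using std_normal_moment_odd[of 0] by (auto simp: has_bochner_integral_iff)
 have j1: "integrable lborel (%x. h' x * \<phi> x)"
 proof (rule Bochner_Integration.integrable_bound[OF integrable_mult_right[OF i1, of B]])
  show "AE x in lborel. norm (h' x * \<phi> x) <= norm (B * \<phi> x)"
   using B \<phi>0 B0 by (auto simp: abs_mult intro!: mult_right_mono)
 qed simp
 have j2: "integrable lborel (%x. x * h x * \<phi> x)"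
 proof (rule Bochner_Integration.integrable_bound[OF integrable_mult_right[OF i2, of B]])
  show "AE x in lborel. norm (x * h x * \<phi> x) <= norm (B * (\<phi> x * x))"
  proof (rule AE_I2)
   fix x
   have "norm (x * h x * \<phi> x) = \<bar>h x\<bar> * (\<bar>x\<bar> * \<phi> x)" using \<phi>0 by (simp add: abs_mult)
   also have "... <= B * (\<bar>x\<bar> * \<phi> x)" using B \<phi>0 by (intro mult_right_mono) auto
   finally show "norm (x * h x * \<phi> x) <= norm (B * (\<phi> x * x))" using B0 \<phi>0 by (simp add: abs_mult mult_ac)
  qed
 qed simp
 have lim: "((%x. h x * \<phi> x) \<longlongrightarrow> 0) at_top" "((%x. h x * \<phi> x) \<longlongrightarrow> 0) at_bot"
 proof -
  have t: "((%x. B * \<phi> x) \<longlongrightarrow> 0) F" if "filterlim (%x::real. x^2) at_top F" for F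
  proof -
   have "((%x::real. exp (- (x^2 / 2))) \<longlongrightarrow> 0) F"
    by (rule filterlim_compose[OF exp_at_bot]) (use filterlim_tendsto_pos_mult_at_top[OF tendsto_const[of "1/2"] _ that] in \<open>simp add: filterlim_uminus_at_bot\<close>)
   from tendsto_mult[OF tendsto_const[of "B * (1 / sqrt (2*pi))"] this]
   show ?thesis by (simp add: \<phi>_def std_normal_density_def mult.assoc)
  qed
  have "filterlim (%x::real. x^2) at_top at_top" by (intro filterlim_pow_at_top filterlim_ident) auto
  from t[OF this] show "((%x. h x * \<phi> x) \<longlongrightarrow> 0) at_top"
   by (rule Lim_null_comparison[rotated]) (use B \<phi>0 in \<open>auto simp: abs_mult intro!: mult_right_mono always_eventually\<close>)
  have "filterlim (%x::real. x^2) at_top at_bot" by (intro filterlim_pow_at_bot_even filterlim_ident) auto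
  from t[OF this] show "((%x. h x * \<phi> x) \<longlongrightarrow> 0) at_bot"
   by (rule Lim_null_comparison[rotated]) (use B \<phi>0 in \<open>auto simp: abs_mult intro!: mult_right_mono always_eventually\<close>)
 qed
 have "(LBINT x=-\<infinity>..\<infinity>. h' x * \<phi> x - x * h x * \<phi> x) = 0 - 0"
 proof (rule interval_integral_FTC_integrable)
  show "((%x. h x * \<phi> x) has_vector_derivative h' x * \<phi> x - x * h x * \<phi> x) (at x)" for x
   unfolding has_real_derivative_iff_has_vector_derivative[symmetric]
   by (auto intro!: derivative_eq_intros h \<phi>)
  show "isCont (%x. h' x * \<phi> x - x * h x * \<phi> x) x" for x
   using hc h'c \<phi>c by (intro continuous_intros) (auto simp: continuous_on_eq_continuous_at)
  show "set_integrable lborel (einterval (- \<infinity>) \<infinity>) (%x. h' x * \<phi> x - x * h x * \<phi> x)"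
   unfolding set_integrable_def using j1 j2 by simp
  show "(((%x. h x * \<phi> x) \<circ> real_of_ereal) \<longlongrightarrow> 0) (at_right (- \<infinity>))"
   using lim(2) by (simp add: ereal_tendsto_simps)
  show "(((%x. h x * \<phi> x) \<circ> real_of_ereal) \<longlongrightarrow> 0) (at_left \<infinity>)"
   using lim(1) by (simp add: ereal_tendsto_simps)
 qed auto
 hence "(LINT x|lborel. h' x * \<phi> x - x * h x * \<phi> x) = 0"
  by (simp add: interval_lebesgue_integral_def set_lebesgue_integral_def)
 hence "(LINT x|lborel. h' x * \<phi> x) = (LINT x|lborel. x * h x * \<phi> x)"
  using j1 j2 by simp
 thus ?thesis
  by (simp add: integral_density \<phi>_def mult_ac)
qed

section \<open>Functions of finitely many coordinates\<close>

definition coord_continuous :: "'v set => (('v => real) => real) => bool" where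
 "coord_continuous V G \<longleftrightarrow> finite V \<and>
   (\<forall>X x. (\<forall>v\<in>V. (%n::nat. X n v) ----> x v) \<longrightarrow> (%n. G (X n)) ----> G x)"

lemma coord_continuousD:
 assumes "coord_continuous V G"
 shows "finite V" "(!!v. v \<in> V ==> (%n. X n v) ----> x v) ==> (%n. G (X n)) ----> G x"
 using assms unfolding coord_continuous_def by auto

text \<open>Applied to a constant sequence, the definition says that \<open>G\<close> ignores the
  coordinates outside \<open>V\<close>.\<close>

lemma coord_continuous_cong:
 assumes "coord_continuous V G" "!!v. v \<in> V ==> x v = y v"
 shows "G x = G y"
 using coord_continuousD(2)[OF assms(1), of "%_. x" y] assms(2) by (simp add: LIMSEQ_const_iff)

lemma coord_continuous_intros:
 "finite V ==> coord_continuous V (%_. c)"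
 "finite V ==> v \<in> V ==> coord_continuous V (%x. x v)"
 "coord_continuous V F ==> coord_continuous V G ==> coord_continuous V (%x. F x + G x)"
 "coord_continuous V F ==> coord_continuous V G ==> coord_continuous V (%x. F x - G x)"
 "coord_continuous V F ==> coord_continuous V G ==> coord_continuous V (%x. F x * G x)"
 "coord_continuous V F ==> coord_continuous V (%x. - F x)"
 "coord_continuous V F ==> coord_continuous V (%x. (F x) ^ n)"
 "coord_continuous V F ==> coord_continuous V G ==> (!!x. G x \<noteq> 0) ==> coord_continuous V (%x. F x / G x)"
 "coord_continuous V F ==> coord_continuous V G ==> coord_continuous V (%x. if b then F x else G x)"
 "finite V ==> (!!i. i \<in> I ==> coord_continuous V (H i)) ==> coord_continuous V (%x. \<Sum>i\<in>I. H i x)"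
 "finite V ==> (!!i. i \<in> I ==> coord_continuous V (H i)) ==> coord_continuous V (%x. \<Prod>i\<in>I. H i x)"
 unfolding coord_continuous_def by (auto intro!: tendsto_intros)

lemma coord_continuous_compose:
 assumes "coord_continuous V F" "continuous_on UNIV q"
 shows "coord_continuous V (%x. q (F x))"
 using assms unfolding coord_continuous_def by (auto intro: continuous_on_tendsto_compose[of UNIV q])

lemma coord_continuous_subst:
 fixes V :: "'v set" and W :: "'w set"
 assumes F: "coord_continuous V F" and y: "finite W" "!!v. v \<in> V ==> coord_continuous W (%x. y x v)"
 shows "coord_continuous W (%x. F (y x))"
 unfolding coord_continuous_def
proof (intro conjI y(1) allI impI)
 fix X :: "nat => 'w => real" and x assume X: "\<forall>w\<in>W. (%n. X n w) ----> x w"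
 show "(%n. F (y (X n))) ----> F (y x)"
  by (rule coord_continuousD(2)[OF F coord_continuousD(2)[OF y(2)]]) (use X in auto)
qed

lemma coord_continuous_isCont:
 assumes G: "coord_continuous V G" and x: "!!v. v \<in> V ==> isCont (%s. x s v) (t::real)"
 shows "isCont (%s. G (x s)) t"
 unfolding continuous_at_sequentially o_def
 by (intro allI impI coord_continuousD(2)[OF G] isCont_tendsto_compose[OF x])

text \<open>Rounding the coordinates down to multiples of 1 / n makes the argument discrete.\<close>

lemma coord_continuous_rv:
 assumes G: "coord_continuous V G" and X [measurable]: "!!v. v \<in> V ==> X v \<in> rv M"
 shows "(%z. G (%v. X v z)) \<in> rv M"
proof -
 have V: "finite V" by (rule coord_continuousD[OF G])
 define r where "r n z = (\<lambda>v\<in>V. \<lfloor>real (Suc n) * X v z\<rfloor>)" for n z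
 have "r n \<in> measurable M (count_space (Pi\<^sub>E V (%_. UNIV)))" for n
 proof -
  have "r n -` {y} \<inter> space M = {z \<in> space M. \<forall>v\<in>V. \<lfloor>real (Suc n) * X v z\<rfloor> = y v}" if "y \<in> Pi\<^sub>E V (%_. UNIV)" for y
   using that by (auto simp: r_def fun_eq_iff PiE_def extensional_def)
  moreover have "{z \<in> space M. \<forall>v\<in>V. \<lfloor>real (Suc n) * X v z\<rfloor> = y v} \<in> sets M" for y
   using V by measurable
  moreover have "countable (Pi\<^sub>E V (%_. UNIV :: int set))" by (intro countable_PiE V) auto
  ultimately show ?thesis by (subst measurable_count_space_eq_countable) (auto simp: r_def)
 qed
 hence 1: "(%z. G (%v. real_of_int (r n z v) / real (Suc n))) \<in> rv M" for n
  by (rule measurable_compose) simp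
 have 2: "(%n. G (%v. real_of_int (r n z v) / real (Suc n))) ----> G (%v. X v z)" for z
 proof (rule coord_continuousD(2)[OF G])
  fix v assume v: "v \<in> V"
  have "\<bar>real_of_int (r n z v) / real (Suc n) - X v z\<bar> <= 1 / real (Suc n)" for n
  proof -
   have "\<bar>real_of_int (r n z v) - real (Suc n) * X v z\<bar> <= 1" using v unfolding r_def by simp linarith
   hence "\<bar>real_of_int (r n z v) - real (Suc n) * X v z\<bar> / real (Suc n) <= 1 / real (Suc n)" by (rule divide_right_mono) simp
   moreover have "real_of_int (r n z v) / real (Suc n) - X v z = (real_of_int (r n z v) - real (Suc n) * X v z) / real (Suc n)"
    by (simp add: diff_divide_distrib del: of_nat_Suc)
   ultimately show ?thesis by simp
  qed
  hence "(%n. real_of_int (r n z v) / real (Suc n) - X v z) ----> 0"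
   by (intro Lim_null_comparison[OF _ LIMSEQ_Suc[OF lim_const_over_n[of 1]]]) auto
  thus "(%n. real_of_int (r n z v) / real (Suc n)) ----> X v z" by (rule LIM_zero_cancel)
 qed
 show ?thesis by (rule borel_measurable_LIMSEQ_real[OF 2 1])
qed

text \<open>The gradient \<open>f\<close> is specified by the chain rule along curves, the form in
  which it is used: along lines, along rotations of two copies and under composition.\<close>

definition C1_on :: "'v set => (('v => real) => real) => (('v => real) => 'v => real) => bool" where
 "C1_on V F f \<longleftrightarrow>
   (\<forall>x x' t. (\<forall>v\<in>V. ((%s. x s v) has_real_derivative x' v) (at t)) \<longrightarrow>
    ((%s. F (x s)) has_real_derivative (\<Sum>v\<in>V. f (x t) v * x' v)) (at t)) \<and>
   coord_continuous V F \<and> (\<forall>v\<in>V. coord_continuous V (%x. f x v))"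

lemma C1_onI:
 assumes "!!x x' t. (!!v. v \<in> V ==> ((%s. x s v) has_real_derivative x' v) (at t)) ==>
    ((%s. F (x s)) has_real_derivative (\<Sum>v\<in>V. f (x t) v * x' v)) (at t)"
  and "coord_continuous V F" "!!v. v \<in> V ==> coord_continuous V (%x. f x v)"
 shows "C1_on V F f"
 using assms unfolding C1_on_def by blast

lemma C1_onD:
 assumes "C1_on V F f"
 shows "(!!v. v \<in> V ==> ((%s. x s v) has_real_derivative x' v) (at t)) ==>
    ((%s. F (x s)) has_real_derivative (\<Sum>v\<in>V. f (x t) v * x' v)) (at t)"
  "coord_continuous V F" "v \<in> V ==> coord_continuous V (%x. f x v)" "finite V"
 using assms unfolding C1_on_def coord_continuous_def by blast+

lemma C1_on_measurable:
 assumes F: "C1_on V F f" and X: "!!v. v \<in> V ==> X v \<in> rv M"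
 shows "(%z. F (%v. X v z)) \<in> rv M"
  "w \<in> V ==> (%z. f (%v. X v z) w) \<in> rv M"
 by (rule coord_continuous_rv[OF C1_onD(2)[OF F] X] coord_continuous_rv[OF C1_onD(3)[OF F] X]; assumption)+

lemma gauss_transfer':
 assumes 1: "gauss_family M V X Q" and 2: "gauss_family N V Y Q'" and Q: "!!v w. v \<in> V ==> w \<in> V ==> Q v w = Q' v w"
  and c: "coord_continuous V \<Phi>"
 shows "(LINT z|M. \<Phi> (%v. X v z)) = (LINT z|N. \<Phi> (%v. Y v z))"
proof -
 have r: "\<Phi> (restrict x V) = \<Phi> x" for x by (rule coord_continuous_cong[OF c]) simp
 have "\<Phi> \<in> rv (\<Pi>\<^sub>M v\<in>V. borel)" using coord_continuous_rv[OF c, of "%v x. x v"] by simp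
 from gauss_transfer[OF 1 2 Q this] show ?thesis by (simp only: r)
qed

text \<open>Linear regression on \<open>X v0\<close>. The residual
  \<open>X w - Q v0 w * X v0\<close> is uncorrelated with \<open>X v0\<close>, so it may be taken
  from a second copy; freezing that copy leaves a function of one standard normal variable.\<close>

lemma gauss_split:
 assumes G: "gauss_family M V X Q" and v0: "v0 \<in> V" "Q v0 v0 = 1"
  and sym: "!!v w. v \<in> V ==> w \<in> V ==> Q v w = Q w v"
 shows "gauss_family (M \<Otimes>\<^sub>M M) V (%w z. Q v0 w * X v0 (fst z) + (X w (snd z) - Q v0 w * X v0 (snd z))) Q"
proof -
 have V: "finite V" by (rule gauss_familyD[OF G])
 \<comment> \<open>The matrix of the map that sends \<open>X\<close> to its residuals.\<close>
 define A where "A = (%w v. (if v = w then 1 else 0) - (if v = v0 then Q v0 w else 0 :: real))"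
 have A: "(\<Sum>u\<in>V. A w u * q u) = q w - Q v0 w * q v0" if "w \<in> V" for w q
  using V that v0 unfolding A_def
  by (simp add: left_diff_distrib sum_subtractf if_distrib[where f="%x. x * _"] cong: if_cong)
 have g2: "gauss_family M V (%w z. X w z - Q v0 w * X v0 z) (%w u. Q w u - Q v0 w * Q v0 u)"
 proof (rule gauss_family_cong[OF gauss_family_linear[OF G V, of A]])
  show "(\<Sum>v\<in>V. A w v * X v z) = X w z - Q v0 w * X v0 z" if "w \<in> V" for w z
   by (rule A[OF that])
  fix w u assume wu: "w \<in> V" "u \<in> V"
  have "(\<Sum>a\<in>V. \<Sum>b\<in>V. A w a * A u b * Q a b) = (\<Sum>a\<in>V. A w a * (\<Sum>b\<in>V. A u b * Q a b))"
   by (simp add: sum_distrib_left mult.assoc)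
  also have "... = (Q w u - Q v0 u * Q w v0) - Q v0 w * (Q v0 u - Q v0 u * Q v0 v0)"
   unfolding A[OF wu(2)] A[OF wu(1)] ..
  also have "... = Q w u - Q v0 w * Q v0 u" using v0 sym[OF wu(1) v0(1)] by simp
  finally show "(\<Sum>a\<in>V. \<Sum>b\<in>V. A w a * A u b * Q a b) = Q w u - Q v0 w * Q v0 u" .
 qed
 have g1: "gauss_family M V (%w z. Q v0 w * X v0 z) (%w u. Q v0 w * Q v0 u * Q v0 v0)"
  by (rule gauss_family_reindex[OF G V v0(1)])
 show ?thesis
  by (rule gauss_family_cong[OF gauss_family_pair[OF g1 g2]]) (use v0 in auto)
qed

text \<open>Stein's identity for vectors. In the split representation the argument of
  \<open>F\<close> moves along a line with direction \<open>Q v0\<close>, so the one-variable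
  identity produces the factors \<open>Q v0 w\<close>.\<close>

lemma gauss_ibp:
 assumes G: "gauss_family M V X Q" and v0: "v0 \<in> V" "Q v0 v0 = 1"
  and sym: "!!v w. v \<in> V ==> w \<in> V ==> Q v w = Q w v"
  and F: "C1_on V F f" and B: "!!x. \<bar>F x\<bar> <= B" "!!x v. v \<in> V ==> \<bar>f x v\<bar> <= B"
 shows "(LINT u|M. X v0 u * F (%v. X v u)) = (\<Sum>w\<in>V. Q v0 w * (LINT u|M. f (%v. X v u) w))"
proof -
 interpret M: prob_space M by (rule gauss_familyD[OF G])
 interpret MM: pair_prob_space M M ..
 have V: "finite V" by (rule gauss_familyD[OF G])
 have B0: "B \<ge> 0" using B(1)[of undefined] by linarith
 have Xm[measurable]: "X v \<in> rv M" if "v \<in> V" for v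
  using gauss_familyD(3)[OF G] that by auto
 define Y where "Y = (%w u. Q v0 w * X v0 (fst u) + (X w (snd u) - Q v0 w * X v0 (snd u)))"
 have GY: "gauss_family (M \<Otimes>\<^sub>M M) V Y Q" unfolding Y_def by (rule gauss_split[OF G v0 sym])
 have [measurable]: "Y v \<in> rv (M \<Otimes>\<^sub>M M)" if "v \<in> V" for v
  using gauss_familyD(3)[OF GY] that by auto
 have v0m[measurable]: "(%x. x v0) \<in> rv (\<Pi>\<^sub>M v\<in>V. borel)"
  using v0 by simp
 have Y0: "Y v0 u = X v0 (fst u)" for u using v0 by (simp add: Y_def)
 have FY[measurable]: "(%u. F (%v. Y v u)) \<in> rv (M \<Otimes>\<^sub>M M)"
  by (rule C1_on_measurable[OF F]) auto
 have fY[measurable]: "w \<in> V ==> (%u. f (%v. Y v u) w) \<in> rv (M \<Otimes>\<^sub>M M)" for w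
  by (rule C1_on_measurable[OF F]) auto
 have int0: "integrable (M \<Otimes>\<^sub>M M) (%u. X v0 (fst u))"
  using gauss_integrable[OF GY v0] unfolding Y0[abs_def] .
 have int1: "integrable (M \<Otimes>\<^sub>M M) (%u. X v0 (fst u) * F (%v. Y v u))"
 proof (rule Bochner_Integration.integrable_bound[OF integrable_mult_right[OF int0, of B]])
  show "AE u in M \<Otimes>\<^sub>M M. norm (X v0 (fst u) * F (%v. Y v u)) <= norm (B * X v0 (fst u))"
   using B(1) B0 by (auto simp: abs_mult mult.commute[of B] intro!: mult_left_mono AE_I2)
 qed (use v0 in measurable)
 have int2: "integrable (M \<Otimes>\<^sub>M M) (%u. f (%v. Y v u) w)" if "w \<in> V" for w
  by (rule MM.P.integrable_const_bound[of _ B]) (use B that in auto)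
 have "(LINT u|M. X v0 u * F (%v. X v u)) = (LINT u|(M \<Otimes>\<^sub>M M). Y v0 u * F (%v. Y v u))"
  by (rule gauss_transfer'[OF G GY refl, of "%x. x v0 * F x"]) (intro coord_continuous_intros V v0 C1_onD(2)[OF F])
 also have "... = (LINT y|M. (LINT x|M. X v0 x * F (%v. Y v (x, y))))"
  unfolding Y0 using int1 by (subst MM.integral_snd[of "%x y. X v0 x * F (%v. Y v (x, y))"]) (auto simp: case_prod_unfold)
 also have "... = (LINT y|M. (LINT x|M. (\<Sum>w\<in>V. Q v0 w * f (%v. Y v (x, y)) w)))"
 proof (rule Bochner_Integration.integral_cong[OF refl])
  fix y
  \<comment> \<open>With the second copy frozen at \<open>y\<close>, this is the line on which the
    argument of \<open>F\<close> moves as \<open>X v0\<close> varies.\<close>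
  define z where "z = (%h w. Q v0 w * h + (X w y - Q v0 w * X v0 y))"
  have zd: "((%s. z s v) has_real_derivative Q v0 v) (at t)" for v t
   unfolding z_def by (auto intro!: derivative_eq_intros)
  have zY: "(%v. Y v (x, y)) = z (X v0 x)" for x by (auto simp: Y_def z_def)
  have fc: "isCont (%h. f (z h) v) t" if "v \<in> V" for v t
   by (rule coord_continuous_isCont[OF C1_onD(3)[OF F that]]) (use zd DERIV_isCont in blast)
  have [measurable]: "(%h. F (z h)) \<in> rv borel"
   by (rule C1_on_measurable(1)[OF F, of "%v h. z h v"]) (auto simp: z_def)
  have [measurable]: "w \<in> V ==> (%h. f (z h) w) \<in> rv borel" for w
   by (rule C1_on_measurable(2)[OF F, of "%v h. z h v"]) (auto simp: z_def)
  have "(LINT x|M. X v0 x * F (%v. Y v (x, y))) = (LINT h|(distr M borel (X v0)). h * F (z h))"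
   unfolding zY using v0 by (subst integral_distr) auto
  also have "... = (LINT h|std_normal_distribution. h * F (z h))"
   by (simp only: gauss_std_normal[OF G v0])
  also have "... = (LINT h|std_normal_distribution. (\<Sum>w\<in>V. f (z h) w * Q v0 w))"
  proof (rule std_normal_ibp[where B = "max B (\<Sum>w\<in>V. B * \<bar>Q v0 w\<bar>)"])
   show "((%h. F (z h)) has_real_derivative (\<Sum>w\<in>V. f (z x) w * Q v0 w)) (at x)" for x
    by (rule C1_onD(1)[OF F zd])
   show "isCont (%h. \<Sum>w\<in>V. f (z h) w * Q v0 w) x" for x
    using fc by (intro continuous_intros) auto
   show "\<bar>F (z x)\<bar> <= max B (\<Sum>w\<in>V. B * \<bar>Q v0 w\<bar>)" for x using B(1)[of "z x"] by simp
   have "\<bar>\<Sum>w\<in>V. f (z x) w * Q v0 w\<bar> <= (\<Sum>w\<in>V. B * \<bar>Q v0 w\<bar>)" for x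
    by (rule sum_abs[THEN order_trans]) (auto simp: abs_mult intro!: sum_mono mult_right_mono B)
   thus "\<bar>\<Sum>w\<in>V. f (z x) w * Q v0 w\<bar> <= max B (\<Sum>w\<in>V. B * \<bar>Q v0 w\<bar>)" for x
    by (simp add: le_max_iff_disj)
  qed
  also have "... = (LINT h|(distr M borel (X v0)). (\<Sum>w\<in>V. f (z h) w * Q v0 w))"
   by (simp only: gauss_std_normal[OF G v0])
  also have "... = (LINT x|M. (\<Sum>w\<in>V. Q v0 w * f (%v. Y v (x, y)) w))"
   unfolding zY using v0 by (subst integral_distr) (auto simp: mult.commute)
  finally show "(LINT x|M. X v0 x * F (%v. Y v (x, y))) = (LINT x|M. (\<Sum>w\<in>V. Q v0 w * f (%v. Y v (x, y)) w))" .
 qed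
 also have "... = (LINT u|(M \<Otimes>\<^sub>M M). (\<Sum>w\<in>V. Q v0 w * f (%v. Y v u) w))"
  using int2 by (subst MM.integral_snd[of "%x y. \<Sum>w\<in>V. Q v0 w * f (%v. Y v (x, y)) w"]) (auto simp: case_prod_unfold)
 also have "... = (\<Sum>w\<in>V. Q v0 w * (LINT u|(M \<Otimes>\<^sub>M M). f (%v. Y v u) w))"
  using int2 by (subst Bochner_Integration.integral_sum) auto
 also have "... = (\<Sum>w\<in>V. Q v0 w * (LINT u|M. f (%v. X v u) w))"
 proof (intro sum.cong refl arg_cong2[of _ _ _ _ "(*)"])
  fix w assume w: "w \<in> V"
  show "(LINT u|(M \<Otimes>\<^sub>M M). f (%v. Y v u) w) = (LINT u|M. f (%v. X v u) w)"
   by (rule gauss_transfer'[OF GY G refl C1_onD(3)[OF F w]])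
 qed
 finally show ?thesis .
qed

section \<open>Covariances by rotation of two independent copies\<close>

lemma gauss_family_two:
 fixes J :: "'j set"
 assumes G: "gauss_family M V X Q" and J: "finite J" and p: "!!j. j \<in> J ==> p j \<in> V"
 shows "gauss_family (M \<Otimes>\<^sub>M M) J (%j w. \<alpha> j * X (p j) (fst w) + \<beta> j * X (p j) (snd w))
  (%j k. (\<alpha> j * \<alpha> k + \<beta> j * \<beta> k) * Q (p j) (p k))"
 by (rule gauss_family_cong[OF gauss_family_pair[OF gauss_family_reindex[OF G J p, where \<alpha>=\<alpha>] gauss_family_reindex[OF G J p, where \<alpha>=\<beta>]]])
  (auto simp: algebra_simps)

lemma C1_on_affine:
 assumes F: "C1_on V F f"
 shows "C1_on V (%x. F (%u. a u + s * x u)) (%x w. s * f (%u. a u + s * x u) w)"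
proof (rule C1_onI)
 fix x x' t assume "!!v. v \<in> V ==> ((%s. x s v) has_real_derivative x' v) (at t)"
 hence "((%r. a v + s * x r v) has_real_derivative s * x' v) (at t)" if "v \<in> V" for v
  using that by (auto intro!: derivative_eq_intros)
 from C1_onD(1)[OF F this]
 show "((%r. F (%u. a u + s * x r u)) has_real_derivative (\<Sum>v\<in>V. s * f (%u. a u + s * x t u) v * x' v)) (at t)"
  by (simp add: mult_ac)
next
 have y: "v \<in> V ==> coord_continuous V (%x. a v + s * x v)" for v by (intro coord_continuous_intros C1_onD(4)[OF F])
 show "coord_continuous V (%x. F (%u. a u + s * x u))" by (rule coord_continuous_subst[OF C1_onD(2)[OF F] C1_onD(4)[OF F] y])
 show "coord_continuous V (%x. s * f (%u. a u + s * x u) v)" if "v \<in> V" for v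
  by (rule coord_continuous_intros(5)[OF coord_continuous_intros(1)[OF C1_onD(4)[OF F]] coord_continuous_subst[OF C1_onD(3)[OF F that] C1_onD(4)[OF F] y]])
qed

text \<open>The velocity \<open>cos t * X v (snd s) - sin t * X v (fst s)\<close> is independent of
  the rotated point at which \<open>h\<close> is evaluated. After a rotation that preserves the
  joint law the point is the first copy and the velocity is minus the second one; integration by
  parts in the second copy, with the first one fixed, gives the factor
  \<open>- sin t\<close>.\<close>

lemma gauss_cov_aux:
 assumes G: "gauss_family M V X Q" and unit: "!!v. v \<in> V ==> Q v v = 1"
  and sym: "!!v w. v \<in> V ==> w \<in> V ==> Q v w = Q w v"
  and F: "C1_on V F f" and BF: "!!x. \<bar>F x\<bar> <= B" "!!x v. v \<in> V ==> \<bar>f x v\<bar> <= B"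
  and H: "C1_on V H h" and BH: "!!x v. v \<in> V ==> \<bar>h x v\<bar> <= B" and v: "v \<in> V"
 shows "(LINT s|(M \<Otimes>\<^sub>M M). F (%u. X u (fst s)) * (h (%u. cos t * X u (fst s) + sin t * X u (snd s)) v *
      (cos t * X v (snd s) - sin t * X v (fst s)))) =
  - sin t * (\<Sum>w\<in>V. Q v w * (LINT s|(M \<Otimes>\<^sub>M M). h (%u. X u (fst s)) v *
      f (%u. cos t * X u (fst s) + sin t * X u (snd s)) w))"
proof -
 interpret M: prob_space M by (rule gauss_familyD[OF G])
 interpret MM: pair_prob_space M M ..
 let ?P = "M \<Otimes>\<^sub>M M"
 have V: "finite V" by (rule gauss_familyD[OF G])
 have B0: "B \<ge> 0" using BF(1)[of undefined] by linarith
 have Xm[measurable]: "X v \<in> rv M" if "v \<in> V" for v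
  using gauss_familyD(3)[OF G] that by auto
 define J where "J = V \<times> (UNIV :: bool set)"
 have J: "finite J" unfolding J_def using V by simp
 have fJ: "j \<in> J ==> fst j \<in> V" for j by (auto simp: J_def)
 note g1 = gauss_family_two[OF G J fJ, where \<alpha>="%j. if snd j then 1 else 0" and \<beta>="%j. if snd j then 0 else 1"]
 note g2 = gauss_family_two[OF G J fJ, where \<alpha>="%j. if snd j then cos t else sin t" and \<beta>="%j. if snd j then sin t else - cos t"]
 define \<Phi> where "\<Phi> = (%z :: _ \<times> bool => real. F (%u. cos t * z (u, True) + sin t * z (u, False)) * (h (%u. z (u, True)) v * (- z (v, False))))"
 have \<Phi>: "coord_continuous J \<Phi>"
  unfolding \<Phi>_def by (intro coord_continuous_intros coord_continuous_subst[OF C1_onD(2)[OF F] J] coord_continuous_subst[OF C1_onD(3)[OF H v] J])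
   (use v J in \<open>auto simp: J_def\<close>)
 have F1[measurable]: "(%s. F (%u. cos t * X u (fst s) + sin t * X u (snd s))) \<in> rv ?P"
  by (rule C1_on_measurable(1)[OF F]) measurable
 have h1[measurable]: "(%x. h (%u. X u x) v) \<in> rv M"
  by (rule C1_on_measurable(2)[OF H _ v]) measurable
 have f1[measurable]: "w \<in> V ==> (%s. f (%u. cos t * X u (fst s) + sin t * X u (snd s)) w) \<in> rv ?P" for w
  by (rule C1_on_measurable(2)[OF F]) measurable
 have iX: "integrable ?P (%s. X v (snd s))"
 proof -
  have "gauss_family ?P V (%j s. 0 * X j (fst s) + 1 * X j (snd s)) (%j k. (0 * 0 + 1 * 1) * Q j k)"
   by (rule gauss_family_two[OF G V])
  from gauss_integrable[OF this v] show ?thesis using unit v by simp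
 qed
 have i1: "integrable ?P (%s. F (%u. cos t * X u (fst s) + sin t * X u (snd s)) * (h (%u. X u (fst s)) v * X v (snd s)))"
 proof (rule Bochner_Integration.integrable_bound[OF integrable_mult_right[OF iX, of "B * B"]])
  have "\<bar>F x * (h y v * z)\<bar> <= \<bar>B * B * z\<bar>" for x y z
   unfolding abs_mult mult.assoc using BF(1)[of x] BH[OF v, of y] B0 by (intro mult_mono) auto
  thus "AE s in ?P. norm (F (%u. cos t * X u (fst s) + sin t * X u (snd s)) * (h (%u. X u (fst s)) v * X v (snd s))) <= norm (B * B * X v (snd s))"
   by auto
 qed (use v in measurable)
 have i2: "integrable ?P (%s. h (%u. X u (fst s)) v * f (%u. cos t * X u (fst s) + sin t * X u (snd s)) w)" if "w \<in> V" for w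
 proof (rule MM.P.integrable_const_bound[of _ "B * B"])
  have "\<bar>h x v * f y w\<bar> <= B * B" for x y
   unfolding abs_mult using BF(2)[OF that, of y] BH[OF v, of x] B0 by (intro mult_mono) auto
  thus "AE s in ?P. norm (h (%u. X u (fst s)) v * f (%u. cos t * X u (fst s) + sin t * X u (snd s)) w) <= B * B"
   by auto
 qed (use that in measurable)
 \<comment> \<open>The orthogonal matrix with rows \<open>(cos t, sin t)\<close> and
   \<open>(sin t, - cos t)\<close> is its own inverse.\<close>
 have sc: "cos t * (cos t * a + sin t * b) + sin t * (sin t * a - cos t * b) = a" for a b
  using sin_cos_squared_add[of t] by (simp add: algebra_simps power2_eq_square flip: distrib_left)
 have "(LINT s|?P. F (%u. X u (fst s)) * (h (%u. cos t * X u (fst s) + sin t * X u (snd s)) v *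
      (cos t * X v (snd s) - sin t * X v (fst s)))) =
  (LINT s|?P. \<Phi> (%j. (if snd j then cos t else sin t) * X (fst j) (fst s) + (if snd j then sin t else - cos t) * X (fst j) (snd s)))"
  by (rule Bochner_Integration.integral_cong[OF refl]) (simp only: \<Phi>_def fst_conv snd_conv if_True if_False sc minus_diff_eq minus_mult_left[symmetric] diff_minus_eq_add add_uminus_conv_diff)
 also have "... = (LINT s|?P. \<Phi> (%j. (if snd j then 1 else 0) * X (fst j) (fst s) + (if snd j then 0 else 1) * X (fst j) (snd s)))"
  by (rule gauss_transfer'[OF g2 g1 _ \<Phi>]) (auto simp: sin_squared_eq power2_eq_square[symmetric])
 also have "... = - (LINT s|?P. F (%u. cos t * X u (fst s) + sin t * X u (snd s)) * (h (%u. X u (fst s)) v * X v (snd s)))"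
  by (simp add: \<Phi>_def)
 also have "(LINT s|?P. F (%u. cos t * X u (fst s) + sin t * X u (snd s)) * (h (%u. X u (fst s)) v * X v (snd s))) =
   (LINT x|M. (LINT y|M. F (%u. cos t * X u x + sin t * X u y) * (h (%u. X u x) v * X v y)))"
  using MM.integral_fst'[OF i1] by simp
 also have "... = (LINT x|M. (LINT y|M. (\<Sum>w\<in>V. Q v w * (sin t * (h (%u. X u x) v * f (%u. cos t * X u x + sin t * X u y) w)))))"
 proof (rule Bochner_Integration.integral_cong[OF refl])
  fix x assume [measurable]: "x \<in> space M"
  have fm[measurable]: "w \<in> V ==> (%y. f (%u. cos t * X u x + sin t * X u y) w) \<in> rv M" for w
   using measurable_compose[OF measurable_Pair1'[OF \<open>x \<in> space M\<close>] f1, of w] by simp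
  have fi: "integrable M (%y. f (%u. cos t * X u x + sin t * X u y) w)" if "w \<in> V" for w
   by (rule M.integrable_const_bound[of _ B]) (use that BF(2) in auto)
  have "(LINT y|M. F (%u. cos t * X u x + sin t * X u y) * (h (%u. X u x) v * X v y)) = h (%u. X u x) v * (LINT y|M. X v y * F (%u. cos t * X u x + sin t * X u y))"
   by (subst integral_mult_right_zero[symmetric]) (simp add: mult_ac)
  also have "(LINT y|M. X v y * F (%u. cos t * X u x + sin t * X u y)) = (\<Sum>w\<in>V. Q v w * (LINT y|M. sin t * f (%u. cos t * X u x + sin t * X u y) w))"
  proof (rule gauss_ibp[OF G v unit[OF v] sym C1_on_affine[OF F, of "%u. cos t * X u x" "sin t"], where B=B])
   show "\<bar>sin t * f (%u. cos t * X u x + sin t * y u) w\<bar> <= B" if "w \<in> V" for y w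
    using mult_mono[of "\<bar>sin t\<bar>" 1 "\<bar>f (%u. cos t * X u x + sin t * y u) w\<bar>" B] BF(2)[OF that] B0 by (simp add: abs_mult)
  qed (use BF in auto)
  also have "h (%u. X u x) v * ... = (LINT y|M. (\<Sum>w\<in>V. Q v w * (sin t * (h (%u. X u x) v * f (%u. cos t * X u x + sin t * X u y) w))))"
   using fi by (subst Bochner_Integration.integral_sum) (auto simp: sum_distrib_left mult_ac)
  finally show "(LINT y|M. F (%u. cos t * X u x + sin t * X u y) * (h (%u. X u x) v * X v y)) =
   (LINT y|M. (\<Sum>w\<in>V. Q v w * (sin t * (h (%u. X u x) v * f (%u. cos t * X u x + sin t * X u y) w))))" .
 qed
 also have "... = (LINT s|?P. (\<Sum>w\<in>V. Q v w * (sin t * (h (%u. X u (fst s)) v * f (%u. cos t * X u (fst s) + sin t * X u (snd s)) w))))"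
  by (subst MM.integral_fst'[symmetric]) (use i2 in auto)
 also have "... = (\<Sum>w\<in>V. Q v w * (sin t * (LINT s|?P. h (%u. X u (fst s)) v * f (%u. cos t * X u (fst s) + sin t * X u (snd s)) w)))"
  using i2 by (subst Bochner_Integration.integral_sum) auto
 finally show ?thesis by (simp add: sum_distrib_left mult_ac sum_negf)
qed

text \<open>The covariance is the mean of \<open>F X * (H X - H X')\<close> for an independent copy
  \<open>X'\<close>. The argument of \<open>H\<close> is moved from \<open>X\<close> at
  \<open>t = 0\<close> to \<open>X'\<close> at \<open>t = pi / 2\<close> by a rotation, under which
  its law does not change.\<close>

theorem gauss_cov:
 assumes G: "gauss_family M V X Q" and unit: "!!v. v \<in> V ==> Q v v = 1"
  and sym: "!!v w. v \<in> V ==> w \<in> V ==> Q v w = Q w v"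
  and F: "C1_on V F f" and BF: "!!x. \<bar>F x\<bar> <= B" "!!x v. v \<in> V ==> \<bar>f x v\<bar> <= B"
  and H: "C1_on V H h" and BH: "!!x. \<bar>H x\<bar> <= B" "!!x v. v \<in> V ==> \<bar>h x v\<bar> <= B"
 shows "(LINT z|M. F (%u. X u z) * H (%u. X u z)) - (LINT z|M. F (%u. X u z)) * (LINT z|M. H (%u. X u z)) =
  (LINT t|lborel. indicator {0..pi/2} t * (sin t * (\<Sum>v\<in>V. \<Sum>w\<in>V. Q v w * (LINT z|(M \<Otimes>\<^sub>M M). h (%u. X u (fst z)) v *
      f (%u. cos t * X u (fst z) + sin t * X u (snd z)) w))))"
proof -
 interpret M: prob_space M by (rule gauss_familyD[OF G])
 interpret MM: pair_prob_space M M ..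
 let ?P = "M \<Otimes>\<^sub>M M"
 interpret PL: pair_sigma_finite ?P lborel ..
 have V: "finite V" by (rule gauss_familyD[OF G])
 have B0: "B \<ge> 0" using BF(1)[of undefined] by linarith
 have Xm[measurable]: "X v \<in> rv M" if "v \<in> V" for v
  using gauss_familyD(3)[OF G] that by auto
 define x where "x = (%t z u. cos t * X u (fst z) + sin t * X u (snd z))"
 define y where "y = (%t z u. cos t * X u (snd z) - sin t * X u (fst z))"
 have Fm[measurable]: "(%z. F (%u. X u z)) \<in> rv M"
  by (rule C1_on_measurable(1)[OF F]) measurable
 have Hm[measurable]: "(%z. H (%u. X u z)) \<in> rv M"
  by (rule C1_on_measurable(1)[OF H]) measurable
 have iX: "integrable ?P (%z. \<bar>X v (fst z)\<bar> + \<bar>X v (snd z)\<bar>)" if v: "v \<in> V" for v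
 proof -
  have "gauss_family ?P V (%j z. 0 * X j (fst z) + 1 * X j (snd z)) (%j k. (0 * 0 + 1 * 1) * Q j k)"
   by (rule gauss_family_two[OF G V])
  from gauss_integrable[OF this v] have 1: "integrable ?P (%z. X v (snd z))" using unit v by simp
  have "gauss_family ?P V (%j z. 1 * X j (fst z) + 0 * X j (snd z)) (%j k. (1 * 1 + 0 * 0) * Q j k)"
   by (rule gauss_family_two[OF G V])
  from gauss_integrable[OF this v] have 2: "integrable ?P (%z. X v (fst z))" using unit v by simp
  show ?thesis using 1 2 by auto
 qed
 have iFH: "integrable M (%z. F (%u. X u z))" "integrable M (%z. H (%u. X u z))"
  by (rule M.integrable_const_bound[of _ B]; use BF BH in simp)+
 have bFH: "\<bar>F a * H b\<bar> <= B * B" for a b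
  unfolding abs_mult using BF(1)[of a] BH(1)[of b] B0 by (intro mult_mono) auto
 have iP: "integrable ?P (%z. F (%u. X u (fst z)) * H (%u. X u (snd z)))" "integrable ?P (%z. F (%u. X u (fst z)) * H (%u. X u (fst z)))"
  by (rule MM.P.integrable_const_bound[of _ "B * B"]; use bFH in simp)+
 have e1: "(LINT z|?P. F (%u. X u (fst z)) * H (%u. X u (snd z))) = (LINT z|M. F (%u. X u z)) * (LINT z|M. H (%u. X u z))"
  using MM.integral_fst'[OF iP(1)] by simp
 have e2: "(LINT z|?P. F (%u. X u (fst z)) * H (%u. X u (fst z))) = (LINT z|M. F (%u. X u z) * H (%u. X u z))"
  using MM.integral_fst'[OF iP(2)] by (simp add: M.prob_space)
 define D where "D = (%t z. F (%u. X u (fst z)) * (\<Sum>v\<in>V. h (x t z) v * y t z v))"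
 have xd: "((%t. x t z v) has_real_derivative y t z v) (at t)" for t z v
  unfolding x_def y_def by (auto intro!: derivative_eq_intros)
 have yc: "isCont (%t. y t z v) t" for t z v
  unfolding y_def by (intro continuous_intros)
 have ftc: "F (%u. X u (fst z)) * (H (%u. X u (snd z)) - H (%u. X u (fst z))) = (LINT t|lborel. D t z * indicator {0..pi/2} t)" for z
 proof -
  have "(LINT t|lborel. (\<Sum>v\<in>V. h (x t z) v * y t z v) * indicator {0..pi/2} t) = H (x (pi/2) z) - H (x 0 z)"
  proof (rule integral_FTC_Icc_real)
   show "((%t. H (x t z)) has_real_derivative (\<Sum>v\<in>V. h (x t z) v * y t z v)) (at t)" for t
    by (rule C1_onD(1)[OF H xd])
   have "isCont (%t. h (x t z) v) t" if "v \<in> V" for v t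
    by (rule coord_continuous_isCont[OF C1_onD(3)[OF H that]]) (use xd DERIV_isCont in blast)
   thus "isCont (%t. \<Sum>v\<in>V. h (x t z) v * y t z v) t" for t
    using yc by (intro continuous_intros) auto
  qed simp
  moreover have "x (pi/2) z = (%u. X u (snd z))" "x 0 z = (%u. X u (fst z))" by (auto simp: x_def)
  ultimately show ?thesis by (simp add: D_def mult.assoc)
 qed
 have hm[measurable]: "(%p. h (x (snd p) (fst p)) v) \<in> rv (?P \<Otimes>\<^sub>M lborel)" if "v \<in> V" for v
  unfolding x_def by (rule C1_on_measurable(2)[OF H _ that]) measurable
 have hm'[measurable]: "(%z. h (x t z) v) \<in> rv ?P" if "v \<in> V" for v t
  unfolding x_def by (rule C1_on_measurable(2)[OF H _ that]) measurable
 have ym[measurable]: "(%p. y (snd p) (fst p) v) \<in> rv (?P \<Otimes>\<^sub>M lborel)" if "v \<in> V" for v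
  unfolding y_def using that by measurable
 have ym'[measurable]: "(%z. y t z v) \<in> rv ?P" if "v \<in> V" for v t
  unfolding y_def using that by measurable
 \<comment> \<open>A majorant of \<open>D\<close> that does not depend on \<open>t\<close>, for
   Fubini's theorem.\<close>
 define S where "S = (%z. \<Sum>v\<in>V. B * B * (\<bar>X v (fst z)\<bar> + \<bar>X v (snd z)\<bar>))"
 have S0: "S z \<ge> 0" for z unfolding S_def using B0 by (intro sum_nonneg) auto
 have iS: "integrable ?P S" unfolding S_def using iX by auto
 have Sm[measurable]: "S \<in> rv ?P" using iS by auto
 have iSt: "integrable (?P \<Otimes>\<^sub>M lborel) (%p. S (fst p) * indicator {0..pi/2} (snd p))"
 proof (rule PL.Fubini_integrable)
  have n: "(LINT t|lborel. norm (S z * indicator {0..pi/2} t :: real)) = S z * (pi/2)" for z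
   using S0 by (simp add: abs_mult)
  show "integrable ?P (%z. (LINT t|lborel. norm (S (fst (z, t)) * indicator {0..pi/2} (snd (z, t)) :: real)))"
   unfolding fst_conv snd_conv n using iS by simp
  show "AE z in ?P. integrable lborel (%t. S (fst (z, t)) * indicator {0..pi/2} (snd (z, t)) :: real)"
   by auto
 qed simp
 have yb: "\<bar>y t z v\<bar> <= \<bar>X v (fst z)\<bar> + \<bar>X v (snd z)\<bar>" for t z v
 proof -
  have "\<bar>y t z v\<bar> <= \<bar>cos t\<bar> * \<bar>X v (snd z)\<bar> + \<bar>sin t\<bar> * \<bar>X v (fst z)\<bar>"
   unfolding y_def by (rule order_trans[OF abs_triangle_ineq4]) (simp add: abs_mult)
  also have "... <= 1 * \<bar>X v (snd z)\<bar> + 1 * \<bar>X v (fst z)\<bar>" by (intro add_mono mult_right_mono) auto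
  finally show ?thesis by simp
 qed
 have Db: "\<bar>D t z\<bar> <= S z" for t z
 proof -
  have "\<bar>D t z\<bar> <= B * (\<Sum>v\<in>V. \<bar>h (x t z) v * y t z v\<bar>)"
   unfolding D_def abs_mult[of "F _"] using BF(1) B0 by (intro mult_mono sum_abs) auto
  also have "... = (\<Sum>v\<in>V. B * (\<bar>h (x t z) v\<bar> * \<bar>y t z v\<bar>))" by (simp add: sum_distrib_left abs_mult)
  also have "... <= S z" unfolding S_def mult.assoc
   using B0 yb by (intro sum_mono mult_left_mono mult_mono BH) auto
  finally show ?thesis .
 qed
 have iD: "integrable (?P \<Otimes>\<^sub>M lborel) (%p. D (snd p) (fst p) * indicator {0..pi/2} (snd p))"
 proof (rule Bochner_Integration.integrable_bound[OF iSt])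
  show "AE p in ?P \<Otimes>\<^sub>M lborel. norm (D (snd p) (fst p) * indicator {0..pi/2} (snd p)) <= norm (S (fst p) * indicator {0..pi/2} (snd p) :: real)"
   using Db S0 by (auto simp: abs_mult intro!: mult_right_mono)
 qed (auto simp: D_def)
 have "(LINT z|M. F (%u. X u z) * H (%u. X u z)) - (LINT z|M. F (%u. X u z)) * (LINT z|M. H (%u. X u z))
  = - (LINT z|?P. F (%u. X u (fst z)) * (H (%u. X u (snd z)) - H (%u. X u (fst z))))"
  unfolding right_diff_distrib using iP by (simp add: e1 e2)
 also have "... = - (LINT z|?P. (LINT t|lborel. D t z * indicator {0..pi/2} t))" unfolding ftc ..
 also have "... = - (LINT t|lborel. (LINT z|?P. D t z * indicator {0..pi/2} t))"
  using iD by (subst PL.Fubini_integral[of "%z t. D t z * indicator {0..pi/2} t"]) (auto simp: case_prod_unfold)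
 also have "... = - (LINT t|lborel. - (indicator {0..pi/2} t * (sin t * (\<Sum>v\<in>V. \<Sum>w\<in>V. Q v w * (LINT z|?P. h (%u. X u (fst z)) v *
      f (%u. cos t * X u (fst z) + sin t * X u (snd z)) w)))))"
 proof (intro arg_cong[of _ _ uminus] Bochner_Integration.integral_cong[OF refl])
  fix t :: real
  have iv: "integrable ?P (%z. F (%u. X u (fst z)) * (h (x t z) v * y t z v))" if "v \<in> V" for v
  proof (rule Bochner_Integration.integrable_bound[OF integrable_mult_right[OF iX[OF that], of "B * B"]])
   have "\<bar>F a * (h b v * y t z v)\<bar> <= \<bar>B * B * (\<bar>X v (fst z)\<bar> + \<bar>X v (snd z)\<bar>)\<bar>" for a b z
    unfolding abs_mult mult.assoc using BF(1)[of a] BH(2)[OF that, of b] B0 yb[of t z v] by (intro mult_mono) auto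
   thus "AE z in ?P. norm (F (%u. X u (fst z)) * (h (x t z) v * y t z v)) <= norm (B * B * (\<bar>X v (fst z)\<bar> + \<bar>X v (snd z)\<bar>))"
    by auto
  qed (use that in measurable)
  have "(LINT z|?P. D t z * indicator {0..pi/2} t) = indicator {0..pi/2} t * (LINT z|?P. (\<Sum>v\<in>V. F (%u. X u (fst z)) * (h (x t z) v * y t z v)))"
   unfolding D_def by (subst integral_mult_right_zero[symmetric]) (simp add: sum_distrib_left mult_ac)
  also have "(LINT z|?P. (\<Sum>v\<in>V. F (%u. X u (fst z)) * (h (x t z) v * y t z v))) = (\<Sum>v\<in>V. (LINT z|?P. F (%u. X u (fst z)) * (h (x t z) v * y t z v)))"
   using iv by (rule Bochner_Integration.integral_sum)
  also have "... = (\<Sum>v\<in>V. - sin t * (\<Sum>w\<in>V. Q v w * (LINT z|?P. h (%u. X u (fst z)) v *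
      f (%u. cos t * X u (fst z) + sin t * X u (snd z)) w)))"
   unfolding x_def y_def by (intro sum.cong refl gauss_cov_aux[OF G unit sym F BF H BH(2)])
  finally show "(LINT z|?P. D t z * indicator {0..pi/2} t) = - (indicator {0..pi/2} t * (sin t * (\<Sum>v\<in>V. \<Sum>w\<in>V. Q v w * (LINT z|?P. h (%u. X u (fst z)) v *
      f (%u. cos t * X u (fst z) + sin t * X u (snd z)) w))))"
   by (simp add: sum_distrib_left sum_negf mult_ac)
 qed
 finally show ?thesis by simp
qed

section \<open>Hypercontractivity\<close>

lemma young_cube:
 fixes x y :: real assumes "0 <= x"
 shows "x ^ 3 * y <= (3 * x ^ 4 + y ^ 4) / 4"
proof -
 have "3 * x ^ 4 + y ^ 4 - 4 * x ^ 3 * y = (x - y)\<^sup>2 * (2 * x\<^sup>2 + (x + y)\<^sup>2)"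
  by (simp add: power2_eq_square power3_eq_cube power4_eq_xxxx algebra_simps)
 also have "... \<ge> 0" by simp
 finally show ?thesis by simp
qed

text \<open>On two equally likely points let \<open>\<phi>\<close> take the values
  \<open>x1 ^ 3\<close> and \<open>x2 ^ 3\<close>. Then \<open>n ^ 3\<close> is its norm with
  exponent 4/3, and the left side is the mean of \<open>\<phi>\<close> times
  \<open>T \<phi>\<close>, where \<open>T\<close> multiplies the odd part by \<open>r\<close>. For
  \<open>r <= 1/3\<close> the fourth moment of \<open>T \<phi>\<close> is at most the square of this
  mean, and Hoelder's inequality with exponents 4/3 and 4 finishes. Cubes and fourth powers avoid
  fractional exponents.\<close>

lemma two_point_norm:
 fixes x1 x2 n r :: real
 assumes "0 <= x1" "0 <= x2" "0 <= n" "n ^ 4 = (x1 ^ 4 + x2 ^ 4) / 2" "0 <= r" "r <= 1/3"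
 shows "((x1 ^ 3 + x2 ^ 3) / 2)\<^sup>2 + r * ((x1 ^ 3 - x2 ^ 3) / 2)\<^sup>2 <= n ^ 6"
proof -
 define a b where "a = (x1 ^ 3 + x2 ^ 3) / 2" and "b = (x1 ^ 3 - x2 ^ 3) / 2"
 define q s where "q = a\<^sup>2 + r * b\<^sup>2" and "s = sqrt q"
 have q0: "q \<ge> 0" using assms by (simp add: q_def)
 have s2: "s\<^sup>2 = q" and s0: "s \<ge> 0" using q0 by (auto simp: s_def)
 have f: "x1 ^ 3 = a + b" "x2 ^ 3 = a - b" by (auto simp: a_def b_def field_simps)
 have "s <= n ^ 3"
 proof (cases "n = 0 \<or> s = 0")
  case True
  then show ?thesis
  proof
   assume "n = 0"
   hence "x1 ^ 4 + x2 ^ 4 = 0" using assms by simp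
   moreover have "x1 ^ 4 \<ge> 0" "x2 ^ 4 \<ge> 0" by auto
   ultimately have "x1 ^ 4 = 0" "x2 ^ 4 = 0" by linarith+
   hence "x1 = 0" "x2 = 0" by auto
   thus ?thesis using assms by (simp add: s_def q_def a_def b_def)
  qed (use assms in auto)
 next
  case False
  hence n: "n > 0" and s: "s > 0" using assms s0 by auto
  \<comment> \<open>This scaling balances the two terms of Young's inequality: they become 3/4 and
    1/4 of \<open>s * n ^ 3\<close>.\<close>
  define u where "u = root 4 (s / n)"
  have u: "u > 0" "u ^ 4 = s / n" using n s by (auto simp: u_def)
  have y1: "x1 ^ 3 * (a + r * b) <= (3 * (u * x1) ^ 4 + ((a + r * b) / u ^ 3) ^ 4) / 4"
   using young_cube[of "u * x1" "(a + r * b) / u ^ 3"] u assms by (simp add: power_mult_distrib)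
  have y2: "x2 ^ 3 * (a - r * b) <= (3 * (u * x2) ^ 4 + ((a - r * b) / u ^ 3) ^ 4) / 4"
   using young_cube[of "u * x2" "(a - r * b) / u ^ 3"] u assms by (simp add: power_mult_distrib)
  \<comment> \<open>The factor \<open>1 - 3 * r\<close> below is the origin of the bound
    \<open>r <= 1/3\<close>.\<close>
  have k4: "((a + r * b) ^ 4 + (a - r * b) ^ 4) / 2 <= q\<^sup>2"
  proof -
   have "q\<^sup>2 - ((a + r * b) ^ 4 + (a - r * b) ^ 4) / 2 = 2 * a\<^sup>2 * b\<^sup>2 * (r * (1 - 3 * r)) + b ^ 4 * (r\<^sup>2 * (1 - r\<^sup>2))"
    by (simp add: q_def power2_eq_square power4_eq_xxxx algebra_simps)
   also have "... \<ge> 0"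
    using assms by (intro add_nonneg_nonneg mult_nonneg_nonneg) (auto simp: power_le_one)
   finally show ?thesis by simp
  qed
  have "q = (x1 ^ 3 * (a + r * b) + x2 ^ 3 * (a - r * b)) / 2"
   unfolding f q_def by (simp add: algebra_simps power2_eq_square)
  also have "... <= ((3 * (u * x1) ^ 4 + ((a + r * b) / u ^ 3) ^ 4) / 4 + (3 * (u * x2) ^ 4 + ((a - r * b) / u ^ 3) ^ 4) / 4) / 2"
   using add_mono[OF y1 y2] by (intro divide_right_mono) auto
  also have "... = 3 / 4 * u ^ 4 * n ^ 4 + 1 / 4 * (((a + r * b) ^ 4 + (a - r * b) ^ 4) / 2) / (u ^ 4) ^ 3"
   unfolding assms(4) using u(1) by (simp add: power_mult_distrib power_divide field_simps flip: power_mult)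
  also have "... <= 3 / 4 * u ^ 4 * n ^ 4 + 1 / 4 * q\<^sup>2 / (u ^ 4) ^ 3"
   using k4 u n s by (intro add_left_mono divide_right_mono mult_left_mono) auto
  also have "... = s * n ^ 3"
   using n s unfolding u(2) s2[symmetric] by (simp add: field_simps power2_eq_square power3_eq_cube power4_eq_xxxx)
  finally have "s * s <= s * n ^ 3" using s2 by (simp add: power2_eq_square)
  thus "s <= n ^ 3" using s by simp
 qed
 hence "s\<^sup>2 <= (n ^ 3)\<^sup>2" using s0 by (intro power_mono) auto
 thus ?thesis unfolding s2 q_def a_def b_def by (simp flip: power_mult)
qed

text \<open>For functions with means \<open>a\<close>, \<open>c\<close> and odd parts
  \<open>b\<close>, \<open>d\<close> of two signs with correlation \<open>r\<close>, the mean of the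
  product is \<open>a * c + r * b * d\<close>. This is an inner product, so Cauchy-Schwarz reduces
  the claim to \<open>two_point_norm\<close>.\<close>

lemma two_point_hypercontractive:
 fixes x1 x2 y1 y2 n m r :: real
 assumes x: "0 <= x1" "0 <= x2" "0 <= n" "n ^ 4 = (x1 ^ 4 + x2 ^ 4) / 2"
  and y: "0 <= y1" "0 <= y2" "0 <= m" "m ^ 4 = (y1 ^ 4 + y2 ^ 4) / 2" and r: "0 <= r" "r <= 1/3"
 shows "((1 + r) * (x1 ^ 3 * y1 ^ 3 + x2 ^ 3 * y2 ^ 3) + (1 - r) * (x1 ^ 3 * y2 ^ 3 + x2 ^ 3 * y1 ^ 3)) / 4 <= n ^ 3 * m ^ 3"
proof -
 define a b c d where "a = (x1 ^ 3 + x2 ^ 3) / 2" and "b = (x1 ^ 3 - x2 ^ 3) / 2"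
  and "c = (y1 ^ 3 + y2 ^ 3) / 2" and "d = (y1 ^ 3 - y2 ^ 3) / 2"
 have f: "x1 ^ 3 = a + b" "x2 ^ 3 = a - b" "y1 ^ 3 = c + d" "y2 ^ 3 = c - d" by (auto simp: a_def b_def c_def d_def field_simps)
 have 1: "a\<^sup>2 + r * b\<^sup>2 <= n ^ 6" unfolding a_def b_def by (rule two_point_norm[OF x r])
 have 2: "c\<^sup>2 + r * d\<^sup>2 <= m ^ 6" unfolding c_def d_def by (rule two_point_norm[OF y r])
 have "((1 + r) * (x1 ^ 3 * y1 ^ 3 + x2 ^ 3 * y2 ^ 3) + (1 - r) * (x1 ^ 3 * y2 ^ 3 + x2 ^ 3 * y1 ^ 3)) / 4 = a * c + r * b * d"
  unfolding f by (simp add: algebra_simps)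
 also have "... <= n ^ 3 * m ^ 3"
 proof (rule power2_le_imp_le)
  have "(a * c + r * b * d)\<^sup>2 + r * (a * d - b * c)\<^sup>2 = (a\<^sup>2 + r * b\<^sup>2) * (c\<^sup>2 + r * d\<^sup>2)"
   by (simp add: algebra_simps power2_eq_square)
  moreover have "r * (a * d - b * c)\<^sup>2 \<ge> 0" using r by simp
  ultimately have "(a * c + r * b * d)\<^sup>2 <= (a\<^sup>2 + r * b\<^sup>2) * (c\<^sup>2 + r * d\<^sup>2)" by linarith
  also have "... <= n ^ 6 * m ^ 6" using 1 2 r by (intro mult_mono) auto
  finally show "(a * c + r * b * d)\<^sup>2 <= (n ^ 3 * m ^ 3)\<^sup>2" by (simp add: power_mult_distrib flip: power_mult)
 qed (use x y in auto)
 finally show ?thesis .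
qed

section \<open>Correlated sign walks and the central limit theorem\<close>

text \<open>The two signs agree with probability \<open>(1 + r) / 2\<close>, so their correlation is
  \<open>r\<close>.\<close>

definition sign_pair_pmf :: "real => plane pmf" where
 "sign_pair_pmf r = do {
   b \<leftarrow> bernoulli_pmf (1/2);
   c \<leftarrow> bernoulli_pmf ((1 + r) / 2);
   return_pmf (if b then 1 else -1, if b = c then 1 else -1)}"

primrec sign_walk_pmf :: "real => real => nat => plane pmf" where
 "sign_walk_pmf r h 0 = return_pmf (0, 0)"
| "sign_walk_pmf r h (Suc n) =
   do {z \<leftarrow> sign_walk_pmf r h n; e \<leftarrow> sign_pair_pmf r; return_pmf (z + h *\<^sub>R e)}"

lemma expectation_sign_pair:
 fixes \<Phi> :: "plane => 'a :: {banach, second_countable_topology}"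
 assumes "0 <= p" "p <= 1"
 shows "measure_pmf.expectation (sign_pair_pmf p) \<Phi> =
  (1/4) *\<^sub>R ((1 + p) *\<^sub>R (\<Phi> (1, 1) + \<Phi> (-1, -1)) + (1 - p) *\<^sub>R (\<Phi> (1, -1) + \<Phi> (-1, 1)))"
proof -
 define q where "q = (1 + p) / 2"
 have q: "0 <= q" "q <= 1" and p: "p = 2 * q - 1" using assms by (auto simp: q_def field_simps)
 have "measure_pmf.expectation (sign_pair_pmf p) \<Phi> =
  (1/2) *\<^sub>R (q *\<^sub>R (\<Phi> (1, 1) + \<Phi> (-1, -1)) + (1 - q) *\<^sub>R (\<Phi> (1, -1) + \<Phi> (-1, 1)))"
 proof -
  have i: "measure_pmf.expectation (bernoulli_pmf r \<bind> k) \<Phi> = r *\<^sub>R measure_pmf.expectation (k True) \<Phi> + (1 - r) *\<^sub>R measure_pmf.expectation (k False) \<Phi>"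
   if "0 <= r" "r <= 1" "!!b. finite (set_pmf (k b))" for k :: "bool => plane pmf" and r
   using that by (subst pmf_expectation_bind[of UNIV]) (auto simp: UNIV_bool)
  show ?thesis
   unfolding sign_pair_pmf_def q_def[symmetric] using q
   by (subst i, simp, simp, simp)+ (simp add: algebra_simps)
 qed
 also have "... = (1/4) *\<^sub>R ((1 + p) *\<^sub>R (\<Phi> (1, 1) + \<Phi> (-1, -1)) + (1 - p) *\<^sub>R (\<Phi> (1, -1) + \<Phi> (-1, 1)))"
  unfolding p by (simp add: algebra_simps)
 finally show ?thesis .
qed

lemma finite_sign_walk [simp]: "finite (set_pmf (sign_pair_pmf r))" "finite (set_pmf (sign_walk_pmf r h n))"
proof -
 show "finite (set_pmf (sign_pair_pmf r))" unfolding sign_pair_pmf_def by simp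
 thus "finite (set_pmf (sign_walk_pmf r h n))" by (induction n) auto
qed

lemma expectation_sign_walk_Suc:
 fixes \<Phi> :: "plane => 'a :: {banach, second_countable_topology}"
 shows "measure_pmf.expectation (sign_walk_pmf r h (Suc n)) \<Phi> =
  measure_pmf.expectation (sign_walk_pmf r h n)
   (%z. measure_pmf.expectation (sign_pair_pmf r) (%e. \<Phi> (z + h *\<^sub>R e)))"
proof -
 let ?A = "set_pmf (sign_walk_pmf r h n)"
 have "measure_pmf.expectation (bind_pmf (sign_pair_pmf r) (%e. return_pmf (z + h *\<^sub>R e))) \<Phi> =
   measure_pmf.expectation (sign_pair_pmf r) (%e. \<Phi> (z + h *\<^sub>R e))" for z
  by (subst pmf_expectation_bind[of "set_pmf (sign_pair_pmf r)"]) (auto simp: integral_measure_pmf[of "set_pmf (sign_pair_pmf r)"])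
 thus ?thesis
  by (simp add: pmf_expectation_bind[of ?A] integral_measure_pmf[of ?A] del: sign_walk_pmf.simps(1))
qed

lemma expectation_sign_walk_Suc':
 fixes \<Phi> :: "plane => 'a :: {banach, second_countable_topology}"
 assumes "0 <= r" "r <= 1"
 shows "measure_pmf.expectation (sign_walk_pmf r h (Suc n)) \<Phi> =
  measure_pmf.expectation (sign_walk_pmf r h n)
   (%(x, y). (1/4) *\<^sub>R ((1 + r) *\<^sub>R (\<Phi> (x + h, y + h) + \<Phi> (x - h, y - h)) + (1 - r) *\<^sub>R (\<Phi> (x + h, y - h) + \<Phi> (x - h, y + h))))"
 unfolding expectation_sign_walk_Suc expectation_sign_pair[OF assms]
 by (simp add: case_prod_unfold plus_prod_def)

text \<open>Integrating out the last step at a fixed earlier position is the two-point inequality.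
  It replaces \<open>f\<close> and \<open>g\<close> by their fourth-power means over that step,
  whose fourth moments along the shorter walk are those of \<open>f\<close> and \<open>g\<close>
  along the longer one.\<close>

lemma sign_walk_hypercontractive:
 fixes f g :: "real => real"
 assumes f: "!!x. 0 <= f x" and g: "!!x. 0 <= g x" and r: "0 <= r" "r <= 1/3"
 shows "measure_pmf.expectation (sign_walk_pmf r h n) (%(x, y). f x ^ 3 * g y ^ 3) <=
  root 4 (measure_pmf.expectation (sign_walk_pmf r h n) (%(x, y). f x ^ 4)) ^ 3 *
  root 4 (measure_pmf.expectation (sign_walk_pmf r h n) (%(x, y). g y ^ 4)) ^ 3"
 using f g
proof (induction n arbitrary: f g)
 case 0
 then show ?case by (simp add: real_root_pos2)
next
 case (Suc n)
 have r1: "r <= 1" using r by simp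
 define f' where "f' x = root 4 ((f (x + h) ^ 4 + f (x - h) ^ 4) / 2)" for x
 define g' where "g' x = root 4 ((g (x + h) ^ 4 + g (x - h) ^ 4) / 2)" for x
 have f': "f' x \<ge> 0" "f' x ^ 4 = (f (x + h) ^ 4 + f (x - h) ^ 4) / 2" for x
  by (auto simp: f'_def)
 have g': "g' x \<ge> 0" "g' x ^ 4 = (g (x + h) ^ 4 + g (x - h) ^ 4) / 2" for x
  by (auto simp: g'_def)
 let ?E = "measure_pmf.expectation (sign_walk_pmf r h n)"
 have int: "integrable (sign_walk_pmf r h n) (\<Phi> :: _ => real)" for \<Phi>
  by (rule integrable_measure_pmf_finite) simp
 have "measure_pmf.expectation (sign_walk_pmf r h (Suc n)) (%(x, y). f x ^ 3 * g y ^ 3) <= ?E (%(x, y). f' x ^ 3 * g' y ^ 3)"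
  unfolding expectation_sign_walk_Suc'[OF r(1) r1]
 proof (intro integral_mono int)
  have "((1 + r) * (f (x + h) ^ 3 * g (y + h) ^ 3 + f (x - h) ^ 3 * g (y - h) ^ 3) +
    (1 - r) * (f (x + h) ^ 3 * g (y - h) ^ 3 + f (x - h) ^ 3 * g (y + h) ^ 3)) / 4 <= f' x ^ 3 * g' y ^ 3" for x y
   by (rule two_point_hypercontractive) (use Suc.prems f' g' r in auto)
  thus "(case z of (x, y) => (1 / 4) *\<^sub>R
    ((1 + r) *\<^sub>R ((case (x + h, y + h) of (x, y) => f x ^ 3 * g y ^ 3) + (case (x - h, y - h) of (x, y) => f x ^ 3 * g y ^ 3)) +
    (1 - r) *\<^sub>R ((case (x + h, y - h) of (x, y) => f x ^ 3 * g y ^ 3) + (case (x - h, y + h) of (x, y) => f x ^ 3 * g y ^ 3)))) <=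
   (case z of (x, y) => f' x ^ 3 * g' y ^ 3)" for z
   by (cases z) simp
 qed
 also have "... <= root 4 (?E (%(x, y). f' x ^ 4)) ^ 3 * root 4 (?E (%(x, y). g' y ^ 4)) ^ 3"
  by (rule Suc.IH) (use f' g' in auto)
 also have "?E (%(x, y). f' x ^ 4) = measure_pmf.expectation (sign_walk_pmf r h (Suc n)) (%(x, y). f x ^ 4)"
  unfolding expectation_sign_walk_Suc'[OF r(1) r1] f'
  by (intro Bochner_Integration.integral_cong refl) (auto simp: field_simps)
 also have "?E (%(x, y). g' y ^ 4) = measure_pmf.expectation (sign_walk_pmf r h (Suc n)) (%(x, y). g y ^ 4)"
  unfolding expectation_sign_walk_Suc'[OF r(1) r1] g'
  by (intro Bochner_Integration.integral_cong refl) (auto simp: field_simps)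
 finally show ?case .
qed

lemma sign_walk_char:
 assumes "0 <= p" "p <= 1"
 shows "measure_pmf.expectation (sign_walk_pmf p h n) (%(x, y). iexp (s * x + t * y)) =
  of_real (((1 + p) / 2 * cos (h * (s + t)) + (1 - p) / 2 * cos (h * (s - t))) ^ n)"
proof (induction n)
 case 0
 then show ?case by simp
next
 case (Suc n)
 let ?c = "(1 + p) / 2 * cos (h * (s + t)) + (1 - p) / 2 * cos (h * (s - t))"
 have st: "(1/4) *\<^sub>R ((1 + p) *\<^sub>R (iexp (s * (x + h) + t * (y + h)) + iexp (s * (x - h) + t * (y - h))) + (1 - p) *\<^sub>R (iexp (s * (x + h) + t * (y - h)) + iexp (s * (x - h) + t * (y + h))))
  = of_real ?c * iexp (s * x + t * y)" for x y
 proof -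
  define u where "u = iexp (s * x + t * y)"
  have cc: "complex_of_real (2 * cos r) = iexp r + iexp (- r)" for r
   by (auto simp: complex_eq_iff Re_exp Im_exp)
  have e: "iexp (s * (x + h) + t * (y + h)) = u * iexp (h * (s + t))" "iexp (s * (x - h) + t * (y - h)) = u * iexp (- (h * (s + t)))"
    "iexp (s * (x + h) + t * (y - h)) = u * iexp (h * (s - t))" "iexp (s * (x - h) + t * (y + h)) = u * iexp (- (h * (s - t)))"
   unfolding u_def exp_add[symmetric] by (rule arg_cong[of _ _ exp]; simp add: algebra_simps)+
  have "of_real ?c = (1/4) *\<^sub>R ((1 + p) *\<^sub>R complex_of_real (2 * cos (h * (s + t))) + (1 - p) *\<^sub>R complex_of_real (2 * cos (h * (s - t))))"
   by (simp add: scaleR_conv_of_real)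
  moreover have "(1/4) *\<^sub>R ((1 + p) *\<^sub>R (u * e1 + u * e2) + (1 - p) *\<^sub>R (u * e3 + u * e4)) =
    ((1/4) *\<^sub>R ((1 + p) *\<^sub>R (e1 + e2) + (1 - p) *\<^sub>R (e3 + e4))) * u" for e1 e2 e3 e4 :: complex
   by (simp add: scaleR_conv_of_real algebra_simps)
  ultimately show ?thesis unfolding e cc u_def[symmetric] by (simp only:)
 qed
 have "measure_pmf.expectation (sign_walk_pmf p h (Suc n)) (%(x, y). iexp (s * x + t * y)) =
  measure_pmf.expectation (sign_walk_pmf p h n) (%z. of_real ?c * (%(x, y). iexp (s * x + t * y)) z)"
  unfolding expectation_sign_walk_Suc'[OF assms]
  by (intro Bochner_Integration.integral_cong refl) (simp only: case_prod_unfold fst_conv snd_conv st)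
 also have "... = of_real ?c * of_real (?c ^ n)"
  by (subst integral_mult_right_zero) (simp only: Suc.IH)
 finally show ?case by simp
qed

lemma abs_cos_minus_le:
 fixes x :: real
 shows "\<bar>cos x - (1 - x\<^sup>2 / 2)\<bar> <= x ^ 4 / 24"
proof -
 obtain t where "cos x = (\<Sum>m<4. cos_coeff m * x ^ m) + (cos (t + 1/2 * real 4 * pi) / fact 4) * x ^ 4"
  using Maclaurin_cos_expansion[of x 4] by auto
 moreover have "(\<Sum>m<4. cos_coeff m * x ^ m) = 1 - x\<^sup>2 / 2"
 proof -
  have "(\<Sum>m<4. cos_coeff m * x ^ m) = cos_coeff 0 * x ^ 0 + cos_coeff 1 * x ^ 1 + cos_coeff 2 * x ^ 2 + cos_coeff 3 * x ^ 3"
   by (simp add: eval_nat_numeral)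
  thus ?thesis by (simp add: cos_coeff_def)
 qed
 ultimately have "cos x - (1 - x\<^sup>2 / 2) = cos (t + 1/2 * real 4 * pi) * (x ^ 4 / 24)"
  by (simp add: fact_numeral)
 also have "\<bar>...\<bar> <= 1 * (x ^ 4 / 24)"
  unfolding abs_mult by (intro mult_mono) auto
 finally show ?thesis by simp
qed

text \<open>By the expansion of the cosine each step contributes \<open>1 - q / (2 * n)\<close> up
  to \<open>K / n ^ 2\<close>; the \<open>n\<close>-th powers of numbers of modulus at most 1 differ
  by at most \<open>n\<close> times the difference of the numbers.\<close>

lemma sign_walk_char_limit:
 assumes "0 <= w" "w <= 1"
 shows "(%n. measure_pmf.expectation (sign_walk_pmf w (1 / sqrt (real n)) n) (%(x, y). iexp (s * x + t * y)))
  ----> of_real (exp (- (s\<^sup>2 + t\<^sup>2 + 2 * w * s * t) / 2))"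
proof -
 define q where "q = s\<^sup>2 + t\<^sup>2 + 2 * w * s * t"
 define c where "c n = (1 + w) / 2 * cos (1 / sqrt (real n) * (s + t)) + (1 - w) / 2 * cos (1 / sqrt (real n) * (s - t))" for n :: nat
 define K where "K = (s + t) ^ 4 + (s - t) ^ 4"
 have b: "\<bar>c n - (1 + (- q / 2) / n)\<bar> <= K / (real n)\<^sup>2" if n: "n > 0" for n
 proof -
  have sq2: "(1 / sqrt (real n) * r)\<^sup>2 = r\<^sup>2 / n" for r
   by (simp add: power_mult_distrib power_divide)
  have "(1 / sqrt (real n) * r) ^ 4 = ((1 / sqrt (real n) * r)\<^sup>2)\<^sup>2" for r by (simp flip: power_mult)
  hence sq: "(1 / sqrt (real n) * r)\<^sup>2 = r\<^sup>2 / n" "(1 / sqrt (real n) * r) ^ 4 = r ^ 4 / (real n)\<^sup>2" for r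
   unfolding sq2 by (simp_all add: power_divide flip: power_mult)
  have "c n - (1 + (- q / 2) / n) = (1 + w) / 2 * (cos (1 / sqrt (real n) * (s + t)) - (1 - (1 / sqrt (real n) * (s + t))\<^sup>2 / 2))
    + (1 - w) / 2 * (cos (1 / sqrt (real n) * (s - t)) - (1 - (1 / sqrt (real n) * (s - t))\<^sup>2 / 2))"
   unfolding sq c_def q_def using n by (simp add: field_simps power2_eq_square)
  also have "\<bar>...\<bar> <= 1 * ((s + t) ^ 4 / (real n)\<^sup>2) + 1 * ((s - t) ^ 4 / (real n)\<^sup>2)"
  proof -
   have p: "A / 24 <= A" if "0 <= A" for A :: real using that by simp
   have "\<bar>cos (1 / sqrt (real n) * r) - (1 - (1 / sqrt (real n) * r)\<^sup>2 / 2)\<bar> <= r ^ 4 / (real n)\<^sup>2" for r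
    by (rule order_trans[OF abs_cos_minus_le], subst sq(2), rule p) simp
   hence st: "\<bar>a * (cos (1 / sqrt (real n) * r) - (1 - (1 / sqrt (real n) * r)\<^sup>2 / 2))\<bar> <= 1 * (r ^ 4 / (real n)\<^sup>2)" if "\<bar>a\<bar> <= 1" for a r
    unfolding abs_mult using that by (intro mult_mono) auto
   have "\<bar>(1 + w) / 2\<bar> <= 1" "\<bar>(1 - w) / 2\<bar> <= 1" using assms by auto
   from add_mono[OF st[OF this(1)] st[OF this(2)]] show ?thesis
    by (rule order_trans[OF abs_triangle_ineq])
  qed
  also have "... = K / (real n)\<^sup>2" by (simp add: K_def add_divide_distrib)
  finally show ?thesis .
 qed
 have c1: "\<bar>c n\<bar> <= 1" for n
 proof -
  have "\<bar>c n\<bar> <= \<bar>(1 + w) / 2\<bar> * 1 + \<bar>(1 - w) / 2\<bar> * 1"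
   unfolding c_def by (intro order_trans[OF abs_triangle_ineq] add_mono; unfold abs_mult; intro mult_mono) auto
  thus ?thesis using assms by (simp add: field_simps)
 qed
 have lim0: "(%n. K / real n) ----> 0" by (rule lim_const_over_n)
 have "(%n. c n ^ n - (1 + (- q / 2) / n) ^ n) ----> 0"
 proof (rule Lim_null_comparison[OF _ lim0])
  have ev: "eventually (%n. real n \<ge> \<bar>q\<bar>) sequentially"
   by (rule eventually_at_top_linorderI[of "nat \<lceil>\<bar>q\<bar>\<rceil>"]) linarith
  show "\<forall>\<^sub>F n in sequentially. norm (c n ^ n - (1 + (- q / 2) / n) ^ n) <= K / real n"
   using ev eventually_gt_at_top[of 0]
  proof eventually_elim
   case (elim n)
   have "\<bar>q\<bar> / n <= 1" using elim by simp
   hence "- 1 <= q / n" "q / n <= 1" by (auto simp: abs_le_iff divide_le_eq le_divide_eq elim)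
   hence "\<bar>1 + (- q / 2) / n\<bar> <= 1 \<or> q < 0" by (auto simp: abs_le_iff)
   moreover have "q \<ge> 0"
   proof -
    have "q = (1 - w) * (s\<^sup>2 + t\<^sup>2) + w * (s + t)\<^sup>2" by (simp add: q_def power2_eq_square algebra_simps)
    thus ?thesis using assms by simp
   qed
   ultimately have "\<bar>1 + (- q / 2) / n\<bar> <= 1" by auto
   hence "norm (c n ^ n - (1 + (- q / 2) / n) ^ n) <= n * norm (c n - (1 + (- q / 2) / n))"
    using c1[of n] by (intro norm_power_diff) auto
   also have "... <= n * (K / (real n)\<^sup>2)" using b[of n] elim by (intro mult_left_mono) auto
   also have "... = K / n" using elim by (simp add: power2_eq_square)
   finally show ?case .
  qed
 qed
 moreover have "(%n. (1 + (- q / 2) / n) ^ n) ----> exp (- q / 2)" by (rule tendsto_exp_limit_sequentially)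
 ultimately have "(%n. c n ^ n) ----> exp (- q / 2)" using tendsto_add[of "%n. c n ^ n - (1 + (- q / 2) / n) ^ n" 0] by force
 hence "(%n. complex_of_real (c n ^ n)) ----> of_real (exp (- q / 2))" by (rule tendsto_of_real)
 thus ?thesis unfolding sign_walk_char[OF assms] c_def q_def by simp
qed

text \<open>Two one-dimensional steps: first \<open>Y\<close> is the variable and the exponential in
  \<open>X\<close> the weight, then \<open>X\<close> is the variable and \<open>g\<close> of
  \<open>Y\<close> the weight.\<close>

lemma joint_levy_continuity:
 fixes X Y :: "nat => 'a => real" and X' Y' :: "'b => real" and f g :: "real => real"
 assumes M: "!!n. prob_space (M n)" and M': "prob_space M'"
  and X: "!!n. X n \<in> rv (M n)" and X': "X' \<in> rv M'"
  and Y: "!!n. Y n \<in> rv (M n)" and Y': "Y' \<in> rv M'"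
  and conv: "!!s t. (%n. CLINT w|M n. iexp (s * X n w + t * Y n w)) ----> (CLINT w|M'. iexp (s * X' w + t * Y' w))"
  and f: "continuous_on UNIV f" "!!x. \<bar>f x\<bar> <= B" and g: "continuous_on UNIV g" "!!x. 0 <= g x" "!!x. g x <= 1"
 shows "(%n. (LINT w|(M n). f (X n w) * g (Y n w))) ----> (LINT w|M'. f (X' w) * g (Y' w))"
proof -
 note [measurable] = X X' Y Y'
 have gb: "\<bar>g x\<bar> <= 1" for x using g(2,3)[of x] by simp
 have [measurable]: "g \<in> rv borel" using g by (auto intro: borel_measurable_continuous_onI)
 have c: "(%n. CLINT w|M n. iexp (s * X n w) * of_real (g (Y n w))) ----> (CLINT w|M'. iexp (s * X' w) * of_real (g (Y' w)))" for s
 proof (rule complex_weight_levy[OF M Y _ _ M' Y' _ _ _ _ g(1) gb])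
  show "(%n. CLINT w|M n. iexp (t * Y n w)) ----> (CLINT w|M'. iexp (t * Y' w))" for t using conv[of 0 t] by simp
  show "(%n. CLINT w|M n. iexp (s * X n w) * iexp (t * Y n w)) ----> (CLINT w|M'. iexp (s * X' w) * iexp (t * Y' w))" for t
   using conv[of s t] by (simp add: distrib_left exp_add)
 qed (auto intro!: measurable_compose[OF _ borel_measurable_exp])
 have "(%n. CLINT w|M n. of_real (g (Y n w)) * of_real (f (X n w))) ----> (CLINT w|M'. of_real (g (Y' w)) * of_real (f (X' w)))"
 proof (rule complex_weight_levy[OF M X _ _ M' X' _ _ _ _ f])
  show "(%n. CLINT w|M n. iexp (t * X n w)) ----> (CLINT w|M'. iexp (t * X' w))" for t using conv[of t 0] by simp
  show "(%n. CLINT w|M n. of_real (g (Y n w)) * iexp (t * X n w)) ----> (CLINT w|M'. of_real (g (Y' w)) * iexp (t * X' w))" for t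
   using c[of t] by (simp only: mult.commute)
 qed (use gb in auto)
 hence "(%n. complex_of_real (LINT w|(M n). f (X n w) * g (Y n w))) ----> of_real (LINT w|M'. f (X' w) * g (Y' w))"
  by (simp add: mult.commute flip: integral_complex_of_real)
 thus ?thesis by (simp only: tendsto_of_real_iff)
qed

section \<open>Hypercontractivity in Gaussian space\<close>

abbreviation std_normal_pair :: "plane measure" where
 "std_normal_pair \<equiv> std_normal_distribution \<Otimes>\<^sub>M std_normal_distribution"

lemma prob_space_std_normal: "prob_space std_normal_distribution"
 by (rule prob_space_normal_density) simp

lemma prob_space_std_normal_pair: "prob_space std_normal_pair"
proof -
 interpret prob_space std_normal_distribution by (rule prob_space_std_normal)
 interpret pair_prob_space std_normal_distribution std_normal_distribution ..
 show ?thesis by unfold_locales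
qed

lemma gauss_family_std_normal: "gauss_family std_normal_distribution {()} (%_ x. x) (%_ _. 1)"
 unfolding gauss_family_def
proof (intro conjI allI)
 show "prob_space std_normal_distribution" by (rule prob_space_std_normal)
 fix c :: "unit => real"
 have "(CLINT x|std_normal_distribution. iexp (\<Sum>v\<in>{()}. c v * x)) = char std_normal_distribution (c ())"
  unfolding char_def by simp
 also have "... = of_real (exp (- (\<Sum>v\<in>{()}. \<Sum>w\<in>{()}. c v * c w * 1) / 2))"
  by (simp add: char_std_normal_distribution power2_eq_square)
 finally show "(CLINT x|std_normal_distribution. iexp (\<Sum>v\<in>{()}. c v * x)) = of_real (exp (- (\<Sum>v\<in>{()}. \<Sum>w\<in>{()}. c v * c w * 1) / 2))" .
qed auto

lemma std_normal_pair_char: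
 "(CLINT z|std_normal_pair. iexp (s * (\<alpha> * fst z + \<beta> * snd z) + t * (c * fst z + d * snd z))) =
  of_real (exp (- ((s * \<alpha> + t * c)\<^sup>2 + (s * \<beta> + t * d)\<^sup>2) / 2))"
proof -
 have g: "gauss_family std_normal_pair (UNIV :: bool set)
  (%j z. (if j then \<alpha> else c) * fst z + (if j then \<beta> else d) * snd z)
  (%j k. ((if j then \<alpha> else c) * (if k then \<alpha> else c) + (if j then \<beta> else d) * (if k then \<beta> else d)) * 1)"
  by (rule gauss_family_two[OF gauss_family_std_normal]) auto
 from gauss_familyD(4)[OF g, of "%j. if j then s else t"] show ?thesis
  by (simp add: UNIV_bool algebra_simps power2_eq_square)
qed

lemma std_normal_pair_marginal:
 assumes "\<alpha>\<^sup>2 + \<beta>\<^sup>2 = 1"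
 shows "distr std_normal_pair borel (%z. \<alpha> * fst z + \<beta> * snd z) = std_normal_distribution"
proof -
 have g: "gauss_family std_normal_pair {()} (%j z. \<alpha> * fst z + \<beta> * snd z) (%j k. (\<alpha> * \<alpha> + \<beta> * \<beta>) * 1)"
  by (rule gauss_family_two[OF gauss_family_std_normal]) auto
 show ?thesis by (rule gauss_std_normal[OF g]) (use assms in \<open>auto simp: power2_eq_square\<close>)
qed

text \<open>The inequality for sign walks with step size \<open>1 / sqrt n\<close> passes to the
  limit, since all functions involved are bounded and continuous.\<close>

lemma std_normal_hypercontractive_continuous:
 fixes f g :: "real => real"
 assumes f: "continuous_on UNIV f" "!!x. 0 <= f x" "!!x. f x <= 1"
  and g: "continuous_on UNIV g" "!!x. 0 <= g x" "!!x. g x <= 1" and r: "0 <= r" "r <= 1/3"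
 shows "(LINT z|std_normal_pair. f (fst z) ^ 3 * g (r * fst z + sqrt (1 - r\<^sup>2) * snd z) ^ 3) <=
  root 4 (LINT z|std_normal_pair. f (fst z) ^ 4) ^ 3 * root 4 (LINT z|std_normal_pair. g (r * fst z + sqrt (1 - r\<^sup>2) * snd z) ^ 4) ^ 3"
proof -
 interpret P: prob_space std_normal_pair by (rule prob_space_std_normal_pair)
 define c where "c = sqrt (1 - r\<^sup>2)"
 have "r\<^sup>2 <= 1" using r by (simp add: power_le_one)
 hence c2: "c\<^sup>2 = 1 - r\<^sup>2" unfolding c_def by simp
 let ?W = "%n. measure_pmf (sign_walk_pmf r (1 / sqrt (real n)) n)"
 have lim: "(%n. (LINT z|(?W n). F (fst z) * G (snd z))) ----> (LINT z|std_normal_pair. F (fst z) * G (r * fst z + c * snd z))"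
  if F: "continuous_on UNIV F" "!!x. \<bar>F x\<bar> <= 1" and G: "continuous_on UNIV G" "!!x. 0 <= G x" "!!x. G x <= 1" for F G :: "real => real"
 proof (rule joint_levy_continuity[OF _ prob_space_std_normal_pair _ _ _ _ _ F G])
  fix s t :: real
  have "(CLINT z|std_normal_pair. iexp (s * fst z + t * (r * fst z + c * snd z))) = of_real (exp (- (s\<^sup>2 + t\<^sup>2 + 2 * r * s * t) / 2))"
  proof -
   have "(s + t * r)\<^sup>2 + (t * c)\<^sup>2 = s\<^sup>2 + t\<^sup>2 + 2 * r * s * t"
    unfolding power_mult_distrib c2 by (simp add: power2_eq_square algebra_simps)
   thus ?thesis using std_normal_pair_char[of s 1 0 t r c] by simp
  qed
  thus "(%n. CLINT z|?W n. iexp (s * fst z + t * snd z)) ----> (CLINT z|std_normal_pair. iexp (s * fst z + t * (r * fst z + c * snd z)))"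
   using sign_walk_char_limit[of r s t] r by (simp add: case_prod_unfold)
 qed (auto simp: measure_pmf.prob_space_axioms)
 have p1: "0 <= x ==> x <= 1 ==> \<bar>x ^ k\<bar> <= 1" for x :: real and k by (simp add: power_le_one)
 have 1: "(%n. (LINT z|(?W n). f (fst z) ^ 3 * g (snd z) ^ 3)) ----> (LINT z|std_normal_pair. f (fst z) ^ 3 * g (r * fst z + c * snd z) ^ 3)"
  by (rule lim[of "%x. f x ^ 3" "%x. g x ^ 3"]) (use f g p1 in \<open>auto intro!: continuous_intros power_le_one\<close>)
 have 2: "(%n. (LINT z|(?W n). f (fst z) ^ 4)) ----> (LINT z|std_normal_pair. f (fst z) ^ 4)"
  using lim[of "%x. f x ^ 4" "%x. 1"] f p1 by (auto intro!: continuous_intros)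
 have 3: "(%n. (LINT z|(?W n). g (snd z) ^ 4)) ----> (LINT z|std_normal_pair. g (r * fst z + c * snd z) ^ 4)"
  using lim[of "%x. 1" "%x. g x ^ 4"] g by (auto intro!: continuous_intros power_le_one)
 show ?thesis
  unfolding c_def[symmetric]
 proof (rule LIMSEQ_le)
  show "(%n. (LINT z|(?W n). f (fst z) ^ 3 * g (snd z) ^ 3)) ----> (LINT z|std_normal_pair. f (fst z) ^ 3 * g (r * fst z + c * snd z) ^ 3)" by (rule 1)
  show "(%n. root 4 (LINT z|(?W n). f (fst z) ^ 4) ^ 3 * root 4 (LINT z|(?W n). g (snd z) ^ 4) ^ 3) ---->
   root 4 (LINT z|std_normal_pair. f (fst z) ^ 4) ^ 3 * root 4 (LINT z|std_normal_pair. g (r * fst z + c * snd z) ^ 4) ^ 3"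
   by (intro tendsto_intros 2 3)
  show "\<exists>N. \<forall>n\<ge>N. (LINT z|(?W n). f (fst z) ^ 3 * g (snd z) ^ 3) <= root 4 (LINT z|(?W n). f (fst z) ^ 4) ^ 3 * root 4 (LINT z|(?W n). g (snd z) ^ 4) ^ 3"
   using sign_walk_hypercontractive[of f g r] f g r by (simp add: case_prod_unfold)
 qed
qed

text \<open>Borel functions are limits of continuous ones off a Lebesgue null set, which is null for
  the normal law as well; clamping keeps the values in the unit interval.\<close>

lemma continuous_approx_AE:
 fixes f :: "real => real"
 assumes [measurable]: "f \<in> rv borel" and f: "!!x. 0 <= f x" "!!x. f x <= 1"
 obtains F :: "nat => real => real" where "!!n. continuous_on UNIV (F n)" "!!n x. 0 <= F n x" "!!n x. F n x <= 1"
  "AE x in std_normal_distribution. (%n. F n x) ----> f x"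
proof -
 have "f measurable_on UNIV"
  by (rule lebesgue_measurable_imp_measurable_on_real) (auto intro: measurable_completion)
 then obtain N g where N: "negligible N" and g: "!!n. continuous_on UNIV (g n)" and lim: "!!x. x \<notin> N ==> (%n. g n x) ----> f x"
  unfolding measurable_on_def by auto
 define F where "F n x = max 0 (min 1 (g n x))" for n x
 have l: "(%n. F n x) ----> f x" if "x \<notin> N" for x
 proof -
  have "(%n. F n x) ----> max 0 (min 1 (f x))" unfolding F_def by (intro tendsto_intros lim that)
  thus ?thesis using f[of x] by simp
 qed
 have "AE x in lebesgue. x \<notin> N" using N by (auto simp: negligible_iff_null_sets intro: AE_not_in)
 hence "AE x in lborel. x \<notin> N" by (simp add: AE_completion_iff)
 hence "AE x in lborel. (%n. F n x) ----> f x" by eventually_elim (rule l)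
 hence ae: "AE x in std_normal_distribution. (%n. F n x) ----> f x" by (subst AE_density) auto
 show ?thesis
  by (rule that[OF _ _ _ ae]) (auto simp: F_def intro!: continuous_intros g)
qed

text \<open>Both arguments are standard normal, so the exceptional null sets of the approximations
  of \<open>f\<close> and \<open>g\<close> remain null for the pair, and dominated convergence
  applies.\<close>

lemma std_normal_hypercontractive:
 fixes f g :: "real => real"
 assumes fm[measurable]: "f \<in> rv borel" and f: "!!x. 0 <= f x" "!!x. f x <= 1"
  and gm[measurable]: "g \<in> rv borel" and g: "!!x. 0 <= g x" "!!x. g x <= 1" and r: "0 <= r" "r <= 1/3"
 shows "(LINT z|std_normal_pair. f (fst z) ^ 3 * g (r * fst z + sqrt (1 - r\<^sup>2) * snd z) ^ 3) <=
  root 4 (LINT z|std_normal_pair. f (fst z) ^ 4) ^ 3 * root 4 (LINT z|std_normal_pair. g (r * fst z + sqrt (1 - r\<^sup>2) * snd z) ^ 4) ^ 3"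
proof -
 interpret P: prob_space std_normal_pair by (rule prob_space_std_normal_pair)
 define c where "c = sqrt (1 - r\<^sup>2)"
 have "r\<^sup>2 <= 1" using r by (simp add: power_le_one)
 hence c2: "r\<^sup>2 + c\<^sup>2 = 1" unfolding c_def by simp
 obtain F where F: "!!n. continuous_on UNIV (F n)" "!!n x. 0 <= F n x" "!!n x. F n x <= 1"
  "AE x in std_normal_distribution. (%n. F n x) ----> f x"
  by (rule continuous_approx_AE[OF fm f]) blast
 obtain G where G: "!!n. continuous_on UNIV (G n)" "!!n x. 0 <= G n x" "!!n x. G n x <= 1"
  "AE x in std_normal_distribution. (%n. G n x) ----> g x"
  by (rule continuous_approx_AE[OF gm g]) blast
 have [measurable]: "F n \<in> rv borel" "G n \<in> rv borel" for n
  using F(1) G(1) by (auto intro: borel_measurable_continuous_onI)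
 have tr: "AE z in std_normal_pair. (%n. H n (\<alpha> * fst z + \<beta> * snd z)) ----> h (\<alpha> * fst z + \<beta> * snd z)"
  if "AE x in std_normal_distribution. (%n. H n x) ----> h x" "\<alpha>\<^sup>2 + \<beta>\<^sup>2 = 1"
   and [measurable]: "h \<in> rv borel" "!!n. H n \<in> rv borel"
  for H :: "nat => real => real" and h \<alpha> \<beta>
 proof -
  have "AE x in distr std_normal_pair borel (%z. \<alpha> * fst z + \<beta> * snd z). (%n. H n x) ----> h x"
   unfolding std_normal_pair_marginal[OF that(2)] by fact
  thus ?thesis by (subst (asm) AE_distr_iff) auto
 qed
 have aF: "AE z in std_normal_pair. (%n. F n (fst z)) ----> f (fst z)"
  using tr[OF F(4), of 1 0] by simp
 have aG: "AE z in std_normal_pair. (%n. G n (r * fst z + c * snd z)) ----> g (r * fst z + c * snd z)"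
  by (rule tr[OF G(4) c2]) auto
 have b: "\<bar>F n x ^ 3 * G n y ^ 3\<bar> <= 1" "\<bar>F n x ^ 4\<bar> <= 1" "\<bar>G n y ^ 4\<bar> <= 1" for n x y
  using F(2,3)[of n x] G(2,3)[of n y] by (auto simp: abs_mult intro!: mult_le_one power_le_one)
 have 1: "(%n. (LINT z|std_normal_pair. F n (fst z) ^ 3 * G n (r * fst z + c * snd z) ^ 3)) ----> (LINT z|std_normal_pair. f (fst z) ^ 3 * g (r * fst z + c * snd z) ^ 3)"
 proof (rule integral_dominated_convergence[where w="%_. 1"])
  show "AE z in std_normal_pair. (%n. F n (fst z) ^ 3 * G n (r * fst z + c * snd z) ^ 3) ----> f (fst z) ^ 3 * g (r * fst z + c * snd z) ^ 3"
   using aF aG by eventually_elim (intro tendsto_intros)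
 qed (use b in auto)
 have 2: "(%n. (LINT z|std_normal_pair. F n (fst z) ^ 4)) ----> (LINT z|std_normal_pair. f (fst z) ^ 4)"
 proof (rule integral_dominated_convergence[where w="%_. 1"])
  show "AE z in std_normal_pair. (%n. F n (fst z) ^ 4) ----> f (fst z) ^ 4"
   using aF by eventually_elim (intro tendsto_intros)
 qed (use b in auto)
 have 3: "(%n. (LINT z|std_normal_pair. G n (r * fst z + c * snd z) ^ 4)) ----> (LINT z|std_normal_pair. g (r * fst z + c * snd z) ^ 4)"
 proof (rule integral_dominated_convergence[where w="%_. 1"])
  show "AE z in std_normal_pair. (%n. G n (r * fst z + c * snd z) ^ 4) ----> g (r * fst z + c * snd z) ^ 4"
   using aG by eventually_elim (intro tendsto_intros)
 qed (use b in auto)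
 show ?thesis
  unfolding c_def[symmetric]
 proof (rule LIMSEQ_le[OF 1])
  show "(%n. root 4 (LINT z|std_normal_pair. F n (fst z) ^ 4) ^ 3 * root 4 (LINT z|std_normal_pair. G n (r * fst z + c * snd z) ^ 4) ^ 3) ---->
   root 4 (LINT z|std_normal_pair. f (fst z) ^ 4) ^ 3 * root 4 (LINT z|std_normal_pair. g (r * fst z + c * snd z) ^ 4) ^ 3"
   by (intro tendsto_intros 2 3)
  show "\<exists>N. \<forall>n\<ge>N. (LINT z|std_normal_pair. F n (fst z) ^ 3 * G n (r * fst z + c * snd z) ^ 3) <=
    root 4 (LINT z|std_normal_pair. F n (fst z) ^ 4) ^ 3 * root 4 (LINT z|std_normal_pair. G n (r * fst z + c * snd z) ^ 4) ^ 3"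
   using std_normal_hypercontractive_continuous[OF F(1-3) G(1-3) r] unfolding c_def by blast
 qed
qed

text \<open>Tensorization: the one-dimensional inequality in the coordinate \<open>i\<close>
  replaces \<open>f\<close> and \<open>g\<close> by their partial fourth-power norms
  \<open>ft\<close> and \<open>gt\<close>, to which the induction hypothesis applies. These norms
  are known here only as measurable functions, hence the extension of the one-dimensional case to
  Borel functions.\<close>

lemma tensor_hypercontractive:
 fixes f g :: "('i => real) => real"
 assumes I: "finite I"
  and fm: "f \<in> rv (\<Pi>\<^sub>M i\<in>I. borel)" and f: "!!x. 0 <= f x" "!!x. f x <= 1"
  and gm: "g \<in> rv (\<Pi>\<^sub>M i\<in>I. borel)" and g: "!!x. 0 <= g x" "!!x. g x <= 1" and r: "0 <= r" "r <= 1/3"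
 shows "(LINT z|(\<Pi>\<^sub>M i\<in>I. std_normal_pair). f (\<lambda>i\<in>I. fst (z i)) ^ 3 * g (\<lambda>i\<in>I. r * fst (z i) + sqrt (1 - r\<^sup>2) * snd (z i)) ^ 3) <=
  root 4 (LINT z|(\<Pi>\<^sub>M i\<in>I. std_normal_pair). f (\<lambda>i\<in>I. fst (z i)) ^ 4) ^ 3 *
  root 4 (LINT z|(\<Pi>\<^sub>M i\<in>I. std_normal_pair). g (\<lambda>i\<in>I. r * fst (z i) + sqrt (1 - r\<^sup>2) * snd (z i)) ^ 4) ^ 3"
 using I fm f gm g
proof (induction I arbitrary: f g)
 case empty
 have e: "(LINT z|(\<Pi>\<^sub>M i\<in>{}. std_normal_pair). h z) = (h (%_. undefined) :: real)" for h
  by (simp add: PiM_empty lebesgue_integral_count_space_finite)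
 show ?case unfolding e using empty.prems(2,5) by (simp add: real_root_pos2)
next
 case (insert i I)
 interpret P: prob_space std_normal_pair by (rule prob_space_std_normal_pair)
 interpret PP: product_prob_space "%_. std_normal_pair" I by unfold_locales
 define c where "c = sqrt (1 - r\<^sup>2)"
 note fm[measurable] = insert.prems(1) and gm[measurable] = insert.prems(4)
 note f = insert.prems(2,3) and g = insert.prems(5,6)
 define ft where "ft n = root 4 (LINT y|std_normal_pair. f (n(i := fst y)) ^ 4)" for n
 define gt where "gt n = root 4 (LINT y|std_normal_pair. g (n(i := r * fst y + c * snd y)) ^ 4)" for n
 have upd[measurable]: "(%p. (fst p)(i := u (snd p))) \<in> measurable ((\<Pi>\<^sub>M i\<in>I. borel) \<Otimes>\<^sub>M std_normal_pair) (\<Pi>\<^sub>M j\<in>insert i I. borel)"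
  if [measurable]: "u \<in> rv std_normal_pair" for u
  by (rule measurable_fun_upd[where J=I]) auto
 have mF: "(%p. f ((fst p)(i := fst (snd p))) ^ 4) \<in> rv ((\<Pi>\<^sub>M i\<in>I. borel) \<Otimes>\<^sub>M std_normal_pair)"
  by (intro borel_measurable_power measurable_compose[OF upd fm]) simp
 have mG: "(%p. g ((fst p)(i := r * fst (snd p) + c * snd (snd p))) ^ 4) \<in> rv ((\<Pi>\<^sub>M i\<in>I. borel) \<Otimes>\<^sub>M std_normal_pair)"
  by (intro borel_measurable_power measurable_compose[OF upd gm]) simp
 have ftm[measurable]: "ft \<in> rv (\<Pi>\<^sub>M i\<in>I. borel)"
  unfolding ft_def using P.borel_measurable_lebesgue_integral[of "%n y. f (n(i := fst y)) ^ 4"] mF by (simp add: case_prod_unfold)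
 have gtm[measurable]: "gt \<in> rv (\<Pi>\<^sub>M i\<in>I. borel)"
  unfolding gt_def using P.borel_measurable_lebesgue_integral[of "%n y. g (n(i := r * fst y + c * snd y)) ^ 4"] mG by (simp add: case_prod_unfold)
 have i01: "0 <= (LINT y|std_normal_pair. h y ^ 4)" "(LINT y|std_normal_pair. h y ^ 4) <= 1" if "!!y. 0 <= h y" "!!y. h y <= 1" for h :: "plane => real"
 proof -
  show "0 <= (LINT y|std_normal_pair. h y ^ 4)" by simp
  show "(LINT y|std_normal_pair. h y ^ 4) <= 1"
  proof (cases "integrable std_normal_pair (%y. h y ^ 4)")
   case True
   have "(LINT y|std_normal_pair. h y ^ 4) <= (LINT y|std_normal_pair. 1)"
    by (intro integral_mono True) (auto intro!: power_le_one that)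
   thus ?thesis by (simp add: P.prob_space)
  qed (simp add: not_integrable_integral_eq)
 qed
 have ft01: "0 <= ft n" "ft n <= 1" for n
  unfolding ft_def using i01[of "%y. f (n(i := fst y))"] f by auto
 have gt01: "0 <= gt n" "gt n <= 1" for n
  unfolding gt_def using i01[of "%y. g (n(i := r * fst y + c * snd y))"] g by auto
 have ft4: "ft n ^ 4 = (LINT y|std_normal_pair. f (n(i := fst y)) ^ 4)" for n
  unfolding ft_def using i01(1)[of "%y. f (n(i := fst y))"] f by simp
 have gt4: "gt n ^ 4 = (LINT y|std_normal_pair. g (n(i := r * fst y + c * snd y)) ^ 4)" for n
  unfolding gt_def using i01(1)[of "%y. g (n(i := r * fst y + c * snd y))"] g by simp
 have r1: "(\<lambda>j\<in>insert i I. fst ((z(i := y)) j)) = (\<lambda>j\<in>I. fst (z j))(i := fst y)" for z :: "'i => plane" and y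
  using insert.hyps by (auto simp: fun_eq_iff)
 have r2: "(\<lambda>j\<in>insert i I. r * fst ((z(i := y)) j) + c * snd ((z(i := y)) j)) = (\<lambda>j\<in>I. r * fst (z j) + c * snd (z j))(i := r * fst y + c * snd y)" for z :: "'i => plane" and y
  using insert.hyps by (auto simp: fun_eq_iff)
 let ?Q = "%J. \<Pi>\<^sub>M i\<in>J. std_normal_pair"
 have a[measurable]: "(%z. \<lambda>j\<in>J. fst (z j)) \<in> measurable (?Q J) (\<Pi>\<^sub>M i\<in>J. borel)" for J :: "'i set"
  by measurable
 have b[measurable]: "(%z. \<lambda>j\<in>J. r * fst (z j) + c * snd (z j)) \<in> measurable (?Q J) (\<Pi>\<^sub>M i\<in>J. borel)" for J :: "'i set"
  by measurable
 have f1: "f x ^ k <= 1" "0 <= f x ^ k" "g x ^ k <= 1" "0 <= g x ^ k" for x k using f g by (auto intro: power_le_one)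
 interpret QI: prob_space "?Q (insert i I)" by (rule prob_space_PiM) (rule prob_space_std_normal_pair)
 have fI: "finite_measure (?Q I)" by (intro prob_space.finite_measure prob_space_PiM prob_space_std_normal_pair)
 have ib: "integrable (?Q (insert i I)) h" if "h \<in> rv (?Q (insert i I))" "!!z. 0 <= h z" "!!z. h z <= 1" for h :: "_ => real"
  by (rule QI.integrable_const_bound[of _ 1]) (use that in auto)
 have ib': "integrable (?Q I) h" if "h \<in> rv (?Q I)" "!!z. 0 <= h z" "!!z. h z <= 1" for h :: "_ => real"
  by (rule finite_measure.integrable_const_bound[OF fI, of _ 1]) (use that in auto)
 have I1: "(LINT z|(?Q (insert i I)). h z) = (LINT z|(?Q I). (LINT y|std_normal_pair. h (z(i := y))))"
  if "h \<in> rv (?Q (insert i I))" "!!z. 0 <= h z" "!!z. h z <= 1" for h :: "_ => real"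
  by (rule PP.product_integral_insert[OF insert.hyps(1,2) ib[OF that]])
 have "(LINT z|(?Q (insert i I)). f (\<lambda>j\<in>insert i I. fst (z j)) ^ 3 * g (\<lambda>j\<in>insert i I. r * fst (z j) + c * snd (z j)) ^ 3) =
  (LINT z|(?Q I). (LINT y|std_normal_pair. f ((\<lambda>j\<in>I. fst (z j))(i := fst y)) ^ 3 * g ((\<lambda>j\<in>I. r * fst (z j) + c * snd (z j))(i := r * fst y + c * snd y)) ^ 3))"
  unfolding r1[symmetric] r2[symmetric]
  by (rule I1[of "%z. f (\<lambda>j\<in>insert i I. fst (z j)) ^ 3 * g (\<lambda>j\<in>insert i I. r * fst (z j) + c * snd (z j)) ^ 3"]) (use f1 f g in \<open>auto intro!: mult_le_one\<close>)
 also have "... <= (LINT z|(?Q I). ft (\<lambda>j\<in>I. fst (z j)) ^ 3 * gt (\<lambda>j\<in>I. r * fst (z j) + c * snd (z j)) ^ 3)"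
 proof (rule integral_mono')
  show "integrable (?Q I) (%z. ft (\<lambda>j\<in>I. fst (z j)) ^ 3 * gt (\<lambda>j\<in>I. r * fst (z j) + c * snd (z j)) ^ 3)"
   by (rule ib') (use ft01 gt01 in \<open>auto intro!: mult_le_one power_le_one\<close>)
  fix z assume xi: "z \<in> space (?Q I)"
  define n \<zeta> where "n = (\<lambda>j\<in>I. fst (z j))" and "\<zeta> = (\<lambda>j\<in>I. r * fst (z j) + c * snd (z j))"
  have sp: "n \<in> space (\<Pi>\<^sub>M i\<in>I. borel)" "\<zeta> \<in> space (\<Pi>\<^sub>M i\<in>I. borel)" by (auto simp: n_def \<zeta>_def space_PiM)
  have [measurable]: "(%x. f (n(i := x))) \<in> rv borel" "(%x. g (\<zeta>(i := x))) \<in> rv borel"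
   by (intro measurable_compose[OF _ fm] measurable_compose[OF _ gm] measurable_fun_upd[where J=I] measurable_const sp measurable_ident_sets; simp)+
  show "(LINT y|std_normal_pair. f ((\<lambda>j\<in>I. fst (z j))(i := fst y)) ^ 3 * g ((\<lambda>j\<in>I. r * fst (z j) + c * snd (z j))(i := r * fst y + c * snd y)) ^ 3)
   <= ft (\<lambda>j\<in>I. fst (z j)) ^ 3 * gt (\<lambda>j\<in>I. r * fst (z j) + c * snd (z j)) ^ 3"
   unfolding n_def[symmetric] \<zeta>_def[symmetric] ft_def gt_def
   by (rule std_normal_hypercontractive[of "%x. f (n(i := x))" "%x. g (\<zeta>(i := x))" r, folded c_def]) (use f g r in auto)
  show "0 <= ft (\<lambda>j\<in>I. fst (z j)) ^ 3 * gt (\<lambda>j\<in>I. r * fst (z j) + c * snd (z j)) ^ 3"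
   using ft01 gt01 by simp
 qed
 also have "... <= root 4 (LINT z|(?Q I). ft (\<lambda>j\<in>I. fst (z j)) ^ 4) ^ 3 * root 4 (LINT z|(?Q I). gt (\<lambda>j\<in>I. r * fst (z j) + c * snd (z j)) ^ 4) ^ 3"
  unfolding c_def by (rule insert.IH[unfolded c_def]) (use ftm gtm ft01 gt01 in auto)
 also have "(LINT z|(?Q I). ft (\<lambda>j\<in>I. fst (z j)) ^ 4) = (LINT z|(?Q (insert i I)). f (\<lambda>j\<in>insert i I. fst (z j)) ^ 4)"
  unfolding ft4 r1[symmetric]
  by (rule I1[of "%z. f (\<lambda>j\<in>insert i I. fst (z j)) ^ 4", symmetric]) (use f1 f in auto)
 also have "(LINT z|(?Q I). gt (\<lambda>j\<in>I. r * fst (z j) + c * snd (z j)) ^ 4) = (LINT z|(?Q (insert i I)). g (\<lambda>j\<in>insert i I. r * fst (z j) + c * snd (z j)) ^ 4)"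
  unfolding gt4 r2[symmetric]
  by (rule I1[of "%z. g (\<lambda>j\<in>insert i I. r * fst (z j) + c * snd (z j)) ^ 4", symmetric]) (use f1 g in auto)
 finally show ?case unfolding c_def .
qed

lemma gauss_family_PiM:
 fixes I :: "'i set"
 assumes I: "finite I"
 shows "gauss_family (\<Pi>\<^sub>M i\<in>I. std_normal_pair) (I \<times> UNIV) (%(i, b) y. if b then fst (y i) else snd (y i)) (%j k. if j = k then 1 else 0)"
 unfolding gauss_family_def
proof (intro conjI allI ballI)
 interpret P: prob_space std_normal_pair by (rule prob_space_std_normal_pair)
 interpret PP: product_prob_space "%_. std_normal_pair" I by unfold_locales
 show "prob_space (\<Pi>\<^sub>M i\<in>I. std_normal_pair)" by (rule prob_space_PiM) (rule prob_space_std_normal_pair)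
 show "finite (I \<times> (UNIV :: bool set))" using I by simp
 show "(case v of (i, b) => %y. if b then fst (y i) else snd (y i)) \<in> rv (\<Pi>\<^sub>M i\<in>I. std_normal_pair)" if "v \<in> I \<times> UNIV" for v
  using that by (cases v) (auto intro!: measurable_compose[OF measurable_component_singleton])
 fix c :: "'i \<times> bool => real"
 have s: "(\<Sum>v\<in>I \<times> UNIV. c v * (case v of (i, b) => %y. if b then fst (y i) else snd (y i)) y) = (\<Sum>i\<in>I. c (i, True) * fst (y i) + c (i, False) * snd (y i))" for y :: "'i => plane"
  using I by (subst sum.cartesian_product') (simp add: UNIV_bool add.commute)
 have i1: "complex_integrable std_normal_pair (%z. iexp (c (i, True) * fst z + c (i, False) * snd z))" for i
  by (rule P.integrable_const_bound[where B=1]) auto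
 have "(CLINT y|(\<Pi>\<^sub>M i\<in>I. std_normal_pair). iexp (\<Sum>i\<in>I. c (i, True) * fst (y i) + c (i, False) * snd (y i))) =
  (CLINT y|(\<Pi>\<^sub>M i\<in>I. std_normal_pair). (\<Prod>i\<in>I. iexp (c (i, True) * fst (y i) + c (i, False) * snd (y i))))"
  using I by (simp only: of_real_sum sum_distrib_left exp_sum)
 also have "... = (\<Prod>i\<in>I. CLINT z|std_normal_pair. iexp (c (i, True) * fst z + c (i, False) * snd z))"
  by (rule PP.product_integral_prod[OF I i1])
 also have "... = (\<Prod>i\<in>I. of_real (exp (- ((c (i, True))\<^sup>2 + (c (i, False))\<^sup>2) / 2)))"
 proof (intro prod.cong refl)
  fix i show "(CLINT z|std_normal_pair. iexp (c (i, True) * fst z + c (i, False) * snd z)) = of_real (exp (- ((c (i, True))\<^sup>2 + (c (i, False))\<^sup>2) / 2))"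
   using std_normal_pair_char[of "c (i, True)" 1 0 "c (i, False)" 0 1] by simp
 qed
 also have "... = of_real (exp (\<Sum>i\<in>I. - ((c (i, True))\<^sup>2 + (c (i, False))\<^sup>2) / 2))"
  by (simp only: exp_sum[OF I] of_real_prod)
 also have "(\<Sum>i\<in>I. - ((c (i, True))\<^sup>2 + (c (i, False))\<^sup>2) / 2) = - (\<Sum>v\<in>I \<times> UNIV. \<Sum>w\<in>I \<times> UNIV. c v * c w * (if v = w then 1 else 0)) / 2"
 proof -
  have "(\<Sum>v\<in>I \<times> (UNIV :: bool set). \<Sum>w\<in>I \<times> UNIV. c v * c w * (if v = w then 1 else 0)) = (\<Sum>v\<in>I \<times> (UNIV :: bool set). c v * c v)"
   using I by (intro sum.cong refl) (simp add: if_distrib[where f="%x. _ * x"] cong: if_cong)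
  also have "... = (\<Sum>i\<in>I. (c (i, True))\<^sup>2 + (c (i, False))\<^sup>2)"
   using I by (subst sum.cartesian_product') (simp add: UNIV_bool power2_eq_square add.commute)
  finally have e: "(\<Sum>v\<in>I \<times> (UNIV :: bool set). \<Sum>w\<in>I \<times> UNIV. c v * c w * (if v = w then 1 else 0)) = (\<Sum>i\<in>I. (c (i, True))\<^sup>2 + (c (i, False))\<^sup>2)" .
  have "(\<Sum>i\<in>I. - h i / 2) = - (\<Sum>i\<in>I. h i) / 2" for h :: "'i => real" by (simp add: sum_negf sum_divide_distrib)
  thus ?thesis unfolding e .
 qed
 finally show "(CLINT y|(\<Pi>\<^sub>M i\<in>I. std_normal_pair). iexp (\<Sum>v\<in>I \<times> UNIV. c v * (case v of (i, b) => %y. if b then fst (y i) else snd (y i)) y)) =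
   of_real (exp (- (\<Sum>v\<in>I \<times> UNIV. \<Sum>w\<in>I \<times> UNIV. c v * c w * (if v = w then 1 else 0)) / 2))"
  unfolding s .
qed

section \<open>Small noise correlations of bounded functions\<close>

lemma integral_Cauchy_Schwarz:
 fixes f g :: "'a => real"
 assumes i: "integrable M (%x. (f x)\<^sup>2)" "integrable M (%x. (g x)\<^sup>2)" "integrable M (%x. f x * g x)"
 shows "(LINT x|M. f x * g x)\<^sup>2 <= (LINT x|M. (f x)\<^sup>2) * (LINT x|M. (g x)\<^sup>2)"
proof -
 define A B C where "A = (LINT x|M. (f x)\<^sup>2)" and "B = (LINT x|M. (g x)\<^sup>2)" and "C = (LINT x|M. f x * g x)"
 have B0: "B \<ge> 0" unfolding B_def by simp
 have q: "0 <= A - 2 * t * C + t\<^sup>2 * B" for t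
 proof -
  have "0 <= (LINT x|M. (f x - t * g x)\<^sup>2)" by simp
  also have "(%x. (f x - t * g x)\<^sup>2) = (%x. (f x)\<^sup>2 - (2 * t) * (f x * g x) + t\<^sup>2 * (g x)\<^sup>2)"
   by (auto simp: power2_eq_square algebra_simps)
  also have "(LINT x|M. (f x)\<^sup>2 - (2 * t) * (f x * g x) + t\<^sup>2 * (g x)\<^sup>2) = A - 2 * t * C + t\<^sup>2 * B"
   unfolding A_def B_def C_def using i by simp
  finally show ?thesis .
 qed
 have "C\<^sup>2 <= A * B"
 proof (cases "B = 0")
  case True
  have "C = 0"
  proof (rule ccontr)
   assume "C \<noteq> 0"
   with q[of "(A + 1) / (2 * C)"] True show False by (simp add: field_simps)
  qed
  thus ?thesis using True by simp
 next
  case False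
  hence "B > 0" using B0 by simp
  with q[of "C / B"] show ?thesis by (simp add: field_simps power2_eq_square)
 qed
 thus ?thesis unfolding A_def B_def C_def .
qed

text \<open>
 \<open>noise s h k\<close> is the mean of \<open>h(X) k(X')\<close> for a pair of copies of \<open>X\<close> with correlation \<open>s\<close>.
\<close>

definition noise :: "'w measure => ('v => 'w => real) => real => (('v => real) => real) => (('v => real) => real) => real" where
 "noise M X s h k = (LINT w|(M \<Otimes>\<^sub>M M). h (%v. X v (fst w)) * k (%v. s * X v (fst w) + sqrt (1 - s\<^sup>2) * X v (snd w)))"

definition unit_coord_fun :: "'v set => (('v => real) => real) => bool" where
 "unit_coord_fun V h \<longleftrightarrow> coord_continuous V h \<and> (\<forall>x. 0 <= h x \<and> h x <= 1)"

lemma unit_coord_funD: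
 assumes "unit_coord_fun V h"
 shows "coord_continuous V h" "0 <= h x" "h x <= 1"
 using assms unfolding unit_coord_fun_def by auto

lemma unit_coord_fun_integrable:
 assumes "prob_space N" "unit_coord_fun V h" "unit_coord_fun V k"
  "!!v. v \<in> V ==> Y v \<in> rv N" "!!v. v \<in> V ==> Y' v \<in> rv N"
 shows "integrable N (%w. h (%v. Y v w) * k (%v. Y' v w))"
proof -
 interpret N: prob_space N by fact
 note h = unit_coord_funD[OF assms(2)] and k = unit_coord_funD[OF assms(3)]
 show ?thesis
  by (rule N.integrable_const_bound[of _ 1, OF _ borel_measurable_times[OF coord_continuous_rv[OF h(1)] coord_continuous_rv[OF k(1)]]])
   (use h k assms in \<open>auto simp: abs_mult intro!: mult_le_one\<close>)
qed

lemma noise_integrable: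
 assumes G: "gauss_family M V X Q" and h: "unit_coord_fun V h" and k: "unit_coord_fun V k"
 shows "integrable (M \<Otimes>\<^sub>M M) (%w. h (%v. X v (fst w)) * k (%v. s * X v (fst w) + c * X v (snd w)))"
proof -
 interpret M: prob_space M by (rule gauss_familyD[OF G])
 interpret MM: pair_prob_space M M ..
 have [measurable]: "X v \<in> rv M" if "v \<in> V" for v using gauss_familyD(3)[OF G] that by auto
 show ?thesis by (rule unit_coord_fun_integrable[OF MM.prob_space_axioms h k]) measurable
qed

text \<open>Conditioning on the first copy turns \<open>noise\<close> into the inner product of
  \<open>h\<close> with a conditional mean \<open>t\<close> of \<open>k\<close>. The square norm of
  \<open>t\<close> is \<open>noise\<close> at \<open>s ^ 2\<close>: two copies that are independent
  given \<open>X\<close>, each with correlation \<open>s\<close> to it, have correlation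
  \<open>s ^ 2\<close> to each other. Values in the unit interval give
  \<open>h ^ 2 <= h\<close>.\<close>

lemma noise_Cauchy_Schwarz:
 assumes G: "gauss_family M V X Q" and h: "unit_coord_fun V h" and k: "unit_coord_fun V k"
  and s: "0 <= s" "s <= 1"
 shows "noise M X s h k <= sqrt (LINT w|M. h (%v. X v w)) * sqrt (noise M X (s\<^sup>2) k k)"
proof -
 interpret M: prob_space M by (rule gauss_familyD[OF G])
 interpret MM: pair_prob_space M M ..
 interpret MMM: pair_prob_space M "M \<Otimes>\<^sub>M M" ..
 let ?T = "M \<Otimes>\<^sub>M (M \<Otimes>\<^sub>M M)"
 define c where "c = sqrt (1 - s\<^sup>2)"
 have s1: "s\<^sup>2 <= 1" using s by (simp add: power_le_one)
 have c2: "c * c = 1 - s * s" using s1 by (simp add: c_def power2_eq_square)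
 have V: "finite V" by (rule gauss_familyD[OF G])
 have Xm[measurable]: "X v \<in> rv M" if "v \<in> V" for v
  using gauss_familyD(3)[OF G] that by auto
 note h' = unit_coord_funD[OF h] and k' = unit_coord_funD[OF k]
 let ?h = "%x. h (%v. X v x)" and ?k = "%x y. k (%v. s * X v x + c * X v y)"
 have hm[measurable]: "?h \<in> rv M" by (rule coord_continuous_rv[OF h'(1)]) simp
 have km[measurable]: "(%p. ?k (fst p) (snd p)) \<in> rv (M \<Otimes>\<^sub>M M)"
  by (rule coord_continuous_rv[OF k'(1)]) measurable
 define t where "t x = (LINT y|M. ?k x y)" for x
 have tm[measurable]: "t \<in> rv M"
  unfolding t_def using M.borel_measurable_lebesgue_integral[of ?k M] km by (simp add: case_prod_unfold)
 have ik: "integrable M (?k x)" "integrable (M \<Otimes>\<^sub>M M) (%q. ?k x (fst q) * ?k x (snd q))" if "x \<in> space M" for x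
  using unit_coord_fun_integrable[OF M.prob_space_axioms k k, of "%v y. s * X v x + c * X v y" "%v y. s * X v x + c * X v y"]
   unit_coord_fun_integrable[OF MM.prob_space_axioms k k, of "%v y. s * X v x + c * X v (fst y)" "%v y. s * X v x + c * X v (snd y)"]
   M.integrable_const_bound[of "?k x" 1, OF _ coord_continuous_rv[OF k'(1)]] k' by auto
 have t01: "0 <= t x" "t x <= 1" if "x \<in> space M" for x
 proof -
  show "0 <= t x" unfolding t_def using k' by simp
  have "t x <= (LINT y|M. 1)" unfolding t_def by (intro integral_mono ik that) (use k' in auto)
  thus "t x <= 1" by (simp add: M.prob_space)
 qed
 have e1: "noise M X s h k = (LINT x|M. ?h x * t x)"
  unfolding noise_def c_def[symmetric] t_def using MM.integral_fst'[OF noise_integrable[OF G h k, of s c]] by simp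
 have int: "integrable M (%x. ?h x * t x)" "integrable M (%x. (?h x)\<^sup>2)" "integrable M (%x. (t x)\<^sup>2)" "integrable M ?h"
  by (rule M.integrable_const_bound[of _ 1]; use h' t01 in \<open>auto simp: abs_mult intro!: mult_le_one power_le_one\<close>)+
 have cs: "(LINT x|M. ?h x * t x)\<^sup>2 <= (LINT x|M. (?h x)\<^sup>2) * (LINT x|M. (t x)\<^sup>2)"
  by (rule integral_Cauchy_Schwarz) (use int in auto)
 have hh: "(LINT x|M. (?h x)\<^sup>2) <= (LINT x|M. ?h x)"
  by (intro integral_mono int) (use h' in \<open>auto simp: power2_eq_square intro: mult_left_le\<close>)
 have t2: "(LINT x|M. (t x)\<^sup>2) = noise M X (s\<^sup>2) k k"
 proof -
  have i2: "integrable ?T (%p. ?k (fst p) (fst (snd p)) * ?k (fst p) (snd (snd p)))"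
   by (rule unit_coord_fun_integrable[OF MMM.prob_space_axioms k k]) measurable
  have "(t x)\<^sup>2 = (LINT q|(M \<Otimes>\<^sub>M M). ?k x (fst q) * ?k x (snd q))" if x: "x \<in> space M" for x
   using MM.integral_fst'[OF ik(2)[OF x]] by (simp add: t_def power2_eq_square)
  hence "(LINT x|M. (t x)\<^sup>2) = (LINT x|M. (LINT q|(M \<Otimes>\<^sub>M M). ?k x (fst q) * ?k x (snd q)))"
   by (rule Bochner_Integration.integral_cong[OF refl])
  also have "... = (LINT p|?T. ?k (fst p) (fst (snd p)) * ?k (fst p) (snd (snd p)))"
   using MMM.integral_fst'[OF i2] by simp
  also have "... = noise M X (s\<^sup>2) k k"
  proof -
   define J where "J = V \<times> (UNIV :: bool set)"
   have J: "finite J" unfolding J_def using V by simp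
   have fJ: "j \<in> J ==> fst j \<in> V" for j by (auto simp: J_def)
   note g1 = gauss_family_pair[OF gauss_family_reindex[OF G J fJ, where \<alpha>="%_. s"]
     gauss_family_two[OF G J fJ, where \<alpha>="%j. if snd j then c else 0" and \<beta>="%j. if snd j then 0 else c"]]
   note g2 = gauss_family_two[OF G J fJ, where \<alpha>="%j. if snd j then 1 else s\<^sup>2" and \<beta>="%j. if snd j then 0 else sqrt (1 - (s\<^sup>2)\<^sup>2)"]
   define \<Phi> where "\<Phi> = (%z :: _ \<times> bool => real. k (%u. z (u, True)) * k (%u. z (u, False)))"
   have \<Phi>: "coord_continuous J \<Phi>"
    unfolding \<Phi>_def by (intro coord_continuous_intros coord_continuous_subst[OF k'(1) J]) (use J in \<open>auto simp: J_def\<close>)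
   have s4: "(s\<^sup>2)\<^sup>2 <= 1" by (rule power_le_one[OF zero_le_power2 s1])
   have cc: "c * (c * q) = q - s * (s * q)" for q
    using c2 by (simp add: left_diff_distrib flip: mult.assoc)
   let ?r = "sqrt (1 - s * (s * (s * s)))"
   have "?r * ?r = 1 - s * (s * (s * s))"
    using s4 by (intro real_sqrt_mult_self[THEN trans]) (auto simp: power2_eq_square mult.assoc)
   hence dd: "?r * (?r * q) = q - s * (s * (s * (s * q)))" for q
    by (simp add: left_diff_distrib mult.assoc flip: mult.assoc[of "sqrt _"])
   have "(LINT p|?T. ?k (fst p) (fst (snd p)) * ?k (fst p) (snd (snd p))) =
    (LINT p|?T. \<Phi> (%j. s * X (fst j) (fst p) + ((if snd j then c else 0) * X (fst j) (fst (snd p)) + (if snd j then 0 else c) * X (fst j) (snd (snd p)))))"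
    by (simp add: \<Phi>_def)
   also have "... = (LINT w|(M \<Otimes>\<^sub>M M). \<Phi> (%j. (if snd j then 1 else s\<^sup>2) * X (fst j) (fst w) + (if snd j then 0 else sqrt (1 - (s\<^sup>2)\<^sup>2)) * X (fst j) (snd w)))"
    by (rule gauss_transfer'[OF g1 g2 _ \<Phi>]) (auto simp: cc dd power2_eq_square distrib_right mult.assoc)
   also have "... = noise M X (s\<^sup>2) k k"
    by (simp add: \<Phi>_def noise_def)
   finally show ?thesis .
  qed
  finally show ?thesis .
 qed
 have "noise M X s h k <= sqrt ((LINT x|M. (?h x)\<^sup>2) * noise M X (s\<^sup>2) k k)"
  using cs unfolding t2 e1 by (rule real_le_rsqrt)
 also have "... <= sqrt ((LINT x|M. ?h x) * noise M X (s\<^sup>2) k k)"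
  unfolding t2[symmetric] by (intro real_sqrt_le_mono mult_right_mono hh) simp
 finally show ?thesis by (simp add: real_sqrt_mult)
qed

lemma AE_pair_fst_snd:
 assumes "prob_space M" and "AE x in M. P x"
 shows "AE t in M \<Otimes>\<^sub>M M. P (fst t)" "AE t in M \<Otimes>\<^sub>M M. P (snd t)"
proof -
 interpret M: prob_space M by fact
 interpret MM: pair_prob_space M M ..
 show 1: "AE t in M \<Otimes>\<^sub>M M. P (fst t)"
  by (rule AE_distrD[of fst _ M], simp, subst M.distr_pair_fst) (rule assms(2))
 show "AE t in M \<Otimes>\<^sub>M M. P (snd t)"
  using AE_distrD[of "%(x, y). (y, x)" "M \<Otimes>\<^sub>M M" "M \<Otimes>\<^sub>M M" "%t. P (fst t)"] 1
  unfolding MM.distr_pair_swap[symmetric] by (simp add: case_prod_unfold)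
qed

text \<open>The series writes \<open>X\<close> as a limit of linear images of independent standard
  normal variables, to which the tensorized inequality applies. Cube roots turn its products of
  cubes into \<open>h\<close> and \<open>k\<close>, and the fourth powers of these roots are at most
  \<open>h\<close> and \<open>k\<close> because the values lie in the unit interval.\<close>

lemma noise_small_base:
 fixes a :: "'i => 'w => real"
 assumes G: "gauss_family M V X Q"
  and a: "!!I. finite I ==> gauss_family M I a (%i j. if i = j then 1 else 0)"
  and I: "!!n::nat. finite (I n)"
  and lim: "!!v. v \<in> V ==> AE t in M. (%n. \<Sum>i\<in>I n. \<phi> v i * a i t) ----> X v t"
  and h: "unit_coord_fun V h" and k: "unit_coord_fun V k"
  and s: "0 <= s" "s <= 1/3"
 shows "noise M X s h k <= root 4 (LINT t|M. h (%v. X v t)) ^ 3 * root 4 (LINT t|M. k (%v. X v t)) ^ 3"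
proof -
 interpret M: prob_space M by (rule gauss_familyD[OF G])
 interpret MM: pair_prob_space M M ..
 let ?P = "M \<Otimes>\<^sub>M M"
 define c where "c = sqrt (1 - s\<^sup>2)"
 have c2: "c * c = 1 - s * s" using s by (simp add: c_def power2_eq_square mult_le_one)
 have V: "finite V" by (rule gauss_familyD[OF G])
 have Xm[measurable]: "X v \<in> rv M" if "v \<in> V" for v
  using gauss_familyD(3)[OF G] that by auto
 have am[measurable]: "a i \<in> rv M" for i
  using gauss_familyD(3)[OF a[of "{i}"]] by auto
 note h' = unit_coord_funD[OF h] and k' = unit_coord_funD[OF k]
 define f where "f x = root 3 (h x)" for x
 define g where "g x = root 3 (k x)" for x
 have f01: "0 <= f x" "f x <= 1" and g01: "0 <= g x" "g x <= 1" for x using h' k' by (auto simp: f_def g_def)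
 have f3: "f x ^ 3 = h x" and g3: "g x ^ 3 = k x" for x using h' k' by (auto simp: f_def g_def)
 have fc: "coord_continuous V f" and gc: "coord_continuous V g"
  unfolding f_def[abs_def] g_def[abs_def]
  by (rule coord_continuous_compose[OF h'(1)], intro continuous_intros, rule coord_continuous_compose[OF k'(1)], intro continuous_intros)
 define Z where "Z n v t = (\<Sum>i\<in>I n. \<phi> v i * a i t)" for n v t
 have Zm[measurable]: "Z n v \<in> rv M" for n v unfolding Z_def by measurable
 let ?f = "%U t. f (%v. U v (fst t))" and ?g = "%U t. g (%v. s * U v (fst t) + c * U v (snd t))"
 define N where "N U i j = (LINT t|?P. ?f U t ^ i * ?g U t ^ j)" for U and i j :: nat
 have fin: "N (Z n) 3 3 <= root 4 (N (Z n) 4 0) ^ 3 * root 4 (N (Z n) 0 4) ^ 3" for n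
 proof -
  let ?Q = "\<Pi>\<^sub>M i\<in>I n. std_normal_pair"
  define J where "J = I n \<times> (UNIV :: bool set)"
  have J: "finite J" unfolding J_def using I by simp
  have fJ: "j \<in> J ==> fst j \<in> I n" for j by (auto simp: J_def)
  note g1 = gauss_family_two[where p=fst and \<alpha>="%j. if snd j then 1 else 0" and \<beta>="%j. if snd j then 0 else 1", OF a[OF I] J fJ]
  note g2 = gauss_family_PiM[OF I, of n, folded J_def]
  define F where "F e = f (%v. \<Sum>i\<in>I n. \<phi> v i * e i)" for e
  define H where "H e = g (%v. \<Sum>i\<in>I n. \<phi> v i * e i)" for e
  have y: "coord_continuous (I n) (%e. \<Sum>i\<in>I n. \<phi> v i * e i)" for v by (intro coord_continuous_intros I)
  have Fc: "coord_continuous (I n) F" unfolding F_def[abs_def] by (rule coord_continuous_subst[OF fc I y])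
  have Hc: "coord_continuous (I n) H" unfolding H_def[abs_def] by (rule coord_continuous_subst[OF gc I y])
  have FI: "F (\<lambda>i\<in>I n. x i) = F x" "H (\<lambda>i\<in>I n. x i) = H x" for x
   by (auto intro: coord_continuous_cong[OF Fc] coord_continuous_cong[OF Hc])
  have ZF: "?f (Z n) t = F (%i. a i (fst t))" for t by (simp add: F_def Z_def)
  have ZH: "?g (Z n) t = H (%i. s * a i (fst t) + c * a i (snd t))" for t
   by (simp add: H_def Z_def sum_distrib_left sum.distrib algebra_simps)
  have N: "N (Z n) i j = (LINT m|?Q. F (%i. fst (m i)) ^ i * H (%i. s * fst (m i) + c * snd (m i)) ^ j)" for i j
  proof -
   have "coord_continuous J (%z. F (%i. z (i, True)) ^ i * H (%i. s * z (i, True) + c * z (i, False)) ^ j)"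
    by (intro coord_continuous_intros coord_continuous_subst[OF Fc J] coord_continuous_subst[OF Hc J]) (use J in \<open>auto simp: J_def\<close>)
   from gauss_transfer'[OF g1 g2 _ this] show ?thesis
    unfolding N_def ZF ZH by (simp add: prod_eq_iff split: if_splits)
  qed
  have "F \<in> rv (\<Pi>\<^sub>M i\<in>I n. borel)" "H \<in> rv (\<Pi>\<^sub>M i\<in>I n. borel)"
   using coord_continuous_rv[OF Fc, of "%v x. x v"] coord_continuous_rv[OF Hc, of "%v x. x v"] by auto
  from tensor_hypercontractive[OF I this(1) _ _ this(2) _ _ s] show ?thesis
   unfolding N FI c_def[symmetric] using f01 g01 by (simp add: F_def H_def)
 qed
 have "AE t in M. \<forall>v\<in>V. (%n. Z n v t) ----> X v t"
  using lim V unfolding Z_def by (simp add: AE_finite_all)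
 note aX = AE_pair_fst_snd[OF M.prob_space_axioms this]
 have fm[measurable]: "?f U \<in> rv ?P" "?g U \<in> rv ?P" if [measurable]: "!!v. v \<in> V ==> U v \<in> rv M" for U
  by (intro coord_continuous_rv[OF fc] coord_continuous_rv[OF gc]; measurable)+
 have b: "\<bar>f x ^ i * g y ^ j\<bar> <= 1" for x y i j
  using f01[of x] g01[of y] by (auto simp: abs_mult intro!: mult_le_one power_le_one)
 have l: "(%n. N (Z n) i j) ----> N X i j" for i j
  unfolding N_def
 proof (rule integral_dominated_convergence[where w="%_. 1"])
  show "AE t in ?P. (%n. ?f (Z n) t ^ i * ?g (Z n) t ^ j) ----> ?f X t ^ i * ?g X t ^ j"
   using aX
  proof eventually_elim
   case (elim t)
   show ?case by (intro tendsto_mult tendsto_power coord_continuousD(2)[OF fc] coord_continuousD(2)[OF gc] tendsto_add tendsto_const)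
     (use elim in auto)
  qed
 qed (use b in auto)
 have main: "N X 3 3 <= root 4 (N X 4 0) ^ 3 * root 4 (N X 0 4) ^ 3"
  by (rule LIMSEQ_le[OF l tendsto_mult[OF tendsto_power[OF tendsto_real_root[OF l]] tendsto_power[OF tendsto_real_root[OF l]]]]) (use fin in auto)
 have f4: "f x ^ 4 <= h x" and g4: "g x ^ 4 <= k x" for x
  using f01[of x] g01[of x] unfolding f3[symmetric] g3[symmetric] by (auto intro!: power_decreasing)
 have E: "(LINT t|?P. q (%v. \<alpha> * X v (fst t) + \<beta> * X v (snd t))) = (LINT t|M. q (%v. X v t))"
  if "unit_coord_fun V q" "\<alpha> * \<alpha> + \<beta> * \<beta> = 1" for q \<alpha> \<beta>
  by (rule gauss_transfer'[OF gauss_family_two[OF G V] G _ unit_coord_funD(1)[OF that(1)]]) (simp_all add: that(2))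
 have [measurable]: "(%t. h (%v. X v (fst t))) \<in> rv ?P" "(%t. k (%v. s * X v (fst t) + c * X v (snd t))) \<in> rv ?P"
  by (intro coord_continuous_rv[OF h'(1)] coord_continuous_rv[OF k'(1)]; measurable)+
 have "N X 4 0 <= (LINT t|?P. h (%v. X v (fst t)))" "N X 0 4 <= (LINT t|?P. k (%v. s * X v (fst t) + c * X v (snd t)))"
  unfolding N_def by (rule integral_mono'; use f4 g4 h' k' in \<open>auto intro!: MM.P.integrable_const_bound[of _ 1]\<close>)+
 hence n: "N X 4 0 <= (LINT t|M. h (%v. X v t))" "N X 0 4 <= (LINT t|M. k (%v. X v t))"
  using E[OF h, of 1 0] E[OF k, of s c] c2 by auto
 have "noise M X s h k = N X 3 3" unfolding noise_def N_def c_def[symmetric] f3 g3 ..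
 also note main
 also have "root 4 (N X 4 0) ^ 3 * root 4 (N X 0 4) ^ 3 <= root 4 (LINT t|M. h (%v. X v t)) ^ 3 * root 4 (LINT t|M. k (%v. X v t)) ^ 3"
  using n h' k' f01 g01 by (intro mult_mono power_mono real_root_le_mono) (auto simp: N_def)
 finally show ?thesis .
qed

text \<open>The base case requires a correlation of at most 1/3. Each use of
  \<open>noise_Cauchy_Schwarz\<close> squares the correlation and halves the exponent gained over
  the product of the two square roots, so every \<open>s < 1\<close> keeps a positive gain.\<close>

lemma noise_small:
 fixes a :: "'i => 'w => real"
 assumes G: "gauss_family M V X Q"
  and a: "!!I. finite I ==> gauss_family M I a (%i j. if i = j then 1 else 0)"
  and I: "!!n::nat. finite (I n)"
  and lim: "!!v. v \<in> V ==> AE w in M. (%n. \<Sum>i\<in>I n. \<phi> v i * a i w) ----> X v w"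
  and h: "unit_coord_fun V h" and k: "unit_coord_fun V k"
  and s: "0 <= s" "s <= 1" "s ^ (2 ^ j) <= 1/3"
 shows "noise M X s h k <= sqrt (LINT w|M. h (%v. X v w)) * sqrt (LINT w|M. k (%v. X v w)) * (LINT w|M. k (%v. X v w)) powr (1 / (4 * 2 ^ j))"
 using h k s
proof (induction j arbitrary: s h k)
 case 0
 interpret M: prob_space M by (rule gauss_familyD[OF G])
 have E01: "0 <= (LINT w|M. q (%v. X v w))" "(LINT w|M. q (%v. X v w)) <= 1" if "unit_coord_fun V q" for q
 proof -
  note q = unit_coord_funD[OF that]
  show "0 <= (LINT w|M. q (%v. X v w))" using q by simp
  have "(LINT w|M. q (%v. X v w)) <= (LINT w|M. 1)" by (rule integral_mono') (use q in auto)
  thus "(LINT w|M. q (%v. X v w)) <= 1" by (simp add: M.prob_space)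
 qed
 define x y where "x = (LINT w|M. h (%v. X v w))" and "y = (LINT w|M. k (%v. X v w))"
 have x: "0 <= x" "x <= 1" and y: "0 <= y" using E01[OF 0(1)] E01[OF 0(2)] by (auto simp: x_def y_def)
 have "noise M X s h k <= root 4 x ^ 3 * root 4 y ^ 3"
  unfolding x_def y_def by (rule noise_small_base[OF G a I lim 0(1,2)]) (use 0 in auto)
 also have "root 4 x ^ 3 <= sqrt x"
 proof -
  have "root 4 x ^ 3 <= root 4 x ^ 2" using x by (intro power_decreasing) auto
  also have "... = sqrt x" using x by (intro real_sqrt_unique[symmetric]) (auto simp flip: power_mult)
  finally show ?thesis .
 qed
 also have "root 4 y ^ 3 = sqrt y * y powr (1 / 4)"
 proof (cases "y = 0")
  case False
  hence "y > 0" using y by simp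
  hence "root 4 y = y powr (1/4)" "sqrt y = y powr (1/2)" by (auto simp: root_powr_inverse powr_half_sqrt)
  thus ?thesis using \<open>y > 0\<close> by (simp add: powr_power flip: powr_add)
 qed simp
 finally show ?case using y unfolding x_def[symmetric] y_def[symmetric] by (simp add: mult_right_mono mult.assoc)
next
 case (Suc j)
 note hk = Suc.prems(1,2) and s = Suc.prems(3,4,5)
 define x y where "x = (LINT w|M. h (%v. X v w))" and "y = (LINT w|M. k (%v. X v w))"
 have x: "0 <= x" and y: "0 <= y" using unit_coord_funD[OF hk(1)] unit_coord_funD[OF hk(2)] by (auto simp: x_def y_def)
 have "noise M X (s\<^sup>2) k k <= sqrt y * sqrt y * y powr (1 / (4 * 2 ^ j))"
  unfolding y_def by (rule Suc.IH[OF hk(2,2)]) (use s in \<open>auto simp: power_le_one simp flip: power_mult\<close>)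
 hence le: "sqrt (noise M X (s\<^sup>2) k k) <= sqrt (y * y powr (1 / (4 * 2 ^ j)))" using y by (intro real_sqrt_le_mono) auto
 have "noise M X s h k <= sqrt x * sqrt (noise M X (s\<^sup>2) k k)"
  unfolding x_def by (rule noise_Cauchy_Schwarz[OF G hk s(1,2)])
 also have "... <= sqrt x * sqrt (y * y powr (1 / (4 * 2 ^ j)))" by (intro mult_left_mono le) (use x in auto)
 also have "... = sqrt x * sqrt y * y powr (1 / (4 * 2 ^ Suc j))"
  by (simp add: real_sqrt_mult powr_half_sqrt[symmetric] powr_powr mult_ac)
 finally show ?case unfolding x_def y_def .
qed

section \<open>Max-min functionals\<close>

text \<open>The largest level at which some set of the family lies in the superlevel set of
  \<open>x\<close>; the sets will be discrete paths.\<close>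

definition mm :: "'v set set => ('v => real) => real" where
 "mm \<P> x = Max ((%P. Min (x ` P)) ` \<P>)"

definition finite_family :: "'v set set => bool" where
 "finite_family \<P> \<longleftrightarrow> finite \<P> \<and> \<P> \<noteq> {} \<and> (\<forall>P\<in>\<P>. finite P \<and> P \<noteq> {})"

text \<open>A smooth version of \<^const>\<open>mm\<close> at inverse temperature \<^term>\<open>\<beta>\<close>.\<close>

definition soft_mm :: "real => 'v set set => ('v => real) => real" where
 "soft_mm \<beta> \<P> x = ln (\<Sum>P\<in>\<P>. 1 / (\<Sum>v\<in>P. exp (- \<beta> * x v))) / \<beta>"

definition soft_mm_grad :: "real => 'v set set => ('v => real) => 'v => real" where
 "soft_mm_grad \<beta> \<P> x v =
   (\<Sum>P\<in>\<P>. (if v \<in> P then exp (- \<beta> * x v) else 0) / (\<Sum>u\<in>P. exp (- \<beta> * x u))\<^sup>2) /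
   (\<Sum>P\<in>\<P>. 1 / (\<Sum>u\<in>P. exp (- \<beta> * x u)))"

lemma finite_familyD:
 assumes "finite_family \<P>"
 shows "finite \<P>" "\<P> \<noteq> {}" "P \<in> \<P> ==> finite P" "P \<in> \<P> ==> P \<noteq> {}" "finite (\<Union>\<P>)"
 using assms unfolding finite_family_def by auto

lemma soft_Z_pos:
 fixes x :: "'v => real"
 assumes "finite_family \<P>" "P \<in> \<P>"
 shows "0 < (\<Sum>u\<in>P. exp (- \<beta> * x u))"
 using finite_familyD(3,4)[OF assms(1) assms(2)] by (intro sum_pos) auto

lemma soft_S_pos:
 fixes x :: "'v => real"
 assumes "finite_family \<P>"
 shows "0 < (\<Sum>P\<in>\<P>. 1 / (\<Sum>u\<in>P. exp (- \<beta> * x u)))"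
 using finite_familyD(1,2)[OF assms] soft_Z_pos[OF assms, where \<beta>=\<beta> and x=x] by (intro sum_pos) auto

lemma soft_mm_grad_nonneg: "finite_family \<P> ==> 0 <= soft_mm_grad \<beta> \<P> x v"
 unfolding soft_mm_grad_def using soft_S_pos[of \<P> \<beta> x]
 by (intro divide_nonneg_pos sum_nonneg divide_nonneg_nonneg) auto

lemma soft_mm_grad_outside: "v \<notin> \<Union>\<P> ==> soft_mm_grad \<beta> \<P> x v = 0"
 unfolding soft_mm_grad_def by (auto intro!: sum.neutral)

text \<open>Summation by sets of the family instead of by sites, the form in which both the chain
  rule and the total mass of the gradient become visible.\<close>

lemma soft_swap:
 assumes f: "finite_family \<P>" and V: "finite V" "\<Union>\<P> \<subseteq> V"
 shows "(\<Sum>v\<in>V. soft_mm_grad \<beta> \<P> x v * y v) =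
   (\<Sum>P\<in>\<P>. (\<Sum>v\<in>P. exp (- \<beta> * x v) * y v) / (\<Sum>u\<in>P. exp (- \<beta> * x u))\<^sup>2) / (\<Sum>P\<in>\<P>. 1 / (\<Sum>u\<in>P. exp (- \<beta> * x u)))"
proof -
 define S where "S = (\<Sum>P\<in>\<P>. 1 / (\<Sum>u\<in>P. exp (- \<beta> * x u)))"
 define Z where "Z P = (\<Sum>u\<in>P. exp (- \<beta> * x u))\<^sup>2" for P
 have "(\<Sum>v\<in>V. soft_mm_grad \<beta> \<P> x v * y v) = (\<Sum>v\<in>V. (\<Sum>P\<in>\<P>. (if v \<in> P then exp (- \<beta> * x v) * y v else 0) / Z P)) / S"
  unfolding soft_mm_grad_def S_def[symmetric] Z_def[symmetric] sum_divide_distrib[of _ V] sum_distrib_right sum_divide_distrib[of _ \<P>]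
  by (intro sum.cong refl) (auto simp: field_simps)
 also have "... = (\<Sum>P\<in>\<P>. (\<Sum>v\<in>V. (if v \<in> P then exp (- \<beta> * x v) * y v else 0)) / Z P) / S"
  by (subst sum.swap) (simp add: sum_divide_distrib)
 also have "(\<Sum>P\<in>\<P>. (\<Sum>v\<in>V. (if v \<in> P then exp (- \<beta> * x v) * y v else 0)) / Z P) = (\<Sum>P\<in>\<P>. (\<Sum>v\<in>P. exp (- \<beta> * x v) * y v) / Z P)"
 proof (rule sum.cong[OF refl])
  fix P assume "P \<in> \<P>"
  hence "P \<subseteq> V" using V by auto
  thus "(\<Sum>v\<in>V. (if v \<in> P then exp (- \<beta> * x v) * y v else 0)) / Z P = (\<Sum>v\<in>P. exp (- \<beta> * x v) * y v) / Z P"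
   using V(1) by (simp add: sum.If_cases Int_absorb1)
 qed
 finally show ?thesis unfolding S_def Z_def .
qed

text \<open>The infinitesimal form of the fact that adding a constant to all values adds it to
  \<open>soft_mm\<close>.\<close>

lemma soft_mm_grad_sum:
 assumes f: "finite_family \<P>" and V: "finite V" "\<Union>\<P> \<subseteq> V"
 shows "(\<Sum>v\<in>V. soft_mm_grad \<beta> \<P> x v) = 1"
proof -
 have "(\<Sum>v\<in>P. exp (- \<beta> * x v)) / (\<Sum>u\<in>P. exp (- \<beta> * x u))\<^sup>2 = 1 / (\<Sum>u\<in>P. exp (- \<beta> * x u))" if "P \<in> \<P>" for P
  using soft_Z_pos[OF f that, of \<beta> x] by (simp add: power2_eq_square)
 hence "(\<Sum>P\<in>\<P>. (\<Sum>v\<in>P. exp (- \<beta> * x v)) / (\<Sum>u\<in>P. exp (- \<beta> * x u))\<^sup>2) = (\<Sum>P\<in>\<P>. 1 / (\<Sum>u\<in>P. exp (- \<beta> * x u)))"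
  by (intro sum.cong refl)
 thus ?thesis
  using soft_swap[OF f V, of \<beta> x "%_. 1"] soft_S_pos[OF f, of \<beta> x] by simp
qed

lemma C1_on_soft_mm:
 assumes f: "finite_family \<P>" and V: "finite V" "\<Union>\<P> \<subseteq> V" and \<beta>: "\<beta> > 0"
 shows "C1_on V (soft_mm \<beta> \<P>) (soft_mm_grad \<beta> \<P>)"
proof (rule C1_onI)
 fix x :: "real => 'a => real" and x' t assume d: "!!v. v \<in> V ==> ((%s. x s v) has_real_derivative x' v) (at t)"
 have d': "v \<in> P ==> P \<in> \<P> ==> ((%s. x s v) has_real_derivative x' v) (at t)" for v P using d V by auto
 define Z where "Z P s = (\<Sum>u\<in>P. exp (- \<beta> * x s u))" for P s
 have Z: "(Z P has_real_derivative (\<Sum>u\<in>P. exp (- \<beta> * x t u) * (- \<beta> * x' u))) (at t)" if "P \<in> \<P>" for P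
  unfolding Z_def[abs_def] by (intro DERIV_sum DERIV_fun_exp DERIV_cmult d'[OF _ that])
 have Z0: "Z P t > 0" if "P \<in> \<P>" for P unfolding Z_def by (rule soft_Z_pos[OF f that])
 have S: "((%s. \<Sum>P\<in>\<P>. 1 / Z P s) has_real_derivative (\<Sum>P\<in>\<P>. (0 * Z P t - 1 * (\<Sum>u\<in>P. exp (- \<beta> * x t u) * (- \<beta> * x' u))) / (Z P t * Z P t))) (at t)"
  using Z0 by (intro DERIV_sum DERIV_divide DERIV_const Z) (auto simp: less_imp_neq[symmetric])
 have S0: "(\<Sum>P\<in>\<P>. 1 / Z P t) > 0" unfolding Z_def by (rule soft_S_pos[OF f])
 have "((%s. ln (\<Sum>P\<in>\<P>. 1 / Z P s) / \<beta>) has_real_derivative (1 / (\<Sum>P\<in>\<P>. 1 / Z P t) * (\<Sum>P\<in>\<P>. (0 * Z P t - 1 * (\<Sum>u\<in>P. exp (- \<beta> * x t u) * (- \<beta> * x' u))) / (Z P t * Z P t))) / \<beta>) (at t)"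
  by (intro DERIV_cdivide DERIV_chain2[OF DERIV_ln_divide[OF S0] S])
 also have "(1 / (\<Sum>P\<in>\<P>. 1 / Z P t) * (\<Sum>P\<in>\<P>. (0 * Z P t - 1 * (\<Sum>u\<in>P. exp (- \<beta> * x t u) * (- \<beta> * x' u))) / (Z P t * Z P t))) / \<beta> = (\<Sum>v\<in>V. soft_mm_grad \<beta> \<P> (x t) v * x' v)"
 proof -
  have "(0 * Z P t - 1 * (\<Sum>u\<in>P. exp (- \<beta> * x t u) * (- \<beta> * x' u))) / (Z P t * Z P t) = \<beta> * ((\<Sum>v\<in>P. exp (- \<beta> * x t v) * x' v) / (Z P t)\<^sup>2)" for P
   by (simp add: sum_distrib_left sum_negf power2_eq_square mult_ac)
  hence "(\<Sum>P\<in>\<P>. (0 * Z P t - 1 * (\<Sum>u\<in>P. exp (- \<beta> * x t u) * (- \<beta> * x' u))) / (Z P t * Z P t)) = \<beta> * (\<Sum>P\<in>\<P>. (\<Sum>v\<in>P. exp (- \<beta> * x t v) * x' v) / (Z P t)\<^sup>2)"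
   by (simp only: sum_distrib_left)
  thus ?thesis unfolding soft_swap[OF f V] Z_def[symmetric] using \<beta> by simp
 qed
 finally show "((%s. soft_mm \<beta> \<P> (x s)) has_real_derivative (\<Sum>v\<in>V. soft_mm_grad \<beta> \<P> (x t) v * x' v)) (at t)"
  unfolding soft_mm_def Z_def .
next
 have nz: "(\<Sum>u\<in>P. exp (- \<beta> * x u)) \<noteq> 0" if "P \<in> \<P>" for P and x :: "'a => real"
  using soft_Z_pos[OF f that, of \<beta> x] by linarith
 have sp: "(\<Sum>P\<in>\<P>. 1 / (\<Sum>u\<in>P. exp (- \<beta> * x u))) > 0" for x :: "'a => real" by (rule soft_S_pos[OF f])
 have e: "coord_continuous V (%x. exp (- \<beta> * x v))" if "v \<in> V" for v
  by (intro coord_continuous_compose[of V "%x. - \<beta> * x v" exp] coord_continuous_intros continuous_intros V that)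
 have S: "coord_continuous V (%x. \<Sum>P\<in>\<P>. 1 / (\<Sum>u\<in>P. exp (- \<beta> * x u)))"
  by (intro coord_continuous_intros V(1) e nz) (use V(2) in blast)+
 have "coord_continuous V (%x. ln (\<Sum>P\<in>\<P>. 1 / (\<Sum>u\<in>P. exp (- \<beta> * x u))))"
  using S sp unfolding coord_continuous_def by (auto intro!: tendsto_ln simp: less_imp_neq[symmetric])
 thus "coord_continuous V (soft_mm \<beta> \<P>)"
  unfolding soft_mm_def[abs_def] using \<beta> V by (intro coord_continuous_intros) auto
 fix w assume w: "w \<in> V"
 show "coord_continuous V (%x. soft_mm_grad \<beta> \<P> x w)"
  unfolding soft_mm_grad_def
  by (intro coord_continuous_intros V(1) e w power_not_zero nz less_imp_neq[OF sp, symmetric]) (use V(2) in blast)+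
qed

lemma mm_witness:
 assumes "finite_family \<P>"
 obtains P where "P \<in> \<P>" "mm \<P> x = Min (x ` P)" "!!P'. P' \<in> \<P> ==> Min (x ` P') <= mm \<P> x"
proof -
 have "mm \<P> x \<in> (%P. Min (x ` P)) ` \<P>"
  unfolding mm_def using finite_familyD[OF assms] by (intro Max_in) auto
 moreover have "!!P'. P' \<in> \<P> ==> Min (x ` P') <= mm \<P> x"
  unfolding mm_def using finite_familyD[OF assms] by (intro Max_ge) auto
 ultimately show ?thesis using that by auto
qed

text \<open>The soft minimum over a set \<open>P\<close> errs by at most
  \<open>ln (card P) / \<beta>\<close>, the soft maximum over the family by at most
  \<open>ln (card \<P>) / \<beta>\<close>.\<close>

lemma soft_mm_approx:
 assumes f: "finite_family \<P>" and \<beta>: "\<beta> > 0"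
 shows "\<bar>soft_mm \<beta> \<P> x - mm \<P> x\<bar> <= (ln (card (\<Union>\<P>)) + ln (card \<P>)) / \<beta>"
proof -
 note ff = finite_familyD[OF f]
 obtain P0 where P0: "P0 \<in> \<P>" "mm \<P> x = Min (x ` P0)" and le: "!!P. P \<in> \<P> ==> Min (x ` P) <= mm \<P> x"
  by (rule mm_witness[OF f]) blast
 define S where "S = (\<Sum>P\<in>\<P>. 1 / (\<Sum>v\<in>P. exp (- \<beta> * x v)))"
 have S0: "S > 0" unfolding S_def by (rule soft_S_pos[OF f])
 have cU: "card (\<Union>\<P>) \<ge> 1" using ff P0 by (simp add: Suc_le_eq card_gt_0_iff)
 have cP: "card \<P> \<ge> 1" using ff by (simp add: Suc_le_eq card_gt_0_iff)
 have up: "S <= card \<P> * exp (\<beta> * mm \<P> x)"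
 proof -
  have "1 / (\<Sum>v\<in>P. exp (- \<beta> * x v)) <= exp (\<beta> * mm \<P> x)" if P: "P \<in> \<P>" for P
  proof -
   have "Min (x ` P) \<in> x ` P" using ff P by (intro Min_in) auto
   then obtain v where v: "v \<in> P" "x v = Min (x ` P)" by auto
   have "exp (- \<beta> * mm \<P> x) <= exp (- \<beta> * x v)" using le[OF P] v \<beta> by simp
   also have "... <= (\<Sum>v\<in>P. exp (- \<beta> * x v))" using ff P v by (intro member_le_sum[of v P "%v. exp (- \<beta> * x v)"]) auto
   finally have "1 / (\<Sum>v\<in>P. exp (- \<beta> * x v)) <= 1 / exp (- \<beta> * mm \<P> x)"
    using soft_Z_pos[OF f P, of \<beta> x] by (intro divide_left_mono) (auto intro!: mult_pos_pos)
   thus ?thesis by (simp add: exp_minus field_simps)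
  qed
  hence "S <= (\<Sum>P\<in>\<P>. exp (\<beta> * mm \<P> x))" unfolding S_def by (intro sum_mono)
  thus ?thesis by simp
 qed
 have lo: "exp (\<beta> * mm \<P> x) / card (\<Union>\<P>) <= S"
 proof -
  have "(\<Sum>v\<in>P0. exp (- \<beta> * x v)) <= (\<Sum>v\<in>P0. exp (- \<beta> * mm \<P> x))"
   using ff P0 \<beta> by (intro sum_mono) auto
  also have "... = card P0 * exp (- \<beta> * mm \<P> x)" by simp
  also have "... <= card (\<Union>\<P>) * exp (- \<beta> * mm \<P> x)"
   using ff P0 by (intro mult_right_mono) (auto intro!: card_mono)
  finally have "1 / (card (\<Union>\<P>) * exp (- \<beta> * mm \<P> x)) <= 1 / (\<Sum>v\<in>P0. exp (- \<beta> * x v))"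
   using cU soft_Z_pos[OF f P0(1), of \<beta> x] by (intro divide_left_mono) (auto intro!: mult_pos_pos)
  also have "... <= S" unfolding S_def using ff P0 soft_Z_pos[OF f]
   by (intro member_le_sum[of P0 \<P> "%P. 1 / (\<Sum>v\<in>P. exp (- \<beta> * x v))"]) (auto intro: less_imp_le)
  finally show ?thesis by (simp add: exp_minus field_simps)
 qed
 have "ln S <= ln (card \<P> * exp (\<beta> * mm \<P> x))" using S0 up by simp
 hence u: "ln S <= ln (card \<P>) + \<beta> * mm \<P> x" using cP by (simp add: ln_mult)
 have "ln (exp (\<beta> * mm \<P> x) / card (\<Union>\<P>)) <= ln S" using S0 lo cU by (intro ln_mono) auto
 hence l: "\<beta> * mm \<P> x - ln (card (\<Union>\<P>)) <= ln S" using cU by (simp add: ln_div)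
 have nn: "0 <= ln (real (card \<P>))" "0 <= ln (real (card (\<Union>\<P>)))" using cU cP by auto
 have "\<bar>ln S - \<beta> * mm \<P> x\<bar> <= ln (card (\<Union>\<P>)) + ln (card \<P>)" using u l nn by linarith
 moreover have "\<bar>soft_mm \<beta> \<P> x - mm \<P> x\<bar> = \<bar>ln S - \<beta> * mm \<P> x\<bar> / \<beta>"
 proof -
  have "soft_mm \<beta> \<P> x - mm \<P> x = (ln S - \<beta> * mm \<P> x) / \<beta>" using \<beta> unfolding soft_mm_def S_def by (simp add: field_simps)
  thus ?thesis using \<beta> by simp
 qed
 ultimately show ?thesis using \<beta> by (simp add: divide_right_mono)
qed

lemma C1_on_compose:
 assumes F: "C1_on V F f" and q: "!!t. (q has_real_derivative q' t) (at t)" and c: "continuous_on UNIV q'"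
 shows "C1_on V (%x. q (F x)) (%x v. q' (F x) * f x v)"
proof (rule C1_onI)
 fix x x' t assume "!!v. v \<in> V ==> ((%s. x s v) has_real_derivative x' v) (at t)"
 from DERIV_chain2[OF q C1_onD(1)[OF F this]]
 show "((%s. q (F (x s))) has_real_derivative (\<Sum>v\<in>V. q' (F (x t)) * f (x t) v * x' v)) (at t)"
  by (simp add: sum_distrib_left mult.assoc)
next
 have "continuous_on UNIV q" using q by (meson DERIV_isCont continuous_at_imp_continuous_on)
 thus "coord_continuous V (%x. q (F x))" by (rule coord_continuous_compose[OF C1_onD(2)[OF F]])
 show "coord_continuous V (%x. q' (F x) * f x v)" if "v \<in> V" for v
  by (intro coord_continuous_intros coord_continuous_compose[OF _ c] C1_onD(2,3)[OF F] that)
qed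

lemma C1_on_mult:
 assumes F: "C1_on V F f" and G: "C1_on V G g"
 shows "C1_on V (%x. F x * G x) (%x v. f x v * G x + F x * g x v)"
proof (rule C1_onI)
 fix x x' t assume d: "!!v. v \<in> V ==> ((%s. x s v) has_real_derivative x' v) (at t)"
 from DERIV_mult[OF C1_onD(1)[where x=x and x'=x' and t=t, OF F d] C1_onD(1)[where x=x and x'=x' and t=t, OF G d]]
 show "((%s. F (x s) * G (x s)) has_real_derivative (\<Sum>v\<in>V. (f (x t) v * G (x t) + F (x t) * g (x t) v) * x' v)) (at t)"
  by (simp add: sum_distrib_left sum_distrib_right sum.distrib algebra_simps)
qed (intro coord_continuous_intros C1_onD[OF F] C1_onD[OF G]; assumption)+

lemma C1_on_linear_sum:
 fixes F :: "'i => ('a => real) => real"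
 assumes V: "finite V" and F: "!!i. i \<in> I ==> C1_on V (F i) (f i)"
 shows "C1_on V (%x. \<Sum>i\<in>I. c i * F i x) (%x v. \<Sum>i\<in>I. c i * f i x v)"
proof (rule C1_onI)
 fix x :: "real => 'a => real" and x' t assume d: "!!v. v \<in> V ==> ((%s. x s v) has_real_derivative x' v) (at t)"
 have "((%s. \<Sum>i\<in>I. c i * F i (x s)) has_real_derivative (\<Sum>i\<in>I. c i * (\<Sum>v\<in>V. f i (x t) v * x' v))) (at t)"
  by (intro DERIV_sum DERIV_cmult C1_onD(1)[OF F d])
 also have "(\<Sum>i\<in>I. c i * (\<Sum>v\<in>V. f i (x t) v * x' v)) = (\<Sum>v\<in>V. (\<Sum>i\<in>I. c i * f i (x t) v) * x' v)"
  unfolding sum_distrib_left sum_distrib_right by (subst sum.swap) (simp add: mult.assoc)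
 finally show "((%s. \<Sum>i\<in>I. c i * F i (x s)) has_real_derivative (\<Sum>v\<in>V. (\<Sum>i\<in>I. c i * f i (x t) v) * x' v)) (at t)" .
qed (intro coord_continuous_intros V C1_onD[OF F]; assumption)+

lemma C1_on_subst:
 assumes F: "C1_on V F f" and V: "finite W" "V' \<subseteq> W" and \<tau>: "bij_betw \<tau> V V'" "!!v. v \<in> V ==> \<tau>' (\<tau> v) = v"
 shows "C1_on W (%x. F (%v. x (\<tau> v))) (%x w. if w \<in> V' then f (%v. x (\<tau> v)) (\<tau>' w) else 0)"
proof (rule C1_onI)
 have \<tau>W: "\<tau> v \<in> W" if "v \<in> V" for v using that V \<tau>(1) by (auto simp: bij_betw_def)
 fix x x' t assume d: "!!v. v \<in> W ==> ((%s. x s v) has_real_derivative x' v) (at t)"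
 have "((%s. F (%v. x s (\<tau> v))) has_real_derivative (\<Sum>v\<in>V. f (%v. x t (\<tau> v)) v * x' (\<tau> v))) (at t)"
  by (rule C1_onD(1)[OF F d]) (rule \<tau>W)
 also have "(\<Sum>v\<in>V. f (%v. x t (\<tau> v)) v * x' (\<tau> v)) = (\<Sum>v\<in>V. f (%v. x t (\<tau> v)) (\<tau>' (\<tau> v)) * x' (\<tau> v))"
  by (intro sum.cong refl) (simp add: \<tau>)
 also have "... = (\<Sum>w\<in>V'. f (%v. x t (\<tau> v)) (\<tau>' w) * x' w)" by (rule sum.reindex_bij_betw[OF \<tau>(1)])
 also have "... = (\<Sum>w\<in>W. (if w \<in> V' then f (%v. x t (\<tau> v)) (\<tau>' w) else 0) * x' w)"
  by (rule sum.mono_neutral_cong_left) (use V in auto)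
 finally show "((%s. F (%v. x s (\<tau> v))) has_real_derivative (\<Sum>w\<in>W. (if w \<in> V' then f (%v. x t (\<tau> v)) (\<tau>' w) else 0) * x' w)) (at t)" .
next
 have c: "coord_continuous W (%x. x (\<tau> v))" if "v \<in> V" for v
  by (rule coord_continuous_intros(2)) (use that V \<tau>(1) in \<open>auto simp: bij_betw_def\<close>)
 show "coord_continuous W (%x. F (%v. x (\<tau> v)))" by (rule coord_continuous_subst[OF C1_onD(2)[OF F] V(1) c])
 show "coord_continuous W (%x. if w \<in> V' then f (%v. x (\<tau> v)) (\<tau>' w) else 0)" for w
 proof (cases "w \<in> V'")
  case True
  hence "\<tau>' w \<in> V" using \<tau> by (auto simp: bij_betw_def)
  from coord_continuous_subst[OF C1_onD(3)[OF F this] V(1) c] show ?thesis using True by simp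
 qed (use V in \<open>auto intro: coord_continuous_intros(1)\<close>)
qed

lemma C1_on_mono:
 assumes "C1_on V F f" "finite W" "V \<subseteq> W" "!!x v. v \<notin> V ==> f x v = 0"
 shows "C1_on W F f"
proof -
 have "(%x w. if w \<in> V then f x w else 0) = f" using assms(4) by (auto simp: fun_eq_iff)
 thus ?thesis using C1_on_subst[OF assms(1-3), of "%v. v" "%v. v"] by (simp add: bij_betw_def)
qed

text \<open>A smooth substitute for truncation. The covariance formula asks for bounded functions,
  and a derivative between 0 and 1 keeps gradients nonnegative with total mass at most 1. As
  \<open>L\<close> grows it tends to the identity.\<close>

definition soft_clamp :: "real => real => real" where "soft_clamp L t = L * arctan (t / L)"

lemma soft_clamp:
 assumes L: "L > 0"
 shows "(soft_clamp L has_real_derivative 1 / (1 + (t / L)\<^sup>2)) (at t)"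
  "continuous_on UNIV (%t. 1 / (1 + (t / L)\<^sup>2))" "0 < 1 / (1 + (t / L)\<^sup>2)" "1 / (1 + (t / L)\<^sup>2) <= 1"
  "\<bar>soft_clamp L t\<bar> <= L * 2" "\<exists>z. \<bar>z\<bar> <= \<bar>t\<bar> \<and> soft_clamp L t = t * (1 / (1 + (z / L)\<^sup>2))"
proof -
 have nz: "1 + (x / L)\<^sup>2 \<noteq> 0" "1 + (x / L)\<^sup>2 > 0" for x by (metis add_pos_nonneg zero_less_one zero_le_power2 less_irrefl)+
 show d: "(soft_clamp L has_real_derivative 1 / (1 + (t / L)\<^sup>2)) (at t)" for t
 proof -
  have "((%t. arctan (t / L)) has_real_derivative inverse (1 + (t / L)\<^sup>2) * (1 / L)) (at t)"
   by (rule DERIV_chain2[OF DERIV_arctan]) (use L in \<open>auto intro!: derivative_eq_intros\<close>)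
  from DERIV_cmult[OF this, of L] show ?thesis
   unfolding soft_clamp_def[abs_def] using L by (simp add: inverse_eq_divide)
 qed
 show "continuous_on UNIV (%t. 1 / (1 + (t / L)\<^sup>2))" using nz L by (intro continuous_intros) auto
 show "0 < 1 / (1 + (t / L)\<^sup>2)" "1 / (1 + (t / L)\<^sup>2) <= 1" using nz(2)[of t] by simp_all
 have "\<bar>arctan (t / L)\<bar> <= 2" using arctan_lbound[of "t/L"] arctan_ubound[of "t/L"] pi_less_4 by linarith
 thus "\<bar>soft_clamp L t\<bar> <= L * 2" unfolding soft_clamp_def abs_mult using L by (intro mult_mono) auto
 \<comment> \<open>The mean value theorem at 0, as a Maclaurin expansion of order 1.\<close>
 have "\<exists>z. \<bar>z\<bar> <= \<bar>t\<bar> \<and> soft_clamp L t = (\<Sum>m<1. (if m = 0 then soft_clamp L else (%t. 1 / (1 + (t / L)\<^sup>2))) 0 / fact m * t ^ m) +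
   (if (1::nat) = 0 then soft_clamp L else (%t. 1 / (1 + (t / L)\<^sup>2))) z / fact 1 * t ^ 1"
  by (rule Maclaurin_bi_le[of "%m. if m = 0 then soft_clamp L else (%t. 1 / (1 + (t / L)\<^sup>2))"]) (use d in auto)
 thus "\<exists>z. \<bar>z\<bar> <= \<bar>t\<bar> \<and> soft_clamp L t = t * (1 / (1 + (z / L)\<^sup>2))" by (simp add: soft_clamp_def)
qed

definition bf_cov :: "plane => plane => real" where
 "bf_cov v w = exp (- (norm (v - w))\<^sup>2 / 2)"

lemma bf_cov_simps [simp]: "bf_cov v v = 1" "0 < bf_cov v w" "0 <= bf_cov v w" "bf_cov v w <= 1"
 by (auto simp: bf_cov_def)

lemma bf_cov_sym: "bf_cov v w = bf_cov w v"
 by (simp add: bf_cov_def norm_minus_commute)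

section \<open>Max-min functionals of a continuous Gaussian field\<close>

definition maxmin :: "((plane => real) => real) => plane set => bool" where
 "maxmin T S \<longleftrightarrow> bounded S \<and>
   (\<exists>\<P> :: nat => plane set set. (\<forall>n. finite_family (\<P> n) \<and> \<Union>(\<P> n) \<subseteq> S) \<and>
    (\<forall>g. continuous_on UNIV g \<longrightarrow> (%n. mm (\<P> n) g) ----> T g))"

text \<open>\<open>series\<close> feeds hypercontractivity, and \<open>bounded\<close> is the
  envelope for dominated convergence. Continuity and the envelope are asked at every sample point
  rather than almost everywhere, so that the approximations converge pointwise.\<close>

locale planar_field = prob_space M for M :: "'w measure" +
 fixes f :: "'w => plane => real" and a :: "nat \<times> nat => 'w => real"
  and \<phi> :: "plane => nat \<times> nat => real"
 assumes gauss: "finite V ==> gauss_family M V (%v w. f w v) bf_cov"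
  and coeff: "finite I ==> gauss_family M I a (%i j. if i = j then 1 else 0)"
  and series: "AE w in M. (%n. \<Sum>i\<in>{..n} \<times> {..n}. \<phi> v i * a i w) ----> f w v"
  and cont: "continuous_on UNIV (f w)"
  and bounded: "\<exists>W. integrable M W \<and> (\<forall>w x. norm x <= r \<longrightarrow> \<bar>f w x\<bar> <= W w)"

lemma mm_bound:
 assumes f: "finite_family \<P>" and b: "!!v. v \<in> \<Union>\<P> ==> \<bar>g v\<bar> <= b"
 shows "\<bar>mm \<P> g\<bar> <= b"
proof -
 obtain P where P: "P \<in> \<P>" "mm \<P> g = Min (g ` P)" by (rule mm_witness[OF f, of g]) blast
 have "Min (g ` P) \<in> g ` P" using finite_familyD[OF f] P by (intro Min_in) auto
 then obtain x where x: "x \<in> P" "mm \<P> g = g x" using P by auto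
 hence "x \<in> \<Union>\<P>" using P by blast
 from b[OF this] x show ?thesis by simp
qed

lemma maxminE:
 assumes "maxmin T S"
 obtains \<P> where "!!n. finite_family (\<P> n)" "!!n. \<Union>(\<P> n) \<subseteq> S"
  "!!g. continuous_on UNIV g ==> (%n. mm (\<P> n) g) ----> T g"
 using assms unfolding maxmin_def by blast

text \<open>
 Soft versions of \<^const>\<open>mm\<close> clamped to bounded intervals approximate a max-min functional by bounded
 smooth functions whose gradients are nonnegative with total mass at most 1.
\<close>

definition smooth_approx :: "((plane => real) => real) => plane set => (nat => plane set) =>
  (nat => (plane => real) => real) => (nat => (plane => real) => plane => real) => bool" where
 "smooth_approx T S V F g \<longleftrightarrow> (\<forall>n. V n \<subseteq> S \<and> C1_on (V n) (F n) (g n)) \<and>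
   (\<forall>n x v. 0 <= g n x v \<and> (v \<notin> V n \<longrightarrow> g n x v = 0)) \<and>
   (\<forall>n x. \<bar>F n x\<bar> <= real (Suc n) * 2 \<and> (\<Sum>v\<in>V n. g n x v) <= 1) \<and>
   (\<forall>n x b. (\<forall>v\<in>S. \<bar>x v\<bar> <= b) \<longrightarrow> \<bar>F n x\<bar> <= b + 1) \<and>
   (\<forall>x. continuous_on UNIV x \<longrightarrow> (%n. F n x) ----> T x \<and> (%n. \<Sum>v\<in>V n. g n x v) ----> 1)"

lemma smooth_approxD:
 assumes "smooth_approx T S V F g"
 shows "V n \<subseteq> S" "C1_on (V n) (F n) (g n)" "0 <= g n x v" "v \<notin> V n ==> g n x v = 0"
  "\<bar>F n x\<bar> <= real (Suc n) * 2" "(!!v. v \<in> S ==> \<bar>x v\<bar> <= b) ==> \<bar>F n x\<bar> <= b + 1"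
  "continuous_on UNIV x ==> (%n. F n x) ----> T x" "continuous_on UNIV x ==> (%n. \<Sum>v\<in>V n. g n x v) ----> 1"
  "finite (V n)" "finite W ==> (\<Sum>v\<in>W. g n x v) <= 1" "g n x v <= 1"
proof -
 note D = assms[unfolded smooth_approx_def]
 show "V n \<subseteq> S" "C1_on (V n) (F n) (g n)" "\<bar>F n x\<bar> <= real (Suc n) * 2" "(!!v. v \<in> S ==> \<bar>x v\<bar> <= b) ==> \<bar>F n x\<bar> <= b + 1"
  "continuous_on UNIV x ==> (%n. F n x) ----> T x" "continuous_on UNIV x ==> (%n. \<Sum>v\<in>V n. g n x v) ----> 1"
  using D by blast+
 show g0: "0 <= g n x v" and out: "v \<notin> V n ==> g n x v = 0" for v using D by blast+
 show V: "finite (V n)" using D C1_onD(4) by blast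
 show W: "(\<Sum>v\<in>W. g n x v) <= 1" if "finite W" for W
 proof -
  have "(\<Sum>v\<in>W. g n x v) = (\<Sum>v\<in>W \<inter> V n. g n x v)" by (rule sum.mono_neutral_right) (use that out in auto)
  also have "... <= (\<Sum>v\<in>V n. g n x v)" by (rule sum_mono2) (use V g0 in auto)
  also have "... <= 1" using D by blast
  finally show ?thesis .
 qed
 show "g n x v <= 1" using W[of "{v}"] by simp
qed

lemma maxmin_smooth:
 assumes "maxmin T S"
 obtains V F g where "smooth_approx T S V F g"
proof -
 obtain \<P> where P: "!!n. finite_family (\<P> n)" "!!n. \<Union>(\<P> n) \<subseteq> S"
  "!!g. continuous_on UNIV g ==> (%n. mm (\<P> n) g) ----> T g" by (rule maxminE[OF assms]) blast
 define c where "c n = ln (card (\<Union>(\<P> n))) + ln (card (\<P> n))" for n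
 \<comment> \<open>An inverse temperature that makes the error in \<open>soft_mm_approx\<close> at
   most \<open>1 / Suc n\<close>.\<close>
 define b where "b n = real (Suc n) * (1 + \<bar>c n\<bar>)" for n
 have b: "0 < b n" for n unfolding b_def by (intro mult_pos_pos) auto
 define s where "s n x = soft_mm (b n) (\<P> n) x" for n x
 define k where "k n t = 1 / (1 + (t / real (Suc n))\<^sup>2)" for n t
 have L0: "0 < real (Suc n)" for n by simp
 note sc = soft_clamp[OF L0]
 have k01: "0 <= k n t" "k n t <= 1" for n t unfolding k_def using less_imp_le[OF sc(3)] sc(4) by auto
 note sg = soft_mm_grad_nonneg[OF P(1)] and ff = finite_familyD(5)[OF P(1)]
 have g1: "(\<Sum>v\<in>\<Union>(\<P> n). k n (s n x) * soft_mm_grad (b n) (\<P> n) x v) = k n (s n x)" for n x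
  unfolding sum_distrib_left[symmetric] soft_mm_grad_sum[OF P(1) ff order_refl] by simp
 have sm: "\<bar>s n x - mm (\<P> n) x\<bar> <= 1 / real (Suc n)" for n x
 proof -
  have "\<bar>s n x - mm (\<P> n) x\<bar> <= c n / b n" unfolding s_def c_def by (rule soft_mm_approx[OF P(1) b])
  also have "... <= (1 + \<bar>c n\<bar>) / b n" by (rule divide_right_mono) (use b[of n] in auto)
  also have "... = 1 / real (Suc n)" by (simp add: b_def del: of_nat_Suc)
  finally show ?thesis .
 qed
 have sT: "(%n. s n x) ----> T x" if "continuous_on UNIV x" for x
 proof -
  have "(%n. s n x - mm (\<P> n) x) ----> 0"
   by (rule Lim_null_comparison[OF _ LIMSEQ_Suc[OF lim_const_over_n[of 1]]]) (use sm in auto)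
  from tendsto_add[OF this P(3)[OF that]] show ?thesis by simp
 qed
 \<comment> \<open>The points \<open>z n\<close> stay bounded while the scale \<open>Suc n\<close>
   of the clamp grows, so its derivative there tends to 1. It is used at \<open>s n x\<close> itself
   for the mass of the gradient and at an intermediate point for the values.\<close>
 have kT: "(%n. k n (z n)) ----> 1" if x: "continuous_on UNIV x" and z: "!!n. \<bar>z n\<bar> <= \<bar>s n x\<bar>" for x z
 proof -
  have "(%n. \<bar>s n x\<bar> * (1 / real (Suc n))) ----> \<bar>T x\<bar> * 0"
   by (intro tendsto_mult tendsto_rabs sT x LIMSEQ_Suc[OF lim_const_over_n])
  moreover have "\<bar>z n / real (Suc n)\<bar> <= \<bar>s n x\<bar> * (1 / real (Suc n))" for n
   using divide_right_mono[OF z, of "real (Suc n)" n] by (simp add: abs_divide)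
  ultimately have "(%n. z n / real (Suc n)) ----> 0"
   by (intro Lim_null_comparison[OF always_eventually, of "%n. z n / real (Suc n)" "%n. \<bar>s n x\<bar> * (1 / real (Suc n))"]) (simp_all only: real_norm_def mult_zero_right, blast?)
  hence "(%n. 1 / (1 + (z n / real (Suc n))\<^sup>2)) ----> 1 / (1 + 0\<^sup>2)" by (intro tendsto_divide tendsto_add tendsto_power tendsto_const) auto
  thus ?thesis unfolding k_def by simp
 qed
 have "smooth_approx T S (%n. \<Union>(\<P> n)) (%n x. soft_clamp (real (Suc n)) (s n x)) (%n x v. k n (s n x) * soft_mm_grad (b n) (\<P> n) x v)"
  unfolding smooth_approx_def g1
 proof (intro conjI allI impI)
  fix n
  show "\<Union>(\<P> n) \<subseteq> S" by (rule P)
  show "C1_on (\<Union>(\<P> n)) (%x. soft_clamp (real (Suc n)) (s n x)) (%x v. k n (s n x) * soft_mm_grad (b n) (\<P> n) x v)"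
   unfolding s_def k_def by (rule C1_on_compose[OF C1_on_soft_mm[OF P(1) ff order_refl b] sc(1,2)])
  fix x :: "plane => real" and v
  show "0 <= k n (s n x) * soft_mm_grad (b n) (\<P> n) x v" by (intro mult_nonneg_nonneg k01 sg)
  show "k n (s n x) * soft_mm_grad (b n) (\<P> n) x v = 0" if "v \<notin> \<Union>(\<P> n)" unfolding soft_mm_grad_outside[OF that] by simp
  show "\<bar>soft_clamp (real (Suc n)) (s n x)\<bar> <= real (Suc n) * 2" "k n (s n x) <= 1" by (rule sc(5), rule k01)
 next
  fix n b and x :: "plane => real" assume x: "\<forall>v\<in>S. \<bar>x v\<bar> <= b"
  obtain z where "soft_clamp (real (Suc n)) (s n x) = s n x * k n z" using sc(6)[of "s n x" n] unfolding k_def by blast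
  hence "\<bar>soft_clamp (real (Suc n)) (s n x)\<bar> <= \<bar>s n x\<bar> * 1" using k01[of n z] by (simp add: abs_mult mult_left_le)
  moreover have "\<bar>mm (\<P> n) x\<bar> <= b" by (rule mm_bound[OF P(1)]) (use x P(2) in blast)
  moreover have "1 / real (Suc n) <= 1" by simp
  ultimately show "\<bar>soft_clamp (real (Suc n)) (s n x)\<bar> <= b + 1" using sm[of n x] by linarith
 next
  fix x :: "plane => real" assume x: "continuous_on UNIV x"
  show "(%n. k n (s n x)) ----> 1" by (rule kT[OF x]) simp
  have "\<exists>z. \<forall>n. \<bar>z n\<bar> <= \<bar>s n x\<bar> \<and> soft_clamp (real (Suc n)) (s n x) = s n x * k n (z n)"
   unfolding k_def by (intro choice allI sc(6))
  then obtain z where z: "!!n. \<bar>z n\<bar> <= \<bar>s n x\<bar>" "!!n. soft_clamp (real (Suc n)) (s n x) = s n x * k n (z n)" by blast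
  show "(%n. soft_clamp (real (Suc n)) (s n x)) ----> T x"
   unfolding z(2) using tendsto_mult[OF sT[OF x] kT[OF x z(1)]] by simp
 qed
 thus ?thesis by (rule that)
qed

lemma (in planar_field) field_measurable [measurable]: "(%w. f w v) \<in> rv M"
 using gauss_familyD(3)[OF gauss[of "{v}"]] by simp

lemma (in planar_field) smooth_measurable:
 assumes "smooth_approx T S V F g"
 shows "(%z. F n (f z)) \<in> rv M" "v \<in> V n ==> (%z. g n (f z) v) \<in> rv M"
 using C1_on_measurable[OF smooth_approxD(2)[OF assms] gauss_familyD(3)[OF gauss[OF smooth_approxD(9)[OF assms]]]] by auto

text \<open>Up to an additive 1 the approximations are bounded by the largest absolute value of the
  field on the bounded set \<open>S\<close>, hence by its envelope.\<close>

lemma (in planar_field) maxmin_dominated: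
 assumes T: "maxmin T S" and A: "smooth_approx T S V F g"
 obtains W where "integrable M W" "!!n z. \<bar>F n (f z)\<bar> <= W z" "!!z. \<bar>T (f z)\<bar> <= W z"
proof -
 obtain r where r: "!!x. x \<in> S ==> norm x <= r" using T unfolding maxmin_def bounded_iff by blast
 obtain W where W: "integrable M W" "!!w x. norm x <= r ==> \<bar>f w x\<bar> <= W w" using bounded by blast
 have F: "\<bar>F n (f z)\<bar> <= W z + 1" for n z by (rule smooth_approxD(6)[OF A]) (use W(2) r in auto)
 show ?thesis
 proof (rule that[OF _ F])
  show "integrable M (%z. W z + 1)" using W(1) by simp
  show "\<bar>T (f z)\<bar> <= W z + 1" for z
   by (rule LIMSEQ_le_const2[OF tendsto_rabs[OF smooth_approxD(7)[OF A cont]]]) (use F in blast)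
 qed
qed

lemma (in planar_field) maxmin_measurable:
 assumes "maxmin T S"
 shows "(%w. T (f w)) \<in> rv M"
proof -
 obtain V F g where A: "smooth_approx T S V F g" by (rule maxmin_smooth[OF assms])
 show ?thesis by (rule borel_measurable_LIMSEQ_real[OF smooth_approxD(7)[OF A cont] smooth_measurable(1)[OF A]])
qed

lemma (in planar_field) maxmin_integrable:
 assumes "maxmin T S"
 shows "integrable M (%w. T (f w))"
proof -
 obtain V F g where A: "smooth_approx T S V F g" by (rule maxmin_smooth[OF assms])
 obtain W where W: "integrable M W" "!!z. \<bar>T (f z)\<bar> <= W z" by (rule maxmin_dominated[OF assms A]) blast
 show ?thesis by (rule Bochner_Integration.integrable_bound[OF W(1) maxmin_measurable[OF assms]])
  (auto intro!: AE_I2 order_trans[OF W(2) abs_ge_self])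
qed

lemma (in planar_field) smooth_mean_limit:
 assumes T: "maxmin T S" and A: "smooth_approx T S V F g"
 shows "(%n. mean (%z. F n (f z))) ----> mean (%z. T (f z))"
proof -
 obtain W where W: "integrable M W" "!!n z. \<bar>F n (f z)\<bar> <= W z" by (rule maxmin_dominated[OF T A]) blast
 show ?thesis
  by (rule integral_dominated_convergence[where w=W, OF maxmin_measurable[OF T] smooth_measurable(1)[OF A] W(1)])
   (auto intro!: smooth_approxD(7)[OF A cont] W(2))
qed

lemma (in planar_field) gauss_isometry:
 assumes \<tau>: "!!v w. bf_cov (\<tau> v) (\<tau> w) = bf_cov v w" and \<epsilon>: "\<epsilon> * \<epsilon> = 1" and V: "finite V"
 shows "gauss_family M V (%v z. \<epsilon> * f z (\<tau> v)) bf_cov"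
 by (rule gauss_family_cong[OF gauss_family_reindex[OF gauss[of "\<tau> ` V"] V, where \<alpha>="%_. \<epsilon>" and p=\<tau>]])
  (use V \<tau> \<epsilon> in auto)

text \<open>Characteristic functions pass to pointwise limits by bounded convergence.\<close>

lemma (in prob_space) distr_eq_limit:
 fixes Y Y' :: "'a => real"
 assumes X: "!!n. X n \<in> rv M" "!!n. X' n \<in> rv M" and d: "!!n. distr M borel (X n) = distr M borel (X' n)"
  and l: "!!z. (%n. X n z) ----> Y z" "!!z. (%n. X' n z) ----> Y' z"
 shows "distr M borel Y = distr M borel Y'"
proof -
 have m: "Y \<in> rv M" "Y' \<in> rv M" by (rule borel_measurable_LIMSEQ_real[OF l(1) X(1)], rule borel_measurable_LIMSEQ_real[OF l(2) X(2)])
 have c: "(%n. char (distr M borel (Z n)) t) ----> char (distr M borel U) t"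
  if [measurable]: "!!n. Z n \<in> rv M" "U \<in> rv M" and l: "!!z. (%n. Z n z) ----> U z" for Z t and U :: "'a => real"
 proof -
  have e: "char (distr M borel Q) t = (CLINT z|M. iexp (t * Q z))" if [measurable]: "Q \<in> rv M" for Q
   unfolding char_def by (subst integral_distr) auto
  show ?thesis unfolding e[OF that(1)] e[OF that(2)]
   by (rule integral_dominated_convergence[where w="%_. 1"]) (auto intro!: tendsto_intros l AE_I2)
 qed
 have "char (distr M borel Y) = char (distr M borel Y')"
 proof
  fix t
  have "(%n. char (distr M borel (X n)) t) ----> char (distr M borel Y) t" by (rule c[OF X(1) m(1) l(1)])
  moreover have "(%n. char (distr M borel (X n)) t) ----> char (distr M borel Y') t" unfolding d by (rule c[OF X(2) m(2) l(2)])
  ultimately show "char (distr M borel Y) t = char (distr M borel Y') t" by (rule LIMSEQ_unique)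
 qed
 thus ?thesis by (intro Levy_uniqueness real_distribution_distr m)
qed

text \<open>On finitely many sites the law of the field depends only on its covariance, so the
  smooth approximations have the same law for both fields, and this survives the limit. The factor
  \<open>\<epsilon>\<close> covers the symmetry between the field and its negative.\<close>

lemma (in planar_field) maxmin_isometry:
 assumes T: "maxmin T S" and \<tau>: "!!v w. bf_cov (\<tau> v) (\<tau> w) = bf_cov v w" and \<epsilon>: "\<epsilon> * \<epsilon> = 1" and c: "continuous_on UNIV \<tau>"
 shows "distr M borel (%z. T (%v. \<epsilon> * f z (\<tau> v))) = distr M borel (%z. T (f z))"
  and "(%z. T (%v. \<epsilon> * f z (\<tau> v))) \<in> rv M"
proof -
 obtain V F g where A: "smooth_approx T S V F g" by (rule maxmin_smooth[OF T])
 note A' = smooth_approxD[OF A]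
 let ?Y = "%z v. \<epsilon> * f z (\<tau> v)"
 have cg: "continuous_on UNIV (?Y z)" for z
  by (intro continuous_intros continuous_on_compose2[OF cont c]) auto
 have G: "gauss_family M (V n) (%v z. ?Y z v) bf_cov" for n by (rule gauss_isometry[OF \<tau> \<epsilon> A'(9)])
 have m: "(%z. F n (?Y z)) \<in> rv M" for n by (rule C1_on_measurable(1)[OF A'(2) gauss_familyD(3)[OF G]])
 show "(%z. T (?Y z)) \<in> rv M" by (rule borel_measurable_LIMSEQ_real[OF A'(7)[OF cg] m])
 have "distr M borel (%z. F n (?Y z)) = distr M borel (%z. F n (f z))" for n
 proof -
  let ?B = "\<Pi>\<^sub>M v\<in>V n. borel :: real measure"
  have F: "F n \<in> rv ?B" using C1_on_measurable(1)[OF A'(2), of n "%v x. x v"] by simp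
  have "distr M borel (%z. F n (%v. X v z)) = distr (distr M ?B (%z. \<lambda>v\<in>V n. X v z)) borel (F n)"
   if X: "!!v. v \<in> V n ==> X v \<in> rv M" for X
  proof (subst distr_distr)
   have "F n (restrict x (V n)) = F n x" for x by (rule coord_continuous_cong[OF C1_onD(2)[OF A'(2)]]) simp
   thus "distr M borel (%z. F n (%v. X v z)) = distr M borel (F n \<circ> (%z. \<lambda>v\<in>V n. X v z))" by (simp add: o_def)
  qed (use F X in auto)
  note this[OF gauss_familyD(3)[OF G]] this[OF gauss_familyD(3)[OF gauss[OF A'(9)]]]
  thus ?thesis using gauss_family_distr_eq[OF G gauss[OF A'(9)] refl] by simp
 qed
 from distr_eq_limit[OF m smooth_measurable(1)[OF A] this A'(7)[OF cg] A'(7)[OF cont]]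
 show "distr M borel (%z. T (?Y z)) = distr M borel (%z. T (f z))" .
qed

lemma (in planar_field) maxmin_isometry_prob:
 assumes T: "maxmin T S" and \<tau>: "!!v w. bf_cov (\<tau> v) (\<tau> w) = bf_cov v w" and \<epsilon>: "\<epsilon> * \<epsilon> = 1" and c: "continuous_on UNIV \<tau>"
 shows "\<P>(z in M. T (%v. \<epsilon> * f z (\<tau> v)) > l) = \<P>(z in M. T (f z) > l)"
proof -
 note [measurable] = maxmin_isometry(2)[OF assms] maxmin_measurable[OF T]
 have "measure (distr M borel (%z. T (%v. \<epsilon> * f z (\<tau> v)))) {l<..} = measure (distr M borel (%z. T (f z))) {l<..}"
  unfolding maxmin_isometry(1)[OF assms] ..
 thus ?thesis by (simp add: measure_distr vimage_def Int_def conj_commute)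
qed

section \<open>Positive association\<close>

text \<open>Covariances and gradients are nonnegative, so every term of the formula
  \<open>gauss_cov\<close> is.\<close>

lemma (in planar_field) cov_nonneg:
 assumes V: "finite V" and F: "C1_on V F g" and BF: "!!x. \<bar>F x\<bar> <= B" "!!x v. 0 <= g x v" "!!x v. g x v <= B"
  and H: "C1_on V H h" and BH: "!!x. \<bar>H x\<bar> <= B" "!!x v. 0 <= h x v" "!!x v. h x v <= B"
 shows "mean (%z. F (f z)) * mean (%z. H (f z)) <= mean (%z. F (f z) * H (f z))"
proof -
 have "0 <= mean (%z. F (%u. f z u) * H (%u. f z u)) - mean (%z. F (%u. f z u)) * mean (%z. H (%u. f z u))"
 proof (subst gauss_cov[OF gauss[OF V] _ _ F _ _ H, of B])
  show "0 <= (LINT t|lborel. indicator {0..pi/2} t * (sin t * (\<Sum>v\<in>V. \<Sum>w\<in>V. bf_cov v w * (LINT z|(M \<Otimes>\<^sub>M M). h (%u. f (fst z) u) v *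
      g (%u. cos t * f (fst z) u + sin t * f (snd z) u) w))))"
  proof (rule Bochner_Integration.integral_nonneg)
   fix t :: real
   have "t \<in> {0..pi/2} ==> 0 <= sin t" by (rule sin_ge_zero) auto
   thus "0 <= indicator {0..pi/2} t * (sin t * (\<Sum>v\<in>V. \<Sum>w\<in>V. bf_cov v w * (LINT z|(M \<Otimes>\<^sub>M M). h (%u. f (fst z) u) v *
      g (%u. cos t * f (fst z) u + sin t * f (snd z) u) w)))"
    using BF BH by (auto simp: indicator_def intro!: mult_nonneg_nonneg sum_nonneg Bochner_Integration.integral_nonneg)
  qed
 qed (use BF BH bf_cov_sym in \<open>auto intro: order_trans[OF _ BF(2)]\<close>)
 thus ?thesis by simp
qed

text \<open>The second conjunct strengthens the induction: the product of the earlier factors again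
  has a bounded nonnegative gradient, so \<open>cov_nonneg\<close> applies to it and the next
  factor.\<close>

lemma (in planar_field) prod_positive_association:
 assumes I: "finite I" and F: "!!i. i \<in> I ==> C1_on V (F i) (g i)"
  and BF: "!!i x. i \<in> I ==> 0 <= F i x \<and> F i x <= 1" "!!i x v. i \<in> I ==> 0 <= g i x v \<and> g i x v <= B"
  and V: "finite V" and B: "0 <= B"
 shows "(\<Prod>i\<in>I. mean (%w. F i (f w))) <= mean (%w. \<Prod>i\<in>I. F i (f w)) \<and>
   (\<exists>h C. C1_on V (%x. \<Prod>i\<in>I. F i x) h \<and> (\<forall>x v. 0 <= h x v \<and> h x v <= C))"
 using I F BF
proof (induction I)
 case empty
 have "C1_on V (%x. 1) (%_ _. 0)" using V by (auto intro!: C1_onI coord_continuous_intros(1))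
 thus ?case by (auto simp: prob_space intro!: exI[of _ "%_ _. 0"] exI[of _ 0])
next
 case (insert i I)
 then obtain h C where IH: "(\<Prod>i\<in>I. mean (%w. F i (f w))) <= mean (%w. \<Prod>i\<in>I. F i (f w))"
   "C1_on V (%x. \<Prod>i\<in>I. F i x) h" "!!x v. 0 <= h x v" "!!x v. h x v <= C" by (metis insertCI)
 note Fi = insert.prems[OF insertI1]
 let ?F = "%x. \<Prod>i\<in>I. F i x" and ?G = "%x. \<Prod>i\<in>insert i I. F i x"
 have P01: "0 <= ?F x" "?F x <= 1" for x using insert.prems(2) by (auto intro!: prod_nonneg prod_le_1)
 have C: "0 <= C" using IH(3,4) by (meson order_trans)
 define D where "D = max 1 (max B C)"
 have Eq: "?G = (%x. F i x * ?F x)" using insert.hyps by auto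
 have "(\<Prod>i\<in>insert i I. mean (%w. F i (f w))) = mean (%w. F i (f w)) * (\<Prod>i\<in>I. mean (%w. F i (f w)))"
  using insert.hyps by simp
 also have "... <= mean (%w. F i (f w)) * mean (%w. ?F (f w))"
  using Fi(2) IH(1) by (intro mult_left_mono) auto
 also have "... <= mean (%w. F i (f w) * ?F (f w))"
 proof (rule cov_nonneg[OF V Fi(1) _ _ _ IH(2), where B=D])
  show "\<bar>F i x\<bar> <= D" "\<bar>?F x\<bar> <= D" for x using Fi(2)[of x] P01[of x] by (auto simp: D_def)
  show "g i x v <= D" "h x v <= D" for x v using Fi(3)[of x v] IH(4)[of x v] by (auto simp: D_def le_max_iff_disj)
 qed (use Fi IH in auto)
 finally have 1: "(\<Prod>i\<in>insert i I. mean (%w. F i (f w))) <= mean (%w. ?G (f w))" using insert.hyps by simp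
 have "g i x v * ?F x + F i x * h x v <= B * 1 + 1 * C" for x v
  by (intro add_mono mult_mono) (use Fi IH P01 B C in auto)
 moreover have "0 <= g i x v * ?F x + F i x * h x v" for x v using Fi IH P01 by auto
 ultimately have "\<exists>h C. C1_on V ?G h \<and> (\<forall>x v. 0 <= h x v \<and> h x v <= C)"
  unfolding Eq using C1_on_mult[OF Fi(1) IH(2)] by blast
 with 1 show ?case by blast
qed

definition logistic :: "real => real" where "logistic t = 1 / (1 + exp (- t))"

lemma logistic_bounds: "0 < logistic t" "logistic t < 1"
 unfolding logistic_def by (auto simp: add_pos_pos divide_less_eq)

lemma logistic_deriv: "(logistic has_real_derivative logistic t * (1 - logistic t)) (at t)"
proof -
 have "1 + exp (- t) \<noteq> 0" by (metis add_pos_pos exp_gt_zero less_irrefl zero_less_one)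
 thus ?thesis unfolding logistic_def
  by (auto intro!: derivative_eq_intros simp: field_simps power2_eq_square)
qed

text \<open>Above \<open>l\<close> the slope \<open>j ^ 2\<close> outweighs the shift
  \<open>j\<close>; at \<open>l\<close> the shift alone forces the limit 0. The limit is thus the
  indicator of the strict inequality.\<close>

lemma logistic_scaled_tendsto: "(%j. logistic ((real j)\<^sup>2 * (t - l) - real j)) ----> (if t > l then 1 else 0)"
proof (cases "t > l")
 case True
 have 1: "filterlim (%j. (t - l) * real j) at_top sequentially"
  by (rule filterlim_tendsto_pos_mult_at_top[OF tendsto_const _ filterlim_real_sequentially]) (use True in simp)
 have 2: "filterlim (%j. - 1 + (t - l) * real j) at_top sequentially"
  by (rule filterlim_tendsto_add_at_top[OF tendsto_const 1])
 have "filterlim (%j. real j * (- 1 + (t - l) * real j)) at_top sequentially"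
  by (rule filterlim_at_top_mult_at_top[OF filterlim_real_sequentially 2])
 hence "filterlim (%j. real j * (real j * (t - l) - 1)) at_top sequentially"
  by (simp add: algebra_simps)
 hence "filterlim (%j. - (real j * (real j * (t - l) - 1))) at_bot sequentially" by (simp add: filterlim_uminus_at_bot)
 from filterlim_compose[OF exp_at_bot this]
 have "(%j. 1 / (1 + exp (- (real j * (real j * (t - l) - 1))))) ----> 1 / (1 + 0)" by (intro tendsto_intros) auto
 thus ?thesis using True by (simp add: logistic_def power2_eq_square algebra_simps)
next
 case False
 have "(%j. logistic ((real j)\<^sup>2 * (t - l) - real j)) ----> 0"
 proof (rule tendsto_sandwich[OF _ _ tendsto_const])
  have "logistic ((real j)\<^sup>2 * (t - l) - real j) <= exp (- real j)" for j
  proof -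
   have "(real j)\<^sup>2 * (t - l) <= 0" using False by (simp add: mult_nonneg_nonpos)
   hence "exp (real j) <= 1 + exp (- ((real j)\<^sup>2 * (t - l) - real j))" by (simp add: add_increasing)
   hence "1 / (1 + exp (- ((real j)\<^sup>2 * (t - l) - real j))) <= 1 / exp (real j)"
    by (intro divide_left_mono) (auto intro!: mult_pos_pos add_pos_pos)
   thus ?thesis by (simp add: logistic_def exp_minus inverse_eq_divide)
  qed
  thus "\<forall>\<^sub>F j in sequentially. logistic ((real j)\<^sup>2 * (t - l) - real j) <= exp (- real j)" by simp
  show "(%j. exp (- real j)) ----> 0"
   by (rule filterlim_compose[OF exp_at_bot]) (simp add: filterlim_uminus_at_bot filterlim_real_sequentially)
 qed (simp add: less_imp_le[OF logistic_bounds(1)])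
 thus ?thesis using False by simp
qed

text \<open>Two limits are taken: at a fixed slope \<open>j\<close> the smooth approximations
  converge to \<open>T i\<close>, then the logistic functions converge to indicators.\<close>

theorem (in planar_field) positive_association:
 assumes I: "finite I" and T: "!!i. i \<in> I ==> maxmin (T i) (S i)"
 shows "(\<Prod>i\<in>I. \<P>(z in M. T i (f z) > l)) <= \<P>(z in M. \<forall>i\<in>I. T i (f z) > l)"
proof -
 have "\<forall>i\<in>I. \<exists>V F g. smooth_approx (T i) (S i) V F g" using T maxmin_smooth by metis
 then obtain V F g where A: "!!i. i \<in> I ==> smooth_approx (T i) (S i) (V i) (F i) (g i)" unfolding bchoice_iff by blast
 note A' = smooth_approxD[OF A]
 note Tm[measurable] = maxmin_measurable[OF T] and Fm[measurable] = smooth_measurable(1)[OF A]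
 define q where "q j t = logistic ((real j)\<^sup>2 * (t - l) - real j)" for j t
 have q01: "0 <= q j t" "q j t <= 1" for j t unfolding q_def using logistic_bounds less_imp_le by auto
 have qd: "(q j has_real_derivative (real j)\<^sup>2 * (q j t * (1 - q j t))) (at t)" for j t
 proof -
  have "((%t. (real j)\<^sup>2 * (t - l) - real j) has_real_derivative (real j)\<^sup>2) (at t)" by (auto intro!: derivative_eq_intros)
  from DERIV_chain2[OF logistic_deriv this] show ?thesis unfolding q_def by (simp add: mult_ac)
 qed
 have qc: "continuous_on UNIV (q j)" for j using qd by (meson DERIV_isCont continuous_at_imp_continuous_on)
 have [measurable]: "q j \<in> rv borel" for j using qc by (rule borel_measurable_continuous_onI)
 have step: "(\<Prod>i\<in>I. mean (%z. q j (F i n (f z)))) <= mean (%z. \<Prod>i\<in>I. q j (F i n (f z)))" for j n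
 proof -
  define U where "U = (\<Union>i\<in>I. V i n)"
  have U: "finite U" unfolding U_def using I A'(9) by blast
  let ?d = "%t. (real j)\<^sup>2 * (q j t * (1 - q j t))"
  have d: "0 <= ?d t" "?d t <= (real j)\<^sup>2" for t using q01[of j t] mult_le_one[of "q j t" "1 - q j t"] by (auto intro: mult_left_le)
  show ?thesis
  proof (rule prod_positive_association[THEN conjunct1, OF I _ _ _ U])
   fix i assume i: "i \<in> I"
   have "C1_on U (F i n) (g i n)" by (rule C1_on_mono[OF A'(2)[OF i] U _ A'(4)[OF i]]) (use i in \<open>auto simp: U_def\<close>)
   thus "C1_on U (%x. q j (F i n x)) (%x v. ?d (F i n x) * g i n x v)"
    by (rule C1_on_compose[OF _ qd]) (intro continuous_intros qc)
   show "0 <= ?d (F i n x) * g i n x v \<and> ?d (F i n x) * g i n x v <= (real j)\<^sup>2 * 1" for x v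
    using mult_nonneg_nonneg[OF d(1) A'(3)[OF i]] mult_mono[OF d(2) A'(11)[OF i] zero_le_power2 A'(3)[OF i]] by blast
  qed (use q01 in auto)
 qed
 have lF: "(%n. q j (F i n (f z))) ----> q j (T i (f z))" if "i \<in> I" for i j z
  by (rule continuous_on_tendsto_compose[OF qc A'(7)[OF that cont]]) auto
 have pb: "\<bar>\<Prod>i\<in>I. q j (x i)\<bar> <= 1" for j x using q01 by (auto simp: abs_prod intro!: prod_le_1)
 have L1: "(%n. mean (%z. q j (F i n (f z)))) ----> mean (%z. q j (T i (f z)))" if i: "i \<in> I" for i j
  by (rule integral_dominated_convergence[where w="%_. 1"]) (use q01 i lF in \<open>auto intro!: Tm measurable_compose[OF Tm] measurable_compose[OF Fm]\<close>)
 have L2: "(%n. mean (%z. \<Prod>i\<in>I. q j (F i n (f z)))) ----> mean (%z. \<Prod>i\<in>I. q j (T i (f z)))" for j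
  by (rule integral_dominated_convergence[where w="%_. 1"]) (use pb in \<open>auto intro!: tendsto_prod lF borel_measurable_prod\<close>)
 have step2: "(\<Prod>i\<in>I. mean (%z. q j (T i (f z)))) <= mean (%z. \<Prod>i\<in>I. q j (T i (f z)))" for j
  by (rule LIMSEQ_le[OF tendsto_prod[OF L1] L2]) (use step in auto)
 let ?i = "%i z. if T i (f z) > l then (1::real) else 0"
 have lq: "(%j. q j t) ----> (if t > l then 1 else 0)" for t unfolding q_def by (rule logistic_scaled_tendsto)
 have m1: "(%j. mean (%z. q j (T i (f z)))) ----> mean (?i i)" if "i \<in> I" for i
  by (rule integral_dominated_convergence[where w="%_. 1"]) (use that q01 lq in \<open>auto intro!: Tm measurable_compose[OF Tm]\<close>)
 have m2: "(%j. mean (%z. \<Prod>i\<in>I. q j (T i (f z)))) ----> mean (%z. \<Prod>i\<in>I. ?i i z)"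
  by (rule integral_dominated_convergence[where w="%_. 1"]) (use pb in \<open>auto intro!: tendsto_prod lq borel_measurable_prod\<close>)
 have "(\<Prod>i\<in>I. mean (?i i)) <= mean (%z. \<Prod>i\<in>I. ?i i z)"
  by (rule LIMSEQ_le[OF tendsto_prod[OF m1] m2]) (use step2 in auto)
 moreover have "mean (?i i) = \<P>(z in M. T i (f z) > l)" if "i \<in> I" for i
 proof -
  have "mean (?i i) = mean (indicator {z \<in> space M. T i (f z) > l})"
   by (intro Bochner_Integration.integral_cong) (auto simp: indicator_def)
  thus ?thesis using Tm[OF that] by simp
 qed
 moreover have "mean (%z. \<Prod>i\<in>I. ?i i z) = \<P>(z in M. \<forall>i\<in>I. T i (f z) > l)"
 proof -
  have "mean (%z. \<Prod>i\<in>I. ?i i z) = mean (indicator {z \<in> space M. \<forall>i\<in>I. T i (f z) > l})"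
   using I by (intro Bochner_Integration.integral_cong) (auto simp: indicator_def prod_zero_iff)
  moreover have "{z \<in> space M. \<forall>i\<in>I. T i (f z) > l} \<in> sets M" using I by measurable
  ultimately show ?thesis by simp
 qed
 ultimately show ?thesis by (simp cong: prod.cong)
qed

section \<open>Concentration and sprinkling\<close>

text \<open>Let \<open>m l\<close> be the mean of \<open>exp (- l * Y)\<close>. The hypothesis
  bounds its logarithmic derivative and says that
  \<open>ln (m l) + l * mean Y - l ^ 2 * K / 2\<close> is nonincreasing for \<open>l >= 0\<close>;
  this expression vanishes at 0.\<close>

lemma (in prob_space) exponential_bound_of_cov_bound:
 fixes Y :: "'a => real"
 assumes Ym[measurable]: "Y \<in> rv M" and YB: "!!z. \<bar>Y z\<bar> <= B" and l0: "0 <= l"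
  and cov: "!!l. 0 <= l ==> mean Y * mean (%z. exp (- l * Y z)) - l * K * mean (%z. exp (- l * Y z))
     <= mean (%z. Y z * exp (- l * Y z))"
 shows "mean (%z. exp (- l * (Y z - mean Y))) <= exp (l\<^sup>2 * K / 2)"
proof -
 define m where "m l = mean (%z. exp (- l * Y z))" for l
 have B0: "0 <= B" using YB[of undefined] by simp
 have eb: "exp (- l * Y z) <= exp (\<bar>l\<bar> * B)" for l z
 proof -
  have "- l * Y z <= \<bar>l\<bar> * \<bar>Y z\<bar>" by (metis abs_ge_self abs_minus_cancel abs_mult)
  also have "... <= \<bar>l\<bar> * B" using YB by (intro mult_left_mono) auto
  finally show ?thesis by simp
 qed
 have ie: "integrable M (%z. exp (- l * Y z))" for l
  by (rule integrable_const_bound[of _ "exp (\<bar>l\<bar> * B)"]) (use eb in auto)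
 have mpos: "m l > 0" for l
 proof -
  have "0 < exp (- (\<bar>l\<bar> * B))" by simp
  also have "... = mean (%z. exp (- (\<bar>l\<bar> * B)))" by (simp add: prob_space)
  also have "... <= m l" unfolding m_def
  proof (intro integral_mono ie)
   fix z
   have "l * Y z <= \<bar>l\<bar> * \<bar>Y z\<bar>" by (metis abs_ge_self abs_mult)
   also have "... <= \<bar>l\<bar> * B" using YB by (intro mult_left_mono) auto
   finally show "exp (- (\<bar>l\<bar> * B)) <= exp (- l * Y z)" by simp
  qed simp
  finally show ?thesis .
 qed
 have diff_exp: "\<bar>exp x - exp y\<bar> <= \<bar>x - y\<bar> * exp b" if "x <= b" "y <= b" for x y b :: real
 proof -
  have one: "exp x - exp y <= (x - y) * exp b" "0 <= exp x - exp y" if "y <= x" "x <= b" for x y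
  proof -
   have "1 + (y - x) <= exp (y - x)" by (rule exp_ge_add_one_self)
   hence "1 - exp (y - x) <= x - y" by linarith
   hence "exp x * (1 - exp (y - x)) <= exp x * (x - y)" by (rule mult_left_mono) simp
   hence "exp x - exp y <= exp x * (x - y)" by (simp add: right_diff_distrib flip: exp_add)
   also have "... <= exp b * (x - y)" using that by (intro mult_right_mono) auto
   finally show "exp x - exp y <= (x - y) * exp b" by (simp add: mult.commute)
   show "0 <= exp x - exp y" using that by simp
  qed
  show ?thesis using one[of y x] one[of x y] that by (cases "y <= x") auto
 qed
 \<comment> \<open>Differentiation under the integral, by dominated convergence of the difference
   quotients along sequences.\<close>
 have md: "(m has_real_derivative - mean (%z. Y z * exp (- l * Y z))) (at l)" for l
  unfolding DERIV_def tendsto_at_iff_sequentially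
 proof (intro allI impI)
  fix X :: "nat => real" assume X: "\<forall>i. X i \<in> UNIV - {0}" and X0: "X ----> 0"
  have X': "X i \<noteq> 0" for i using X by auto
  obtain N where N: "!!n. n \<ge> N ==> \<bar>X n\<bar> <= 1"
   using X0[unfolded LIMSEQ_def, rule_format, of 1] by (auto simp: dist_real_def intro: less_imp_le)
  have eq: "(m (l + X n) - m l) / X n = mean (%z. (exp (- (l + X n) * Y z) - exp (- l * Y z)) / X n)" for n
   using ie[of "l + X n"] ie[of l] unfolding m_def by (simp only: integral_divide_zero Bochner_Integration.integral_diff)
  have "(%n. mean (%z. (exp (- (l + X (n + N)) * Y z) - exp (- l * Y z)) / X (n + N))) ----> mean (%z. - (Y z * exp (- l * Y z)))"
  proof (rule integral_dominated_convergence[where w="%_. B * exp ((\<bar>l\<bar> + 1) * B)"])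
   show "AE z in M. (%n. (exp (- (l + X (n + N)) * Y z) - exp (- l * Y z)) / X (n + N)) ----> - (Y z * exp (- l * Y z))"
   proof (rule AE_I2)
    fix z
    have "((%l. exp (- l * Y z)) has_real_derivative - (Y z * exp (- l * Y z))) (at l)"
     by (auto intro!: derivative_eq_intros)
    hence "((%h. (exp (- (l + h) * Y z) - exp (- l * Y z)) / h) \<longlongrightarrow> - (Y z * exp (- l * Y z))) (at 0)"
     unfolding DERIV_def .
    hence "((%h. (exp (- (l + h) * Y z) - exp (- l * Y z)) / h) \<circ> (%n. X (n + N))) ----> - (Y z * exp (- l * Y z))"
     by (rule tendsto_at_iff_sequentially[THEN iffD1, rule_format]) (use X' LIMSEQ_ignore_initial_segment[OF X0] in auto)
    thus "(%n. (exp (- (l + X (n + N)) * Y z) - exp (- l * Y z)) / X (n + N)) ----> - (Y z * exp (- l * Y z))"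
     by (simp add: o_def)
   qed
   show "AE z in M. norm ((exp (- (l + X (n + N)) * Y z) - exp (- l * Y z)) / X (n + N)) <= B * exp ((\<bar>l\<bar> + 1) * B)" for n
   proof (rule AE_I2)
    fix z
    have X1: "\<bar>X (n + N)\<bar> <= 1" by (rule N) simp
    have b: "- r * Y z <= (\<bar>l\<bar> + 1) * B" if "\<bar>r\<bar> <= \<bar>l\<bar> + 1" for r
    proof -
     have "- r * Y z <= \<bar>r\<bar> * \<bar>Y z\<bar>" by (metis abs_ge_self abs_minus_cancel abs_mult)
     also have "... <= (\<bar>l\<bar> + 1) * B" using YB that by (intro mult_mono) auto
     finally show ?thesis .
    qed
    have "\<bar>exp (- (l + X (n + N)) * Y z) - exp (- l * Y z)\<bar> <= \<bar>- (l + X (n + N)) * Y z - - l * Y z\<bar> * exp ((\<bar>l\<bar> + 1) * B)"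
     by (rule diff_exp; rule b) (use X1 in auto)
    also have "... = \<bar>X (n + N)\<bar> * (\<bar>Y z\<bar> * exp ((\<bar>l\<bar> + 1) * B))" by (simp add: algebra_simps abs_mult[symmetric])
    also have "... <= \<bar>X (n + N)\<bar> * (B * exp ((\<bar>l\<bar> + 1) * B))" using YB by (intro mult_left_mono mult_right_mono) auto
    finally show "norm ((exp (- (l + X (n + N)) * Y z) - exp (- l * Y z)) / X (n + N)) <= B * exp ((\<bar>l\<bar> + 1) * B)"
     using X'[of "n + N"] by (simp add: field_simps)
   qed
  qed auto
  hence "(%n. (m (l + X (n + N)) - m l) / X (n + N)) ----> - mean (%z. Y z * exp (- l * Y z))"
   unfolding eq by simp
  thus "((%h. (m (l + h) - m l) / h) \<circ> X) ----> - mean (%z. Y z * exp (- l * Y z))"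
   unfolding o_def by (rule LIMSEQ_offset)
 qed
 define h where "h l = ln (m l) + l * mean Y - l\<^sup>2 * K / 2" for l
 have hd: "(h has_real_derivative (- mean (%z. Y z * exp (- l * Y z)) / m l + mean Y - l * K)) (at l)" for l
 proof -
  have "((%l. l * mean Y - l\<^sup>2 * K / 2) has_real_derivative (mean Y - l * K)) (at l)"
   by (auto intro!: derivative_eq_intros)
  from DERIV_add[OF DERIV_chain2[OF DERIV_ln_divide[OF mpos] md] this] show ?thesis
   unfolding h_def[abs_def] by (simp add: add_diff_eq)
 qed
 have "h l <= h 0"
 proof (rule DERIV_nonpos_imp_nonincreasing[OF l0])
  fix x assume x: "0 <= x" "x <= l"
  have "- mean (%z. Y z * exp (- x * Y z)) / m x + mean Y - x * K <= 0"
  proof -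
   have "(mean Y - x * K) * m x <= mean (%z. Y z * exp (- x * Y z))"
    using cov[OF x(1)] unfolding m_def left_diff_distrib .
   hence "mean Y - x * K <= mean (%z. Y z * exp (- x * Y z)) / m x" by (rule mult_imp_le_div_pos[OF mpos])
   thus ?thesis by simp
  qed
  thus "\<exists>y. (h has_real_derivative y) (at x) \<and> y <= 0" using hd by blast
 qed
 also have "h 0 = 0" by (simp add: h_def m_def prob_space)
 finally have "ln (m l) <= - l * mean Y + l\<^sup>2 * K / 2" by (simp add: h_def)
 hence "m l <= exp (- l * mean Y + l\<^sup>2 * K / 2)" using mpos[of l] using exp_le_cancel_iff[of "ln (m l)"] by simp
 hence "m l * exp (l * mean Y) <= exp (- l * mean Y + l\<^sup>2 * K / 2) * exp (l * mean Y)" by (intro mult_right_mono) auto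
 also have "... = exp (l\<^sup>2 * K / 2)" by (simp flip: exp_add)
 also have "m l * exp (l * mean Y) = mean (%z. exp (- l * (Y z - mean Y)))"
  unfolding m_def by (subst integral_mult_left_zero[symmetric]) (simp add: algebra_simps flip: exp_add)
 finally show ?thesis .
qed

lemma integral_sin: "(LINT t|lborel. indicator {0..b} t * sin t) = 1 - cos b" if "0 <= b" for b :: real
proof -
 have "(LINT t|lborel. sin t * indicator {0..b} t) = (- cos b) - (- cos 0)"
  by (rule integral_FTC_Icc_real[OF that]) (auto intro!: derivative_eq_intros continuous_intros)
 thus ?thesis by (simp add: mult.commute)
qed

lemma integrable_sin: "integrable lborel (%t. indicator {0..b} t * sin (t::real))"
proof -
 have "integrable lborel (%t. indicator {0..b} t *\<^sub>R sin (t::real))"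
  by (rule borel_integrable_compact) (auto intro!: continuous_intros)
 thus ?thesis by simp
qed

text \<open>Integrate \<open>f z 0 * q (T (f z))\<close> by parts, where \<open>q\<close> is a clamp
  of width \<open>\<epsilon>\<close> around \<open>l\<close>. The integral is of order
  \<open>\<epsilon>\<close>, because \<open>q\<close> is. On the other side it is at least
  \<open>r\<close> times the mean of \<open>q' (T (f z))\<close>, where \<open>r\<close> bounds the
  covariance between the origin and the points of \<open>S\<close> from below and the gradient mass
  tends to 1. Since \<open>q' l = 1\<close>, the probability of the value \<open>l\<close> is of
  order \<open>\<epsilon>\<close>.\<close>

lemma (in planar_field) maxmin_no_atom:
 assumes T: "maxmin T S"
 shows "\<P>(z in M. T (f z) = l) = 0"
proof -
 obtain V F g where A: "smooth_approx T S V F g" by (rule maxmin_smooth[OF T])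
 note A' = smooth_approxD[OF A]
 note Tm[measurable] = maxmin_measurable[OF T] and [measurable] = smooth_measurable[OF A]
 obtain b where b: "!!x. x \<in> S ==> norm x <= b" using T unfolding maxmin_def bounded_iff by blast
 define r where "r = exp (- b\<^sup>2 / 2)"
 have r0: "r > 0" by (simp add: r_def)
 have rS: "r <= bf_cov 0 w" if "w \<in> S" for w
  unfolding r_def bf_cov_def using b[OF that] by (auto intro!: power_mono)
 define C where "C = mean (%z. \<bar>f z 0\<bar>)"
 have i0: "integrable M (%z. f z 0)" using gauss_integrable[OF gauss[of "{0}"], of 0] by simp
 have main: "\<P>(z in M. T (f z) = l) <= \<epsilon> * 2 * C / r" if \<epsilon>: "\<epsilon> > 0" for \<epsilon>
 proof -
  define q where "q t = soft_clamp \<epsilon> (t - l)" for t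
  define q' where "q' t = 1 / (1 + ((t - l) / \<epsilon>)\<^sup>2)" for t
  have qd: "(q has_real_derivative q' t) (at t)" for t
  proof -
   have "((%t. t - l) has_real_derivative 1) (at t)" by (auto intro!: derivative_eq_intros)
   from DERIV_chain2[OF soft_clamp(1)[OF \<epsilon>] this] show ?thesis unfolding q_def q'_def by simp
  qed
  have q'c: "continuous_on UNIV q'"
   unfolding q'_def by (rule continuous_on_compose2[OF soft_clamp(2)[OF \<epsilon>], of UNIV "%t. t - l"]) (auto intro!: continuous_intros)
  have q'b: "0 < q' t" "q' t <= 1" for t unfolding q'_def using soft_clamp(3,4)[OF \<epsilon>] by auto
  have qb: "\<bar>q t\<bar> <= \<epsilon> * 2" for t unfolding q_def by (rule soft_clamp(5)[OF \<epsilon>])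
  have [measurable]: "q' \<in> rv borel" using q'c by (rule borel_measurable_continuous_onI)
  have s: "r * mean (%z. q' (F n (f z)) * (\<Sum>w\<in>V n. g n (f z) w)) <= \<epsilon> * 2 * C" for n
  proof -
   define W where "W = insert 0 (V n)"
   have W: "finite W" "V n \<subseteq> W" unfolding W_def using A'(9) by auto
   have C1: "C1_on W (%x. q (F n x)) (%x v. q' (F n x) * g n x v)"
    by (rule C1_on_compose[OF C1_on_mono[OF A'(2) W A'(4)] qd q'c])
   have pg: "0 <= q' t * g n x v" "q' t * g n x v <= 1" for t x v
    using q'b[of t] A'(3,11)[of n x v] by (auto intro!: mult_le_one simp: less_imp_le)
   let ?m = "%w. LINT z|M. q' (F n (f z)) * g n (f z) w"
   have ibp: "(LINT z|M. f z 0 * q (F n (f z))) = (\<Sum>w\<in>W. bf_cov 0 w * ?m w)"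
    by (rule gauss_ibp[OF gauss[OF W(1)] _ _ _ C1, where B="max 1 (\<epsilon> * 2)"])
     (use qb pg in \<open>auto simp: W_def bf_cov_sym le_max_iff_disj\<close>)
   have ig: "integrable M (%z. q' (F n (f z)) * g n (f z) w)" if "w \<in> V n" for w
    by (rule integrable_const_bound[of _ 1], rule AE_I2, simp only: real_norm_def abs_of_nonneg[OF pg(1)] pg(2)) (use that in measurable)
   have "r * mean (%z. q' (F n (f z)) * (\<Sum>w\<in>V n. g n (f z) w)) = (\<Sum>w\<in>V n. r * ?m w)"
    unfolding sum_distrib_left by (subst Bochner_Integration.integral_sum) (use ig in \<open>auto simp: sum_distrib_left\<close>)
   also have "... <= (\<Sum>w\<in>V n. bf_cov 0 w * ?m w)"
    using rS A'(1) pg by (intro sum_mono mult_right_mono) auto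
   also have "... <= (\<Sum>w\<in>W. bf_cov 0 w * ?m w)" by (rule sum_mono2[OF W]) (use pg in auto)
   also have "... = (LINT z|M. f z 0 * q (F n (f z)))" by (rule ibp[symmetric])
   also have "... <= (LINT z|M. (\<epsilon> * 2) * \<bar>f z 0\<bar>)"
   proof (rule integral_mono')
    fix z
    have "f z 0 * q (F n (f z)) <= \<bar>f z 0\<bar> * \<bar>q (F n (f z))\<bar>" by (metis abs_ge_self abs_mult)
    also have "... <= \<bar>f z 0\<bar> * (\<epsilon> * 2)" using qb by (intro mult_left_mono) auto
    finally show "f z 0 * q (F n (f z)) <= (\<epsilon> * 2) * \<bar>f z 0\<bar>" by (simp add: mult_ac)
   qed (use i0 \<epsilon> in auto)
   finally show ?thesis by (simp add: C_def)
  qed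
  have qm[measurable]: "(%z. q' (T (f z))) \<in> rv M" by measurable
  have "(%n. mean (%z. q' (F n (f z)) * (\<Sum>w\<in>V n. g n (f z) w))) ----> mean (%z. q' (T (f z)) * 1)"
  proof (rule integral_dominated_convergence[where w="%_. 1"])
   have "0 <= (\<Sum>w\<in>V n. g n x w)" "(\<Sum>w\<in>V n. g n x w) <= 1" for n x by (intro sum_nonneg A'(3), intro A'(10) A'(9))
   hence "0 <= q' t * (\<Sum>w\<in>V n. g n x w) \<and> q' t * (\<Sum>w\<in>V n. g n x w) <= 1" for n t x
    using q'b[of t] by (auto intro!: mult_le_one simp: less_imp_le)
   thus "AE z in M. norm (q' (F n (f z)) * (\<Sum>w\<in>V n. g n (f z) w)) <= 1" for n by (auto simp: abs_of_nonneg)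
   show "AE z in M. (%n. q' (F n (f z)) * (\<Sum>w\<in>V n. g n (f z) w)) ----> q' (T (f z)) * 1"
    by (intro AE_I2 tendsto_mult A'(8)[OF cont] continuous_on_tendsto_compose[OF q'c A'(7)[OF cont]]) auto
  qed auto
  hence s3: "r * mean (%z. q' (T (f z)) * 1) <= \<epsilon> * 2 * C"
   by (intro LIMSEQ_le_const2[OF tendsto_mult[OF tendsto_const]]) (use s in auto)
  have "\<P>(z in M. T (f z) = l) = mean (indicator {z \<in> space M. T (f z) = l})" by simp
  also have "... <= mean (%z. q' (T (f z)))"
  proof (rule integral_mono')
   show "integrable M (%z. q' (T (f z)))"
    by (rule integrable_const_bound[of _ 1, OF AE_I2 qm]) (simp only: real_norm_def abs_of_pos[OF q'b(1)] q'b(2))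
   have "q' l = 1" by (simp add: q'_def)
   thus "indicator {z \<in> space M. T (f z) = l} z <= q' (T (f z))" for z
    using less_imp_le[OF q'b(1)] by (auto simp: indicator_def)
   show "0 <= q' (T (f z))" for z by (rule less_imp_le[OF q'b(1)])
  qed
  finally have "r * \<P>(z in M. T (f z) = l) <= r * mean (%z. q' (T (f z)) * 1)" using r0 by (intro mult_left_mono) auto
  from order_trans[OF this s3] show ?thesis by (intro mult_imp_le_div_pos[OF r0]) (subst mult.commute)
 qed
 have C0: "C \<ge> 0" by (simp add: C_def)
 have "\<P>(z in M. T (f z) = l) <= 0"
 proof (rule field_le_epsilon)
  fix e :: real assume e: "e > 0"
  define k where "k = e / (C + 1)"
  define \<epsilon> where "\<epsilon> = k * (r / 2)"
  have "\<epsilon> > 0" using e r0 C0 by (simp add: \<epsilon>_def k_def)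
  note main[OF this]
  also have "\<epsilon> * 2 * C / r = k * C" using r0 by (simp add: \<epsilon>_def)
  also have "k * C = e * (C / (C + 1))" by (simp add: k_def)
  also have "... <= e * 1" using e C0 by (intro mult_left_mono) auto
  finally show "\<P>(z in M. T (f z) = l) <= 0 + e" by simp
 qed
 thus ?thesis by (rule antisym[OF _ measure_nonneg])
qed

text \<open>The argument of \<open>k\<close> has the law of \<open>X\<close>, whatever
  \<open>s\<close> is.\<close>

lemma noise_one:
 assumes G: "gauss_family M V X Q" and k: "unit_coord_fun V k" and s: "s\<^sup>2 <= 1"
 shows "noise M X s (%_. 1) k = (LINT w|M. k (%v. X v w))"
 unfolding noise_def mult_1
by (rule gauss_transfer'[OF gauss_family_two[OF G gauss_familyD(2)[OF G], where p="%v. v"] G _ unit_coord_funD(1)[OF k]])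
  (use s in \<open>auto simp: power2_eq_square\<close>)

text \<open>The range of angles is cut at \<open>b\<close>. Below it a crude bound \<open>A1\<close>
  costs only \<open>1 - cos b\<close>, the integral of the sine; above it the correlation
  \<open>cos t\<close> stays away from 1, and hypercontractivity can make \<open>A2\<close>
  small.\<close>

lemma gauss_cov_le:
 assumes G: "gauss_family M V X Q" and unit: "!!v. v \<in> V ==> Q v v = 1"
  and sym: "!!v w. v \<in> V ==> w \<in> V ==> Q v w = Q w v"
  and F: "C1_on V F f" and BF: "!!x. \<bar>F x\<bar> <= B" "!!x v. v \<in> V ==> \<bar>f x v\<bar> <= B"
  and H: "C1_on V H h" and BH: "!!x. \<bar>H x\<bar> <= B" "!!x v. v \<in> V ==> \<bar>h x v\<bar> <= B"
  and pq: "!!j. j \<in> J ==> unit_coord_fun V (p j)" "!!j. j \<in> J ==> unit_coord_fun V (q j)"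
  and le: "!!x y. (\<Sum>v\<in>V. \<Sum>w\<in>V. Q v w * (h x v * f y w)) <= (\<Sum>j\<in>J. c j * (p j x * q j y))"
  and b: "0 <= b" "b <= pi/2" and A: "0 <= A1" "0 <= A2"
  and n1: "!!t. 0 <= t ==> t <= b ==> (\<Sum>j\<in>J. c j * noise M X (cos t) (p j) (q j)) <= A1"
  and n2: "!!t. b <= t ==> t <= pi/2 ==> (\<Sum>j\<in>J. c j * noise M X (cos t) (p j) (q j)) <= A2"
 shows "(LINT z|M. F (%u. X u z) * H (%u. X u z)) - (LINT z|M. F (%u. X u z)) * (LINT z|M. H (%u. X u z)) <= A1 * (1 - cos b) + A2"
proof -
 interpret M: prob_space M by (rule gauss_familyD[OF G])
 interpret MM: pair_prob_space M M ..
 have Xm[measurable]: "X v \<in> rv M" if "v \<in> V" for v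
  using gauss_familyD(3)[OF G] that by auto
 let ?y = "%t z u. cos t * X u (fst z) + sin t * X u (snd z)"
 let ?g = "%t. A1 * (indicator {0..b} t * sin t) + A2 * (indicator {0..pi/2} t * sin t)"
 have B0: "0 <= B" using BF(1) abs_ge_zero by (rule order_trans[rotated])
 have inner: "(\<Sum>v\<in>V. \<Sum>w\<in>V. Q v w * (LINT z|(M \<Otimes>\<^sub>M M). h (%u. X u (fst z)) v * f (?y t z) w))
   <= (\<Sum>j\<in>J. c j * noise M X (cos t) (p j) (q j))" if t: "0 <= t" "t <= pi/2" for t
 proof -
  have st: "sqrt (1 - (cos t)\<^sup>2) = sin t"
   using sin_ge_zero[of t] t by (simp add: sin_squared_eq[symmetric])
  have m: "(%z. h (%u. X u (fst z)) v) \<in> rv (M \<Otimes>\<^sub>M M)" "(%z. f (?y t z) v) \<in> rv (M \<Otimes>\<^sub>M M)" if "v \<in> V" for v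
   using that by (auto intro!: C1_on_measurable(2)[OF H] C1_on_measurable(2)[OF F])
  have i: "integrable (M \<Otimes>\<^sub>M M) (%z. h (%u. X u (fst z)) v * f (?y t z) w)" if "v \<in> V" "w \<in> V" for v w
   by (rule MM.P.integrable_const_bound[of _ "B * B"])
    (use BF(2)[OF that(2)] BH(2)[OF that(1)] B0 m that in \<open>auto simp: abs_mult intro!: mult_mono\<close>)
  have ij: "integrable (M \<Otimes>\<^sub>M M) (%z. p j (%u. X u (fst z)) * q j (?y t z))" if "j \<in> J" for j
   by (rule noise_integrable[OF G pq(1)[OF that] pq(2)[OF that]])
  have "(\<Sum>v\<in>V. \<Sum>w\<in>V. Q v w * (LINT z|(M \<Otimes>\<^sub>M M). h (%u. X u (fst z)) v * f (?y t z) w))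
    = (LINT z|(M \<Otimes>\<^sub>M M). (\<Sum>v\<in>V. \<Sum>w\<in>V. Q v w * (h (%u. X u (fst z)) v * f (?y t z) w)))"
   using i by (simp add: Bochner_Integration.integral_sum)
  also have "... <= (LINT z|(M \<Otimes>\<^sub>M M). (\<Sum>j\<in>J. c j * (p j (%u. X u (fst z)) * q j (?y t z))))"
   using i ij by (intro integral_mono le Bochner_Integration.integrable_sum integrable_mult_right)
  also have "... = (\<Sum>j\<in>J. c j * noise M X (cos t) (p j) (q j))"
   unfolding noise_def st using ij by (subst Bochner_Integration.integral_sum) auto
  finally show ?thesis .
 qed
 have s0: "0 <= sin t" if "t \<in> {0..pi/2}" for t using that by (intro sin_ge_zero) auto
 have "(LINT z|M. F (%u. X u z) * H (%u. X u z)) - (LINT z|M. F (%u. X u z)) * (LINT z|M. H (%u. X u z))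
   <= (LINT t|lborel. ?g t)"
  apply (subst gauss_cov[OF G unit sym F BF H BH])
  apply assumption+
 proof (rule integral_mono')
  show "integrable lborel ?g" by (intro Bochner_Integration.integrable_add integrable_mult_right integrable_sin)
  fix t :: real
  show "0 <= ?g t" using A s0 b by (auto simp: indicator_def)
  show "indicator {0..pi/2} t * (sin t * (\<Sum>v\<in>V. \<Sum>w\<in>V. Q v w * (LINT z|(M \<Otimes>\<^sub>M M). h (%u. X u (fst z)) v * f (?y t z) w))) <= ?g t"
  proof (cases "t \<in> {0..pi/2}")
   case True
   have "(\<Sum>v\<in>V. \<Sum>w\<in>V. Q v w * (LINT z|(M \<Otimes>\<^sub>M M). h (%u. X u (fst z)) v * f (?y t z) w)) <= A1 * indicator {0..b} t + A2"
    using order_trans[OF inner[of t] n1[of t]] order_trans[OF inner[of t] n2[of t]] True A by (cases "t <= b") auto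
   from mult_left_mono[OF this s0[OF True]] True show ?thesis by (simp add: algebra_simps)
  qed (use b A in \<open>auto simp: indicator_def\<close>)
 qed
 also have "... = A1 * (1 - cos b) + A2"
  using b by (subst Bochner_Integration.integral_add)
   (auto simp: integral_sin intro!: integrable_mult_right integrable_sin)
 finally show ?thesis .
qed

text \<open>Gradients are grouped into blocks between which the covariance has a constant bound
  \<open>c i j\<close>, so that only the masses of the blocks remain.\<close>

lemma sum_quadratic_le:
 fixes g :: "'i => 'v => real"
 assumes g: "!!i v. i \<in> I ==> 0 <= g i v" "!!i v. i \<in> I ==> v \<notin> S i ==> g i v = 0"
  and g': "!!i v. i \<in> I' ==> 0 <= g' i v" "!!i v. i \<in> I' ==> v \<notin> S' i ==> g' i v = 0"
  and Q: "!!i j v w. i \<in> I ==> j \<in> I' ==> v \<in> S i ==> w \<in> S' j ==> Q v w <= c i j"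
 shows "(\<Sum>v\<in>V. \<Sum>w\<in>V. Q v w * ((\<Sum>i\<in>I. g i v) * (\<Sum>j\<in>I'. g' j w)))
   <= (\<Sum>i\<in>I. \<Sum>j\<in>I'. c i j * ((\<Sum>v\<in>V. g i v) * (\<Sum>w\<in>V. g' j w)))"
proof -
 have "(\<Sum>v\<in>V. \<Sum>w\<in>V. Q v w * ((\<Sum>i\<in>I. g i v) * (\<Sum>j\<in>I'. g' j w))) = (\<Sum>v\<in>V. \<Sum>w\<in>V. \<Sum>i\<in>I. \<Sum>j\<in>I'. Q v w * (g i v * g' j w))"
  unfolding sum_product by (simp only: sum_distrib_left)
 also have "... = (\<Sum>v\<in>V. \<Sum>i\<in>I. \<Sum>w\<in>V. \<Sum>j\<in>I'. Q v w * (g i v * g' j w))"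
  by (rule sum.cong[OF refl], rule sum.swap)
 also have "... = (\<Sum>i\<in>I. \<Sum>v\<in>V. \<Sum>j\<in>I'. \<Sum>w\<in>V. Q v w * (g i v * g' j w))"
  by (subst sum.swap) (intro sum.cong[OF refl] sum.swap)
 also have "... = (\<Sum>i\<in>I. \<Sum>j\<in>I'. \<Sum>v\<in>V. \<Sum>w\<in>V. Q v w * (g i v * g' j w))"
  by (intro sum.cong[OF refl] sum.swap)
 also have "... <= (\<Sum>i\<in>I. \<Sum>j\<in>I'. \<Sum>v\<in>V. \<Sum>w\<in>V. c i j * (g i v * g' j w))"
 proof (intro sum_mono)
  fix i j v w assume "i \<in> I" "j \<in> I'"
  thus "Q v w * (g i v * g' j w) <= c i j * (g i v * g' j w)"
  proof (cases "v \<in> S i \<and> w \<in> S' j")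
   case True
   with Q[of i j v w] \<open>i \<in> I\<close> \<open>j \<in> I'\<close> show ?thesis using g(1)[OF \<open>i \<in> I\<close>] g'(1)[OF \<open>j \<in> I'\<close>] by (intro mult_right_mono) auto
  next
   case False
   hence "g i v * g' j w = 0" using g(2)[OF \<open>i \<in> I\<close>] g'(2)[OF \<open>j \<in> I'\<close>] by auto
   thus ?thesis by (simp only: mult_zero_right)
  qed
 qed
 also have "... = (\<Sum>i\<in>I. \<Sum>j\<in>I'. c i j * ((\<Sum>v\<in>V. g i v) * (\<Sum>w\<in>V. g' j w)))"
  unfolding sum_product by (simp only: sum_distrib_left)
 finally show ?thesis .
qed

text \<open>The covariance formula for \<open>Y\<close> and the increasing function
  \<open>- exp (- l * Y)\<close>, whose gradient is that of \<open>Y\<close> times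
  \<open>l * exp (- l * Y)\<close>. Each summand has gradient mass at most 1, so the covariances
  contribute at most \<open>K\<close>.\<close>

lemma (in planar_field) smooth_sum_cov:
 fixes n :: nat
 assumes I: "finite I" and A: "!!i. i \<in> I ==> smooth_approx (T i) (S i) (V i) (F i) (g i)"
  and c: "!!i j v w. i \<in> I ==> j \<in> I ==> v \<in> S i ==> w \<in> S j ==> bf_cov v w <= c i j" "!!i j. 0 <= c i j"
  and K: "(\<Sum>i\<in>I. \<Sum>j\<in>I. c i j) = K" and l: "0 <= l"
 defines "Y \<equiv> %z. \<Sum>i\<in>I. F i n (f z)"
 shows "mean Y * mean (%z. exp (- l * Y z)) - l * K * mean (%z. exp (- l * Y z))
     <= mean (%z. Y z * exp (- l * Y z))"
proof -
 note A' = smooth_approxD[OF A]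
 define U where "U = (\<Union>i\<in>I. V i n)"
 have U: "finite U" unfolding U_def using I A'(9) by blast
 define H h where "H x = (\<Sum>i\<in>I. 1 * F i n x)" and "h x v = (\<Sum>i\<in>I. 1 * g i n x v)" for x v
 have CH: "C1_on U H h" unfolding H_def[abs_def] h_def[abs_def]
  by (intro C1_on_linear_sum U C1_on_mono[OF A'(2) U _ A'(4)]) (auto simp: U_def)
 define L where "L = card I * (real (Suc n) * 2)"
 have Hb: "\<bar>H x\<bar> <= L" for x
 proof -
  have "\<bar>H x\<bar> <= (\<Sum>i\<in>I. \<bar>F i n x\<bar>)" unfolding H_def by simp
  also have "... <= (\<Sum>i\<in>I. real (Suc n) * 2)" by (intro sum_mono A'(5))
  finally show ?thesis by (simp add: L_def)
 qed
 have h0: "0 <= h x v" "h x v <= card I" for x v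
 proof -
  show "0 <= h x v" unfolding h_def mult_1 by (intro sum_nonneg A'(3))
  have "h x v <= (\<Sum>i\<in>I. 1)" unfolding h_def mult_1 by (intro sum_mono A'(11))
  thus "h x v <= card I" by simp
 qed
 have out: "i \<in> I ==> v \<notin> S i ==> g i n x v = 0" for i x v using A'(1,4) by blast
 have L0: "0 <= L" unfolding L_def by simp
 have K0: "0 <= K" unfolding K[symmetric] by (intro sum_nonneg c(2))
 define D where "D = exp (l * L)"
 have D: "1 <= D" unfolding D_def using l L0 by simp
 have eD: "exp (- l * H x) <= D" for x
 proof -
  have "- l * H x <= l * \<bar>H x\<bar>" using l by (simp add: abs_if mult_less_0_iff)
  also have "... <= l * L" by (rule mult_left_mono[OF Hb l])
  finally show ?thesis by (simp add: D_def)
 qed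
 have CF: "C1_on U (%x. - exp (- l * H x)) (%x v. (l * exp (- l * H x)) * h x v)"
  by (rule C1_on_compose[OF CH]) (auto intro!: derivative_eq_intros continuous_intros)
 define B where "B = max (max L D) (max (card I) (l * D * card I))"
 have fb: "l * exp (- l * H x) * h x v <= l * D * card I" for x v
  using l eD h0 D by (intro mult_mono) auto
 \<comment> \<open>Scaled by \<open>D\<close> to take values in the unit interval, as
   \<open>unit_coord_fun\<close> demands.\<close>
 define q where "q x = exp (- l * H x) / D" for x
 have "coord_continuous U (%x. exp (- l * H x) / D)"
  by (rule coord_continuous_compose[OF C1_onD(2)[OF CH]]) (use D in \<open>auto intro!: continuous_intros\<close>)
 hence q: "unit_coord_fun U q" unfolding unit_coord_fun_def q_def[abs_def] using eD D by (auto simp: divide_le_eq_1)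
 have one: "unit_coord_fun U (%_. 1)" using U by (auto simp: unit_coord_fun_def intro: coord_continuous_intros(1))
 let ?E = "mean (%z. exp (- l * H (f z)))"
 have qE: "D * (LINT z|M. q (%v. f z v)) = ?E"
  unfolding q_def using D by simp
 \<comment> \<open>The gradient of \<open>Y\<close> is bounded through the constant function 1, for
   which \<open>noise\<close> does not depend on the angle; hence the trivial cut at angle
   0.\<close>
 have "mean (%z. - exp (- l * H (%u. f z u)) * H (%u. f z u)) - mean (%z. - exp (- l * H (%u. f z u))) * mean (%z. H (%u. f z u))
   <= l * K * ?E * (1 - cos 0) + l * K * ?E"
 proof (rule gauss_cov_le[OF gauss[OF U] _ bf_cov_sym CF _ _ CH, where J="{()}" and p="%_ _. 1" and q="%_. q" and c="%_. l * K * D" and B=B])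
  show "\<bar>- exp (- l * H x)\<bar> <= B" for x using eD[of x] by (simp add: B_def le_max_iff_disj)
  show "\<bar>l * exp (- l * H x) * h x v\<bar> <= B" for x v using fb[of x v] l h0[of x v] by (simp add: B_def le_max_iff_disj)
  show "\<bar>H x\<bar> <= B" for x using Hb[of x] by (simp add: B_def le_max_iff_disj)
  show "\<bar>h x v\<bar> <= B" for x v using h0[of x v] by (simp add: B_def le_max_iff_disj)
  fix x y :: "plane => real"
  let ?e = "l * exp (- l * H y)"
  have "(\<Sum>v\<in>U. \<Sum>w\<in>U. bf_cov v w * (h x v * (?e * h y w))) = ?e * (\<Sum>v\<in>U. \<Sum>w\<in>U. bf_cov v w * (h x v * h y w))"
   by (simp add: sum_distrib_left mult_ac)
  also have "... <= ?e * (\<Sum>i\<in>I. \<Sum>j\<in>I. c i j * ((\<Sum>v\<in>U. g i n x v) * (\<Sum>w\<in>U. g j n y w)))"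
   unfolding h_def mult_1
   by (intro mult_left_mono sum_quadratic_le[where S=S and S'=S] A'(3) out c(1)) (use l in auto)
  also have "... <= ?e * (\<Sum>i\<in>I. \<Sum>j\<in>I. c i j * (1 * 1))"
   using l by (intro mult_left_mono sum_mono mult_mono A'(10) U c sum_nonneg A'(3)) (auto intro!: mult_nonneg_nonneg sum_nonneg A'(3))
  also have "... = (\<Sum>j\<in>{()}. l * K * D * (1 * q y))" using D by (simp add: q_def K)
  finally show "(\<Sum>v\<in>U. \<Sum>w\<in>U. bf_cov v w * (h x v * (?e * h y w))) <= (\<Sum>j\<in>{()}. l * K * D * (1 * q y))" .
 next
  fix t :: real
  let ?n = "\<Sum>j\<in>{()}. l * K * D * noise M (%v z. f z v) (cos t) (%_. 1) q"
  have "?n = l * K * ?E"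
   using noise_one[OF gauss[OF U] q, of "cos t"] qE[symmetric] by (simp add: abs_square_le_1)
  thus "?n <= l * K * ?E" "?n <= l * K * ?E" by (simp_all only: order_refl)
 qed (use q one K0 l in auto)
 thus ?thesis unfolding Y_def H_def by (simp add: mult.commute)
qed

text \<open>Chernoff's bound for the sum of the functionals: on the event this sum is at least
  \<open>card I * t\<close> below its mean. The variance proxy is the sum of all
  \<open>c i j\<close>, hence at most \<open>card I * C\<close>, and \<open>l = t / C\<close> is the
  optimal exponent for that bound.\<close>

theorem (in planar_field) maxmin_concentration:
 fixes c :: "'i => 'i => real" and t C :: real
 assumes I: "finite I" and T: "!!i. i \<in> I ==> maxmin (T i) (S i)"
  and c: "!!i j v w. i \<in> I ==> j \<in> I ==> v \<in> S i ==> w \<in> S j ==> bf_cov v w <= c i j"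
  and c0: "!!i j. 0 <= c i j" and C: "!!i. i \<in> I ==> (\<Sum>j\<in>I. c i j) <= C" "C > 0" and t: "0 <= t"
 shows "\<P>(y in M. \<forall>i\<in>I. T i (f y) <= mean (%y. T i (f y)) - t) <= exp (- card I * t\<^sup>2 / (2 * C))"
proof -
 have "\<forall>i\<in>I. \<exists>V F g. smooth_approx (T i) (S i) V F g" using T maxmin_smooth by metis
 then obtain V F g where A: "!!i. i \<in> I ==> smooth_approx (T i) (S i) (V i) (F i) (g i)" unfolding bchoice_iff by blast
 note A' = smooth_approxD[OF A] and Tm = maxmin_measurable[OF T] and Fm = smooth_measurable(1)[OF A]
 define K where "K = (\<Sum>i\<in>I. \<Sum>j\<in>I. c i j)"
 have KC: "K <= card I * C" unfolding K_def using sum_mono[of I "%i. \<Sum>j\<in>I. c i j" "%_. C"] C by simp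
 define Z where "Z y = (\<Sum>i\<in>I. T i (f y))" for y
 have Zm[measurable]: "Z \<in> rv M" unfolding Z_def using Tm by (intro borel_measurable_sum)
 define l where "l = t / C"
 have l0: "0 <= l" using t C by (simp add: l_def)
 define Y where "Y n y = (\<Sum>i\<in>I. F i n (f y))" for n y
 have Ym[measurable]: "Y n \<in> rv M" for n unfolding Y_def using Fm by (intro borel_measurable_sum)
 define b where "b n = card I * (real (Suc n) * 2)" for n
 have b: "\<bar>Y n y\<bar> <= b n" for n y
 proof -
  have "\<bar>Y n y\<bar> <= (\<Sum>i\<in>I. \<bar>F i n (f y)\<bar>)" unfolding Y_def by (rule sum_abs)
  also have "... <= (\<Sum>i\<in>I. real (Suc n) * 2)" by (intro sum_mono A'(5))
  finally show ?thesis by (simp add: b_def)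
 qed
 have bound: "mean (%y. exp (- l * (Y n y - mean (Y n)))) <= exp (l\<^sup>2 * K / 2)" for n
  by (rule exponential_bound_of_cov_bound[OF Ym b l0]) (unfold Y_def, rule smooth_sum_cov[OF I A c c0 K_def[symmetric]])
 define s where "s = card I * t"
 have s0: "0 <= s" using t by (simp add: s_def)
 \<comment> \<open>Truncation permits bounded convergence from the approximations to the
   functionals; on the event the minimum equals \<open>exp (l * s)\<close>.\<close>
 let ?m = "%z. min (exp (- l * z)) (exp (l * s))"
 have mint: "integrable M (%y. ?m (g y))" if [measurable]: "g \<in> rv M" for g
  by (rule integrable_const_bound[of _ "exp (l * s)"]) auto
 have le1: "mean (%y. ?m (Y n y - mean (Y n))) <= exp (l\<^sup>2 * K / 2)" for n
 proof (rule order_trans[OF integral_mono[OF mint] bound])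
  have eb: "\<bar>mean (Y n)\<bar> <= b n"
  proof -
   have "\<bar>mean (Y n)\<bar> <= mean (%y. \<bar>Y n y\<bar>)" by (rule integral_abs_bound)
   also have "... <= mean (%_. b n)" by (rule integral_mono') (use b in \<open>auto intro: order_trans[OF abs_ge_zero]\<close>)
   finally show ?thesis by (simp add: prob_space)
  qed
  show "integrable M (%y. exp (- l * (Y n y - mean (Y n))))"
  proof (rule integrable_const_bound[of _ "exp (l * (2 * b n))", OF AE_I2])
   fix y
   have "l * - (Y n y - mean (Y n)) <= l * (2 * b n)" using b[of n y] eb l0 by (intro mult_left_mono) auto
   thus "norm (exp (- l * (Y n y - mean (Y n)))) <= exp (l * (2 * b n))"
    by (simp only: mult_minus_left mult_minus_right real_norm_def abs_exp_cancel exp_le_cancel_iff)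
  qed simp
 qed simp_all
 have Yl: "(%n. Y n y) ----> Z y" for y unfolding Y_def Z_def by (intro tendsto_sum A'(7) cont)
 have Fi: "integrable M (%y. F i n (f y))" if "i \<in> I" for i n
  by (rule integrable_const_bound[OF AE_I2 Fm[OF that]]) (use A'(5)[OF that] in auto)
 have EY: "mean (Y n) = (\<Sum>i\<in>I. mean (%y. F i n (f y)))" for n unfolding Y_def by (rule Bochner_Integration.integral_sum[OF Fi])
 have EZ: "mean Z = (\<Sum>i\<in>I. mean (%y. T i (f y)))" unfolding Z_def by (rule Bochner_Integration.integral_sum[OF maxmin_integrable[OF T]])
 have EYl: "(%n. mean (Y n)) ----> mean Z" unfolding EY EZ by (intro tendsto_sum smooth_mean_limit[OF T A])
 have "(%n. mean (%y. ?m (Y n y - mean (Y n)))) ----> mean (%y. ?m (Z y - mean Z))"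
  by (rule integral_dominated_convergence[where w="%y. exp (l * s)"]) (auto intro!: tendsto_intros Yl EYl)
 from LIMSEQ_le_const2[OF this] le1 have le2: "mean (%y. ?m (Z y - mean Z)) <= exp (l\<^sup>2 * K / 2)" by blast
 let ?E = "{y \<in> space M. \<forall>i\<in>I. T i (f y) <= mean (%y. T i (f y)) - t}"
 have Em: "?E \<in> sets M" using I Tm by measurable
 have "exp (l * s) * prob ?E = mean (%y. exp (l * s) * indicator ?E y)" using Em by simp
 also have "... <= mean (%y. ?m (Z y - mean Z))"
 proof (rule integral_mono'[OF mint])
  fix y
  show "exp (l * s) * indicator ?E y <= ?m (Z y - mean Z)"
  proof (cases "y \<in> ?E")
   case True
   hence "Z y <= (\<Sum>i\<in>I. mean (%y. T i (f y)) - t)" unfolding Z_def by (intro sum_mono) auto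
   hence "s <= - (Z y - mean Z)" by (simp add: EZ sum_subtractf s_def)
   hence "l * s <= l * - (Z y - mean Z)" using l0 by (rule mult_left_mono)
   hence "l * s <= - l * (Z y - mean Z)" by (simp only: mult_minus_left mult_minus_right)
   thus ?thesis using True by simp
  qed simp
 qed auto
 also note le2
 finally have "prob ?E <= exp (l\<^sup>2 * K / 2) / exp (l * s)" by (simp add: pos_le_divide_eq mult.commute)
 also have "... = exp (l\<^sup>2 * K / 2 - l * s)" by (simp add: exp_diff)
 also have "... <= exp (l\<^sup>2 * (card I * C) / 2 - l * s)" using KC by (simp add: mult_left_mono)
 also have "l\<^sup>2 * (card I * C) / 2 - l * s = - card I * t\<^sup>2 / (2 * C)"
  using C(2) by (simp add: l_def s_def power2_eq_square field_simps)
 finally show ?thesis .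
qed

section \<open>Variance of vertical averages\<close>

lemma sum_geometric_int:
 fixes q :: real
 assumes q: "0 <= q" "q < 1" and J: "finite J"
 shows "(\<Sum>i\<in>J. q ^ nat \<bar>i - k\<bar>) <= 2 / (1 - q)"
proof -
 have half: "(\<Sum>i\<in>A. q ^ nat \<bar>i - k\<bar>) <= 1 / (1 - q)" if A: "A \<subseteq> J" and inj: "inj_on (%i. nat \<bar>i - k\<bar>) A" for A
 proof -
  have "(\<Sum>i\<in>A. q ^ nat \<bar>i - k\<bar>) = (\<Sum>n\<in>(%i. nat \<bar>i - k\<bar>) ` A. q ^ n)"
   by (simp add: sum.reindex[OF inj])
  also have "... <= (\<Sum>n. q ^ n)"
   by (rule sum_le_suminf) (use q J finite_subset[OF A] in \<open>auto intro!: summable_geometric\<close>)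
  finally show ?thesis using q by (simp add: suminf_geometric)
 qed
 have "(\<Sum>i\<in>J. q ^ nat \<bar>i - k\<bar>) = (\<Sum>i\<in>{i\<in>J. i < k}. q ^ nat \<bar>i - k\<bar>) + (\<Sum>i\<in>{i\<in>J. \<not> i < k}. q ^ nat \<bar>i - k\<bar>)"
  using J by (subst sum.union_disjoint[symmetric]) (auto intro!: sum.cong)
 also have "... <= 1 / (1 - q) + 1 / (1 - q)"
  by (intro add_mono half) (auto simp: inj_on_def)
 finally show ?thesis by simp
qed

definition row :: "plane => int" where "row v = \<lfloor>snd v\<rfloor>"

definition row_cov :: "int => int => real" where "row_cov j k = exp (3 / 2) * exp (- 1) ^ nat \<bar>j - k\<bar>"

definition row_sum :: real where "row_sum = exp (3 / 2) * (2 / (1 - exp (- 1)))"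

text \<open>Points in rows \<open>i\<close> apart are at distance at least \<open>i - 1\<close>.
  With \<open>x - 1 / 2 <= x ^ 2 / 2\<close> this costs \<open>1 + 1 / 2\<close>, the constant
  \<open>3 / 2\<close> in the exponent.\<close>

lemma row_cov:
 "bf_cov v w <= row_cov (row v) (row w)" "0 <= row_cov j k" "row_cov j k = row_cov k j"
 "finite J ==> (\<Sum>j\<in>J. row_cov j k) <= row_sum" "0 < row_sum"
proof -
 define i where "i = \<bar>row v - row w\<bar>"
 have "real_of_int i <= \<bar>snd v - snd w\<bar> + 1" unfolding i_def row_def by linarith
 also have "\<bar>snd v - snd w\<bar> <= norm (v - w)" using dist_snd_le[of v w] by (simp add: dist_norm)
 finally have n: "real_of_int i - 1 <= norm (v - w)" by simp
 have "0 <= (norm (v - w) - 1)\<^sup>2" by simp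
 hence "norm (v - w) - 1 / 2 <= (norm (v - w))\<^sup>2 / 2" by (simp add: power2_eq_square algebra_simps)
 hence "- (norm (v - w))\<^sup>2 / 2 <= 3 / 2 + real (nat i) * (- 1)" using n by (simp add: i_def)
 hence "bf_cov v w <= exp (3 / 2 + real (nat i) * (- 1))" unfolding bf_cov_def by (simp only: exp_le_cancel_iff)
 also have "... = row_cov (row v) (row w)" unfolding row_cov_def i_def exp_add exp_of_nat_mult ..
 finally show "bf_cov v w <= row_cov (row v) (row w)" .
 show "0 <= row_cov j k" "row_cov j k = row_cov k j" unfolding row_cov_def by (simp_all add: abs_minus_commute)
 have e1: "exp (- 1) < (1::real)" by simp
 show "(\<Sum>j\<in>J. row_cov j k) <= row_sum" if "finite J"
  unfolding row_cov_def row_sum_def sum_distrib_left[symmetric]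
  by (intro mult_left_mono sum_geometric_int that e1) auto
 show "0 < row_sum" unfolding row_sum_def using e1 by (intro mult_pos_pos divide_pos_pos) auto
qed

lemma bf_cov_translate: "bf_cov (v + d) (w + d) = bf_cov v w"
 by (simp add: bf_cov_def)

text \<open>
 The gradient of the average of the vertical translates by 0, ..., m - 1 is spread over the rows of
 the plane so that each row carries expected mass at most 1 / m; by hypercontractivity such an average
 has small variance.
\<close>

lemma (in planar_field) vertical_average_variance:
 fixes n :: nat
 assumes S: "smooth_approx T S V F g" and m: "0 < m" and s: "0 <= s" "s <= 1" "s ^ (2 ^ J) <= 1 / 3"
 defines "Y \<equiv> %z. \<Sum>u<m. 1 / real m * F n (%v. f z (v + (0, real u)))"
 shows "mean (%z. Y z * Y z) - mean Y * mean Y <= row_sum * (1 - s) + row_sum * (1 / real m) powr (1 / (4 * 2 ^ J))"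
proof -
 note S' = smooth_approxD[OF S]
 define e where "e u = (0 :: real, real u)" for u
 define U where "U u = (%v. v + e u) ` V n" for u
 have inj: "inj_on (%v. v + e u) B" for u B by (auto simp: inj_on_def)
 have re: "row (v + e u) = row v + int u" for v u by (simp add: row_def e_def)
 define W where "W = (\<Union>u<m. U u)"
 have W: "finite W" unfolding W_def U_def using S'(9) by blast
 have UW: "u < m ==> U u \<subseteq> W" for u unfolding W_def by blast
 \<comment> \<open>The gradient of the approximation applied to the shifted field; it is carried by
   the translated sites.\<close>
 define h where "h u x w = (if w \<in> U u then g n (%v. x (v + e u)) (w - e u) else 0)" for u x w
 have h0: "0 <= h u x w" "w \<notin> U u ==> h u x w = 0" "h u x w <= 1" for u x w
  unfolding h_def using S'(3,11) by auto
 have he: "h u x (v + e u) = g n (%v. x (v + e u)) v" if "v \<in> V n" for u x v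
  using that by (auto simp: h_def U_def)
 have hU: "(\<Sum>w\<in>W. q w (h u x w)) = (\<Sum>v\<in>V n. q (v + e u) (g n (%v. x (v + e u)) v))"
  if "u < m" "!!w. q w 0 = 0" for u x and q :: "plane => real => real"
 proof -
  have "(\<Sum>w\<in>W. q w (h u x w)) = (\<Sum>w\<in>U u. q w (h u x w))"
   by (rule sum.mono_neutral_right[OF W UW]) (use that h0(2) in auto)
  also have "... = (\<Sum>v\<in>V n. q (v + e u) (h u x (v + e u)))" unfolding U_def sum.reindex[OF inj] o_def ..
  finally show ?thesis by (simp add: he)
 qed
 have Ch: "C1_on W (%x. F n (%v. x (v + e u))) (h u)" if "u < m" for u
  unfolding h_def[abs_def] by (rule C1_on_subst[OF S'(2) W UW[OF that]]) (auto simp: U_def bij_betw_def inj)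
 define A where "A x = (\<Sum>u<m. 1 / real m * F n (%v. x (v + e u)))" for x
 define G where "G x v = (\<Sum>u<m. 1 / real m * h u x v)" for x v
 have CA: "C1_on W A G" unfolding A_def[abs_def] G_def[abs_def] by (intro C1_on_linear_sum W Ch) simp
 have G0: "0 <= G x v" for x v unfolding G_def using h0(1) by (intro sum_nonneg mult_nonneg_nonneg) auto
 have G1: "(\<Sum>v\<in>W. G x v) <= 1" for x
 proof -
  have "(\<Sum>v\<in>W. G x v) = (\<Sum>u<m. 1 / real m * (\<Sum>v\<in>W. h u x v))" unfolding G_def sum_distrib_left by (rule sum.swap)
  also have "... <= (\<Sum>u<m. 1 / real m * 1)" using hU[of _ "%_ t. t"] S'(9,10) by (intro sum_mono mult_left_mono) auto
  also have "... = 1" using m by simp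
  finally show ?thesis .
 qed
 have Gle: "G x v <= 1" if "v \<in> W" for x v using member_le_sum[of v W "G x"] that G0 G1[of x] W by auto
 define D where "D = max 1 (real (Suc n) * 2)"
 have AD: "\<bar>A x\<bar> <= D" for x
 proof -
  have "\<bar>A x\<bar> <= (\<Sum>u<m. \<bar>1 / real m * F n (%v. x (v + e u))\<bar>)" unfolding A_def by (rule sum_abs)
  also have "... <= (\<Sum>u<m. 1 / real m * (real (Suc n) * 2))" unfolding abs_mult using S'(5) by (intro sum_mono mult_mono) auto
  also have "... = real (Suc n) * 2" using m by simp
  finally show ?thesis by (simp add: D_def)
 qed
 define R where "R = row ` W"
 have R: "finite R" using W by (simp add: R_def)
 \<comment> \<open>The gradient mass in row \<open>j\<close>: covariances enter only through the
   rows of the two points.\<close>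
 define p where "p j x = (\<Sum>v\<in>W. if row v = j then G x v else 0)" for j x
 have p01: "0 <= p j x" "p j x <= 1" for j x
 proof -
  show "0 <= p j x" unfolding p_def using G0 by (intro sum_nonneg) auto
  have "p j x <= (\<Sum>v\<in>W. G x v)" unfolding p_def using G0 by (intro sum_mono) auto
  thus "p j x <= 1" using G1[of x] by linarith
 qed
 have pu: "unit_coord_fun W (p j)" for j
  unfolding unit_coord_fun_def p_def[abs_def]
  by (intro conjI allI p01[unfolded p_def] coord_continuous_intros W C1_onD(3)[OF CA])
 \<comment> \<open>By stationarity the expected gradient at a site is the same for all
   translates.\<close>
 define e0 where "e0 v = mean (%z. g n (f z) v)" for v
 have e00: "0 <= e0 v" for v unfolding e0_def using S'(3) by simp
 have eg: "mean (%z. g n (%v. f z (v + e u)) v) = e0 v" if v: "v \<in> V n" for u v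
 proof -
  have "mean (%z. g n (%v. 1 * f z (v + e u)) v) = mean (%z. g n (%v. f z v) v)"
   by (rule gauss_transfer'[OF gauss_isometry[of "%v. v + e u" 1, OF bf_cov_translate _ S'(9)] gauss[OF S'(9)] refl C1_onD(3)[OF S'(2) v]]) simp
  thus ?thesis by (simp add: e0_def)
 qed
 have gi: "integrable M (%z. g n (%v. f z (v + c)) v)" if v: "v \<in> V n" for c v
  by (rule integrable_const_bound[of _ 1, OF AE_I2 C1_on_measurable(2)[OF S'(2) field_measurable v]]) (use S'(3,11) in auto)
 have e0sum: "(\<Sum>v\<in>V n. e0 v) <= 1"
 proof -
  have gi0: "integrable M (%z. g n (f z) v)" if "v \<in> V n" for v using gi[OF that, of 0] by simp
  have "(\<Sum>v\<in>V n. e0 v) = mean (%z. \<Sum>v\<in>V n. g n (f z) v)"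
   unfolding e0_def using gi0 by (rule Bochner_Integration.integral_sum[symmetric])
  also have "... <= (LINT z|M. 1)" by (rule integral_mono) (use gi0 S'(9,10) in auto)
  finally show ?thesis by (simp add: prob_space)
 qed
 have pE: "p j x = (\<Sum>u<m. \<Sum>v\<in>V n. 1 / m * (if row v + int u = j then g n (%v. x (v + e u)) v else 0))" for j x
 proof -
  have "p j x = (\<Sum>v\<in>W. \<Sum>u<m. 1 / m * (if row v = j then h u x v else 0))" unfolding p_def G_def by (intro sum.cong refl) auto
  also have "... = (\<Sum>u<m. \<Sum>v\<in>W. 1 / m * (if row v = j then h u x v else 0))" by (rule sum.swap)
  also have "... = (\<Sum>u<m. \<Sum>v\<in>V n. 1 / m * (if row (v + e u) = j then g n (%v. x (v + e u)) v else 0))"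
   by (intro sum.cong refl hU) auto
  finally show ?thesis by (simp only: re)
 qed
 define E where "E j = (LINT z|M. p j (%v. f z v))" for j
 have E0: "0 <= E j" for j unfolding E_def using p01 by simp
 have EE: "E j = (\<Sum>u<m. \<Sum>v\<in>V n. 1 / m * (if row v + int u = j then e0 v else 0))" for j
 proof -
  let ?g = "%u v z. 1 / m * (if row v + int u = j then g n (%v. f z (v + e u)) v else 0)"
  have i: "integrable M (?g u v)" "mean (?g u v) = 1 / m * (if row v + int u = j then e0 v else 0)" if "v \<in> V n" for u v
   using gi[OF that] eg[OF that] by (cases "row v + int u = j"; simp)+
  have "E j = (\<Sum>u<m. mean (%z. \<Sum>v\<in>V n. ?g u v z))"
   unfolding E_def pE using i(1) by (intro Bochner_Integration.integral_sum Bochner_Integration.integrable_sum)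
  also have "... = (\<Sum>u<m. \<Sum>v\<in>V n. mean (?g u v))" by (intro sum.cong refl Bochner_Integration.integral_sum i(1))
  also have "... = (\<Sum>u<m. \<Sum>v\<in>V n. 1 / m * (if row v + int u = j then e0 v else 0))" by (intro sum.cong refl i(2))
  finally show ?thesis .
 qed
 have ifs: "(\<Sum>j\<in>B. if i = j then e0 v else 0) <= e0 v" if "finite B" for B and i :: int and v
  using that e00 by (simp add: sum.delta')
 have Esum: "(\<Sum>j\<in>R. E j) <= 1"
 proof -
  have "(\<Sum>j\<in>R. E j) = (\<Sum>u<m. \<Sum>v\<in>V n. 1 / m * (\<Sum>j\<in>R. if row v + int u = j then e0 v else 0))"
   unfolding EE sum_distrib_left by (subst sum.swap, rule sum.cong[OF refl], rule sum.swap)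
  also have "... <= (\<Sum>u<m. \<Sum>v\<in>V n. 1 / m * e0 v)" by (intro sum_mono mult_left_mono ifs R) auto
  also have "... = real m * (1 / m * (\<Sum>v\<in>V n. e0 v))" by (simp add: sum_distrib_left)
  also have "... <= 1" using m e0sum by simp
  finally show ?thesis .
 qed
 \<comment> \<open>At most one \<open>u\<close> moves a given site into row \<open>j\<close>, so
   averaging over \<open>m\<close> translates leaves a row at most \<open>1 / m\<close> of the total
   mass.\<close>
 have Em: "E j <= 1 / m" for j
 proof -
  have "E j = (\<Sum>v\<in>V n. 1 / m * (\<Sum>u<m. if row v + int u = j then e0 v else 0))"
   unfolding EE sum_distrib_left by (rule sum.swap)
  also have "... <= (\<Sum>v\<in>V n. 1 / m * e0 v)"
  proof (intro sum_mono mult_left_mono)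
   fix v
   have "(\<Sum>u<m. if row v + int u = j then e0 v else 0) <= (\<Sum>u<m. if nat (j - row v) = u then e0 v else 0)"
    using e00 by (intro sum_mono) auto
   also have "... <= e0 v" using e00 by (simp add: sum.delta')
   finally show "(\<Sum>u<m. if row v + int u = j then e0 v else 0) <= e0 v" .
  qed simp
  also have "... <= 1 / m * 1" unfolding sum_distrib_left[symmetric] by (intro mult_left_mono e0sum) auto
  finally show ?thesis by simp
 qed
 \<comment> \<open>Beyond this angle the correlation \<open>cos t\<close> is at most
   \<open>s\<close>, the range in which \<open>noise_small\<close> applies with \<open>J\<close>
   squarings.\<close>
 define b where "b = arccos s"
 have b: "0 <= b" "b <= pi/2" "cos b = s" unfolding b_def using s arccos_le_pi2[of s] arccos_lbound[of s] by auto
 define r where "r = 1 / (4 * 2 ^ J :: real)"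
 have r: "r > 0" by (simp add: r_def)
 have sumE: "(\<Sum>i\<in>R \<times> R. row_cov (fst i) (snd i) * E (fst i)) <= row_sum" "(\<Sum>i\<in>R \<times> R. row_cov (fst i) (snd i) * E (snd i)) <= row_sum"
 proof -
  have 1: "(\<Sum>j\<in>R. \<Sum>k\<in>R. row_cov k j * E j) <= row_sum"
  proof -
   have "(\<Sum>j\<in>R. \<Sum>k\<in>R. row_cov k j * E j) = (\<Sum>j\<in>R. (\<Sum>k\<in>R. row_cov k j) * E j)" by (simp only: sum_distrib_right)
   also have "... <= (\<Sum>j\<in>R. row_sum * E j)" by (intro sum_mono mult_right_mono row_cov(4) R E0)
   also have "... <= row_sum * 1" unfolding sum_distrib_left[symmetric] using row_cov(5) by (intro mult_left_mono Esum) auto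
   finally show ?thesis by simp
  qed
  show "(\<Sum>i\<in>R \<times> R. row_cov (fst i) (snd i) * E (fst i)) <= row_sum"
   using 1 unfolding sum.cartesian_product' fst_conv snd_conv by (simp only: row_cov(3)[of _ "_ :: int"])
  show "(\<Sum>i\<in>R \<times> R. row_cov (fst i) (snd i) * E (snd i)) <= row_sum"
   using 1 unfolding sum.cartesian_product' fst_conv snd_conv by (subst sum.swap)
 qed
 have "(LINT z|M. A (%u. f z u) * A (%u. f z u)) - (LINT z|M. A (%u. f z u)) * (LINT z|M. A (%u. f z u))
   <= row_sum * (1 - cos b) + row_sum * (1 / real m) powr r"
 proof (rule gauss_cov_le[OF gauss[OF W] _ bf_cov_sym CA _ _ CA, where J="R \<times> R" and p="%i. p (fst i)" and q="%i. p (snd i)" and c="%i. row_cov (fst i) (snd i)" and B=D])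
  show "\<bar>A x\<bar> <= D" "\<bar>A x\<bar> <= D" for x by (rule AD)+
  have GD: "\<bar>G x v\<bar> <= D" if "v \<in> W" for x v using G0[of x v] Gle[OF that, of x] by (simp add: D_def le_max_iff_disj)
  show "\<bar>G x v\<bar> <= D" "\<bar>G x v\<bar> <= D" if "v \<in> W" for x v using GD[OF that] by blast+
  fix x y :: "plane => real"
  define d where "d x j v = (if v \<in> W \<and> row v = j then G x v else 0)" for x j v
  have k: "(\<Sum>j\<in>R. d x j v) = G x v" if "v \<in> W" for x v
   unfolding d_def using that R by (auto simp: R_def sum.delta)
  have kp: "(\<Sum>v\<in>W. d x j v) = p j x" for x j unfolding d_def p_def by (rule sum.cong) auto
  have "(\<Sum>v\<in>W. \<Sum>w\<in>W. bf_cov v w * (G x v * G y w)) = (\<Sum>v\<in>W. \<Sum>w\<in>W. bf_cov v w * ((\<Sum>j\<in>R. d x j v) * (\<Sum>j\<in>R. d y j w)))"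
   by (intro sum.cong[OF refl]) (simp add: k)
  also have "... <= (\<Sum>i\<in>R. \<Sum>j\<in>R. row_cov i j * ((\<Sum>v\<in>W. d x i v) * (\<Sum>w\<in>W. d y j w)))"
   by (rule sum_quadratic_le[where S="%j. {v. row v = j}" and S'="%j. {v. row v = j}"]) (use G0 row_cov(1) in \<open>auto simp: d_def\<close>)
  also have "... = (\<Sum>i\<in>R \<times> R. row_cov (fst i) (snd i) * (p (fst i) x * p (snd i) y))"
   unfolding kp sum.cartesian_product' fst_conv snd_conv ..
  finally show "(\<Sum>v\<in>W. \<Sum>w\<in>W. bf_cov v w * (G x v * G y w)) <= (\<Sum>i\<in>R \<times> R. row_cov (fst i) (snd i) * (p (fst i) x * p (snd i) y))" .
 next
  fix t :: real
  let ?n = "%i. noise M (%v z. f z v) (cos t) (p (fst i)) (p (snd i))"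
  \<comment> \<open>The crude bound, used below the cut: the second factor is at most 1.\<close>
  have 1: "?n i <= E (fst i)" for i
  proof -
   note ni = noise_integrable[OF gauss[OF W] pu]
   have o: "unit_coord_fun W (%_. 1)" using W by (auto simp: unit_coord_fun_def intro: coord_continuous_intros(1))
   interpret MM: pair_prob_space M M ..
   have "?n i <= (LINT z|(M \<Otimes>\<^sub>M M). p (fst i) (%v. f (fst z) v) * 1)"
    unfolding noise_def by (rule integral_mono[OF ni[OF pu] ni[OF o]]) (use p01 in \<open>auto intro: mult_left_le\<close>)
   also have "... = E (fst i)"
    unfolding E_def using MM.integral_fst'[of "%z. p (fst i) (f (fst z))"] ni[OF o] by (simp add: prob_space)
   finally show ?thesis .
  qed
  have "(\<Sum>i\<in>R \<times> R. row_cov (fst i) (snd i) * ?n i) <= (\<Sum>i\<in>R \<times> R. row_cov (fst i) (snd i) * E (fst i))"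
   by (intro sum_mono mult_left_mono 1 row_cov(2))
  thus "(\<Sum>i\<in>R \<times> R. row_cov (fst i) (snd i) * ?n i) <= row_sum" using sumE(1) by linarith
  assume t: "b <= t" "t <= pi/2"
  have ct: "0 <= cos t" "cos t <= s" using t b cos_ge_zero[of t] cos_monotone_0_pi_le[of b t] by auto
  have ct3: "cos t ^ (2 ^ J) <= 1 / 3" using power_mono[OF ct(2,1), of "2 ^ J"] s(3) by linarith
  \<comment> \<open>The gain in the exponent is applied to the row mass \<open>1 / m\<close>; the
    remaining geometric mean of two row masses is replaced by the arithmetic mean, which the sums of
    \<open>row_cov\<close> control.\<close>
  have 2: "?n i <= (1 / real m) powr r * ((E (fst i) + E (snd i)) / 2)" for i
  proof -
   have "?n i <= sqrt (E (fst i)) * sqrt (E (snd i)) * E (snd i) powr (1 / (4 * 2 ^ J))"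
    unfolding E_def
    by (rule noise_small[OF gauss[OF W] coeff _ series pu pu ct(1) order_trans[OF ct(2) s(2)] ct3]) auto
   also have "... <= sqrt (E (fst i)) * sqrt (E (snd i)) * (1 / real m) powr r"
    unfolding r_def[symmetric] using Em[of "snd i"] E0 r by (intro mult_left_mono powr_mono2) auto
   also have "... <= (E (fst i) + E (snd i)) / 2 * (1 / real m) powr r"
    using arith_geo_mean_sqrt[OF E0 E0, of "fst i" "snd i"] by (intro mult_right_mono) (auto simp: real_sqrt_mult)
   finally show ?thesis by (simp add: mult.commute)
  qed
  have "(\<Sum>i\<in>R \<times> R. row_cov (fst i) (snd i) * ?n i)
    <= (\<Sum>i\<in>R \<times> R. row_cov (fst i) (snd i) * ((1 / real m) powr r * ((E (fst i) + E (snd i)) / 2)))"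
   by (intro sum_mono mult_left_mono 2 row_cov(2))
  also have "... = (1 / real m) powr r * (((\<Sum>i\<in>R \<times> R. row_cov (fst i) (snd i) * E (fst i)) + (\<Sum>i\<in>R \<times> R. row_cov (fst i) (snd i) * E (snd i))) / 2)"
   by (simp add: sum_distrib_left sum.distrib[symmetric] sum_divide_distrib algebra_simps add_divide_distrib)
  also have "... <= (1 / real m) powr r * row_sum" using sumE by (intro mult_left_mono) auto
  finally show "(\<Sum>i\<in>R \<times> R. row_cov (fst i) (snd i) * ?n i) <= row_sum * (1 / real m) powr r" by (simp add: mult.commute)
 qed (use pu b row_cov(5) in auto)
 thus ?thesis
  unfolding Y_def A_def b r_def e_def by simp
qed

text \<open>When \<open>Th\<close> exceeds \<open>l\<close>, so do all \<open>m\<close> translates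
  of \<open>T\<close>, hence their average. If the mean of \<open>T\<close> were below
  \<open>l - \<epsilon>\<close>, the average would exceed its mean by \<open>\<epsilon>\<close> with
  probability at least \<open>c\<close>, although its variance is at most
  \<open>\<epsilon> ^ 2 * c / 2\<close>. The number \<open>m\<close> depends on
  \<open>\<epsilon>\<close> and \<open>c\<close> only, so a scale larger than \<open>m\<close> can
  be chosen afterwards.\<close>

theorem (in planar_field) vertical_sprinkling:
 assumes \<epsilon>: "\<epsilon> > 0" and c: "c > 0"
 obtains m :: nat where "m > 0" "!!T S Th Sh l. maxmin T S ==> maxmin Th Sh ==>
  (!!g u. continuous_on UNIV g ==> u < m ==> Th g <= T (%v. g (v + (0, real u)))) ==>
  c <= \<P>(x in M. Th (f x) > l) ==> l - \<epsilon> <= mean (%x. T (f x))"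
proof -
 \<comment> \<open>Each of the two terms of the variance bound will be at most
   \<open>row_sum * k\<close>.\<close>
 define k where "k = \<epsilon>\<^sup>2 * c / (4 * row_sum)"
 have k: "k > 0" unfolding k_def using \<epsilon> c row_cov(5) by simp
 define s where "s = max 0 (1 - k)"
 have s: "0 <= s" "s < 1" "1 - s <= k" using k by (auto simp: s_def)
 obtain J where "s ^ J < 1 / 3" using real_arch_pow_inv[of "1/3" s] s by auto
 hence J: "s ^ (2 ^ J) <= 1 / 3" using power_decreasing[of J "2 ^ J" s] s less_exp[of J] by auto
 define h where "h = 1 / (4 * 2 ^ J :: real)"
 have h: "h > 0" by (simp add: h_def)
 obtain m where m: "0 < m" "1 / real m < k powr (1 / h)"
  using real_arch_inverse[of "k powr (1 / h)"] k by (auto simp: inverse_eq_divide)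
 have mh: "(1 / real m) powr h <= k"
 proof -
  have "(1 / real m) powr h <= (k powr (1 / h)) powr h" using m h by (intro powr_mono2) auto
  thus ?thesis using h k by (simp add: powr_powr)
 qed
 have var: "row_sum * (1 - s) + row_sum * (1 / real m) powr h <= \<epsilon>\<^sup>2 * c / 2"
 proof -
  have "row_sum * (1 - s) + row_sum * (1 / real m) powr h <= row_sum * k + row_sum * k"
   using s(3) mh row_cov(5) by (intro add_mono mult_left_mono) auto
  also have "... = \<epsilon>\<^sup>2 * c / 2" using row_cov(5) by (simp add: k_def)
  finally show ?thesis .
 qed
 show ?thesis
 proof (rule that[OF m(1)])
  fix T S Th Sh l
  assume T: "maxmin T S" and Th: "maxmin Th Sh"
   and le: "!!g u. continuous_on UNIV g ==> u < m ==> Th g <= T (%v. g (v + (0, real u)))"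
   and pc: "c <= \<P>(x in M. Th (f x) > l)"
  define \<mu> where "\<mu> = mean (%x. T (f x))"
  define A where "A x = (\<Sum>u<m. 1 / real m * T (%v. f x (v + (0, real u))))" for x
  obtain V F g where S: "smooth_approx T S V F g" by (rule maxmin_smooth[OF T])
  note S' = smooth_approxD[OF S]
  let ?f = "%z u v. f z (v + (0, real u))"
  have fm: "(%z. F n (?f z u)) \<in> rv M" for n u by (rule C1_on_measurable(1)[OF S'(2), where X="%v z. f z (v + (0, real u))"]) (rule field_measurable)
  define Y where "Y n x = (\<Sum>u<m. 1 / real m * F n (?f x u))" for n x
  have Ym[measurable]: "Y n \<in> rv M" for n unfolding Y_def using fm by (intro borel_measurable_sum borel_measurable_times borel_measurable_const)
  have "continuous_on UNIV (?f x u)" for x u by (intro continuous_on_compose2[OF cont] continuous_intros) auto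
  hence Yl: "(%n. Y n x) ----> A x" for x unfolding Y_def A_def by (intro tendsto_sum tendsto_mult tendsto_const S'(7))
  have Am[measurable]: "A \<in> rv M" by (rule borel_measurable_LIMSEQ_real[OF Yl Ym])
  have Fi: "integrable M (%z. F n (?f z u))" for n u
   by (rule integrable_const_bound[OF AE_I2 fm]) (use S'(5) in auto)
  have Yb: "\<bar>Y n x\<bar> <= real (Suc n) * 2" for n x
  proof -
   have "\<bar>Y n x\<bar> <= (\<Sum>u<m. \<bar>1 / real m * F n (?f x u)\<bar>)" unfolding Y_def by (rule sum_abs)
   also have "... <= (\<Sum>u<m. 1 / real m * (real (Suc n) * 2))" unfolding abs_mult using S'(5) by (intro sum_mono mult_mono) auto
   finally show ?thesis using m by simp
  qed
  have "mean (Y n) = mean (%x. F n (f x))" for n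
  proof -
   have "mean (%z. F n (%v. 1 * f z (v + (0, real u)))) = mean (%z. F n (%v. f z v))" for u
    by (rule gauss_transfer'[OF gauss_isometry[of "%v. v + (0, real u)" 1, OF bf_cov_translate _ S'(9)] gauss[OF S'(9)] refl C1_onD(2)[OF S'(2)]]) simp
   thus ?thesis using m Fi unfolding Y_def by (simp add: Bochner_Integration.integral_sum)
  qed
  hence EYl: "(%n. mean (Y n)) ----> \<mu>" unfolding \<mu>_def using smooth_mean_limit[OF T S] by simp
  \<comment> \<open>Truncation at \<open>\<epsilon> ^ 2\<close> permits bounded convergence; on the
    event that matters the minimum is \<open>\<epsilon> ^ 2\<close>.\<close>
  let ?m = "%z. min (z\<^sup>2) (\<epsilon>\<^sup>2)"
  have le1: "mean (%x. ?m (Y n x - mean (Y n))) <= \<epsilon>\<^sup>2 * c / 2" for n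
  proof -
   define y where "y = mean (Y n)"
   have iY: "integrable M (Y n)" by (rule integrable_const_bound[OF AE_I2]) (use Yb in auto)
   have iYY: "integrable M (%x. Y n x * Y n x)"
    by (rule integrable_const_bound[of _ "(real (Suc n) * 2) * (real (Suc n) * 2)", OF AE_I2]) (unfold real_norm_def abs_mult, intro mult_mono Yb, auto)
   have sq: "(Y n x - y)\<^sup>2 = Y n x * Y n x - 2 * y * Y n x + y * y" for x by (simp add: power2_eq_square algebra_simps)
   have "mean (%x. ?m (Y n x - y)) <= mean (%x. (Y n x - y)\<^sup>2)"
   proof (rule integral_mono')
    show "integrable M (%x. (Y n x - y)\<^sup>2)" unfolding sq using iY iYY by auto
   qed auto
   also have "... = mean (%x. Y n x * Y n x) - y * y"
    unfolding sq using iY iYY by (simp add: prob_space y_def[symmetric])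
   also have "... <= row_sum * (1 - s) + row_sum * (1 / real m) powr h"
    unfolding y_def Y_def h_def by (rule vertical_average_variance[OF S m(1)]) (use s J in auto)
   also note var
   finally show ?thesis unfolding y_def .
  qed
  have "(%n. mean (%x. ?m (Y n x - mean (Y n)))) ----> mean (%x. ?m (A x - \<mu>))"
   by (rule integral_dominated_convergence[where w="%x. \<epsilon>\<^sup>2"]) (auto intro!: tendsto_intros Yl EYl)
  hence le2: "mean (%x. ?m (A x - \<mu>)) <= \<epsilon>\<^sup>2 * c / 2" by (rule LIMSEQ_le_const2) (use le1 in blast)
  show "l - \<epsilon> <= mean (%x. T (f x))"
  proof (rule ccontr)
   assume "\<not> l - \<epsilon> <= mean (%x. T (f x))"
   hence \<mu>l: "\<mu> < l - \<epsilon>" by (simp add: \<mu>_def)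
   let ?E = "{x \<in> space M. Th (f x) > l}"
   have Em: "?E \<in> sets M" using maxmin_measurable[OF Th] by measurable
   have "\<epsilon>\<^sup>2 * c <= \<epsilon>\<^sup>2 * prob ?E" using pc by (intro mult_left_mono) auto
   also have "... = mean (%x. \<epsilon>\<^sup>2 * indicator ?E x)" using Em by simp
   also have "... <= mean (%x. ?m (A x - \<mu>))"
   proof (rule integral_mono')
    show "integrable M (%x. ?m (A x - \<mu>))" by (rule integrable_const_bound[of _ "\<epsilon>\<^sup>2"]) auto
    fix x
    show "\<epsilon>\<^sup>2 * indicator ?E x <= ?m (A x - \<mu>)"
    proof (cases "x \<in> ?E")
     case True
     have "Th (f x) = (\<Sum>u<m. 1 / real m * Th (f x))" using m by simp
     also have "... <= A x" unfolding A_def by (intro sum_mono mult_left_mono le cont) auto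
     finally have "\<epsilon> <= A x - \<mu>" using True \<mu>l by simp
     hence "\<epsilon>\<^sup>2 <= (A x - \<mu>)\<^sup>2" using \<epsilon> by (intro power_mono) auto
     thus ?thesis using True by simp
    qed simp
   qed simp
   also note le2
   finally show False using \<epsilon> c by simp
  qed
 qed
qed

section \<open>The Bargmann-Fock field\<close>

definition bf_weight :: "real => nat => real" where "bf_weight r i = r ^ i / sqrt (fact i)"

definition bf_mono :: "plane => nat \<times> nat => real" where
 "bf_mono x i = bf_weight (fst x) (fst i) * bf_weight (snd x) (snd i)"

definition bf_coeff :: "plane => nat \<times> nat => real" where
 "bf_coeff x i = exp (- (norm x)\<^sup>2 / 2) * bf_mono x i"

lemma summable_bf_weight:
 assumes r: "0 <= r"
 shows "summable (bf_weight r)"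
proof -
 obtain N :: nat where N: "4 * r\<^sup>2 <= real N" using real_arch_simple by blast
 show ?thesis
 proof (rule summable_ratio_test[of "1/2" N])
  fix n assume n: "n \<ge> N"
  have "2 * r <= sqrt (real (Suc n))"
   by (rule real_le_rsqrt) (use N n in \<open>auto simp: power_mult_distrib\<close>)
  hence "r / sqrt (real (Suc n)) <= 1 / 2" by (simp add: field_simps)
  hence "bf_weight r n * (r / sqrt (real (Suc n))) <= bf_weight r n * (1 / 2)"
   using r by (intro mult_left_mono) (auto simp: bf_weight_def)
  moreover have "bf_weight r (Suc n) = bf_weight r n * (r / sqrt (real (Suc n)))"
   by (simp add: bf_weight_def real_sqrt_mult mult_ac)
  ultimately show "norm (bf_weight r (Suc n)) <= 1/2 * norm (bf_weight r n)"
   using r by (simp add: bf_weight_def)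
 qed simp
qed

text \<open>On the ball of radius \<open>r\<close> a monomial is dominated by its value at the
  corner \<open>(r, r)\<close> of the surrounding square.\<close>

lemma bf_mono_bound:
 assumes "norm x <= r"
 shows "\<bar>bf_mono x i\<bar> <= bf_mono (r, r) i" "0 <= bf_mono (r, r) i"
proof -
 have "\<bar>fst x\<bar> <= r" "\<bar>snd x\<bar> <= r" using assms norm_fst_le[of "fst x" "snd x"] norm_snd_le[of "snd x" "fst x"] by auto
 thus "\<bar>bf_mono x i\<bar> <= bf_mono (r, r) i" "0 <= bf_mono (r, r) i"
  unfolding bf_mono_def bf_weight_def abs_mult abs_divide power_abs
  by (auto intro!: mult_mono divide_right_mono power_mono)
qed

lemma summable_bf_mono:
 assumes r: "0 <= r"
 shows "bf_mono (r, r) summable_on UNIV"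
proof (rule nonneg_bdd_above_summable_on)
 have w0: "0 <= bf_weight r i" for i using r by (simp add: bf_weight_def)
 thus "0 <= bf_mono (r, r) x" for x by (simp add: bf_mono_def)
 have "sum (bf_mono (r, r)) F <= suminf (bf_weight r) * suminf (bf_weight r)" if F: "finite F" for F
 proof -
  have "sum (bf_mono (r, r)) F <= sum (bf_mono (r, r)) (fst ` F \<times> snd ` F)"
   by (rule sum_mono2) (use F w0 in \<open>auto simp: bf_mono_def subset_fst_snd simp del: mem_Times_iff\<close>)
  also have "... = sum (bf_weight r) (fst ` F) * sum (bf_weight r) (snd ` F)"
   unfolding sum_product sum.cartesian_product' bf_mono_def by simp
  also have "... <= suminf (bf_weight r) * suminf (bf_weight r)"
   using F w0 by (intro mult_mono sum_le_suminf summable_bf_weight r suminf_nonneg sum_nonneg) auto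
  finally show ?thesis .
 qed
 thus "bdd_above (sum (bf_mono (r, r)) ` {F. F \<subseteq> UNIV \<and> finite F})" by (intro bdd_aboveI2) auto
qed

text \<open>It lets unordered sums be read along squares of indices, the form required by
  \<open>series\<close>.\<close>

lemma filterlim_square: "filterlim (%n::nat. {..n} \<times> {..n}) (finite_subsets_at_top UNIV) sequentially"
 unfolding filterlim_finite_subsets_at_top
proof (intro allI impI)
 fix X :: "(nat \<times> nat) set" assume X: "finite X \<and> X \<subseteq> UNIV"
 define m where "m = Max (insert 0 (fst ` X \<union> snd ` X))"
 have "fst x <= m" "snd x <= m" if "x \<in> X" for x unfolding m_def using X that by (auto intro!: Max_ge)
 thus "\<forall>\<^sub>F y in sequentially. finite ({..y} \<times> {..y}) \<and> X \<subseteq> {..y} \<times> {..y} \<and> {..y} \<times> {..y} \<subseteq> UNIV"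
  by (intro eventually_sequentiallyI[of m]) (force simp: subset_iff)
qed

lemma AE_summable:
 fixes X :: "nat => 'w => real"
 assumes X: "!!n. integrable M (X n)" "!!n w. 0 <= X n w" and s: "summable (%n. (LINT w|M. X n w))"
 shows "AE w in M. summable (%n. X n w)"
proof -
 have [measurable]: "X n \<in> rv M" for n using X(1) by auto
 have "(\<integral>\<^sup>+w. (\<Sum>n. ennreal (X n w)) \<partial>M) = (\<Sum>n. \<integral>\<^sup>+w. ennreal (X n w) \<partial>M)" by (rule nn_integral_suminf) measurable
 also have "... = (\<Sum>n. ennreal (LINT w|M. X n w))" using X by (intro suminf_cong nn_integral_eq_integral) auto
 also have "... = ennreal (\<Sum>n. (LINT w|M. X n w))" using X by (intro suminf_ennreal2 s) auto
 finally have "(\<integral>\<^sup>+w. (\<Sum>n. ennreal (X n w)) \<partial>M) \<noteq> \<infinity>" by simp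
 hence "AE w in M. (\<Sum>n. ennreal (X n w)) \<noteq> \<infinity>" by (intro nn_integral_PInf_AE) auto
 thus ?thesis by eventually_elim (rule summable_suminf_not_top, use X(2) in auto)
qed

lemma iid_gauss_family:
 assumes a: "iid_std_normal M a" and I: "finite I"
 shows "gauss_family M I a (%i j. if i = j then 1 else 0)"
proof -
 interpret prob_space M using a by (simp add: iid_std_normal_def)
 have d: "distributed M lborel (a i) std_normal_density" for i using a unfolding iid_std_normal_def by blast
 have am[measurable]: "a i \<in> rv M" for i using distributed_measurable[OF d] by simp
 have da: "distr M borel (a i) = std_normal_distribution" for i
  using distributed_distr_eq_density[OF d] distr_cong[OF refl sets_lborel refl, of M "a i"] by simp
 have ind: "indep_vars (%_. borel) a I" using a indep_vars_subset[of "%_. borel" a UNIV I] by (auto simp: iid_std_normal_def)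
 show ?thesis unfolding gauss_family_def
 proof (intro conjI ballI allI)
  fix c :: "nat \<times> nat => real"
  have ind': "indep_vars (%_. borel) (%i z. c i * a i z) I" by (rule indep_vars_compose2[OF ind]) measurable
  have ch: "char (distr M borel (%z. c i * a i z)) 1 = of_real (exp (- (c i)\<^sup>2 / 2))" for i
  proof -
   have "char (distr M borel (%z. c i * a i z)) 1 = char (distr M borel (a i)) (c i)"
    unfolding char_def by (simp add: integral_distr)
   thus ?thesis unfolding da char_std_normal_distribution by simp
  qed
  have "(CLINT z|M. iexp (\<Sum>i\<in>I. c i * a i z)) = char (distr M borel (%z. \<Sum>i\<in>I. c i * a i z)) 1"
   unfolding char_def by (simp add: integral_distr)
  also have "... = (\<Prod>i\<in>I. of_real (exp (- (c i)\<^sup>2 / 2)))" unfolding char_distr_sum[OF ind'] ch ..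
  also have "... = of_real (exp (- (\<Sum>i\<in>I. (c i)\<^sup>2) / 2))"
   unfolding of_real_prod[symmetric] exp_sum[OF I, symmetric] by (simp add: sum_negf sum_divide_distrib)
  also have "(\<Sum>i\<in>I. (c i)\<^sup>2) = (\<Sum>v\<in>I. \<Sum>w\<in>I. c v * c w * (if v = w then 1 else 0))"
   using I by (intro sum.cong refl) (simp add: if_distrib[where f="%x. _ * x"] power2_eq_square cong: if_cong)
  finally show "(CLINT z|M. iexp (\<Sum>i\<in>I. c i * a i z)) = of_real (exp (- (\<Sum>v\<in>I. \<Sum>w\<in>I. c v * c w * (if v = w then 1 else 0)) / 2))" .
 qed (use I in \<open>auto intro: prob_space_axioms\<close>)
qed

text \<open>The double sum factors into two exponential series with sums
  \<open>exp (fst v * fst w)\<close> and \<open>exp (snd v * snd w)\<close>; the Gaussian factors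
  complete the square.\<close>

lemma bf_coeff_cov: "(%n. \<Sum>i\<in>{..n} \<times> {..n}. bf_coeff v i * bf_coeff w i) ----> bf_cov v w"
proof -
 have e: "(%n. \<Sum>i\<le>n. bf_weight x i * bf_weight y i) ----> exp (x * y)" for x y
 proof -
  have "bf_weight x i * bf_weight y i = (x * y) ^ i /\<^sub>R fact i" for i
  proof -
   have "bf_weight x i * bf_weight y i = (x * y) ^ i / (sqrt (fact i) * sqrt (fact i))" by (simp add: bf_weight_def power_mult_distrib)
   also have "... = (x * y) ^ i /\<^sub>R fact i" by (simp add: divide_inverse mult.commute)
   finally show ?thesis .
  qed
  thus ?thesis using exp_converges[of "x * y"] by (simp add: sums_def_le)
 qed
 have "(\<Sum>i\<in>{..n} \<times> {..n}. bf_coeff v i * bf_coeff w i) = exp (- (norm v)\<^sup>2 / 2) * exp (- (norm w)\<^sup>2 / 2) *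
   ((\<Sum>i\<le>n. bf_weight (fst v) i * bf_weight (fst w) i) * (\<Sum>i\<le>n. bf_weight (snd v) i * bf_weight (snd w) i))" for n
  unfolding sum.cartesian_product' sum_product unfolding sum_distrib_left
  by (intro sum.cong[OF refl]) (simp add: bf_coeff_def bf_mono_def mult_ac)
 moreover have "(%n. exp (- (norm v)\<^sup>2 / 2) * exp (- (norm w)\<^sup>2 / 2) *
   ((\<Sum>i\<le>n. bf_weight (fst v) i * bf_weight (fst w) i) * (\<Sum>i\<le>n. bf_weight (snd v) i * bf_weight (snd w) i)))
   ----> exp (- (norm v)\<^sup>2 / 2) * exp (- (norm w)\<^sup>2 / 2) * (exp (fst v * fst w) * exp (snd v * snd w))"
  by (intro tendsto_intros e)
 moreover have "exp (- (norm v)\<^sup>2 / 2) * exp (- (norm w)\<^sup>2 / 2) * (exp (fst v * fst w) * exp (snd v * snd w)) = bf_cov v w"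
 proof -
  have "(norm u)\<^sup>2 = (fst u)\<^sup>2 + (snd u)\<^sup>2" for u :: "plane" by (simp add: norm_prod_def)
  thus ?thesis unfolding bf_cov_def exp_add[symmetric]
   by (intro arg_cong[of _ _ exp]) (simp add: power2_eq_square field_simps)
 qed
 ultimately show ?thesis by (simp only:)
qed

text \<open>At each integer radius the mean absolute values of the terms have a finite sum, so off a
  single null set the series converges absolutely and uniformly on every ball. On that null set the
  field is replaced by 0, which makes continuity and the envelope hold at every sample
  point.\<close>

theorem bargmann_fock_planar_field:
 assumes a: "iid_std_normal M a"
 obtains f where "planar_field M f a bf_coeff" "AE z in M. f z = bargmann_fock a z"
proof -
 interpret prob_space M using a by (simp add: iid_std_normal_def)
 note G = iid_gauss_family[OF a]
 have am[measurable]: "a i \<in> rv M" for i using gauss_familyD(3)[OF G[of "{i}"]] by simp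
 have ai: "integrable M (a i)" for i using gauss_integrable[OF G[of "{i}"], of i] by simp
 define C where "C = (LINT x|std_normal_distribution. \<bar>x\<bar>)"
 have Ea: "mean (%z. \<bar>a i z\<bar>) = C" for i
  unfolding C_def gauss_std_normal[OF G[of "{i}"], of i, simplified, symmetric] by (simp add: integral_distr)
 define b where "b r = bf_mono (real r, real r)" for r :: nat
 have b0: "0 <= b r i" for r i unfolding b_def using bf_mono_bound(2)[of "0::plane" "real r" i] by simp
 define X where "X r n z = b r (prod_decode n) * \<bar>a (prod_decode n) z\<bar>" for r n z
 have X0: "0 <= X r n z" for r n z unfolding X_def using b0 by simp
 have Xi: "integrable M (X r n)" for r n unfolding X_def using ai by auto
 have EX: "mean (X r n) = b r (prod_decode n) * C" for r n unfolding X_def using Ea by simp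
 have bij: "bij_betw prod_decode UNIV UNIV" by (rule bij_prod_decode)
 have bs: "summable (%n. b r (prod_decode n))" for r
  unfolding b_def by (rule summable_on_imp_summable) (simp only: summable_on_reindex_bij_betw[OF bij] summable_bf_mono of_nat_0_le_iff)
 have sEX: "summable (%n. mean (X r n))" for r unfolding EX using bs by (rule summable_mult2)
 have "AE z in M. \<forall>r. summable (%n. X r n z)"
  unfolding AE_all_countable by (intro allI AE_summable Xi X0 sEX)
 then obtain N where N: "N \<in> null_sets M" "!!z. z \<in> space M ==> z \<notin> N ==> \<forall>r. summable (%n. X r n z)"
  by (elim AE_E3) auto
 define A where "A = space M - N"
 have Am[measurable]: "A \<in> sets M" using N by (auto simp: A_def)
 have AEA: "AE z in M. z \<in> A" using AE_not_in[OF N(1)] by (auto simp: A_def)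
 have good: "summable (%n. X r n z)" if "z \<in> A" for z r using N(2) that by (auto simp: A_def)
 have good': "(%i. b r i * \<bar>a i z\<bar>) summable_on UNIV" if "z \<in> A" for z r
 proof -
  have "X r n z = norm (X r n z)" for n using X0 by simp
  hence "(%n. X r n z) summable_on UNIV" using good[OF that, of r] by (intro norm_summable_imp_summable_on) simp
  thus ?thesis unfolding X_def using summable_on_reindex_bij_betw[OF bij, of "%i. b r i * \<bar>a i z\<bar>"] by simp
 qed
 define f where "f z x = (if z \<in> A then exp (- (norm x)\<^sup>2 / 2) * (\<Sum>\<^sub>\<infinity>i. a i z * bf_mono x i) else 0)" for z x
 have term_le: "norm (a i z * bf_mono x i) <= b r i * \<bar>a i z\<bar>" if "norm x <= real r" for x i r z
  using mult_left_mono[OF bf_mono_bound(1)[OF that, of i], of "\<bar>a i z\<bar>"] by (simp add: b_def abs_mult mult.commute)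
 have real_bound: "norm x <= real (nat \<lceil>norm x\<rceil>)" for x :: "plane" by (rule real_nat_ceiling_ge)
 have sx: "(%i. norm (a i z * bf_mono x i)) summable_on UNIV" if "z \<in> A" for z x
  by (rule summable_on_comparison_test[OF good'[OF that, of "nat \<lceil>norm x\<rceil>"]]) (use term_le[OF real_bound] in auto)
 have eq: "f z = bargmann_fock a z" if "z \<in> A" for z
 proof
  fix x
  have "(%(i, j). a (i, j) z * (fst x ^ i * snd x ^ j / sqrt (fact i * fact j))) = (%i. a i z * bf_mono x i)"
   by (auto simp: bf_mono_def bf_weight_def real_sqrt_mult)
  thus "f z x = bargmann_fock a z x" unfolding f_def bargmann_fock_def using that by simp
 qed
 have ser: "(%n. \<Sum>i\<in>{..n} \<times> {..n}. bf_coeff v i * a i z) ----> f z v" if "z \<in> A" for v z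
 proof -
  have "((%i. a i z * bf_mono v i) has_sum (\<Sum>\<^sub>\<infinity>i. a i z * bf_mono v i)) UNIV"
   using abs_summable_summable[OF sx[OF that]] by (rule has_sum_infsum)
  from filterlim_compose[OF this[unfolded has_sum_def] filterlim_square]
  have "(%n. exp (- (norm v)\<^sup>2 / 2) * (\<Sum>i\<in>{..n} \<times> {..n}. a i z * bf_mono v i)) ----> f z v"
   unfolding f_def using that by (auto intro!: tendsto_intros)
  thus ?thesis unfolding bf_coeff_def sum_distrib_left by (simp only: mult_ac)
 qed
 have ser_AE: "AE z in M. (%n. \<Sum>i\<in>{..n} \<times> {..n}. bf_coeff v i * a i z) ----> f z v" for v
  using AEA by eventually_elim (rule ser)
 have fm[measurable]: "(%z. f z v) \<in> rv M" for v
 proof (rule borel_measurable_LIMSEQ_real)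
  show "(%z. (\<Sum>i\<in>{..n} \<times> {..n}. bf_coeff v i * a i z) * indicator A z) \<in> rv M" for n by measurable
  show "(%n. (\<Sum>i\<in>{..n} \<times> {..n}. bf_coeff v i * a i z) * indicator A z) ----> f z v" for z
   using ser[of z v] by (cases "z \<in> A") (auto simp: f_def)
 qed
 have "planar_field M f a bf_coeff"
 proof (unfold_locales)
  show "gauss_family M I a (%i j. if i = j then 1 else 0)" if "finite I" for I by (rule G[OF that])
  show "AE z in M. (%n. \<Sum>i\<in>{..n} \<times> {..n}. bf_coeff v i * a i z) ----> f z v" for v by (rule ser_AE)
  show "continuous_on UNIV (f z)" for z
  proof (cases "z \<in> A")
   case True
   have c0: "continuous_on (cball 0 (real r)) (%x. \<Sum>\<^sub>\<infinity>i. a i z * bf_mono x i)" for r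
   proof (rule uniform_limit_theorem)
    show "uniform_limit (cball 0 (real r)) (%X x. \<Sum>i\<in>X. a i z * bf_mono x i) (%x. \<Sum>\<^sub>\<infinity>i. a i z * bf_mono x i) (finite_subsets_at_top UNIV)"
     by (rule Weierstrass_m_test_general[OF _ good'[OF True, of r]]) (use term_le in auto)
    show "\<forall>\<^sub>F X in finite_subsets_at_top UNIV. continuous_on (cball 0 (real r)) (%x. \<Sum>i\<in>X. a i z * bf_mono x i)"
     unfolding bf_mono_def bf_weight_def by (intro always_eventually allI continuous_intros) auto
   qed simp
   have c: "continuous_on (ball 0 (real r)) (%x. \<Sum>\<^sub>\<infinity>i. a i z * bf_mono x i)" for r
    using c0[of r] by (rule continuous_on_subset) auto
   have "isCont (%x. \<Sum>\<^sub>\<infinity>i. a i z * bf_mono x i) x" for x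
   proof -
    have "x \<in> ball 0 (real (Suc (nat \<lceil>norm x\<rceil>)))" using real_bound[of x] unfolding mem_ball dist_0_norm of_nat_Suc by linarith
    thus ?thesis using c continuous_on_eq_continuous_at[OF open_ball] by blast
   qed
   hence "continuous_on UNIV (%x. \<Sum>\<^sub>\<infinity>i. a i z * bf_mono x i)" by (simp add: continuous_on_eq_continuous_at)
   moreover have "continuous_on UNIV (%x::plane. exp (- (norm x)\<^sup>2 / 2))" by (intro continuous_intros) auto
   ultimately show ?thesis unfolding f_def[abs_def] using True by (auto intro!: continuous_on_mult)
  qed (simp add: f_def[abs_def])
  show "\<exists>W. integrable M W \<and> (\<forall>z x. norm x <= r \<longrightarrow> \<bar>f z x\<bar> <= W z)" for r
  proof -
   define R where "R = nat \<lceil>r\<rceil>"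
   have rR: "norm x <= real R" if "norm x <= r" for x :: "plane" using that unfolding R_def by linarith
   define W where "W z = indicator A z * (\<Sum>n. X R n z)" for z
   have "integrable M (%z. \<Sum>n. X R n z)"
   proof (rule integrable_suminf[OF Xi])
    show "AE z in M. summable (%n. norm (X R n z))" using AEA by eventually_elim (use good X0 in auto)
    show "summable (%n. mean (%z. norm (X R n z)))" using sEX[of R] X0 by simp
   qed
   hence "integrable M W" unfolding W_def by (subst mult.commute) (rule integrable_real_mult_indicator[OF Am])
   moreover have "\<bar>f z x\<bar> <= W z" if x: "norm x <= r" for z x
   proof (cases "z \<in> A")
    case True
    have "\<bar>\<Sum>\<^sub>\<infinity>i. a i z * bf_mono x i\<bar> <= (\<Sum>\<^sub>\<infinity>i. norm (a i z * bf_mono x i))"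
     using norm_infsum_bound[OF sx[OF True, of x]] by simp
    also have "... <= (\<Sum>\<^sub>\<infinity>i. b R i * \<bar>a i z\<bar>)"
     by (rule infsum_mono[OF sx[OF True] good'[OF True]]) (rule term_le[OF rR[OF x]])
    also have "... = (\<Sum>\<^sub>\<infinity>n. X R n z)" unfolding X_def by (rule infsum_reindex_bij_betw[OF bij, symmetric])
    also have "... = (\<Sum>n. X R n z)"
    proof -
     have "(%n. X R n z) summable_on UNIV" using good'[OF True, of R] unfolding X_def by (simp only: summable_on_reindex_bij_betw[OF bij, of "%i. b R i * \<bar>a i z\<bar>"])
     thus ?thesis by (intro sums_unique has_sum_imp_sums has_sum_infsum)
    qed
    finally have 1: "\<bar>\<Sum>\<^sub>\<infinity>i. a i z * bf_mono x i\<bar> <= (\<Sum>n. X R n z)" .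
    have "\<bar>f z x\<bar> = exp (- (norm x)\<^sup>2 / 2) * \<bar>\<Sum>\<^sub>\<infinity>i. a i z * bf_mono x i\<bar>" using True by (simp add: f_def abs_mult)
    also have "... <= 1 * (\<Sum>n. X R n z)" by (rule mult_mono[OF _ 1]) auto
    finally show ?thesis using True by (simp add: W_def)
   qed (simp add: f_def W_def)
   ultimately show ?thesis by blast
  qed
  fix V :: "plane set" assume V: "finite V"
  show "gauss_family M V (%v z. f z v) bf_cov"
   unfolding gauss_family_def
  proof (intro conjI allI ballI V)
   fix c :: "plane => real"
   let ?Y = "%n z. \<Sum>v\<in>V. c v * (\<Sum>i\<in>{..n} \<times> {..n}. bf_coeff v i * a i z)"
   have Ym: "?Y n \<in> rv M" for n by measurable
   have Gn: "gauss_family M V (%v z. \<Sum>i\<in>{..n} \<times> {..n}. bf_coeff v i * a i z) (%v w. \<Sum>i\<in>{..n} \<times> {..n}. bf_coeff v i * bf_coeff w i)" for n :: nat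
    by (rule gauss_family_cong[OF gauss_family_linear[OF G V]]) (auto simp: if_distrib[where f="%x. _ * x"] sum.delta cong: if_cong)
   have l1: "(%n. CLINT z|M. iexp (?Y n z)) ----> (CLINT z|M. iexp (\<Sum>v\<in>V. c v * f z v))"
   proof (rule integral_dominated_convergence[where w="%_. 1"])
    show "AE z in M. (%n. iexp (?Y n z)) ----> iexp (\<Sum>v\<in>V. c v * f z v)"
     using AEA
    proof eventually_elim
     fix z assume "z \<in> A"
     hence "(%n. ?Y n z) ----> (\<Sum>v\<in>V. c v * f z v)" by (intro tendsto_intros ser)
     thus "(%n. iexp (?Y n z)) ----> iexp (\<Sum>v\<in>V. c v * f z v)"
      by (intro tendsto_exp tendsto_mult tendsto_const tendsto_of_real)
    qed
   qed auto
   have "(%n. \<Sum>v\<in>V. \<Sum>w\<in>V. c v * c w * (\<Sum>i\<in>{..n} \<times> {..n}. bf_coeff v i * bf_coeff w i)) ----> (\<Sum>v\<in>V. \<Sum>w\<in>V. c v * c w * bf_cov v w)"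
    by (intro tendsto_intros bf_coeff_cov)
   hence l2: "(%n. complex_of_real (exp (- (\<Sum>v\<in>V. \<Sum>w\<in>V. c v * c w * (\<Sum>i\<in>{..n} \<times> {..n}. bf_coeff v i * bf_coeff w i)) / 2))) ----> of_real (exp (- (\<Sum>v\<in>V. \<Sum>w\<in>V. c v * c w * bf_cov v w) / 2))"
    by (intro tendsto_of_real tendsto_exp tendsto_divide tendsto_minus tendsto_const) auto
   show "(CLINT z|M. iexp (\<Sum>v\<in>V. c v * f z v)) = of_real (exp (- (\<Sum>v\<in>V. \<Sum>w\<in>V. c v * c w * bf_cov v w) / 2))"
    by (rule LIMSEQ_unique[OF l1[unfolded gauss_familyD(4)[OF Gn]] l2])
  qed (auto intro: prob_space_axioms)
 qed
 moreover have "AE z in M. f z = bargmann_fock a z" using AEA by eventually_elim (rule eq)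
 ultimately show ?thesis by (rule that)
qed

section \<open>Crossings and duality\<close>

text \<open>Path connected sets take the place of paths, so that crossings are glued by forming
  unions.\<close>

definition linked :: "plane set => plane set => plane set => bool" where
 "linked D A B \<longleftrightarrow> (\<exists>K. path_connected K \<and> K \<subseteq> D \<and> K \<inter> A \<noteq> {} \<and> K \<inter> B \<noteq> {})"

lemma linked_mono: "linked D A B ==> D \<subseteq> D' ==> D \<inter> A \<subseteq> A' ==> D \<inter> B \<subseteq> B' ==> linked D' A' B'"
 unfolding linked_def by blast

lemma linked_path:
 assumes "linked D A B"
 obtains c where "path c" "path_image c \<subseteq> D" "pathstart c \<in> A" "pathfinish c \<in> B"
proof -
 obtain K x y where K: "path_connected K" "K \<subseteq> D" "x \<in> K" "x \<in> A" "y \<in> K" "y \<in> B"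
  using assms unfolding linked_def by blast
 then obtain g where "path g" "path_image g \<subseteq> K" "pathstart g = x" "pathfinish g = y"
  unfolding path_connected_def by blast
 thus ?thesis using K by (intro that[of g]) auto
qed

lemma linkedI_path:
 assumes "path g" "path_image g \<subseteq> D" "pathstart g \<in> A" "pathfinish g \<in> B"
 shows "linked D A B"
 unfolding linked_def using assms path_connected_path_image[of g] pathstart_in_path_image[of g] pathfinish_in_path_image[of g]
 by (intro exI[of _ "path_image g"]) auto

text \<open>The planar intersection theorem \<open>fashoda\<close>, applied to paths inside the two
  sets after identifying pairs with vectors.\<close>

lemma path_connected_meet:
 fixes K L :: "plane set"
 assumes K: "path_connected K" "K \<subseteq> {a..b} \<times> {c..d}" "x \<in> K" "fst x = a" "x' \<in> K" "fst x' = b"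
  and L: "path_connected L" "L \<subseteq> {a..b} \<times> {c..d}" "y \<in> L" "snd y = c" "y' \<in> L" "snd y' = d"
 shows "K \<inter> L \<noteq> {}"
proof -
 obtain g where g: "path g" "path_image g \<subseteq> K" "pathstart g = x" "pathfinish g = x'"
  using K unfolding path_connected_def by blast
 obtain h where h: "path h" "path_image h \<subseteq> L" "pathstart h = y" "pathfinish h = y'"
  using L unfolding path_connected_def by blast
 define v :: "plane => real^2" where "v p = (\<chi> i. if i = 1 then fst p else snd p)" for p
 have vc: "continuous_on S v" for S
 proof -
  have "continuous_on S (%p. if i = 1 then fst p else snd p)" for i :: 2
   by (cases "i = 1") (auto intro!: continuous_intros)
  thus ?thesis unfolding v_def continuous_on_def by (auto intro!: tendsto_vec_lambda)
 qed
 have box: "v p \<in> cbox (v (a, c)) (v (b, d))" if "p \<in> {a..b} \<times> {c..d}" for p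
  using that by (auto simp: mem_box_cart forall_2 v_def)
 obtain z where z: "z \<in> path_image (v \<circ> g)" "z \<in> path_image (v \<circ> h)"
 proof (rule fashoda[of "v \<circ> g" "v \<circ> h" "v (a, c)" "v (b, d)"])
  show "path (v \<circ> g)" "path (v \<circ> h)" using g h vc by (auto intro!: path_continuous_image)
  show "path_image (v \<circ> g) \<subseteq> cbox (v (a, c)) (v (b, d))" "path_image (v \<circ> h) \<subseteq> cbox (v (a, c)) (v (b, d))"
   unfolding path_image_compose image_subset_iff using g(2) h(2) K(2) L(2) box by (meson subsetD)+
 qed (use g h K L in \<open>auto simp: pathstart_compose pathfinish_compose v_def\<close>)
 obtain p q where p: "p \<in> path_image g" "z = v p" and q: "q \<in> path_image h" "z = v q"
  using z unfolding path_image_compose by blast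
 have pq: "p \<in> path_image g" "q \<in> path_image h" "v p = v q" using p q by auto
 have "p = q" using pq(3) by (auto simp: v_def vec_eq_iff forall_2 prod_eq_iff)
 thus ?thesis using pq g h by blast
qed

text \<open>Cut a path at the first time \<open>t1\<close> with value \<open>b\<close> and at the
  last earlier time \<open>t0\<close> with value \<open>i\<close>. By the intermediate value theorem
  it stays between the two values in the meantime.\<close>

lemma path_connected_between:
 fixes h :: "'a::topological_space => real"
 assumes K: "path_connected K" "x \<in> K" "h x <= i" "y \<in> K" "b <= h y" and h: "continuous_on K h" and ib: "i <= b"
 obtains K' x' y' where "path_connected K'" "K' \<subseteq> K" "x' \<in> K'" "h x' = i" "y' \<in> K'" "h y' = b" "!!z. z \<in> K' ==> i <= h z \<and> h z <= b"
proof -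
 obtain g where g: "path g" "path_image g \<subseteq> K" "pathstart g = x" "pathfinish g = y"
  using K unfolding path_connected_def by blast
 define u where "u t = h (g t)" for t
 have uc: "continuous_on {0..1} u"
  unfolding u_def by (rule continuous_on_compose2[OF h]) (use g in \<open>auto simp: path_def path_image_def\<close>)
 have u0: "u 0 <= i" and u1: "b <= u 1" using K g by (auto simp: u_def pathstart_def pathfinish_def)
 have hit: "\<exists>t\<ge>p. t <= q \<and> u t = c" if "u p <= c" "c <= u q" "p <= q" "0 <= p" "q <= 1" for p q c
  by (rule IVT'[OF that(1,2,3)]) (use that in \<open>auto intro!: continuous_on_subset[OF uc]\<close>)
 define S where "S = {t \<in> {0..1}. u t = b}"
 have cS: "compact S" unfolding S_def compact_eq_bounded_closed
  by (intro conjI continuous_closed_preimage_constant uc closed_atLeastAtMost bounded_subset[OF bounded_closed_interval[of 0 "1::real"]]) auto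
 have "S \<noteq> {}" using hit[of 0 b 1] u0 u1 ib unfolding S_def by force
 then obtain t1 where t1: "t1 \<in> S" "!!t. t \<in> S ==> t1 <= t"
  using continuous_attains_inf[OF cS, of "%t. t"] by (auto intro: continuous_on_id)
 have t11: "0 <= t1" "t1 <= 1" "u t1 = b" using t1 by (auto simp: S_def)
 define S' where "S' = {t \<in> {0..t1}. u t = i}"
 have uc': "continuous_on {0..t1} u" by (rule continuous_on_subset[OF uc]) (use t11 in auto)
 have cS': "compact S'" unfolding S'_def compact_eq_bounded_closed
  by (intro conjI continuous_closed_preimage_constant uc' closed_atLeastAtMost bounded_subset[OF bounded_closed_interval[of 0 t1]]) auto
 have "S' \<noteq> {}" using hit[of 0 i t1] u0 t11 ib unfolding S'_def by force
 then obtain t0 where t0: "t0 \<in> S'" "!!t. t \<in> S' ==> t <= t0"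
  using continuous_attains_sup[OF cS', of "%t. t"] by (auto intro: continuous_on_id)
 have t00: "0 <= t0" "t0 <= t1" "u t0 = i" using t0 by (auto simp: S'_def)
 have mid: "i <= u t \<and> u t <= b" if t: "t0 <= t" "t <= t1" for t
 proof (intro conjI; rule ccontr)
  assume "\<not> i <= u t"
  then obtain t' where "t <= t'" "t' <= t1" "u t' = i" using hit[of t i t1] t t00 t11 ib by force
  with t0(2)[of t'] t t00 have "t' = t" "t = t0" by (auto simp: S'_def)
  thus False using \<open>\<not> i <= u t\<close> t00 by simp
 next
  assume "\<not> u t <= b"
  then obtain t' where "0 <= t'" "t' <= t" "u t' = b" using hit[of 0 b t] t t00 t11 ib u0 by force
  with t1(2)[of t'] t t11 have "t' = t" by (auto simp: S_def)
  thus False using \<open>\<not> u t <= b\<close> \<open>u t' = b\<close> by simp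
 qed
 have "path_connected (g ` {t0..t1})"
  by (rule path_connected_continuous_image) (use g t00 t11 in \<open>auto simp: path_def intro: continuous_on_subset convex_imp_path_connected\<close>)
 moreover have "g ` {t0..t1} \<subseteq> K" using g t00 t11 by (force simp: path_image_def)
 ultimately show ?thesis
  by (rule that[of "g ` {t0..t1}" "g t0" "g t1"]) (use mid t00 t11 in \<open>auto simp: u_def\<close>)
qed

section \<open>Topological duality\<close>

text \<open>Brouwer's theorem gives a fixed point of the map that subtracts \<open>\<phi>\<close>
  and \<open>q\<close> and projects back to the rectangle; the signs on the boundary exclude fixed
  points created by the projection.\<close>

lemma poincare_miranda:
 fixes \<phi> q :: "plane => real"
 assumes ab: "a <= b" "c <= d" and con: "continuous_on ({a..b} \<times> {c..d}) \<phi>" "continuous_on ({a..b} \<times> {c..d}) q"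
  and 1: "!!y. y \<in> {c..d} ==> \<phi> (a, y) <= 0" "!!y. y \<in> {c..d} ==> 0 <= \<phi> (b, y)"
  and 2: "!!x. x \<in> {a..b} ==> q (x, c) <= 0" "!!x. x \<in> {a..b} ==> 0 <= q (x, d)"
 obtains z where "z \<in> {a..b} \<times> {c..d}" "\<phi> z = 0" "q z = 0"
proof -
 let ?R = "{a..b} \<times> {c..d}"
 define F where "F z = (max a (min b (fst z - \<phi> z)), max c (min d (snd z - q z)))" for z
 have "compact ?R" "convex ?R" "?R \<noteq> {}" using ab by (auto intro: compact_Times convex_Times)
 moreover have "continuous_on ?R F" unfolding F_def by (intro continuous_intros con)
 moreover have "F \<in> ?R \<rightarrow> ?R" using ab by (auto simp: F_def)
 ultimately obtain z where z: "z \<in> ?R" "F z = z" using brouwer[of ?R F] by blast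
 obtain x y where xy: "z = (x, y)" "x \<in> {a..b}" "y \<in> {c..d}" using z(1) by (cases z) auto
 have "max a (min b (x - \<phi> z)) = x" "max c (min d (y - q z)) = y" using z(2) unfolding F_def xy by auto
 moreover have "p = 0" if "max a (min b (x - p)) = x" "a <= x" "x <= b" "x = a ==> p <= 0" "x = b ==> 0 <= p" for a b x p :: real
  using that by (auto simp: max_def min_def split: if_splits)
 ultimately have "\<phi> z = 0" "q z = 0" using 1[OF xy(3)] 2[OF xy(2)] xy by auto
 thus ?thesis using that z by blast
qed

text \<open>Where \<open>u\<close> is positive, the sign is constant on a small ball intersected
  with the convex set \<open>R\<close>; where \<open>u\<close> vanishes, the product tends to 0
  whatever the signs are.\<close>

lemma continuous_on_signed:
 fixes u :: "'a::real_normed_vector => real"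
 assumes R: "convex R" and u: "continuous_on R u" "!!x. x \<in> R ==> 0 <= u x" and s: "!!x. \<bar>s x\<bar> = (1::real)"
  and inv: "!!x y. path_component {x \<in> R. 0 < u x} x y ==> s x = s y"
 shows "continuous_on R (%x. u x * s x)"
 unfolding continuous_on_def
proof
 fix x assume x: "x \<in> R"
 have ux: "(u \<longlongrightarrow> u x) (at x within R)" using u(1) x by (simp add: continuous_on_def)
 show "((%x. u x * s x) \<longlongrightarrow> u x * s x) (at x within R)"
 proof (cases "u x = 0")
  case True
  have "((%y. u y * s y) \<longlongrightarrow> 0) (at x within R)"
   by (rule Lim_null_comparison[of _ "%y. \<bar>u y\<bar>"]) (use tendsto_rabs[OF ux] True s in \<open>auto simp: abs_mult\<close>)
  thus ?thesis using True by simp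
 next
  case False
  hence pos: "0 < u x" using u(2)[OF x] by simp
  from order_tendstoD(1)[OF ux pos] obtain e where e: "e > 0" "!!y. y \<in> R ==> y \<noteq> x ==> dist y x < e ==> 0 < u y"
   unfolding eventually_at by blast
  have sub: "R \<inter> ball x e \<subseteq> {x \<in> R. 0 < u x}" using e pos by (auto simp: dist_commute) (metis dist_commute)
  have "path_connected (R \<inter> ball x e)" using R by (intro convex_imp_path_connected convex_Int) auto
  hence eq: "s y = s x" if "y \<in> R \<inter> ball x e" for y
   using inv[OF path_component_of_subset[OF sub], of y x] that x e by (auto simp: path_connected_component)
  have "((%y. u y * s x) \<longlongrightarrow> u x * s x) (at x within R)" by (intro tendsto_intros ux)
  thus ?thesis
  proof (rule Lim_transform_eventually)
   show "\<forall>\<^sub>F y in at x within R. u y * s x = u y * s y"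
    unfolding eventually_at using e eq by (intro exI[of _ e]) (auto simp: dist_commute)
  qed
 qed
qed

text \<open>
 If both crossings were absent, \<^term>\<open>u\<close> and \<^term>\<open>1 - u\<close> with signs constant on the components of their
 supports would satisfy the boundary conditions of the Poincare-Miranda theorem without a common zero.
\<close>

theorem crossing_duality:
 fixes f :: "plane => real"
 assumes ab: "a <= b" "c <= d" and f: "continuous_on ({a..b} \<times> {c..d}) f" and l: "l < l'"
  and no: "\<not> linked (({a..b} \<times> {c..d}) \<inter> {x. l < f x}) ({a} \<times> UNIV) ({b} \<times> UNIV)"
 shows "linked (({a..b} \<times> {c..d}) \<inter> {x. f x < l'}) (UNIV \<times> {c}) (UNIV \<times> {d})"
proof (rule ccontr)
 assume no': "\<not> ?thesis"
 let ?R = "{a..b} \<times> {c..d}"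
 \<comment> \<open>It is positive exactly where \<open>f > l\<close> and less than 1 exactly where
   \<open>f < l'\<close>, so the supports of \<open>u\<close> and \<open>1 - u\<close> are the two
   excursion sets.\<close>
 define u where "u x = max 0 (min 1 ((f x - l) / (l' - l)))" for x
 have uc: "continuous_on ?R u" unfolding u_def using l by (intro continuous_intros f) auto
 have u01: "0 <= u x" "u x <= 1" for x by (auto simp: u_def)
 have u0: "0 < u x \<longleftrightarrow> l < f x" and u1: "u x < 1 \<longleftrightarrow> f x < l'" for x
  using l by (auto simp: u_def less_max_iff_disj min_less_iff_disj max_less_iff_conj divide_less_eq zero_less_divide_iff)
 \<comment> \<open>The sign is -1 on the components that reach the starting side. Since no component
   joins the two sides, it is +1 on the opposite side.\<close>
 define s where "s U A x = (if \<exists>y\<in>A. path_component U x y then - 1 else 1 :: real)" for U A and x :: "plane"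
 have s1: "\<bar>s U A x\<bar> = 1" for U A x by (simp add: s_def)
 have sinv: "s U A x = s U A y" if "path_component U x y" for U A x y
  using that unfolding s_def by (meson path_component_sym path_component_trans)
 let ?U = "{x \<in> ?R. 0 < u x}" and ?W = "{x \<in> ?R. 0 < 1 - u x}"
 let ?s = "s ?U ({a} \<times> UNIV)" and ?t = "s ?W (UNIV \<times> {c})"
 have Rc: "convex ?R" by (intro convex_Times) auto
 have sg: "s U A x = - 1" if "x \<in> U" "x \<in> A" for U A x using that path_component_refl[OF that(1)] by (auto simp: s_def)
 have lk: "linked U A B" if "x \<in> B" "s U A x = - 1" for U A B x
 proof -
  have "\<exists>y\<in>A. path_component U x y" using that by (simp add: s_def split: if_splits)
  then obtain y where "y \<in> A" "path_component U x y" by blast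
  then obtain g where "path g" "path_image g \<subseteq> U" "pathstart g = y" "pathfinish g = x"
   using path_component_sym unfolding path_component_def by metis
  thus ?thesis using \<open>y \<in> A\<close> that by (intro linkedI_path[of g]) auto
 qed
 have U: "?U = ?R \<inter> {x. l < f x}" "?W = ?R \<inter> {x. f x < l'}" using u0 u1 by auto
 have sv: "s U A x = - 1 \<or> s U A x = 1" for U A x by (auto simp: s_def)
 obtain z where z: "z \<in> ?R" "u z * ?s z = 0" "(1 - u z) * ?t z = 0"
 proof (rule poincare_miranda[OF ab, of "%z. u z * ?s z" "%z. (1 - u z) * ?t z"])
  show "continuous_on ?R (%z. u z * ?s z)" by (rule continuous_on_signed[OF Rc uc u01(1) s1 sinv])
  show "continuous_on ?R (%z. (1 - u z) * ?t z)"
   by (rule continuous_on_signed[OF Rc _ _ s1 sinv]) (use u01 in \<open>auto intro!: continuous_intros uc\<close>)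
  fix y assume y: "y \<in> {c..d}"
  show "u (a, y) * ?s (a, y) <= 0"
   using sg[of "(a, y)" ?U "{a} \<times> UNIV"] u01(1)[of "(a, y)"] y ab by (cases "0 < u (a, y)") auto
  show "0 <= u (b, y) * ?s (b, y)"
   using lk[of "(b, y)" "{b} \<times> UNIV" ?U "{a} \<times> UNIV"] no sv[of ?U "{a} \<times> UNIV" "(b, y)"] u01(1)[of "(b, y)"] unfolding U by auto
 next
  fix x assume x: "x \<in> {a..b}"
  show "(1 - u (x, c)) * ?t (x, c) <= 0"
   using sg[of "(x, c)" ?W "UNIV \<times> {c}"] u01(2)[of "(x, c)"] x ab by (cases "u (x, c) < 1") auto
  show "0 <= (1 - u (x, d)) * ?t (x, d)"
   using lk[of "(x, d)" "UNIV \<times> {d}" ?W "UNIV \<times> {c}"] no' sv[of ?W "UNIV \<times> {c}" "(x, d)"] u01(2)[of "(x, d)"] unfolding U by auto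
 qed
 have "?s z \<noteq> 0" "?t z \<noteq> 0" using s1[of ?U "{a} \<times> UNIV" z] s1[of ?W "UNIV \<times> {c}" z] by auto
 thus False using z by simp
qed

section \<open>Crossing levels as max-min functionals\<close>

definition crossable :: "plane set => plane set => plane set => bool" where
 "crossable S A B \<longleftrightarrow> compact S \<and> convex S \<and> compact A \<and> compact B \<and> A \<subseteq> S \<and> B \<subseteq> S \<and> A \<noteq> {} \<and> B \<noteq> {}"

lemma crossableD:
 assumes "crossable S A B"
 shows "compact S" "convex S" "compact A" "compact B" "A \<subseteq> S" "B \<subseteq> S" "A \<noteq> {}" "B \<noteq> {}"
 using assms unfolding crossable_def by auto

definition cross :: "plane set => plane set => plane set => (plane => real) => real" where
 "cross S A B g = Sup {l. linked (S \<inter> {x. l < g x}) A B}"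

lemma linked_self: "crossable S A B ==> linked S A B"
 unfolding crossable_def linked_def by (intro exI[of _ S]) (auto intro: convex_imp_path_connected)

text \<open>A path above \<open>l\<close> is compact, so the minimum of \<open>g\<close> on it is
  still larger than \<open>l\<close> and some higher level is crossed as well. Hence the supremum is
  compared with \<open>l\<close> by a strict inequality.\<close>

lemma cross_gt_iff:
 assumes S: "crossable S A B" and g: "continuous_on UNIV g"
 shows "l < cross S A B g \<longleftrightarrow> linked (S \<inter> {x. l < g x}) A B"
proof -
 note c = crossableD[OF S]
 have gc: "continuous_on K g" for K using g continuous_on_subset by blast
 have ne: "S \<noteq> {}" using c by auto
 obtain p where p: "p \<in> S" "!!x. x \<in> S ==> g x <= g p" using continuous_attains_sup[OF c(1) ne gc] by blast
 obtain q where q: "q \<in> S" "!!x. x \<in> S ==> g q <= g x" using continuous_attains_inf[OF c(1) ne gc] by blast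
 let ?X = "{l. linked (S \<inter> {x. l < g x}) A B}"
 have "S \<subseteq> S \<inter> {x. g q - 1 < g x}" using q(2) by force
 hence "g q - 1 \<in> ?X" using linked_mono[OF linked_self[OF S], of "S \<inter> {x. g q - 1 < g x}" A B] by auto
 hence X0: "?X \<noteq> {}" by blast
 have "l <= g p" if "l \<in> ?X" for l
 proof -
  from that obtain x where "x \<in> S" "l < g x" unfolding linked_def by blast
  thus ?thesis using p(2)[of x] by simp
 qed
 hence Xb: "bdd_above ?X" by (rule bdd_aboveI)
 show ?thesis unfolding cross_def less_cSup_iff[OF X0 Xb]
 proof
  assume "\<exists>l'\<in>?X. l < l'"
  thus "linked (S \<inter> {x. l < g x}) A B" by (auto elim!: linked_mono)
 next
  assume "linked (S \<inter> {x. l < g x}) A B"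
  then obtain h where h: "path h" "path_image h \<subseteq> S \<inter> {x. l < g x}" "pathstart h \<in> A" "pathfinish h \<in> B" by (rule linked_path) blast
  obtain x where x: "x \<in> path_image h" "!!y. y \<in> path_image h ==> g x <= g y"
   using continuous_attains_inf[OF compact_path_image[OF h(1)] path_image_nonempty gc] by blast
  have "l < g x" using x(1) h(2) by auto
  moreover have "linked (S \<inter> {y. (l + g x) / 2 < g y}) A B"
  proof (rule linkedI_path[OF h(1) _ h(3,4)])
   show "path_image h \<subseteq> S \<inter> {y. (l + g x) / 2 < g y}" using h(2) x(2) \<open>l < g x\<close> by force
  qed
  ultimately show "\<exists>l'\<in>?X. l < l'" by (intro bexI[of _ "(l + g x) / 2"]) auto
 qed
qed

definition near :: "real => plane set => (plane \<times> plane) set" where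
 "near e P = {(x, y). x \<in> P \<and> y \<in> P \<and> dist x y < e}"

lemma nearI: "x \<in> P ==> y \<in> P ==> dist x y < e ==> (x, y) \<in> near e P"
 by (simp add: near_def)

text \<open>Discrete substitutes for paths. A set \<open>P\<close> may contain more points than a
  chain, so the set of all net points near a path qualifies.\<close>

definition chains :: "real => plane set => plane set => plane set => plane set set" where
 "chains e D A B = {P. P \<subseteq> D \<and> (\<exists>a\<in>A \<inter> P. \<exists>b\<in>B \<inter> P. (a, b) \<in> (near e P)\<^sup>*)}"

text \<open>Net points within \<open>r\<close> of two points of the path that are less than
  \<open>r\<close> apart are less than \<open>3 * r\<close> apart. Net points chosen in
  \<open>A\<close> and in \<open>B\<close> provide the two ends.\<close>

lemma linked_imp_chain:
 assumes K: "linked K A B" "K \<subseteq> S" and r: "r > 0"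
  and D: "!!x. x \<in> S ==> \<exists>d\<in>D. dist x d < r" and DA: "!!x. x \<in> A ==> \<exists>d\<in>D \<inter> A. dist x d < r" and DB: "!!x. x \<in> B ==> \<exists>d\<in>D \<inter> B. dist x d < r"
 shows "{d \<in> D. \<exists>x\<in>K. dist x d < r} \<in> chains (3 * r) D A B"
proof -
 let ?P = "{d \<in> D. \<exists>x\<in>K. dist x d < r}"
 obtain h where h: "path h" "path_image h \<subseteq> K" "pathstart h \<in> A" "pathfinish h \<in> B" using K(1) by (rule linked_path) blast
 have "uniformly_continuous_on {0..1} h" using h(1) by (intro compact_uniformly_continuous) (auto simp: path_def)
 then obtain e where e: "e > 0" "!!s t. s \<in> {0..1} ==> t \<in> {0..1} ==> dist s t < e ==> dist (h s) (h t) < r"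
  using r unfolding uniformly_continuous_on_def by metis
 obtain N where N: "0 < N" "1 / real N < e" using real_arch_inverse[of e] e by (auto simp: inverse_eq_divide)
 define t where "t i = min 1 (real i / real N)" for i
 have t: "t i \<in> {0..1}" for i by (auto simp: t_def)
 have hK: "h (t i) \<in> K" for i using h(2) t[of i] by (auto simp: path_image_def)
 have "\<exists>d. d \<in> D \<and> dist (h (t i)) d < r" for i using D[of "h (t i)"] hK[of i] K(2) by blast
 then obtain c where c: "!!i. c i \<in> D" "!!i. dist (h (t i)) (c i) < r" by metis
 have cP: "c i \<in> ?P" for i using c hK by blast
 have step: "dist x y < 3 * r" if "dist u x < r" "dist v y < r" "dist u v < r" for x y u v :: "plane"
  using dist_triangle[of x y u] dist_triangle[of u y v] that by (simp add: dist_commute)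
 have ch: "(c 0, c i) \<in> (near (3 * r) ?P)\<^sup>*" for i
 proof (induction i)
  case (Suc i)
  have "dist (t i) (t (Suc i)) <= 1 / real N"
   using N(1) by (auto simp: t_def dist_real_def min_def field_simps)
  hence "dist (h (t i)) (h (t (Suc i))) < r" using N(2) by (intro e(2) t) auto
  hence "(c i, c (Suc i)) \<in> near (3 * r) ?P" by (intro nearI cP step[OF c(2) c(2)])
  with Suc show ?case by (rule rtrancl_into_rtrancl)
 qed simp
 have h0: "h (t 0) = pathstart h" "h (t N) = pathfinish h" using N(1) by (auto simp: t_def pathstart_def pathfinish_def)
 obtain a where a: "a \<in> D \<inter> A" "dist (h (t 0)) a < r" using DA[of "h (t 0)"] h(3) h0 by auto
 obtain b where b: "b \<in> D \<inter> B" "dist (h (t N)) b < r" using DB[of "h (t N)"] h(4) h0 by auto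
 have aP: "a \<in> ?P" using a hK[of 0] by blast
 have bP: "b \<in> ?P" using b hK[of N] by blast
 have d0: "dist z z < r" for z :: "plane" using r by simp
 have "(a, c 0) \<in> near (3 * r) ?P" by (rule nearI[OF aP cP step[OF a(2) c(2) d0]])
 moreover have "(c N, b) \<in> near (3 * r) ?P" by (rule nearI[OF cP bP step[OF c(2) b(2) d0]])
 ultimately have "(a, b) \<in> (near (3 * r) ?P)\<^sup>*"
  using rtrancl_into_rtrancl[OF converse_rtrancl_into_rtrancl[OF _ ch[of N]]] by blast
 thus ?thesis unfolding chains_def using a b aP bP by blast
qed

text \<open>Consecutive points of the chain are joined by segments, which stay in the convex set
  \<open>S\<close> and within \<open>e\<close> of a point of \<open>P\<close>.\<close>

lemma chain_imp_linked:
 assumes P: "P \<in> chains e D A B" and D: "D \<subseteq> S" and S: "convex S" and e: "0 < e"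
  and K: "!!x y. x \<in> P ==> y \<in> S ==> dist x y < e ==> y \<in> K"
 shows "linked (S \<inter> K) A B"
proof -
 from P obtain a b where ab: "a \<in> A" "a \<in> P" "b \<in> B" "b \<in> P" "(a, b) \<in> (near e P)\<^sup>*" and PD: "P \<subseteq> D"
  unfolding chains_def by blast
 from ab(5) have "path_component (S \<inter> K) a b"
 proof (induction rule: rtrancl_induct)
  case base
  have "a \<in> S \<inter> K" using K[of a a] ab PD D e by auto
  thus ?case by (rule path_component_refl)
 next
  case (step x y)
  hence xy: "x \<in> P" "y \<in> P" "dist x y < e" by (auto simp: near_def)
  have "closed_segment x y \<subseteq> S" using xy PD D S by (intro closed_segment_subset) auto
  moreover have "dist x z < e" if "z \<in> closed_segment x y" for z
   using segment_bound(1)[OF that] xy(3) by (simp add: dist_norm norm_minus_commute)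
  ultimately have "closed_segment x y \<subseteq> S \<inter> K" using K xy(1) by blast
  moreover have "path_component (closed_segment x y) x y" by (meson ends_in_segment path_connected_component path_connected_segment)
  ultimately have "path_component (S \<inter> K) x y" by (rule path_component_of_subset)
  with step.IH show ?case by (rule path_component_trans)
 qed
 then obtain h where "path h" "path_image h \<subseteq> S \<inter> K" "pathstart h = a" "pathfinish h = b"
  unfolding path_component_def by blast
 thus ?thesis using ab by (intro linkedI_path[of h]) auto
qed

text \<open>The families consist of the chains in finer and finer nets of \<open>S\<close>,
  \<open>A\<close> and \<open>B\<close>. By uniform continuity on \<open>S\<close>, passing from a
  path to nearby net points, or back along segments, changes the values of \<open>g\<close> by less
  than \<open>e\<close> once the mesh is small.\<close>

theorem maxmin_cross:
 assumes S: "crossable S A B"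
 shows "maxmin (cross S A B) S"
proof -
 note c = crossableD[OF S]
 have net: "\<exists>k. finite k \<and> k \<subseteq> X \<and> (\<forall>x\<in>X. \<exists>d\<in>k. dist x d < r)" if X: "compact X" and r: "r > 0" for X :: "plane set" and r
 proof -
  obtain k where "finite k" "k \<subseteq> X" "X \<subseteq> (\<Union>x\<in>k. ball x r)"
   using seq_compact_imp_totally_bounded[OF compact_imp_seq_compact[OF X], rule_format, OF r] by blast
  moreover have "\<exists>d\<in>k. dist x d < r" if x: "x \<in> X" for x
  proof -
   obtain d where "d \<in> k" "x \<in> ball d r" using \<open>X \<subseteq> (\<Union>x\<in>k. ball x r)\<close> x by blast
   thus ?thesis by (intro bexI[of _ d]) (auto simp: dist_commute)
  qed
  ultimately show ?thesis by blast
 qed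
 define r where "r n = 1 / real (Suc n)" for n
 have r: "r n > 0" for n by (simp add: r_def)
 define good where "good n D \<longleftrightarrow> finite D \<and> D \<subseteq> S \<and> (\<forall>x\<in>S. \<exists>d\<in>D. dist x d < r n) \<and> (\<forall>x\<in>A. \<exists>d\<in>D \<inter> A. dist x d < r n) \<and> (\<forall>x\<in>B. \<exists>d\<in>D \<inter> B. dist x d < r n)" for n D
 have "\<exists>D. good n D" for n
 proof -
  obtain k1 k2 k3 where "finite k1" "k1 \<subseteq> S" "\<forall>x\<in>S. \<exists>d\<in>k1. dist x d < r n"
   "finite k2" "k2 \<subseteq> A" "\<forall>x\<in>A. \<exists>d\<in>k2. dist x d < r n" "finite k3" "k3 \<subseteq> B" "\<forall>x\<in>B. \<exists>d\<in>k3. dist x d < r n"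
   using net[OF c(1) r[of n]] net[OF c(3) r[of n]] net[OF c(4) r[of n]] by metis
  hence "good n (k1 \<union> k2 \<union> k3)" unfolding good_def using c(5,6) by blast
  thus ?thesis ..
 qed
 then obtain D where D: "!!n. good n (D n)" by metis
 define \<P> where "\<P> n = chains (3 * r n) (D n) A B" for n
 have chain: "{d \<in> D n. \<exists>x\<in>K. dist x d < r n} \<in> \<P> n" if "linked K A B" "K \<subseteq> S" for K n
  unfolding \<P>_def by (rule linked_imp_chain[OF that r]) (use D[of n] in \<open>auto simp: good_def\<close>)
 have fin: "finite_family (\<P> n)" for n
  unfolding finite_family_def
 proof (intro conjI ballI)
  have "\<P> n \<subseteq> Pow (D n)" unfolding \<P>_def chains_def by blast
  thus "finite (\<P> n)" using D[of n] finite_subset by (auto simp: good_def)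
  show "\<P> n \<noteq> {}" using chain[OF linked_self[OF S]] by blast
  fix P assume "P \<in> \<P> n"
  thus "finite P" "P \<noteq> {}" using D[of n] finite_subset by (auto simp: good_def \<P>_def chains_def)
 qed
 show ?thesis unfolding maxmin_def
 proof (intro conjI exI[of _ \<P>] allI impI fin)
  show "bounded S" using c(1) by (rule compact_imp_bounded)
  show "\<Union>(\<P> n) \<subseteq> S" for n using D[of n] by (auto simp: good_def \<P>_def chains_def)
  fix g :: "plane => real" assume g: "continuous_on UNIV g"
  note gt = cross_gt_iff[OF S g]
  have uc: "uniformly_continuous_on S g" by (rule compact_uniformly_continuous[OF continuous_on_subset[OF g] c(1)]) simp
  show "(%n. mm (\<P> n) g) ----> cross S A B g"
   unfolding lim_sequentially
  proof (intro allI impI)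
   fix e0 :: real assume "e0 > 0"
   define e where "e = e0 / 2"
   have e: "e > 0" "e < e0" using \<open>e0 > 0\<close> by (auto simp: e_def)
   obtain w where w: "w > 0" "!!x y. x \<in> S ==> y \<in> S ==> dist x y < w ==> dist (g x) (g y) < e"
    using uc e unfolding uniformly_continuous_on_def by metis
   obtain N where N: "3 / real (Suc N) < w" using reals_Archimedean[of "w / 3"] w(1) by (auto simp: inverse_eq_divide field_simps)
   show "\<exists>N. \<forall>n\<ge>N. dist (mm (\<P> n) g) (cross S A B g) < e0"
   proof (intro exI[of _ N] allI impI)
    fix n assume "n \<ge> N"
    hence "3 * r n <= 3 / real (Suc N)" unfolding r_def by (simp add: frac_le)
    hence rn: "3 * r n < w" using N by simp
    have close: "\<bar>g x - g y\<bar> < e" if "x \<in> S" "y \<in> S" "dist x y < 3 * r n" for x y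
     using w(2)[OF that(1,2)] that(3) rn by (simp add: dist_real_def)
    have DS: "D n \<subseteq> S" using D[of n] by (auto simp: good_def)
    have "cross S A B g <= mm (\<P> n) g + e"
    proof (rule dense_le)
     fix l assume "l < cross S A B g"
     hence lk: "linked (S \<inter> {x. l < g x}) A B" using gt by simp
     let ?P = "{d \<in> D n. \<exists>x\<in>S \<inter> {x. l < g x}. dist x d < r n}"
     have P: "?P \<in> \<P> n" by (rule chain[OF lk]) simp
     obtain P' where P': "!!P. P \<in> \<P> n ==> Min (g ` P) <= mm (\<P> n) g" by (rule mm_witness[OF fin[of n], of g]) blast
     have "l - e <= Min (g ` ?P)"
     proof (rule Min.boundedI)
      show "finite (g ` ?P)" "g ` ?P \<noteq> {}" using finite_familyD(3,4)[OF fin P] by auto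
      fix y assume "y \<in> g ` ?P"
      then obtain d x where d: "d \<in> D n" "x \<in> S" "l < g x" "dist x d < r n" "y = g d" by blast
      thus "l - e <= y" using close[of x d] DS r[of n] by force
     qed
     thus "l <= mm (\<P> n) g + e" using P'[OF P] by linarith
    qed
    moreover have "mm (\<P> n) g - e <= cross S A B g"
    proof -
     obtain P where P: "P \<in> \<P> n" "mm (\<P> n) g = Min (g ` P)" by (rule mm_witness[OF fin[of n], of g]) blast
     have PS: "P \<subseteq> S" using P DS unfolding \<P>_def chains_def by blast
     have "linked (S \<inter> {x. mm (\<P> n) g - e < g x}) A B"
     proof (rule chain_imp_linked[OF P(1)[unfolded \<P>_def] DS c(2)])
      fix x y assume xy: "x \<in> P" "y \<in> S" "dist x y < 3 * r n"
      have "mm (\<P> n) g <= g x" unfolding P(2) using finite_familyD(3)[OF fin P(1)] xy by (intro Min_le) auto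
      thus "y \<in> {x. mm (\<P> n) g - e < g x}" using close[of x y] xy PS by force
     qed (use r in simp)
     thus ?thesis using gt by (auto intro: less_imp_le)
    qed
    ultimately show "dist (mm (\<P> n) g) (cross S A B g) < e0" using e by (simp add: dist_real_def abs_le_iff)
   qed
  qed
 qed
qed

text \<open>By distributivity a minimum of two maxima of minima is a maximum of minima over the
  unions \<open>p \<union> q\<close>.\<close>

lemma maxmin_min:
 assumes T1: "maxmin T1 S1" and T2: "maxmin T2 S2"
 shows "maxmin (%g. min (T1 g) (T2 g)) (S1 \<union> S2)"
proof -
 obtain \<P> where P: "!!n. finite_family (\<P> n)" "!!n. \<Union>(\<P> n) \<subseteq> S1"
  "!!g. continuous_on UNIV g ==> (%n. mm (\<P> n) g) ----> T1 g" by (rule maxminE[OF T1]) blast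
 obtain \<Q> where Q: "!!n. finite_family (\<Q> n)" "!!n. \<Union>(\<Q> n) \<subseteq> S2"
  "!!g. continuous_on UNIV g ==> (%n. mm (\<Q> n) g) ----> T2 g" by (rule maxminE[OF T2]) blast
 define \<R> where "\<R> n = (%(p, q). p \<union> q) ` (\<P> n \<times> \<Q> n)" for n
 have R: "finite_family (\<R> n)" for n
  using P(1)[of n] Q(1)[of n] unfolding \<R>_def finite_family_def by auto
 have mmR: "mm (\<R> n) g = min (mm (\<P> n) g) (mm (\<Q> n) g)" for n g
 proof -
  obtain p where p: "p \<in> \<P> n" "mm (\<P> n) g = Min (g ` p)" "!!P. P \<in> \<P> n ==> Min (g ` P) <= mm (\<P> n) g" by (rule mm_witness[OF P(1)[of n], of g]) blast
  obtain q where q: "q \<in> \<Q> n" "mm (\<Q> n) g = Min (g ` q)" "!!P. P \<in> \<Q> n ==> Min (g ` P) <= mm (\<Q> n) g" by (rule mm_witness[OF Q(1)[of n], of g]) blast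
  obtain s where s: "s \<in> \<R> n" "mm (\<R> n) g = Min (g ` s)" "!!P. P \<in> \<R> n ==> Min (g ` P) <= mm (\<R> n) g" by (rule mm_witness[OF R[of n], of g]) blast
  have U: "Min (g ` (p \<union> q)) = min (Min (g ` p)) (Min (g ` q))" if "p \<in> \<P> n" "q \<in> \<Q> n" for p q
   unfolding image_Un using finite_familyD(3,4)[OF P(1) that(1)] finite_familyD(3,4)[OF Q(1) that(2)] by (intro Min_Un) auto
  have "p \<union> q \<in> \<R> n" unfolding \<R>_def using p q by force
  from s(3)[OF this] have 1: "min (mm (\<P> n) g) (mm (\<Q> n) g) <= mm (\<R> n) g" using U[OF p(1) q(1)] p q by simp
  obtain p' q' where pq: "p' \<in> \<P> n" "q' \<in> \<Q> n" "s = p' \<union> q'" using s(1) unfolding \<R>_def by auto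
  have "mm (\<R> n) g <= min (mm (\<P> n) g) (mm (\<Q> n) g)"
   unfolding s(2) pq(3) U[OF pq(1,2)] using p(3)[OF pq(1)] q(3)[OF pq(2)] by (rule min.mono)
  with 1 show ?thesis by simp
 qed
 show ?thesis unfolding maxmin_def
 proof (intro conjI exI[of _ \<R>] allI impI R)
  show "bounded (S1 \<union> S2)" using T1 T2 by (simp add: maxmin_def)
  show "\<Union>(\<R> n) \<subseteq> S1 \<union> S2" for n using P(2)[of n] Q(2)[of n] unfolding \<R>_def by auto
  fix g :: "plane => real" assume g: "continuous_on UNIV g"
  show "(%n. mm (\<R> n) g) ----> min (T1 g) (T2 g)" unfolding mmR by (intro tendsto_min P Q g)
 qed
qed

lemma linked_image:
 assumes "linked D A B" "continuous_on D \<tau>" "\<tau> ` D \<subseteq> D'" "\<tau> ` A \<subseteq> A'" "\<tau> ` B \<subseteq> B'"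
 shows "linked D' A' B'"
proof -
 obtain K x y where K: "path_connected K" "K \<subseteq> D" "x \<in> K" "x \<in> A" "y \<in> K" "y \<in> B"
  using assms(1) unfolding linked_def by blast
 have "path_connected (\<tau> ` K)" using K by (intro path_connected_continuous_image continuous_on_subset[OF assms(2)])
 thus ?thesis unfolding linked_def using K assms by (intro exI[of _ "\<tau> ` K"]) blast
qed

lemma cross_image:
 assumes "continuous_on UNIV \<tau>" "continuous_on UNIV \<sigma>" "!!x. \<sigma> (\<tau> x) = x"
 shows "cross S A B (%v. g (\<tau> v)) = cross (\<tau> ` S) (\<tau> ` A) (\<tau> ` B) g"
proof -
 have c: "continuous_on X \<tau>" "continuous_on X \<sigma>" for X using assms(1,2) continuous_on_subset by blast+
 have "linked (S \<inter> {x. l < g (\<tau> x)}) A B \<longleftrightarrow> linked (\<tau> ` S \<inter> {x. l < g x}) (\<tau> ` A) (\<tau> ` B)" for l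
 proof
  assume "linked (S \<inter> {x. l < g (\<tau> x)}) A B"
  thus "linked (\<tau> ` S \<inter> {x. l < g x}) (\<tau> ` A) (\<tau> ` B)"
   by (rule linked_image[OF _ c(1)]) auto
 next
  assume "linked (\<tau> ` S \<inter> {x. l < g x}) (\<tau> ` A) (\<tau> ` B)"
  thus "linked (S \<inter> {x. l < g (\<tau> x)}) A B"
   by (rule linked_image[OF _ c(2)]) (auto simp: assms(3))
 qed
 thus ?thesis unfolding cross_def by simp
qed

text \<open>
 Extending both sets beyond the common side reduces this to the crossing of a rectangle.
\<close>

lemma interlace_meet:
 fixes K L :: "plane set"
 assumes K: "path_connected K" "K \<subseteq> {a..b} \<times> {c..d}" "x \<in> K" "fst x = a" "(b, y0) \<in> K"
  and L: "path_connected L" "L \<subseteq> {a..b} \<times> {c..d}" "(b, y1) \<in> L" "(b, y2) \<in> L" and y: "y2 <= y0" "y0 <= y1"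
 shows "K \<inter> L \<noteq> {}"
proof (cases "y0 = y1 \<or> y0 = y2")
 case True thus ?thesis using K L by auto
next
 case False
 hence y': "y2 < y0" "y0 < y1" using y by auto
 have ab: "a <= b" and cd: "c <= y2" "y1 <= d" using K L by auto
 \<comment> \<open>\<open>K\<close> is continued to the right at height \<open>y0\<close>;
   \<open>L\<close> is continued to the vertical line at \<open>b + 1\<close> and from there upwards
   beyond \<open>y1\<close> and downwards beyond \<open>y2\<close>. As \<open>y2 < y0 < y1\<close>,
   the added pieces do not meet, so a common point must come from \<open>K\<close> and
   \<open>L\<close>.\<close>
 define K' where "K' = K \<union> {b..b+2} \<times> {y0}"
 define L1 where "L1 = L \<union> {b..b+1} \<times> {y1}"
 define L2 where "L2 = L1 \<union> {b+1} \<times> {y1..d+1}"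
 define L3 where "L3 = L2 \<union> {b..b+1} \<times> {y2}"
 define L' where "L' = L3 \<union> {b+1} \<times> {c-1..y2}"
 have box: "path_connected ({p..q} \<times> {r..s})" for p q r s :: real
  by (intro convex_imp_path_connected convex_Times) auto
 have box1: "path_connected ({p..q} \<times> {r})" "path_connected ({r} \<times> {p..q})" for p q r :: real
  using box[of p q r r] box[of r r p q] by simp_all
 have un: "path_connected (S \<union> T)" if "path_connected S" "path_connected T" "z \<in> S" "z \<in> T" for S T and z :: "plane"
  using that by (intro path_connected_Un) auto
 have "path_connected K'" unfolding K'_def by (rule un[OF K(1) box1(1) K(5)]) simp
 moreover have "path_connected L'"
 proof -
  have "path_connected L1" unfolding L1_def by (rule un[OF L(1) box1(1) L(3)]) simp
  hence "path_connected L2" unfolding L2_def by (rule un[OF _ box1(2), of _ "(b + 1, y1)"]) (use cd in \<open>auto simp: L1_def\<close>)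
  hence "path_connected L3" unfolding L3_def by (rule un[OF _ box1(1), of _ "(b, y2)"]) (use L in \<open>auto simp: L1_def L2_def\<close>)
  thus ?thesis unfolding L'_def by (rule un[OF _ box1(2), of _ "(b + 1, y2)"]) (use cd in \<open>auto simp: L3_def\<close>)
 qed
 moreover have "K' \<subseteq> {a..b+2} \<times> {c-1..d+1}" "L' \<subseteq> {a..b+2} \<times> {c-1..d+1}"
  using K(2) L(2) ab cd y' unfolding K'_def L'_def L3_def L2_def L1_def by force+
 moreover have "x \<in> K'" "(b + 2, y0) \<in> K'" "(b + 1, c - 1) \<in> L'" "(b + 1, d + 1) \<in> L'"
  using K cd y' unfolding K'_def L'_def L3_def L2_def L1_def by auto
 ultimately have "K' \<inter> L' \<noteq> {}" using K(4) by (intro path_connected_meet[of K' a "b+2" "c-1" "d+1" x "(b+2, y0)" L' "(b+1, c-1)" "(b+1, d+1)"]) auto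
 then obtain z where z: "z \<in> K'" "z \<in> L'" by blast
 have zK: "z \<in> K \<or> (b <= fst z \<and> snd z = y0)" using z(1) by (auto simp: K'_def)
 have zL: "z \<in> L \<or> (b <= fst z \<and> (snd z = y1 \<or> snd z = y2)) \<or> (fst z = b + 1 \<and> (y1 <= snd z \<or> snd z <= y2))"
  using z(2) by (auto simp: L'_def L3_def L2_def L1_def)
 have Kb: "fst z <= b" if "z \<in> K" using K(2) that by auto
 have Lb: "fst z <= b" if "z \<in> L" using L(2) that by auto
 have "z \<in> K"
 proof (rule ccontr)
  assume "z \<notin> K"
  hence "b <= fst z" "snd z = y0" using zK by auto
  moreover from this have "z \<in> L" using zL y' by auto
  ultimately have "z = (b, y0)" using Lb by (auto simp: prod_eq_iff)
  thus False using \<open>z \<notin> K\<close> K(5) by simp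
 qed
 moreover have "z \<in> L"
 proof (rule ccontr)
  assume "z \<notin> L"
  hence "z = (b, y1) \<or> z = (b, y2)" using zL Kb[OF \<open>z \<in> K\<close>] by (auto simp: prod_eq_iff)
  thus False using \<open>z \<notin> L\<close> L by auto
 qed
 ultimately show ?thesis by blast
qed

text \<open>The mirror image of \<open>interlace_meet\<close>.\<close>

lemma interlace_meet':
 fixes K L :: "plane set"
 assumes K: "path_connected K" "K \<subseteq> {a..b} \<times> {c..d}" "x \<in> K" "fst x = b" "(a, y0) \<in> K"
  and L: "path_connected L" "L \<subseteq> {a..b} \<times> {c..d}" "(a, y1) \<in> L" "(a, y2) \<in> L" and y: "y2 <= y0" "y0 <= y1"
 shows "K \<inter> L \<noteq> {}"
proof -
 let ?r = "%z :: plane. (- fst z, snd z)"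
 have pc: "path_connected (?r ` X)" if "path_connected X" for X
  using that by (intro path_connected_continuous_image) (auto intro!: continuous_intros)
 have "?r ` K \<inter> ?r ` L \<noteq> {}"
 proof (rule interlace_meet[of "?r ` K" "- b" "- a" c d "?r x" y0 "?r ` L" y1 y2])
  show "?r ` K \<subseteq> {- b..- a} \<times> {c..d}" "?r ` L \<subseteq> {- b..- a} \<times> {c..d}" using K(2) L(2) by force+
 qed (use K L y pc in \<open>auto intro: image_eqI[rotated]\<close>)
 thus ?thesis by (auto simp: prod_eq_iff)
qed

section \<open>Crossing long rectangles\<close>

definition rect :: "real => real => real => real => plane set" where
 "rect a b c d = {a..b} \<times> {c..d}"

lemma mem_rect: "z \<in> rect a b c d \<longleftrightarrow> a <= fst z \<and> fst z <= b \<and> c <= snd z \<and> snd z <= d"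
 by (cases z) (auto simp: rect_def)

lemma crossable_rect:
 assumes "a <= a1" "a1 <= b1" "b1 <= b" "c <= c1" "c1 <= d1" "d1 <= d"
  "a <= a2" "a2 <= b2" "b2 <= b" "c <= c2" "c2 <= d2" "d2 <= d"
 shows "crossable (rect a b c d) (rect a1 b1 c1 d1) (rect a2 b2 c2 d2)"
 unfolding crossable_def rect_def using assms by (auto intro!: compact_Times convex_Times)

lemma linkedE:
 assumes "linked D A B"
 obtains K x y where "path_connected K" "K \<subseteq> D" "x \<in> K" "x \<in> A" "y \<in> K" "y \<in> B"
 using assms unfolding linked_def by blast

definition hcross :: "real => real => real => real => (plane => real) => real" where
 "hcross a b c d = cross (rect a b c d) (rect a a c d) (rect b b c d)"

definition vcross :: "real => real => real => real => (plane => real) => real" where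
 "vcross a b c d = cross (rect a b c d) (rect a b c c) (rect a b d d)"

lemma hcrossE:
 assumes "hcross a b c d g > l" "continuous_on UNIV g" "a <= b" "c <= d"
 obtains K x y where "path_connected K" "K \<subseteq> {x. l < g x}" "K \<subseteq> rect a b c d" "x \<in> K" "fst x = a" "y \<in> K" "fst y = b"
proof -
 have "linked (rect a b c d \<inter> {x. l < g x}) (rect a a c d) (rect b b c d)"
  using assms(1) unfolding hcross_def by (subst cross_gt_iff[OF crossable_rect assms(2), symmetric]) (use assms(3,4) in auto)
 then obtain K x y where "path_connected K" "K \<subseteq> rect a b c d \<inter> {x. l < g x}" "x \<in> K" "x \<in> rect a a c d" "y \<in> K" "y \<in> rect b b c d"
  unfolding linked_def by blast
 thus ?thesis by (intro that[of K x y]) (auto simp: mem_rect)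
qed

lemma vcrossE:
 assumes "vcross a b c d g > l" "continuous_on UNIV g" "a <= b" "c <= d"
 obtains K x y where "path_connected K" "K \<subseteq> {x. l < g x}" "K \<subseteq> rect a b c d" "x \<in> K" "snd x = c" "y \<in> K" "snd y = d"
proof -
 have "linked (rect a b c d \<inter> {x. l < g x}) (rect a b c c) (rect a b d d)"
  using assms(1) unfolding vcross_def by (subst cross_gt_iff[OF crossable_rect assms(2), symmetric]) (use assms(3,4) in auto)
 then obtain K x y where "path_connected K" "K \<subseteq> rect a b c d \<inter> {x. l < g x}" "x \<in> K" "x \<in> rect a b c c" "y \<in> K" "y \<in> rect a b d d"
  unfolding linked_def by blast
 thus ?thesis by (intro that[of K x y]) (auto simp: mem_rect)
qed

text \<open>A connected set in the horizontal strip that overshoots the vertical sides is trimmed by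
  \<open>path_connected_between\<close>.\<close>

lemma hcrossI:
 assumes K: "path_connected K" "K \<subseteq> {x. l < g x}" "x \<in> K" "fst x <= a" "y \<in> K" "b <= fst y" "K \<subseteq> {z. c <= snd z \<and> snd z <= d}"
  and g: "continuous_on UNIV g" and ab: "a <= b"
 shows "hcross a b c d g > l"
proof -
 obtain K' x' y' where K': "path_connected K'" "K' \<subseteq> K" "x' \<in> K'" "fst x' = a" "y' \<in> K'" "fst y' = b" "!!z. z \<in> K' ==> a <= fst z \<and> fst z <= b"
  by (rule path_connected_between[OF K(1) K(3,4) K(5,6) _ ab]) (auto intro!: continuous_intros)
 have sub: "K' \<subseteq> rect a b c d" using K' K(7) by (auto simp: rect_def)
 have "c <= d" using K(3,7) by force
 moreover have "linked (rect a b c d \<inter> {x. l < g x}) (rect a a c d) (rect b b c d)"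
 proof -
  have "x' \<in> rect a a c d" "y' \<in> rect b b c d" using K'(3-6) sub by (auto simp: mem_rect)
  thus ?thesis unfolding linked_def using K'(1-3,5) K(2) sub by (intro exI[of _ K'] conjI) blast+
 qed
 ultimately show ?thesis unfolding hcross_def by (subst cross_gt_iff[OF crossable_rect g]) (use ab in auto)
qed

lemma vcrossI:
 assumes K: "path_connected K" "K \<subseteq> {x. l < g x}" "x \<in> K" "snd x <= c" "y \<in> K" "d <= snd y" "K \<subseteq> {z. a <= fst z \<and> fst z <= b}"
  and g: "continuous_on UNIV g" and cd: "c <= d"
 shows "vcross a b c d g > l"
proof -
 obtain K' x' y' where K': "path_connected K'" "K' \<subseteq> K" "x' \<in> K'" "snd x' = c" "y' \<in> K'" "snd y' = d" "!!z. z \<in> K' ==> c <= snd z \<and> snd z <= d"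
  by (rule path_connected_between[OF K(1) K(3,4) K(5,6) _ cd]) (auto intro!: continuous_intros)
 have sub: "K' \<subseteq> rect a b c d" using K' K(7) by (auto simp: rect_def)
 have "a <= b" using K(3,7) by force
 moreover have "linked (rect a b c d \<inter> {x. l < g x}) (rect a b c c) (rect a b d d)"
 proof -
  have "x' \<in> rect a b c c" "y' \<in> rect a b d d" using K'(3-6) sub by (auto simp: mem_rect)
  thus ?thesis unfolding linked_def using K'(1-3,5) K(2) sub by (intro exI[of _ K'] conjI) blast+
 qed
 ultimately show ?thesis unfolding vcross_def by (subst cross_gt_iff[OF crossable_rect g]) (use cd in auto)
qed

lemma maxmin_hcross: "a <= b ==> c <= d ==> maxmin (hcross a b c d) (rect a b c d)"
 and maxmin_vcross: "a <= b ==> c <= d ==> maxmin (vcross a b c d) (rect a b c d)"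
 unfolding hcross_def vcross_def by (auto intro!: maxmin_cross crossable_rect)

definition bf_isometry :: "(plane => plane) => (plane => plane) => bool" where
 "bf_isometry \<tau> \<sigma> \<longleftrightarrow> (\<forall>v w. bf_cov (\<tau> v) (\<tau> w) = bf_cov v w) \<and> continuous_on UNIV \<tau> \<and> continuous_on UNIV \<sigma> \<and>
   (\<forall>x. \<sigma> (\<tau> x) = x) \<and> (\<forall>x. \<tau> (\<sigma> x) = x)"

lemma bf_isometry_simps:
 "bf_isometry (%v. v + d) (%v. v - d)" "bf_isometry (%v. (- fst v, snd v)) (%v. (- fst v, snd v))"
 "bf_isometry (%v. (fst v, - snd v)) (%v. (fst v, - snd v))" "bf_isometry prod.swap prod.swap"
proof -
 show "bf_isometry (%v. v + d) (%v. v - d)"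
  unfolding bf_isometry_def by (auto simp: bf_cov_translate intro!: continuous_intros)
 show "bf_isometry (%v. (- fst v, snd v)) (%v. (- fst v, snd v))" "bf_isometry (%v. (fst v, - snd v)) (%v. (fst v, - snd v))" "bf_isometry prod.swap prod.swap"
  unfolding bf_isometry_def prod.swap_def bf_cov_def norm_prod_def
  by (auto simp: add.commute intro!: continuous_intros power2_commute)
qed

lemma rect_image:
 "(%v. v + e) ` rect a b c d = rect (a + fst e) (b + fst e) (c + snd e) (d + snd e)"
 "(%v. (- fst v, snd v)) ` rect a b c d = rect (- b) (- a) c d"
 "(%v. (fst v, - snd v)) ` rect a b c d = rect a b (- d) (- c)"
 "prod.swap ` rect a b c d = rect c d a b"
proof -
 have im: "\<tau> ` X = {z. \<sigma> z \<in> X}" if "bf_isometry \<tau> \<sigma>" for \<tau> \<sigma> X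
 proof -
  have st: "\<sigma> (\<tau> x) = x" "\<tau> (\<sigma> x) = x" for x using that unfolding bf_isometry_def by blast+
  have "z \<in> \<tau> ` X" if "\<sigma> z \<in> X" for z using imageI[OF that, of \<tau>] by (simp only: st)
  thus ?thesis by (auto simp only: st mem_Collect_eq)
 qed
 show "(%v. v + e) ` rect a b c d = rect (a + fst e) (b + fst e) (c + snd e) (d + snd e)"
  "(%v. (- fst v, snd v)) ` rect a b c d = rect (- b) (- a) c d"
  "(%v. (fst v, - snd v)) ` rect a b c d = rect a b (- d) (- c)" "prod.swap ` rect a b c d = rect c d a b"
  unfolding im[OF bf_isometry_simps(1)] im[OF bf_isometry_simps(2)] im[OF bf_isometry_simps(3)] im[OF bf_isometry_simps(4)]
  by (auto simp: mem_rect)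
qed

context planar_field
begin

text \<open>The max-min property is part of the notion, so that positive association applies to
  whatever is likely.\<close>

definition likely :: "real => ((plane => real) => real) => real => bool" where
 "likely l T p \<longleftrightarrow> (\<exists>S. maxmin T S) \<and> p <= \<P>(w in M. T (f w) > l)"

lemma likely_mono:
 assumes T: "likely l T p" and T': "maxmin T' S" and le: "!!g. continuous_on UNIV g ==> T g > l ==> T' g > l"
 shows "likely l T' p"
proof -
 note [measurable] = maxmin_measurable[OF T']
 have "\<P>(w in M. T (f w) > l) <= \<P>(w in M. T' (f w) > l)"
  by (intro finite_measure_mono) (use le[OF cont] in auto)
 thus ?thesis using T T' unfolding likely_def by auto
qed

text \<open>Positive association of two functionals, the tool by which crossings are
  combined.\<close>

lemma likely_min:
 assumes 1: "likely l T1 p1" and 2: "likely l T2 p2" and p: "0 <= p1" "0 <= p2"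
 shows "likely l (%g. min (T1 g) (T2 g)) (p1 * p2)"
proof -
 obtain S1 S2 where S: "maxmin T1 S1" "maxmin T2 S2" using 1 2 unfolding likely_def by blast
 have "p1 * p2 <= \<P>(w in M. T1 (f w) > l) * \<P>(w in M. T2 (f w) > l)"
  using 1 2 p unfolding likely_def by (intro mult_mono) auto
 also have "... = (\<Prod>b\<in>(UNIV :: bool set). \<P>(w in M. (if b then T1 else T2) (f w) > l))" by (simp add: UNIV_bool mult.commute)
 also have "... <= \<P>(w in M. \<forall>b\<in>(UNIV :: bool set). (if b then T1 else T2) (f w) > l)"
  by (rule positive_association[where S="%b. if b then S1 else S2"]) (use S in auto)
 also have "... = \<P>(w in M. min (T1 (f w)) (T2 (f w)) > l)" by (simp add: all_bool_eq conj_commute)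
 finally show ?thesis using maxmin_min[OF S] unfolding likely_def by blast
qed

lemma likely_image:
 assumes T: "likely l (cross S A B) p" and S: "crossable S A B" and S': "crossable (\<tau> ` S) (\<tau> ` A) (\<tau> ` B)" and \<tau>: "bf_isometry \<tau> \<sigma>"
 shows "likely l (cross (\<tau> ` S) (\<tau> ` A) (\<tau> ` B)) p"
proof -
 have "\<P>(w in M. cross (\<tau> ` S) (\<tau> ` A) (\<tau> ` B) (f w) > l) = \<P>(w in M. cross S A B (%v. 1 * f w (\<tau> v)) > l)"
 proof -
  have "cross S A B (%v. g (\<tau> v)) = cross (\<tau> ` S) (\<tau> ` A) (\<tau> ` B) g" for g
   using \<tau> unfolding bf_isometry_def by (intro cross_image[of \<tau> \<sigma>]) auto
  thus ?thesis by (simp only: mult_1)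
 qed
 also have "... = \<P>(w in M. cross S A B (f w) > l)"
  using \<tau> unfolding bf_isometry_def by (intro maxmin_isometry_prob[OF maxmin_cross[OF S]]) auto
 finally show ?thesis using T maxmin_cross[OF S'] unfolding likely_def by auto
qed

lemma likely_hcross_image:
 assumes T: "likely l (hcross x1 x2 y1 y2) p" and ab: "x1 <= x2" "y1 <= y2"
 shows "likely l (hcross (x1 + x) (x2 + x) (y1 + y) (y2 + y)) p" "likely l (vcross y1 y2 x1 x2) p"
proof -
 have c: "crossable (rect x1 x2 y1 y2) (rect x1 x1 y1 y2) (rect x2 x2 y1 y2)" using ab by (intro crossable_rect) auto
 show "likely l (hcross (x1 + x) (x2 + x) (y1 + y) (y2 + y)) p"
  using likely_image[OF T[unfolded hcross_def] c _ bf_isometry_simps(1)[of "(x, y)"]] ab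
  unfolding hcross_def rect_image fst_conv snd_conv by (simp add: crossable_rect)
 show "likely l (vcross y1 y2 x1 x2) p"
  using likely_image[OF T[unfolded hcross_def] c _ bf_isometry_simps(4)] ab
  unfolding vcross_def rect_image by (simp add: crossable_rect)
qed

text \<open>If the square is not crossed horizontally above \<open>l\<close>, then by duality the
  set where \<open>f < 0\<close> crosses it vertically. As \<open>l < 0\<close>, this is a vertical
  crossing of the negative field above \<open>l\<close>, which by symmetry is as probable as a
  horizontal crossing of the field. Hence a probability and its complement satisfy
  \<open>1 - q <= q\<close>.\<close>

lemma likely_square:
 assumes l: "l < 0" and s: "0 <= s"
 shows "likely l (hcross (- s) s (- s) s) (1 / 2)"
proof -
 let ?H = "hcross (- s) s (- s) s" and ?V = "vcross (- s) s (- s) s"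
 have mH: "maxmin ?H (rect (- s) s (- s) s)" and mV: "maxmin ?V (rect (- s) s (- s) s)"
  using s maxmin_hcross maxmin_vcross by auto
 note [measurable] = maxmin_measurable[OF mH] maxmin_isometry(2)[OF mV, of "%x. x" "- 1", simplified]
 have "1 - \<P>(w in M. ?H (f w) > l) = \<P>(w in M. \<not> ?H (f w) > l)" by (subst prob_neg[symmetric]) auto
 also have "... <= \<P>(w in M. ?V (%v. - f w v) > l)"
 proof (rule finite_measure_mono)
  show "{w \<in> space M. \<not> ?H (f w) > l} \<subseteq> {w \<in> space M. ?V (%v. - f w v) > l}"
  proof safe
   fix w assume n: "\<not> ?H (f w) > l"
   have cn: "continuous_on UNIV (%v. - f w v)" by (intro continuous_intros cont)
   have "\<not> linked ({- s..s} \<times> {- s..s} \<inter> {x. l < f w x}) ({- s} \<times> UNIV) ({s} \<times> UNIV)"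
   proof
    assume "linked ({- s..s} \<times> {- s..s} \<inter> {x. l < f w x}) ({- s} \<times> UNIV) ({s} \<times> UNIV)"
    then obtain K x y where "path_connected K" "K \<subseteq> {- s..s} \<times> {- s..s} \<inter> {x. l < f w x}" "x \<in> K" "x \<in> {- s} \<times> UNIV" "y \<in> K" "y \<in> {s} \<times> UNIV"
     by (rule linkedE) blast
    hence "?H (f w) > l" by (intro hcrossI[where K=K and x=x and y=y, OF _ _ _ _ _ _ _ cont]) (use s in auto)
    thus False using n by simp
   qed
   from crossing_duality[OF _ _ continuous_on_subset[OF cont] l this]
   have "linked ({- s..s} \<times> {- s..s} \<inter> {x. f w x < 0}) (UNIV \<times> {- s}) (UNIV \<times> {s})" using s by simp
   then obtain K x y where "path_connected K" "K \<subseteq> {- s..s} \<times> {- s..s} \<inter> {x. f w x < 0}" "x \<in> K" "x \<in> UNIV \<times> {- s}" "y \<in> K" "y \<in> UNIV \<times> {s}"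
    by (rule linkedE) blast
   thus "?V (%v. - f w v) > l" by (intro vcrossI[where K=K and x=x and y=y, OF _ _ _ _ _ _ _ cn]) (use s l in auto)
  qed
 qed measurable
 also have "... = \<P>(w in M. ?V (f w) > l)"
  using maxmin_isometry_prob[OF mV, of "%x. x" "- 1"] by simp
 also have "... = \<P>(w in M. ?H (%v. 1 * f w (prod.swap v)) > l)"
  using bf_isometry_simps(4) unfolding hcross_def vcross_def bf_isometry_def mult_1 by (subst cross_image) (auto simp: rect_image)
 also have "... = \<P>(w in M. ?H (f w) > l)"
  using bf_isometry_simps(4) unfolding bf_isometry_def by (intro maxmin_isometry_prob[OF mH]) auto
 finally show ?thesis unfolding likely_def using mH by auto
qed

text \<open>Consecutive rectangles overlap in a square of side \<open>h\<close>, whose vertical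
  crossing joins the two horizontal ones. A step gains the length \<open>w - h\<close> at the price
  of the factor \<open>1 / 2 * p\<close>.\<close>

lemma likely_extend:
 assumes l: "l < 0" and p: "likely l (hcross 0 w 0 h) p" "0 < p" and h: "0 < h" "h <= w"
 shows "likely l (hcross 0 (w + real n * (w - h)) 0 h) ((1 / 2 * p) ^ n * p)"
proof (induction n)
 case (Suc n)
 define q where "q = (1 / 2 * p) ^ n * p"
 have q: "q > 0" "likely l (hcross 0 (w + real n * (w - h)) 0 h) q" using p Suc by (auto simp: q_def)
 define W where "W = w + real n * (w - h)"
 have W: "h <= W" using h by (simp add: W_def add_increasing2)
 have V: "likely l (vcross (W - h) W 0 h) (1 / 2)"
 proof -
  have e: "- (h / 2) + (W - h / 2) = W - h" "h / 2 + (W - h / 2) = W" "- (h / 2) + h / 2 = 0" "h / 2 + h / 2 = h" by simp_all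
  show ?thesis
   using likely_hcross_image(2)[OF likely_hcross_image(1)[OF likely_square[OF l, of "h / 2"], of "h / 2" "W - h / 2"]] h
   unfolding e by simp
 qed
 have S: "likely l (hcross (W - h) (W - h + w) 0 h) p"
  using likely_hcross_image(1)[OF p(1), of "W - h" 0] h by (simp add: add.commute)
 let ?T = "%g. min (hcross 0 W 0 h g) (min (vcross (W - h) W 0 h g) (hcross (W - h) (W - h + w) 0 h g))"
 have LT: "likely l ?T (q * (1 / 2 * p))"
  using q p V S unfolding W_def by (intro likely_min) auto
 have eq: "w + real (Suc n) * (w - h) = W - h + w" by (simp add: W_def algebra_simps)
 have cr: "hcross 0 (W - h + w) 0 h g > l" if g: "continuous_on UNIV g" and T: "?T g > l" for g
 proof -
  have *: "0 <= W" "W - h <= W" "W - h <= W - h + w" "0 <= h" using h W by auto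
  obtain K1 x1 y1 where 1: "path_connected K1" "K1 \<subseteq> {x. l < g x}" "K1 \<subseteq> rect 0 W 0 h" "x1 \<in> K1" "fst x1 = 0" "y1 \<in> K1" "fst y1 = W"
   using T hcrossE[OF _ g *(1,4)] by (metis min_less_iff_conj)
  obtain K2 x2 y2 where 2: "path_connected K2" "K2 \<subseteq> {x. l < g x}" "K2 \<subseteq> rect (W - h) W 0 h" "x2 \<in> K2" "snd x2 = 0" "y2 \<in> K2" "snd y2 = h"
   using T vcrossE[OF _ g *(2,4)] by (metis min_less_iff_conj)
  obtain K3 x3 y3 where 3: "path_connected K3" "K3 \<subseteq> {x. l < g x}" "K3 \<subseteq> rect (W - h) (W - h + w) 0 h" "x3 \<in> K3" "fst x3 = W - h" "y3 \<in> K3" "fst y3 = W - h + w"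
   using T hcrossE[OF _ g *(3,4)] by (metis min_less_iff_conj)
  have "K1 \<inter> K2 \<noteq> {}"
   by (rule path_connected_meet[OF 1(1) _ 1(4,5,6,7) 2(1) _ 2(4,5,6,7)]) (use 1(3) 2(3) W in \<open>auto simp: rect_def\<close>)
  moreover have "K3 \<inter> K2 \<noteq> {}"
   by (rule path_connected_meet[OF 3(1) _ 3(4,5,6,7) 2(1) _ 2(4,5,6,7)]) (use 3(3) 2(3) h in \<open>auto simp: rect_def\<close>)
  ultimately have pc: "path_connected ((K1 \<union> K2) \<union> K3)" using 1(1) 2(1) 3(1) by (intro path_connected_Un) auto
  have sub: "(K1 \<union> K2) \<union> K3 \<subseteq> {x. l < g x}" using 1(2) 2(2) 3(2) by blast
  have sn: "(K1 \<union> K2) \<union> K3 \<subseteq> {z. 0 <= snd z \<and> snd z <= h}" using 1(3) 2(3) 3(3) unfolding rect_def by auto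
  show ?thesis
   by (rule hcrossI[where x=x1 and y=y3, OF pc sub _ _ _ _ sn g]) (use 1(4,5) 3(6,7) h W in auto)
 qed
 have "likely l (hcross 0 (w + real (Suc n) * (w - h)) 0 h) (q * (1 / 2 * p))"
  unfolding eq by (rule likely_mono[OF LT maxmin_hcross cr]) (use h W in auto)
 moreover have "q * (1 / 2 * p) = (1 / 2 * p) ^ Suc n * p" by (simp add: q_def)
 ultimately show ?case by (simp only:)
qed (use p in auto)

end

section \<open>Crossings that land on a prescribed part of a side\<close>

definition lcross :: "real => real => real => real => real => real => (plane => real) => real" where
 "lcross a b c d p q = cross (rect a b c d) (rect a a c d) (rect b b p q)"

definition rcross :: "real => real => real => real => real => real => (plane => real) => real" where
 "rcross a b c d p q = cross (rect a b c d) (rect b b c d) (rect a a p q)"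

lemma lcrossE:
 assumes "lcross a b c d p q g > l" "continuous_on UNIV g" "a <= b" "c <= p" "p <= q" "q <= d"
 obtains K x y where "path_connected K" "K \<subseteq> {x. l < g x}" "K \<subseteq> rect a b c d" "x \<in> K" "fst x = a" "(b, y) \<in> K" "p <= y" "y <= q"
proof -
 have "linked (rect a b c d \<inter> {x. l < g x}) (rect a a c d) (rect b b p q)"
  using assms(1) unfolding lcross_def by (subst cross_gt_iff[OF crossable_rect assms(2), symmetric]) (use assms(3-) in auto)
 then obtain K x y where "path_connected K" "K \<subseteq> rect a b c d \<inter> {x. l < g x}" "x \<in> K" "x \<in> rect a a c d" "y \<in> K" "y \<in> rect b b p q"
  by (rule linkedE) blast
 thus ?thesis by (intro that[of K x "snd y"]) (auto simp: mem_rect prod_eq_iff)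
qed

lemma rcrossE:
 assumes "rcross a b c d p q g > l" "continuous_on UNIV g" "a <= b" "c <= p" "p <= q" "q <= d"
 obtains K x y where "path_connected K" "K \<subseteq> {x. l < g x}" "K \<subseteq> rect a b c d" "x \<in> K" "fst x = b" "(a, y) \<in> K" "p <= y" "y <= q"
proof -
 have "linked (rect a b c d \<inter> {x. l < g x}) (rect b b c d) (rect a a p q)"
  using assms(1) unfolding rcross_def by (subst cross_gt_iff[OF crossable_rect assms(2), symmetric]) (use assms(3-) in auto)
 then obtain K x y where "path_connected K" "K \<subseteq> rect a b c d \<inter> {x. l < g x}" "x \<in> K" "x \<in> rect b b c d" "y \<in> K" "y \<in> rect a a p q"
  by (rule linkedE) blast
 thus ?thesis by (intro that[of K x "snd y"]) (auto simp: mem_rect prod_eq_iff)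
qed

lemma rect_subset: "a' <= a ==> b <= b' ==> c' <= c ==> d <= d' ==> rect a b c d \<subseteq> {a'..b'} \<times> {c'..d'}"
 by (auto simp: rect_def)

lemma subset_rect_snd: "X \<subseteq> rect a b c d ==> c' <= c ==> d <= d' ==> X \<subseteq> {z. c' <= snd z \<and> snd z <= d'}"
 by (force simp: rect_def)

context planar_field
begin

lemma likely_lcross_image:
 assumes T: "likely l (lcross x1 x2 y1 y2 p q) r" and ab: "x1 <= x2" "y1 <= p" "p <= q" "q <= y2"
 shows "likely l (lcross (x1 + x) (x2 + x) (y1 + y) (y2 + y) (p + y) (q + y)) r"
  "likely l (lcross x1 x2 (- y2) (- y1) (- q) (- p)) r" "likely l (rcross (- x2) (- x1) y1 y2 p q) r"
proof -
 have c: "crossable (rect x1 x2 y1 y2) (rect x1 x1 y1 y2) (rect x2 x2 p q)" using ab by (intro crossable_rect) auto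
 note i = likely_image[OF T[unfolded lcross_def] c]
 show "likely l (lcross (x1 + x) (x2 + x) (y1 + y) (y2 + y) (p + y) (q + y)) r"
  using i[OF _ bf_isometry_simps(1)[of "(x, y)"]] ab unfolding lcross_def rect_image fst_conv snd_conv by (simp add: crossable_rect)
 show "likely l (lcross x1 x2 (- y2) (- y1) (- q) (- p)) r"
  using i[OF _ bf_isometry_simps(3)] ab unfolding lcross_def rect_image by (simp add: crossable_rect)
 show "likely l (rcross (- x2) (- x1) y1 y2 p q) r"
  using i[OF _ bf_isometry_simps(2)] ab unfolding rcross_def rect_image by (simp add: crossable_rect)
qed

text \<open>
 Four reflected crossings of the small square and a vertical one form a connected set whose traces on both
 vertical sides lie above and below the window in which the two big crossings land.
\<close>

lemma likely_glue:
 assumes l: "l < 0" and s: "0 < s" and t: "0 <= t" "t <= s / 2" and q: "0 < q"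
  and G: "likely l (lcross (- (2 * s / 3)) (2 * s / 3) (- (2 * s / 3)) (2 * s / 3) t (2 * s / 3)) q"
  and H: "likely l (lcross (- s) s (- s) s 0 (2 * t)) q"
 shows "likely l (hcross 0 (8 * s / 3) 0 (7 * s / 3)) (q * (q * (q * (q * (1 / 2 * (q * q))))))"
proof -
 define r where "r = 2 * s / 3"
 have r: "0 < r" "r < s" "t <= r" using s t by (auto simp: r_def)
 note G = G[folded r_def]
 have g1: "likely l (lcross (- r) r (- r) r (- r) (- t)) q"
  using likely_lcross_image(2)[OF G] r t by simp
 have g2: "likely l (rcross (- r) r (- r) r t r) q" "likely l (rcross (- r) r (- r) r (- r) (- t)) q"
  using likely_lcross_image(3)[OF G] likely_lcross_image(3)[OF g1] r t by simp_all
 have V: "likely l (vcross (- r) r (- r) r) (1 / 2)"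
  using likely_hcross_image(2)[OF likely_square[OF l]] r by simp
 \<comment> \<open>As \<open>t <= s / 2\<close>, both the top \<open>s - t\<close> of the big
   squares and the top \<open>2 * s / 3\<close> of the small one lie below
   \<open>4 * s / 3 - t\<close>. With this choice the height \<open>d - c = 7 * s / 3\<close> does
   not depend on \<open>t\<close>.\<close>
 define c d where "c = - s - t" and "d = 4 * s / 3 - t"
 \<comment> \<open>The big square is shifted until its right side lies on that of the small square
   and its window is symmetric about height 0.\<close>
 have L: "likely l (lcross (r - 2 * s) r c (s - t) (- t) t) q"
  using likely_lcross_image(1)[OF H, of "r - s" "- t"] s t by (simp add: c_def algebra_simps)
 have R: "likely l (rcross (- r) (2 * s - r) c (s - t) (- t) t) q"
 proof -
  have "r - 2 * s <= r" "c <= - t" "- t <= t" "t <= s - t" using s t by (auto simp: c_def)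
  from likely_lcross_image(3)[OF L this] show ?thesis by (simp only: minus_diff_eq)
 qed
 let ?T = "%g. min (lcross (- r) r (- r) r t r g) (min (lcross (- r) r (- r) r (- r) (- t) g) (min (rcross (- r) r (- r) r t r g)
  (min (rcross (- r) r (- r) r (- r) (- t) g) (min (vcross (- r) r (- r) r g) (min (lcross (r - 2 * s) r c (s - t) (- t) t g) (rcross (- r) (2 * s - r) c (s - t) (- t) t g))))))"
 have LT: "likely l ?T (q * (q * (q * (q * (1 / 2 * (q * q))))))"
  using q by (intro likely_min G g1 g2 V L R) auto
 have cr: "hcross (r - 2 * s) (2 * s - r) c d g > l" if g: "continuous_on UNIV g" and T: "?T g > l" for g
 proof -
  have o: "- r <= r" "- r <= t" "t <= r" "- r <= - r" "- r <= - t" "- t <= r" "r <= r" "r - 2 * s <= r" "- r <= 2 * s - r" "c <= - t" "- t <= t" "t <= s - t"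
   using r t s by (auto simp: c_def)
  obtain K1 x1 y1 where 1: "path_connected K1" "K1 \<subseteq> {x. l < g x}" "K1 \<subseteq> rect (- r) r (- r) r" "x1 \<in> K1" "fst x1 = - r" "(r, y1) \<in> K1" "t <= y1" "y1 <= r"
   using T lcrossE[OF _ g o(1,2,3,7)] by (metis min_less_iff_conj)
  obtain K2 x2 y2 where 2: "path_connected K2" "K2 \<subseteq> {x. l < g x}" "K2 \<subseteq> rect (- r) r (- r) r" "x2 \<in> K2" "fst x2 = - r" "(r, y2) \<in> K2" "- r <= y2" "y2 <= - t"
   using T lcrossE[OF _ g o(1,4,5,6)] by (metis min_less_iff_conj)
  obtain K3 x3 y3 where 3: "path_connected K3" "K3 \<subseteq> {x. l < g x}" "K3 \<subseteq> rect (- r) r (- r) r" "x3 \<in> K3" "fst x3 = r" "(- r, y3) \<in> K3" "t <= y3" "y3 <= r"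
   using T rcrossE[OF _ g o(1,2,3,7)] by (metis min_less_iff_conj)
  obtain K4 x4 y4 where 4: "path_connected K4" "K4 \<subseteq> {x. l < g x}" "K4 \<subseteq> rect (- r) r (- r) r" "x4 \<in> K4" "fst x4 = r" "(- r, y4) \<in> K4" "- r <= y4" "y4 <= - t"
   using T rcrossE[OF _ g o(1,4,5,6)] by (metis min_less_iff_conj)
  obtain K5 x5 y5 where 5: "path_connected K5" "K5 \<subseteq> {x. l < g x}" "K5 \<subseteq> rect (- r) r (- r) r" "x5 \<in> K5" "snd x5 = - r" "y5 \<in> K5" "snd y5 = r"
   using T vcrossE[OF _ g o(1,1)] by (metis min_less_iff_conj)
  obtain K6 x6 y6 where 6: "path_connected K6" "K6 \<subseteq> {x. l < g x}" "K6 \<subseteq> rect (r - 2 * s) r c (s - t)" "x6 \<in> K6" "fst x6 = r - 2 * s" "(r, y6) \<in> K6" "- t <= y6" "y6 <= t"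
   using T lcrossE[OF _ g o(8,10,11,12)] by (metis min_less_iff_conj)
  obtain K7 x7 y7 where 7: "path_connected K7" "K7 \<subseteq> {x. l < g x}" "K7 \<subseteq> rect (- r) (2 * s - r) c (s - t)" "x7 \<in> K7" "fst x7 = 2 * s - r" "(- r, y7) \<in> K7" "- t <= y7" "y7 <= t"
   using T rcrossE[OF _ g o(9,10,11,12)] by (metis min_less_iff_conj)
  have m: "K \<inter> K5 \<noteq> {}" if "path_connected K" "K \<subseteq> rect (- r) r (- r) r" "x \<in> K" "fst x = - r" "y \<in> K" "fst y = r" for K x y
   by (rule path_connected_meet[OF that(1) that(2)[unfolded rect_def] that(3-6) 5(1) 5(3)[unfolded rect_def] 5(4-7)])
  have m5: "K1 \<inter> K5 \<noteq> {}" "K2 \<inter> K5 \<noteq> {}" "K3 \<inter> K5 \<noteq> {}" "K4 \<inter> K5 \<noteq> {}"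
   using m[OF 1(1,3,4,5,6)] m[OF 2(1,3,4,5,6)] m[OF 3(1,3,6) _ 3(4,5)] m[OF 4(1,3,6) _ 4(4,5)] by auto
  define J where "J = (((K1 \<union> K5) \<union> K2) \<union> K3) \<union> K4"
  have J: "path_connected J" unfolding J_def using m5 1(1) 2(1) 3(1) 4(1) 5(1) by (intro path_connected_Un) auto
  have Jr: "J \<subseteq> rect (- r) r (- r) r" unfolding J_def using 1(3) 2(3) 3(3) 4(3) 5(3) by blast
  have Jp: "(r, y1) \<in> J" "(r, y2) \<in> J" "(- r, y3) \<in> J" "(- r, y4) \<in> J" unfolding J_def using 1(6) 2(6) 3(6) 4(6) by auto
  have cd: "c <= - r" "r <= d" "s - t <= d" using r t s by (auto simp: c_def d_def r_def)
  have "K6 \<inter> J \<noteq> {}"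
   by (rule interlace_meet[OF 6(1) order_trans[OF 6(3) rect_subset] 6(4,5,6) J order_trans[OF Jr rect_subset] Jp(1,2), where c=c and d=d])
    (use 6(7,8) 1(7) 2(8) cd s r in auto)
  moreover have "K7 \<inter> J \<noteq> {}"
   by (rule interlace_meet'[OF 7(1) order_trans[OF 7(3) rect_subset] 7(4,5,6) J order_trans[OF Jr rect_subset] Jp(3,4), where c=c and d=d])
    (use 7(7,8) 3(7) 4(8) cd s r in auto)
  ultimately have pc: "path_connected ((K6 \<union> J) \<union> K7)" using 6(1) 7(1) J by (intro path_connected_Un) auto
  have sub: "(K6 \<union> J) \<union> K7 \<subseteq> {x. l < g x}" unfolding J_def using 1(2) 2(2) 3(2) 4(2) 5(2) 6(2) 7(2) by blast
  have sn: "(K6 \<union> J) \<union> K7 \<subseteq> {z. c <= snd z \<and> snd z <= d}" using cd by (intro Un_least subset_rect_snd[OF 6(3)] subset_rect_snd[OF Jr] subset_rect_snd[OF 7(3)]) auto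
  show ?thesis
   by (rule hcrossI[where x=x6 and y=x7, OF pc sub _ _ _ _ sn g]) (use 6(4,5) 7(4,5) r in auto)
 qed
 have o: "r - 2 * s <= 2 * s - r" "c <= d" using r t s by (auto simp: c_def d_def)
 have "likely l (hcross (r - 2 * s) (2 * s - r) c d) (q * (q * (q * (q * (1 / 2 * (q * q))))))"
  by (rule likely_mono[OF LT maxmin_hcross[OF o]]) (rule cr)
 note likely_hcross_image(1)[OF this o, of "2 * s - r" "- c"]
 moreover have "r - 2 * s + (2 * s - r) = 0" "2 * s - r + (2 * s - r) = 8 * s / 3" "c + - c = 0" "d + - c = 7 * s / 3"
  by (simp_all add: c_def d_def r_def)
 ultimately show ?thesis by (simp only:)
qed

definition arm :: "real => real => real => real" where
 "arm l s t = \<P>(w in M. lcross (- s) s (- s) s t s (f w) > l)"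

text \<open>At height 0 the value is at least \<open>1 / 4\<close> by \<open>arm_0\<close>. Below
  this threshold half of it persists in landings above \<open>t\<close>; beyond the threshold the
  other half must be carried by landings below \<open>t\<close>.\<close>

definition arm_height :: "real => real => real" where
 "arm_height l s = Sup {t. 0 <= t \<and> t <= s \<and> 1 / 8 <= arm l s t}"

lemma maxmin_lcross: "x1 <= x2 ==> y1 <= p ==> p <= q ==> q <= y2 ==> maxmin (lcross x1 x2 y1 y2 p q) (rect x1 x2 y1 y2)"
 unfolding lcross_def by (intro maxmin_cross crossable_rect) auto

lemma lcross_meas: "x1 <= x2 ==> y1 <= p ==> p <= q ==> q <= y2 ==> {w \<in> space M. lcross x1 x2 y1 y2 p q (f w) > l} \<in> sets M"
 using maxmin_measurable[OF maxmin_lcross] by auto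

lemma lcross_gt_iff: "x1 <= x2 ==> y1 <= p ==> p <= q ==> q <= y2 ==> continuous_on UNIV g ==>
  lcross x1 x2 y1 y2 p q g > l \<longleftrightarrow> linked (rect x1 x2 y1 y2 \<inter> {x. l < g x}) (rect x1 x1 y1 y2) (rect x2 x2 p q)"
 unfolding lcross_def by (rule cross_gt_iff[OF crossable_rect]) auto

lemma lcross_split:
 assumes "x1 <= x2" "y1 <= p" "p <= m" "m <= q" "q <= y2"
 shows "\<P>(w in M. lcross x1 x2 y1 y2 p q (f w) > l) <= \<P>(w in M. lcross x1 x2 y1 y2 p m (f w) > l) + \<P>(w in M. lcross x1 x2 y1 y2 m q (f w) > l)"
proof -
 have "{w \<in> space M. lcross x1 x2 y1 y2 p q (f w) > l} \<subseteq> {w \<in> space M. lcross x1 x2 y1 y2 p m (f w) > l} \<union> {w \<in> space M. lcross x1 x2 y1 y2 m q (f w) > l}"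
 proof
  fix w assume "w \<in> {w \<in> space M. lcross x1 x2 y1 y2 p q (f w) > l}"
  hence "w \<in> space M" "linked (rect x1 x2 y1 y2 \<inter> {x. l < f w x}) (rect x1 x1 y1 y2) (rect x2 x2 p q)"
   using assms by (auto simp: lcross_gt_iff[OF _ _ _ _ cont])
  moreover have "rect x2 x2 p q = rect x2 x2 p m \<union> rect x2 x2 m q" using assms by (auto simp: rect_def)
  ultimately show "w \<in> {w \<in> space M. lcross x1 x2 y1 y2 p m (f w) > l} \<union> {w \<in> space M. lcross x1 x2 y1 y2 m q (f w) > l}"
   using assms by (auto simp: lcross_gt_iff[OF _ _ _ _ cont] linked_def Int_Un_distrib)
 qed
 hence "\<P>(w in M. lcross x1 x2 y1 y2 p q (f w) > l) <= prob ({w \<in> space M. lcross x1 x2 y1 y2 p m (f w) > l} \<union> {w \<in> space M. lcross x1 x2 y1 y2 m q (f w) > l})"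
  using assms by (intro finite_measure_mono sets.Un lcross_meas) auto
 also have "... <= \<P>(w in M. lcross x1 x2 y1 y2 p m (f w) > l) + \<P>(w in M. lcross x1 x2 y1 y2 m q (f w) > l)"
  using assms by (intro measure_Un_le lcross_meas) auto
 finally show ?thesis .
qed

text \<open>A crossing of the square, of probability at least \<open>1 / 2\<close>, ends in the
  upper or in the lower half of the right side, and reflection makes the two cases equally
  likely.\<close>

lemma arm_0:
 assumes "l < 0" "0 < s"
 shows "1 / 4 <= arm l s 0"
proof -
 have "1 / 2 <= \<P>(w in M. lcross (- s) s (- s) s (- s) s (f w) > l)"
  using likely_square[OF assms(1), of s] assms(2) unfolding likely_def hcross_def lcross_def by simp
 also have "... <= \<P>(w in M. lcross (- s) s (- s) s (- s) 0 (f w) > l) + arm l s 0"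
  unfolding arm_def by (rule lcross_split) (use assms in auto)
 also have "likely l (lcross (- s) s (- s) s (- s) 0) p ==> p <= arm l s 0" for p
  using likely_lcross_image(2)[of l "- s" s "- s" s "- s" 0 p] assms unfolding likely_def arm_def by auto
 from this[of "\<P>(w in M. lcross (- s) s (- s) s (- s) 0 (f w) > l)"] maxmin_lcross[of "- s" s "- s" "- s" 0 s]
 have "\<P>(w in M. lcross (- s) s (- s) s (- s) 0 (f w) > l) <= arm l s 0" using assms unfolding likely_def by auto
 finally show ?thesis by simp
qed

lemma arm_mono:
 assumes "0 <= t" "t <= t'" "t' <= s"
 shows "arm l s t' <= arm l s t"
 unfolding arm_def
proof (rule finite_measure_mono)
 show "{w \<in> space M. lcross (- s) s (- s) s t' s (f w) > l} \<subseteq> {w \<in> space M. lcross (- s) s (- s) s t s (f w) > l}"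
  using assms by (auto simp: lcross_gt_iff[OF _ _ _ _ cont] mem_rect elim!: linked_mono)
qed (use assms lcross_meas in auto)

text \<open>Positivity is the delicate claim: the crossings that land at height at least 0 are the
  increasing union of those that land at height at least \<open>d n\<close>, because a crossing that
  ends exactly at \<open>(s, 0)\<close> can be continued upwards inside the open excursion set. So
  some \<open>d n\<close> still has probability above \<open>1 / 8\<close>.\<close>

lemma arm_height:
 assumes l: "l < 0" and s: "0 < s"
 shows "0 < arm_height l s" "arm_height l s <= s"
  "0 <= t ==> t < arm_height l s ==> 1 / 8 <= arm l s t"
  "arm_height l s < t ==> t <= s ==> 1 / 8 <= \<P>(w in M. lcross (- s) s (- s) s 0 t (f w) > l)"
proof -
 let ?X = "{t. 0 <= t \<and> t <= s \<and> 1 / 8 <= arm l s t}"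
 note a0 = arm_0[OF l s]
 have ne: "?X \<noteq> {}" using a0 s by (auto intro!: exI[of _ 0])
 have bd: "bdd_above ?X" by (auto intro: bdd_aboveI[of _ s])
 show "arm_height l s <= s" unfolding arm_height_def by (rule cSup_least[OF ne]) auto
 show "1 / 8 <= arm l s t" if t0: "0 <= t" and lt: "t < arm_height l s"
 proof -
  obtain t' where "t' \<in> ?X" "t < t'" using lt unfolding arm_height_def less_cSup_iff[OF ne bd] by blast
  thus ?thesis using arm_mono[of t t' s l] t0 by auto
 qed
 show "1 / 8 <= \<P>(w in M. lcross (- s) s (- s) s 0 t (f w) > l)" if t: "arm_height l s < t" "t <= s"
 proof -
  have "0 <= arm_height l s" unfolding arm_height_def using a0 s by (intro cSup_upper bd) auto
  hence t0: "0 <= t" using t by simp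
  have "\<not> 1 / 8 <= arm l s t" using cSup_upper[OF _ bd, of t] t t0 unfolding arm_height_def by auto
  moreover have "arm l s 0 <= \<P>(w in M. lcross (- s) s (- s) s 0 t (f w) > l) + arm l s t"
   unfolding arm_def by (rule lcross_split) (use s t t0 in auto)
  ultimately show ?thesis using a0 by simp
 qed
 show "0 < arm_height l s"
 proof -
  define d where "d n = s / real (Suc n)" for n
  have d: "0 < d n" "d n <= s" for n using s by (auto simp: d_def divide_le_eq mult_le_cancel_left1)
  define E where "E n = {w \<in> space M. lcross (- s) s (- s) s (d n) s (f w) > l}" for n
  have Em: "E n \<in> sets M" for n unfolding E_def using d[of n] s by (intro lcross_meas) auto
  have dm: "d (Suc n) <= d n" for n unfolding d_def using s by (intro divide_left_mono) auto
  have inc: "incseq E"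
  proof (rule incseq_SucI)
   fix n show "E n \<subseteq> E (Suc n)" unfolding E_def using d[of n] d[of "Suc n"] dm[of n] s
    by (auto simp: lcross_gt_iff[OF _ _ _ _ cont] mem_rect elim!: linked_mono)
  qed
  have "{w \<in> space M. lcross (- s) s (- s) s 0 s (f w) > l} \<subseteq> (\<Union>n. E n)"
  proof
   fix w assume "w \<in> {w \<in> space M. lcross (- s) s (- s) s 0 s (f w) > l}"
   hence w: "w \<in> space M" and "lcross (- s) s (- s) s 0 s (f w) > l" by auto
   then obtain K x y where K: "path_connected K" "K \<subseteq> {x. l < f w x}" "K \<subseteq> rect (- s) s (- s) s" "x \<in> K" "fst x = - s" "(s, y) \<in> K" "0 <= y" "y <= s"
    by (elim lcrossE[OF _ cont]) (use s in auto)
   have "\<exists>n z. path_connected (K \<union> z) \<and> z \<subseteq> {x. l < f w x} \<inter> rect (- s) s (- s) s \<and> (K \<union> z) \<inter> rect s s (d n) s \<noteq> {}"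
   proof (cases "y = 0")
    case False
    obtain n where "inverse (real (Suc n)) < y / s" using reals_Archimedean[of "y / s"] False K s by auto
    hence "d n <= y" using s by (simp add: d_def field_simps)
    hence "(s, y) \<in> (K \<union> {}) \<inter> rect s s (d n) s" using K by (auto simp: mem_rect)
    thus ?thesis using K(1) by (intro exI[of _ n] exI[of _ "{}"]) auto
   next
    case True
    have "l < f w (s, 0)" using K(2,6) True by auto
    moreover have "open {x. l < f w x}" by (intro open_Collect_less continuous_intros cont)
    ultimately obtain e where e: "e > 0" "ball (s, 0) e \<subseteq> {x. l < f w x}" unfolding open_contains_ball by blast
    obtain n where "inverse (real (Suc n)) < e / s" using reals_Archimedean[of "e / s"] e s by auto
    hence n: "d n < e" using s by (simp add: d_def field_simps)
    have "rect s s 0 (d n) \<subseteq> ball (s, 0) e"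
     using n by (auto simp: rect_def dist_norm norm_prod_def)
    moreover have "rect s s 0 (d n) \<subseteq> rect (- s) s (- s) s" using d[of n] s by (auto simp: rect_def)
    moreover have "path_connected (K \<union> rect s s 0 (d n))"
     using K True d[of n] by (intro path_connected_Un) (auto simp: rect_def intro!: convex_imp_path_connected convex_Times)
    moreover have "(s, d n) \<in> (K \<union> rect s s 0 (d n)) \<inter> rect s s (d n) s" using d[of n] by (auto simp: mem_rect)
    ultimately show ?thesis using e(2) by (intro exI[of _ n] exI[of _ "rect s s 0 (d n)"]) auto
   qed
   then obtain n z where z: "path_connected (K \<union> z)" "z \<subseteq> {x. l < f w x} \<inter> rect (- s) s (- s) s" "(K \<union> z) \<inter> rect s s (d n) s \<noteq> {}" by blast
   have "x \<in> (K \<union> z) \<inter> rect (- s) (- s) (- s) s" using K(3,4,5) by (auto simp: mem_rect)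
   hence "linked (rect (- s) s (- s) s \<inter> {x. l < f w x}) (rect (- s) (- s) (- s) s) (rect s s (d n) s)"
    unfolding linked_def using z K(2,3) by (intro exI[of _ "K \<union> z"]) blast
   thus "w \<in> (\<Union>n. E n)" using w d[of n] s by (auto simp: E_def lcross_gt_iff[OF _ _ _ _ cont] intro!: exI[of _ n])
  qed
  hence "arm l s 0 <= prob (\<Union>n. E n)" unfolding arm_def using Em by (intro finite_measure_mono) auto
  moreover have "(%n. prob (E n)) ----> prob (\<Union>n. E n)" using Em inc by (intro finite_Lim_measure_incseq) auto
  ultimately have "\<forall>\<^sub>F n in sequentially. 1 / 8 < prob (E n)" using a0 by (intro order_tendstoD(1)) auto
  then obtain n where "1 / 8 < prob (E n)" by (auto simp: eventually_sequentially)
  hence "d n \<in> ?X" using d[of n] by (simp add: arm_def E_def)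
  hence "d n <= arm_height l s" unfolding arm_height_def using bd by (intro cSup_upper)
  thus ?thesis using d[of n] by simp
 qed
qed

text \<open>Scales with \<open>arm_height l s < 2 * arm_height l (2 * s / 3)\<close> are good: there
  the crossings of the small square end beyond the window in which those of the big one land. Good
  scales are unbounded, for otherwise \<open>arm_height\<close> would at least double whenever
  \<open>s\<close> grows by the factor 3/2, against \<open>arm_height l s <= s\<close>.\<close>

theorem rsw:
 assumes l: "l < 0"
  and K: "0 < K"
 shows "\<exists>c>0. \<forall>h0. \<exists>h\<ge>h0. h > 0 \<and> likely l (hcross 0 (K * h) 0 h) c"
proof -
 define q where "q = (1 / 8 * (1 / 8 * (1 / 8 * (1 / 8 * (1 / 2 * (1 / 8 * (1 / 8)))))) :: real)"
 \<comment> \<open>Each extension adds \<open>8 * s / 3 - 7 * s / 3 = s / 3\<close>, and the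
   required length \<open>K * h\<close> with \<open>h = 7 * s / 3\<close> is \<open>7 * K\<close>
   times that.\<close>
 define n where "n = nat \<lceil>7 * K\<rceil>"
 have good: "\<exists>s\<ge>s0. arm_height l s < 2 * arm_height l (2 * s / 3)" if s0: "0 < s0" for s0
 proof (rule ccontr)
  assume "\<not> ?thesis"
  hence no: "2 * arm_height l (2 * s / 3) <= arm_height l s" if "s0 <= s" for s using that by force
  have ge: "2 ^ k * arm_height l s0 <= arm_height l ((3 / 2) ^ k * s0)" for k :: nat
  proof (induction k)
   case (Suc k)
   have "s0 <= (3 / 2) ^ Suc k * s0" using s0 one_le_power[of "3/2 :: real" "Suc k"] by (simp add: mult_le_cancel_right1)
   moreover have "2 * ((3 / 2) ^ Suc k * s0) / 3 = (3 / 2) ^ k * s0" by simp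
   ultimately have "2 * arm_height l ((3 / 2) ^ k * s0) <= arm_height l ((3 / 2) ^ Suc k * s0)" using no by metis
   thus ?case using Suc by simp
  qed simp
  have le: "2 ^ k * arm_height l s0 <= (3 / 2) ^ k * s0" for k :: nat
   using order_trans[OF ge arm_height(2)[OF l]] s0 by simp
  obtain k :: nat where k: "s0 / arm_height l s0 < (4 / 3) ^ k" using real_arch_pow[of "4 / 3"] by auto
  have "s0 < (4 / 3) ^ k * arm_height l s0" using k arm_height(1)[OF l s0] by (simp add: pos_divide_less_eq)
  hence "(3 / 2) ^ k * s0 < (3 / 2) ^ k * ((4 / 3) ^ k * arm_height l s0)" by (intro mult_strict_left_mono) auto
  also have "... = 2 ^ k * arm_height l s0" by (simp add: power_mult_distrib[symmetric] mult.assoc[symmetric])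
  finally show False using le[of k] by simp
 qed
 have glue: "likely l (hcross 0 (8 * s / 3) 0 (7 * s / 3)) q" if s: "0 < s" and g: "arm_height l s < 2 * arm_height l (2 * s / 3)" for s
 proof -
  define r where "r = 2 * s / 3"
  have r: "0 < r" using s by (simp add: r_def)
  note A = arm_height[OF l s] and B = arm_height[OF l r]
  \<comment> \<open>Halfway between \<open>arm_height l s\<close> and
    \<open>2 * arm_height l r\<close>, or \<open>s\<close> if that is smaller. Big crossings land
    below \<open>u\<close>, small ones above \<open>u / 2\<close>. If \<open>u = s\<close>, the
    window is the whole upper half and \<open>arm_0\<close> applies.\<close>
  define u where "u = min s ((arm_height l s + 2 * arm_height l r) / 2)"
  define t where "t = u / 2"
  have t: "0 <= t" "t <= s / 2" "t < arm_height l r"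
   using A(1) B(1) s g[folded r_def] unfolding t_def u_def by (auto simp: min_def)
  have "likely l (lcross (- r) r (- r) r t r) (1 / 8)"
   using B(3)[OF t(1,3)] maxmin_lcross[of "- r" r "- r" t r r] t B(2) r unfolding likely_def arm_def by auto
  moreover have "likely l (lcross (- s) s (- s) s 0 (2 * t)) (1 / 8)"
  proof -
   have "1 / 8 <= \<P>(w in M. lcross (- s) s (- s) s 0 u (f w) > l)"
   proof (cases "u = s")
    case True thus ?thesis using arm_0[OF l s] by (simp add: arm_def)
   next
    case False
    hence "arm_height l s < u" "u <= s" using g by (auto simp: u_def r_def min_def split: if_splits)
    thus ?thesis by (rule A(4))
   qed
   thus ?thesis using maxmin_lcross[of "- s" s "- s" 0 u s] s t unfolding likely_def by (auto simp: t_def)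
  qed
  ultimately show ?thesis unfolding q_def r_def by (intro likely_glue[OF l s t(1,2)]) simp_all
 qed
 have q: "0 < q" by (simp add: q_def)
 define c where "c = (1 / 2 * q) ^ n * q"
 have c: "0 < c" using q by (simp add: c_def)
 have "\<exists>h\<ge>h0. h > 0 \<and> likely l (hcross 0 (K * h) 0 h) c" for h0
 proof -
  obtain s where s: "max 1 h0 <= s" "arm_height l s < 2 * arm_height l (2 * s / 3)" using good[of "max 1 h0"] by (metis less_max_iff_disj zero_less_one)
  define h where "h = 7 * s / 3"
  have h: "h0 <= h" "0 < h" using s by (auto simp: h_def)
  have 1: "likely l (hcross 0 (8 * s / 3 + real n * (8 * s / 3 - h)) 0 h) c"
   unfolding c_def h_def by (rule likely_extend[OF l glue q]) (use s in auto)
  have "7 * K <= real n" unfolding n_def by linarith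
  hence "7 * K * (s / 3) <= real n * (s / 3)" using s by (intro mult_right_mono) auto
  moreover have e: "8 * s / 3 - h = s / 3" "K * h = 7 * K * (s / 3)" by (simp_all add: h_def)
  moreover have "0 <= 8 * s / 3" using s by simp
  ultimately have W: "K * h <= 8 * s / 3 + real n * (8 * s / 3 - h)" unfolding e by linarith
  have "likely l (hcross 0 (K * h) 0 h) c"
  proof (rule likely_mono[OF 1 maxmin_hcross])
   fix g :: "plane => real" assume g: "continuous_on UNIV g" and T: "hcross 0 (8 * s / 3 + real n * (8 * s / 3 - h)) 0 h g > l"
   have o: "0 <= 8 * s / 3 + real n * (8 * s / 3 - h)" "0 <= h" "0 <= K * h" using W K h by (auto intro: order_trans[OF _ W])
   obtain X x y where X: "path_connected X" "X \<subseteq> {x. l < g x}" "X \<subseteq> rect 0 (8 * s / 3 + real n * (8 * s / 3 - h)) 0 h" "x \<in> X" "fst x = 0" "y \<in> X" "fst y = 8 * s / 3 + real n * (8 * s / 3 - h)"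
    using hcrossE[OF T g o(1,2)] by blast
   have sn: "X \<subseteq> {z. 0 <= snd z \<and> snd z <= h}" using X(3) by (auto simp: rect_def)
   show "hcross 0 (K * h) 0 h g > l"
    by (rule hcrossI[where x=x and y=y, OF X(1,2) _ _ _ _ sn g o(3)]) (use X W in auto)
  qed (use K h in auto)
  thus ?thesis using h by blast
 qed
 thus ?thesis using c by blast
qed

end

section \<open>Rings and walks\<close>

definition sup_dist :: "plane => plane => real" where
 "sup_dist p z = max \<bar>fst z - fst p\<bar> \<bar>snd z - snd p\<bar>"

lemma sup_dist_le: "sup_dist p z <= sup_dist p w + norm (z - w)" "sup_dist p q <= sup_dist p z + sup_dist q z"
proof -
 have "\<bar>fst z - fst w\<bar> <= norm (z - w)" "\<bar>snd z - snd w\<bar> <= norm (z - w)"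
  using dist_fst_le[of z w] dist_snd_le[of z w] by (auto simp: dist_norm)
 thus "sup_dist p z <= sup_dist p w + norm (z - w)" unfolding sup_dist_def by linarith
 show "sup_dist p q <= sup_dist p z + sup_dist q z" unfolding sup_dist_def by linarith
qed

text \<open>Crossings of the four strips of a square annulus, each along the full side of the outer
  square, so that they overlap at the corners and contain a circuit.\<close>

definition ring :: "plane => real => real => (plane => real) => real" where
 "ring p i b g = min (min (vcross (fst p + i) (fst p + b) (snd p - b) (snd p + b) g) (vcross (fst p - b) (fst p - i) (snd p - b) (snd p + b) g))
   (min (hcross (fst p - b) (fst p + b) (snd p + i) (snd p + b) g) (hcross (fst p - b) (fst p + b) (snd p - b) (snd p - i) g))"

definition annulus :: "plane => real => real => plane set" where
 "annulus p i b = {z. i <= sup_dist p z \<and> sup_dist p z <= b}"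

lemma maxmin_superset: "maxmin T S ==> S \<subseteq> S' ==> bounded S' ==> maxmin T S'"
 unfolding maxmin_def by (meson order_trans)

lemma maxmin_ring:
 assumes "0 <= i" "i <= b"
 shows "maxmin (ring p i b) (annulus p i b)"
proof (rule maxmin_superset)
 show "maxmin (ring p i b) ((rect (fst p + i) (fst p + b) (snd p - b) (snd p + b) \<union> rect (fst p - b) (fst p - i) (snd p - b) (snd p + b))
   \<union> (rect (fst p - b) (fst p + b) (snd p + i) (snd p + b) \<union> rect (fst p - b) (fst p + b) (snd p - b) (snd p - i)))"
  unfolding ring_def[abs_def] by (intro maxmin_min maxmin_hcross maxmin_vcross) (use assms in auto)
 show "(rect (fst p + i) (fst p + b) (snd p - b) (snd p + b) \<union> rect (fst p - b) (fst p - i) (snd p - b) (snd p + b))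
   \<union> (rect (fst p - b) (fst p + b) (snd p + i) (snd p + b) \<union> rect (fst p - b) (fst p + b) (snd p - b) (snd p - i)) \<subseteq> annulus p i b"
  using assms by (auto simp: mem_rect annulus_def sup_dist_def abs_le_iff le_max_iff_disj)
 have "annulus p i b \<subseteq> rect (fst p - b) (fst p + b) (snd p - b) (snd p + b)"
  by (auto simp: annulus_def sup_dist_def mem_rect abs_le_iff)
 thus "bounded (annulus p i b)" unfolding rect_def by (rule bounded_subset[rotated]) (intro bounded_Times bounded_closed_interval)
qed

text \<open>The part of \<open>K\<close> between the distances \<open>i\<close> and \<open>b\<close>
  from \<open>p\<close> ends on one of the four sides of the outer square. There it traverses the
  strip of that side and meets the crossing along the strip, on which \<open>g > l\<close>.\<close>

lemma ring_blocks:
 assumes r: "l < ring p i b g" and g: "continuous_on UNIV g" and ib: "0 <= i" "i < b"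
  and K: "path_connected K" "K \<subseteq> {z. g z < l}" "x \<in> K" "sup_dist p x <= i" "y \<in> K" "b <= sup_dist p y"
 shows False
proof -
 have o: "fst p + i <= fst p + b" "snd p - b <= snd p + b" "fst p - b <= fst p - i" "fst p - b <= fst p + b" "snd p + i <= snd p + b" "snd p - b <= snd p - i"
  using ib by auto
 have sc: "continuous_on A (sup_dist p)" for A unfolding sup_dist_def[abs_def] by (intro continuous_intros)
 obtain K' x' y' where K': "path_connected K'" "K' \<subseteq> K" "x' \<in> K'" "sup_dist p x' = i" "y' \<in> K'" "sup_dist p y' = b" "!!z. z \<in> K' ==> i <= sup_dist p z \<and> sup_dist p z <= b"
  by (rule path_connected_between[OF K(1) K(3,4) K(5,6) sc]) (use ib in auto)
 have box: "\<bar>fst z - fst p\<bar> <= b" "\<bar>snd z - snd p\<bar> <= b" if "z \<in> K'" for z using K'(7)[OF that] by (auto simp: sup_dist_def)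
 have x': "\<bar>fst x' - fst p\<bar> <= i" "\<bar>snd x' - snd p\<bar> <= i" using K'(4) by (auto simp: sup_dist_def)
 have no: "L \<inter> L' = {}" if "L \<subseteq> K'" "L' \<subseteq> {z. l < g z}" for L L' using that K(2) K'(2) by fastforce
 have "fst y' = fst p + b \<or> fst y' = fst p - b \<or> snd y' = snd p + b \<or> snd y' = snd p - b"
  using K'(6) ib unfolding sup_dist_def by (auto simp: max_def abs_if split: if_splits)
 thus False
 proof (elim disjE)
  assume y: "fst y' = fst p + b"
  obtain L s t where L: "path_connected L" "L \<subseteq> K'" "s \<in> L" "fst s = fst p + i" "t \<in> L" "fst t = fst p + b" "!!z. z \<in> L ==> fst p + i <= fst z \<and> fst z <= fst p + b"
   by (rule path_connected_between[OF K'(1) K'(3), of fst "fst p + i" y' "fst p + b"]) (use x' y K'(5) ib in \<open>auto intro!: continuous_intros\<close>)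
  obtain V s' t' where V: "path_connected V" "V \<subseteq> {z. l < g z}" "V \<subseteq> rect (fst p + i) (fst p + b) (snd p - b) (snd p + b)" "s' \<in> V" "snd s' = snd p - b" "t' \<in> V" "snd t' = snd p + b"
   using r vcrossE[OF _ g o(1,2)] unfolding ring_def by (metis min_less_iff_conj)
  have "L \<subseteq> {fst p + i..fst p + b} \<times> {snd p - b..snd p + b}" using L(2,7) box(2) by (fastforce simp: abs_le_iff mem_Times_iff)
  from path_connected_meet[OF L(1) this L(3-6) V(1) V(3)[unfolded rect_def] V(4-7)] no[OF L(2) V(2)] show False by simp
 next
  assume y: "fst y' = fst p - b"
  obtain L s t where L: "path_connected L" "L \<subseteq> K'" "s \<in> L" "- fst s = i - fst p" "t \<in> L" "- fst t = b - fst p" "!!z. z \<in> L ==> i - fst p <= - fst z \<and> - fst z <= b - fst p"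
   by (rule path_connected_between[OF K'(1) K'(3), of "%z. - fst z" "i - fst p" y' "b - fst p"]) (use x' y K'(5) ib in \<open>auto intro!: continuous_intros\<close>)
  obtain V s' t' where V: "path_connected V" "V \<subseteq> {z. l < g z}" "V \<subseteq> rect (fst p - b) (fst p - i) (snd p - b) (snd p + b)" "s' \<in> V" "snd s' = snd p - b" "t' \<in> V" "snd t' = snd p + b"
   using r vcrossE[OF _ g o(3,2)] unfolding ring_def by (metis min_less_iff_conj)
  have "L \<subseteq> {fst p - b..fst p - i} \<times> {snd p - b..snd p + b}" using L(2,7) box(2) by (fastforce simp: abs_le_iff mem_Times_iff)
  from path_connected_meet[OF L(1) this L(5) _ L(3) _ V(1) V(3)[unfolded rect_def] V(4-7)] no[OF L(2) V(2)] L(4,6) show False by simp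
 next
  assume y: "snd y' = snd p + b"
  obtain L s t where L: "path_connected L" "L \<subseteq> K'" "s \<in> L" "snd s = snd p + i" "t \<in> L" "snd t = snd p + b" "!!z. z \<in> L ==> snd p + i <= snd z \<and> snd z <= snd p + b"
   by (rule path_connected_between[OF K'(1) K'(3), of snd "snd p + i" y' "snd p + b"]) (use x' y K'(5) ib in \<open>auto intro!: continuous_intros\<close>)
  obtain V s' t' where V: "path_connected V" "V \<subseteq> {z. l < g z}" "V \<subseteq> rect (fst p - b) (fst p + b) (snd p + i) (snd p + b)" "s' \<in> V" "fst s' = fst p - b" "t' \<in> V" "fst t' = fst p + b"
   using r hcrossE[OF _ g o(4,5)] unfolding ring_def by (metis min_less_iff_conj)
  have "L \<subseteq> {fst p - b..fst p + b} \<times> {snd p + i..snd p + b}" using L(2,7) box(1) by (fastforce simp: abs_le_iff mem_Times_iff)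
  from path_connected_meet[OF V(1) V(3)[unfolded rect_def] V(4-7) L(1) this L(3-6)] no[OF L(2) V(2)] show False by (simp add: Int_commute)
 next
  assume y: "snd y' = snd p - b"
  obtain L s t where L: "path_connected L" "L \<subseteq> K'" "s \<in> L" "- snd s = i - snd p" "t \<in> L" "- snd t = b - snd p" "!!z. z \<in> L ==> i - snd p <= - snd z \<and> - snd z <= b - snd p"
   by (rule path_connected_between[OF K'(1) K'(3), of "%z. - snd z" "i - snd p" y' "b - snd p"]) (use x' y K'(5) ib in \<open>auto intro!: continuous_intros\<close>)
  obtain V s' t' where V: "path_connected V" "V \<subseteq> {z. l < g z}" "V \<subseteq> rect (fst p - b) (fst p + b) (snd p - b) (snd p - i)" "s' \<in> V" "fst s' = fst p - b" "t' \<in> V" "fst t' = fst p + b"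
   using r hcrossE[OF _ g o(4,6)] unfolding ring_def by (metis min_less_iff_conj)
  have "L \<subseteq> {fst p - b..fst p + b} \<times> {snd p - b..snd p - i}" using L(2,7) box(1) by (fastforce simp: abs_le_iff mem_Times_iff)
  from path_connected_meet[OF V(1) V(3)[unfolded rect_def] V(4-7) L(1) this L(5) _ L(3)] no[OF L(2) V(2)] L(4,6) show False by (simp add: Int_commute)
 qed
qed

lemma hcross_narrow:
 assumes "hcross 0 w 0 h g > l" "continuous_on UNIV g" "0 <= w'" "w' <= w" "0 <= h"
 shows "hcross 0 w' 0 h g > l"
proof -
 have w: "0 <= w" using assms by simp
 obtain K x y where K: "path_connected K" "K \<subseteq> {x. l < g x}" "K \<subseteq> rect 0 w 0 h" "x \<in> K" "fst x = 0" "y \<in> K" "fst y = w"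
  using hcrossE[OF assms(1,2) w assms(5)] by blast
 show ?thesis
  by (rule hcrossI[OF K(1,2,4) _ K(6) _ subset_rect_snd[OF K(3)] assms(2,3)]) (use K assms in auto)
qed

context planar_field
begin

text \<open>
 A ring made of thin strips whose vertical parts are slightly too long lies, after any small downward
 translation, in the ring of thick strips.
\<close>

lemma ring_expectation:
 assumes c: "0 < c" and \<epsilon>: "0 < \<epsilon>"
 obtains m :: nat where "!!p i b h w. real m <= h ==> 0 < h ==> 0 <= i ==> b = i + 2 * h ==> 2 * b + h <= w ==>
  likely l (hcross 0 w 0 h) c ==> l - \<epsilon> <= mean (%n. ring p i b (f n))"
proof -
 \<comment> \<open>Positive association of the four strip crossings gives the fourth power of
   \<open>c\<close>.\<close>
 have c4: "0 < c * c * (c * c)" using c by simp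
 obtain m where m: "!!T S Th Sh l. maxmin T S ==> maxmin Th Sh ==>
  (!!g u. continuous_on UNIV g ==> u < m ==> Th g <= T (%v. g (v + (0, real u)))) ==>
  c * c * (c * c) <= \<P>(n in M. Th (f n) > l) ==> l - \<epsilon> <= mean (%n. T (f n))"
  by (rule vertical_sprinkling[OF \<epsilon> c4]) blast
 show ?thesis
 proof (rule that)
  fix p :: "plane" and i b h w :: real
  assume mh: "real m <= h" and h: "0 < h" and i: "0 <= i" and b: "b = i + 2 * h" and w: "2 * b + h <= w" and lk: "likely l (hcross 0 w 0 h) c"
  define p1 p2 where "p1 = fst p" and "p2 = snd p"
  have p: "p = (p1, p2)" by (simp add: p1_def p2_def)
  have h0: "0 <= h" "0 <= 2 * b" "2 * b <= w" "0 <= 2 * b + h" using h i b w by auto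
  have nar: "likely l (hcross 0 w' 0 h) c" if "0 <= w'" "w' <= w" for w'
   by (rule likely_mono[OF lk maxmin_hcross]) (use that h in \<open>auto intro: hcross_narrow\<close>)
  have H: "likely l (hcross (p1 - b) (p1 + b) y (y + h)) c" for y
  proof -
   have e: "0 + (p1 - b) = p1 - b" "2 * b + (p1 - b) = p1 + b" "0 + y = y" "h + y = y + h" by simp_all
   show ?thesis using likely_hcross_image(1)[OF nar[OF h0(2,3)] h0(2,1), of "p1 - b" y] unfolding e .
  qed
  have V: "likely l (vcross x (x + h) (p2 - b) (p2 + b + h)) c" for x
  proof -
   have e: "0 + (p2 - b) = p2 - b" "2 * b + h + (p2 - b) = p2 + b + h" "0 + x = x" "h + x = x + h" by simp_all
   have "likely l (hcross (p2 - b) (p2 + b + h) x (x + h)) c"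
    using likely_hcross_image(1)[OF nar[OF h0(4) w] h0(4,1), of "p2 - b" x] unfolding e .
   from likely_hcross_image(2)[OF this] show ?thesis using h i b by simp
  qed
  \<comment> \<open>Strips of width \<open>h\<close> inside those of width
    \<open>b - i = 2 * h\<close>. The horizontal ones occupy the upper halves and the vertical ones
    are longer by \<open>h\<close> at the top, which leaves room for a downward shift by at most
    \<open>h\<close>.\<close>
  let ?Th = "%g. min (min (vcross (p1 + i) (p1 + i + h) (p2 - b) (p2 + b + h) g) (vcross (p1 - b) (p1 - b + h) (p2 - b) (p2 + b + h) g))
   (min (hcross (p1 - b) (p1 + b) (p2 + i + h) (p2 + i + h + h) g) (hcross (p1 - b) (p1 + b) (p2 - b + h) (p2 - b + h + h) g))"
  have Th: "likely l ?Th (c * c * (c * c))" using c by (intro likely_min H V) auto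
  then obtain Sh where Sh: "maxmin ?Th Sh" "c * c * (c * c) <= \<P>(n in M. ?Th (f n) > l)" unfolding likely_def by blast
  show "l - \<epsilon> <= mean (%n. ring p i b (f n))"
  proof (rule m[OF maxmin_ring Sh(1) _ Sh(2)])
   fix g :: "plane => real" and u assume g: "continuous_on UNIV g" and u: "u < m"
   have u': "0 <= real u" "real u <= h" using u mh by auto
   define g' where "g' v = g (v + (0, real u))" for v
   have gc: "continuous_on UNIV g'" unfolding g'_def by (rule continuous_on_compose2[OF g]) (auto intro!: continuous_intros)
   let ?t = "%v. v + (0, - real u)"
   have tr: "path_connected (?t ` K)" "?t ` K \<subseteq> {x. k < g' x}" if "path_connected K" "K \<subseteq> {x. k < g x}" for K k
    using that by (auto simp: g'_def intro!: path_connected_continuous_image continuous_intros)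
   have vc: "vcross x1 x2 (p2 - b) (p2 + b) g' > k" if cr: "vcross x (x + h) (p2 - b) (p2 + b + h) g > k" and le: "x1 <= x" "x + h <= x2" for x x1 x2 k
   proof -
    have o: "x <= x + h" "p2 - b <= p2 + b + h" using h0 h by auto
    obtain K s t where K: "path_connected K" "K \<subseteq> {x. k < g x}" "K \<subseteq> rect x (x + h) (p2 - b) (p2 + b + h)" "s \<in> K" "snd s = p2 - b" "t \<in> K" "snd t = p2 + b + h"
     using vcrossE[OF cr g o(1,2)] by blast
    have "?t ` K \<subseteq> {z. x1 <= fst z \<and> fst z <= x2}"
    proof (rule image_subsetI)
     fix z assume "z \<in> K"
     hence "z \<in> rect x (x + h) (p2 - b) (p2 + b + h)" using K(3) by blast
     thus "?t z \<in> {z. x1 <= fst z \<and> fst z <= x2}" using le u' by (simp add: mem_rect)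
    qed
    from vcrossI[OF tr[OF K(1,2)] imageI[OF K(4)] _ imageI[OF K(6)] _ this gc] show ?thesis using K(5,7) u' h0 by simp
   qed
   have hc: "hcross (p1 - b) (p1 + b) y1 y2 g' > k" if cr: "hcross (p1 - b) (p1 + b) y (y + h) g > k" and le: "y1 + h <= y" "y + h <= y2" for y y1 y2 k
   proof -
    have o: "y <= y + h" "p1 - b <= p1 + b" using h0 h by auto
    obtain K s t where K: "path_connected K" "K \<subseteq> {x. k < g x}" "K \<subseteq> rect (p1 - b) (p1 + b) y (y + h)" "s \<in> K" "fst s = p1 - b" "t \<in> K" "fst t = p1 + b"
     using hcrossE[OF cr g o(2,1)] by blast
    have "?t ` K \<subseteq> {z. y1 <= snd z \<and> snd z <= y2}"
    proof (rule image_subsetI)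
     fix z assume "z \<in> K"
     hence "z \<in> rect (p1 - b) (p1 + b) y (y + h)" using K(3) by blast
     thus "?t z \<in> {z. y1 <= snd z \<and> snd z <= y2}" using le u' by (simp add: mem_rect)
    qed
    from hcrossI[OF tr[OF K(1,2)] imageI[OF K(4)] _ imageI[OF K(6)] _ this gc] show ?thesis using K(5,7) u' h0 by simp
   qed
   have "?Th g <= ring p i b g'"
   proof (rule dense_le)
    fix k assume k: "k < ?Th g"
    have "k < ring p i b g'" unfolding ring_def p fst_conv snd_conv min_less_iff_conj
     using k vc[of k "p1 + i" "p1 + i" "p1 + b"] vc[of k "p1 - b" "p1 - b" "p1 - i"] hc[of k "p2 + i + h" "p2 + i" "p2 + b"] hc[of k "p2 - b + h" "p2 - b" "p2 - i"] b h
     by simp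
    thus "k <= ring p i b g'" by simp
   qed
   thus "?Th g <= ring p i b (%v. g (v + (0, real u)))" unfolding g'_def .
  qed (use i b h in auto)
 qed
qed

end

section \<open>Nested rings on a lattice of cells\<close>

definition cell_center :: "real => int \<times> int => plane" where
 "cell_center a z = (a * of_int (fst z), a * of_int (snd z))"

text \<open>The rings of a cell reach at most 3/2 cell sides from its centre, so rings of cells at
  index distance 5 or more are at least two cell sides apart.\<close>

definition spaced :: "(int \<times> int) set => bool" where
 "spaced Z \<longleftrightarrow> (\<forall>z\<in>Z. \<forall>z'\<in>Z. z \<noteq> z' \<longrightarrow> 5 <= max \<bar>fst z - fst z'\<bar> \<bar>snd z - snd z'\<bar>)"

text \<open>Cells have side \<open>2 * K * u\<close>. For numbers from 0 to \<open>K - 1\<close> the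
  annuli have thickness \<open>u\<close> and gaps of width \<open>u\<close>; the innermost surrounds
  the cell, whose half side is \<open>K * u\<close>, and the outermost stays within
  \<open>3 * K * u\<close>.\<close>

definition nested_annulus :: "nat => real => (int \<times> int) \<times> int => plane set" where
 "nested_annulus K u j = annulus (cell_center (2 * real K * u) (fst j)) ((real K + 2 * real_of_int (snd j)) * u) ((real K + 2 * real_of_int (snd j) + 1) * u)"

definition nested_ring :: "nat => real => (int \<times> int) \<times> int => (plane => real) => real" where
 "nested_ring K u j = ring (cell_center (2 * real K * u) (fst j)) ((real K + 2 * real_of_int (snd j)) * u) ((real K + 2 * real_of_int (snd j) + 1) * u)"

text \<open>A bound by the sum of the differences of the three indices. As a product of geometric
  factors it has sums at most \<open>lattice_sum\<close>, whatever \<open>K\<close>,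
  \<open>u\<close> and the set of cells are. The constant \<open>1 / 2\<close> comes from
  \<open>x - 1 / 2 <= x ^ 2 / 2\<close>.\<close>

definition lattice_cov :: "(int \<times> int) \<times> int => (int \<times> int) \<times> int => real" where
 "lattice_cov i j = exp (1 / 2) * (exp (- 1) ^ nat \<bar>fst (fst j) - fst (fst i)\<bar> * exp (- 1) ^ nat \<bar>snd (fst j) - snd (fst i)\<bar> * exp (- 1) ^ nat \<bar>snd j - snd i\<bar>)"

definition lattice_sum :: real where "lattice_sum = exp (1 / 2) * (2 / (1 - exp (- 1))) ^ 3"

lemma lattice_sum_pos: "0 < lattice_sum" unfolding lattice_sum_def by (intro mult_pos_pos zero_less_power) auto

lemma lattice_cov_sum:
 assumes I: "finite I"
 shows "(\<Sum>j\<in>I. lattice_cov i j) <= lattice_sum"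
proof -
 let ?A = "fst ` fst ` I" and ?B = "snd ` fst ` I" and ?C = "snd ` I"
 let ?g = "%k j. exp (- 1 :: real) ^ nat \<bar>j - k\<bar>"
 have s: "(\<Sum>j\<in>J. ?g k j) <= 2 / (1 - exp (- 1))" if "finite J" for J and k :: int
  by (intro sum_geometric_int that) auto
 have "(\<Sum>j\<in>I. lattice_cov i j) <= (\<Sum>j\<in>(?A \<times> ?B) \<times> ?C. lattice_cov i j)"
  by (rule sum_mono2) (use I in \<open>force simp: lattice_cov_def\<close>)+
 also have "... = exp (1 / 2) * ((\<Sum>x\<in>?A. ?g (fst (fst i)) x) * (\<Sum>y\<in>?B. ?g (snd (fst i)) y) * (\<Sum>k\<in>?C. ?g (snd i) k))"
  unfolding lattice_cov_def by (simp only: sum.cartesian_product' fst_conv snd_conv sum_distrib_left[symmetric] sum_distrib_right[symmetric])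
 also have "... <= exp (1 / 2) * (2 / (1 - exp (- 1)) * (2 / (1 - exp (- 1))) * (2 / (1 - exp (- 1))))"
  using I by (intro mult_left_mono mult_mono s) (auto intro!: sum_nonneg mult_nonneg_nonneg)
 finally show ?thesis by (simp add: lattice_sum_def power3_eq_cube)
qed

text \<open>Around one cell, rings whose numbers differ by \<open>d >= 1\<close> are at least
  \<open>(2 * d - 1) * u >= d\<close> apart. Around cells at index distance \<open>m >= 5\<close>
  the gap is at least \<open>2 * K * u * (m - 3)\<close>. This dominates \<open>2 * m + K\<close>,
  because \<open>m - 3 >= 2 / 5 * m\<close> and \<open>u >= 5\<close>.\<close>

lemma nested_annulus_dist:
 assumes K: "1 <= K" and u: "5 <= u" and k: "snd i \<in> {0..<int K}" "snd j \<in> {0..<int K}" and Z: "spaced Z" "fst i \<in> Z" "fst j \<in> Z"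
  and v: "v \<in> nested_annulus K u i" and w: "w \<in> nested_annulus K u j"
 shows "real_of_int (\<bar>fst (fst j) - fst (fst i)\<bar> + \<bar>snd (fst j) - snd (fst i)\<bar> + \<bar>snd j - snd i\<bar>) <= norm (v - w)"
proof -
 define p q where "p = cell_center (2 * real K * u) (fst i)" and "q = cell_center (2 * real K * u) (fst j)"
 have V: "(real K + 2 * real_of_int (snd i)) * u <= sup_dist p v" "sup_dist p v <= (real K + 2 * real_of_int (snd i) + 1) * u" using v by (auto simp: nested_annulus_def annulus_def p_def)
 have W: "(real K + 2 * real_of_int (snd j)) * u <= sup_dist q w" "sup_dist q w <= (real K + 2 * real_of_int (snd j) + 1) * u" using w by (auto simp: nested_annulus_def annulus_def q_def)
 define n where "n = norm (v - w)"
 have n1: "sup_dist p v <= sup_dist p w + n" "sup_dist p w <= sup_dist p v + n"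
  using sup_dist_le(1)[of p v w] sup_dist_le(1)[of p w v] by (auto simp: n_def norm_minus_commute)
 show ?thesis
 proof (cases "fst i = fst j")
  case True
  hence pq: "q = p" by (simp add: p_def q_def)
  have gap: "real_of_int (y - x) <= n" if "(real K + 2 * real_of_int y) * u <= (real K + 2 * real_of_int x + 1) * u + n" "x < y" for x y :: int
  proof -
   have "real_of_int (y - x) <= (2 * real_of_int (y - x) - 1) * 1" using that(2) by simp
   also have "... <= (2 * real_of_int (y - x) - 1) * u" using that(2) u by (intro mult_left_mono) auto
   also have "... <= n" using that(1) by (simp add: algebra_simps)
   finally show ?thesis .
  qed
  have "real_of_int \<bar>snd j - snd i\<bar> <= n"
  proof (cases "snd i" "snd j" rule: linorder_cases)
   case less
   thus ?thesis using gap[of "snd j" "snd i"] V W n1 pq by auto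
  next
   case greater
   thus ?thesis using gap[of "snd i" "snd j"] V W n1 pq by auto
  qed (auto simp: n_def)
  thus ?thesis using True by (simp add: n_def)
 next
  case False
  define m where "m = real_of_int (max \<bar>fst (fst i) - fst (fst j)\<bar> \<bar>snd (fst i) - snd (fst j)\<bar>)"
  have m5: "5 <= m" using Z False unfolding spaced_def m_def by (metis of_int_le_iff of_int_numeral)
  have a0: "0 <= 2 * real K * u" using u by simp
  have e: "\<bar>2 * real K * u * of_int x - 2 * real K * u * of_int y\<bar> = 2 * real K * u * \<bar>real_of_int y - of_int x\<bar>" for x y
  proof -
   have "2 * real K * u * of_int x - 2 * real K * u * of_int y = (2 * real K * u) * (of_int x - of_int y)" by (rule right_diff_distrib[symmetric])
   also have "\<bar>...\<bar> = 2 * real K * u * \<bar>real_of_int y - of_int x\<bar>" unfolding abs_mult[of "2 * real K * u"] abs_of_nonneg[OF a0] abs_minus_commute[of "real_of_int x"] ..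
   finally show ?thesis .
  qed
  have "2 * real K * u * m = sup_dist p q"
   unfolding sup_dist_def p_def q_def cell_center_def fst_conv snd_conv e m_def of_int_max of_int_abs of_int_diff
   using a0 by (simp only: max_mult_distrib_left if_True)
  also have "... <= sup_dist p w + sup_dist q w" by (rule sup_dist_le(2))
  also have "... <= (real K + 2 * real_of_int (snd i) + 1) * u + n + (real K + 2 * real_of_int (snd j) + 1) * u" using V W n1 by linarith
  also have "... <= 3 * real K * u + n + 3 * real K * u"
   using k u by (intro add_mono mult_right_mono) auto
  finally have 1: "2 * real K * u * (m - 3) <= n" by (simp add: algebra_simps)
  have "2 * m + real K <= 4 * real K * m"
  proof -
   have "2 * m * 1 + real K * 1 <= 2 * m * real K + real K * (2 * m)" using K m5 by (intro add_mono mult_left_mono) auto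
   thus ?thesis by (simp add: algebra_simps)
  qed
  also have "... = 2 * real K * 5 * (2 / 5 * m)" by simp
  also have "... <= 2 * real K * u * (m - 3)" by (rule mult_mono[OF mult_left_mono[OF u]]) (use u m5 in auto)
  also note 1
  finally have "2 * m + real K <= n" .
  moreover have "real_of_int (\<bar>fst (fst j) - fst (fst i)\<bar> + \<bar>snd (fst j) - snd (fst i)\<bar> + \<bar>snd j - snd i\<bar>) <= 2 * m + real K"
  proof -
   have "\<bar>fst (fst j) - fst (fst i)\<bar> + \<bar>snd (fst j) - snd (fst i)\<bar> + \<bar>snd j - snd i\<bar> <= 2 * max \<bar>fst (fst i) - fst (fst j)\<bar> \<bar>snd (fst i) - snd (fst j)\<bar> + int K"
   proof -
    have "\<bar>fst (fst j) - fst (fst i)\<bar> <= max \<bar>fst (fst i) - fst (fst j)\<bar> \<bar>snd (fst i) - snd (fst j)\<bar>"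
     "\<bar>snd (fst j) - snd (fst i)\<bar> <= max \<bar>fst (fst i) - fst (fst j)\<bar> \<bar>snd (fst i) - snd (fst j)\<bar>"
     by (simp_all add: abs_minus_commute)
    moreover have "\<bar>snd j - snd i\<bar> <= int K" using k by auto
    moreover have "A + B + C <= 2 * X + Y" if "A <= X" "B <= X" "C <= Y" for A B C X Y :: int using that by simp
    ultimately show ?thesis by blast
   qed
   hence "real_of_int (\<bar>fst (fst j) - fst (fst i)\<bar> + \<bar>snd (fst j) - snd (fst i)\<bar> + \<bar>snd j - snd i\<bar>) <= real_of_int (2 * max \<bar>fst (fst i) - fst (fst j)\<bar> \<bar>snd (fst i) - snd (fst j)\<bar> + int K)"
    by (simp only: of_int_le_iff)
   thus ?thesis by (simp only: m_def of_int_add of_int_mult of_int_of_nat_eq of_int_numeral)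
  qed
  ultimately show ?thesis by (simp add: n_def)
 qed
qed

lemma nested_annulus_cov:
 assumes "1 <= K" "5 <= u" "snd i \<in> {0..<int K}" "snd j \<in> {0..<int K}" "spaced Z" "fst i \<in> Z" "fst j \<in> Z"
  "v \<in> nested_annulus K u i" "w \<in> nested_annulus K u j"
 shows "bf_cov v w <= lattice_cov i j"
proof -
 define D where "D = nat \<bar>fst (fst j) - fst (fst i)\<bar> + nat \<bar>snd (fst j) - snd (fst i)\<bar> + nat \<bar>snd j - snd i\<bar>"
 have n: "real D <= norm (v - w)" using nested_annulus_dist[OF assms] by (simp add: D_def)
 have "0 <= (norm (v - w) - 1)\<^sup>2" by simp
 hence "norm (v - w) - 1 / 2 <= (norm (v - w))\<^sup>2 / 2" by (simp add: power2_eq_square algebra_simps)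
 hence "- (norm (v - w))\<^sup>2 / 2 <= 1 / 2 + real D * (- 1)" using n by simp
 hence "bf_cov v w <= exp (1 / 2 + real D * (- 1))" unfolding bf_cov_def by (simp only: exp_le_cancel_iff)
 thus ?thesis unfolding exp_add exp_of_nat_mult D_def lattice_cov_def by (simp add: power_add mult.assoc)
qed

text \<open>Each cell contributes \<open>K\<close> rings, and the covariances of all rings are
  summed by a constant independent of \<open>K\<close>. Nesting thus multiplies the exponent by
  \<open>K\<close> without using more cells.\<close>

lemma (in planar_field) spaced_rings_bound:
 fixes e t :: real
 assumes K: "1 <= K" and u: "5 <= u" and Z: "finite Z" "spaced Z" and t: "0 <= t"
  and E: "!!j. snd j \<in> {0..<int K} ==> e <= mean (%z. nested_ring K u j (f z))"
 shows "\<P>(z in M. \<forall>j\<in>Z \<times> {0..<int K}. nested_ring K u j (f z) <= e - t) <= exp (- (card Z * K) * t\<^sup>2 / (2 * lattice_sum))"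
proof -
 let ?I = "Z \<times> {0..<int K}"
 have T: "maxmin (nested_ring K u j) (nested_annulus K u j)" if "j \<in> ?I" for j
  unfolding nested_ring_def nested_annulus_def using that u by (intro maxmin_ring) (auto intro!: mult_nonneg_nonneg)
 note [measurable] = maxmin_measurable[OF T]
 have I: "finite ?I" using Z by simp
 have "\<P>(z in M. \<forall>j\<in>?I. nested_ring K u j (f z) <= e - t) <= \<P>(z in M. \<forall>j\<in>?I. nested_ring K u j (f z) <= mean (%z. nested_ring K u j (f z)) - t)"
 proof (rule finite_measure_mono)
  show "{z \<in> space M. \<forall>j\<in>?I. nested_ring K u j (f z) <= e - t} \<subseteq> {z \<in> space M. \<forall>j\<in>?I. nested_ring K u j (f z) <= mean (%z. nested_ring K u j (f z)) - t}"
  proof (intro subsetI CollectI conjI ballI)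
   fix z j assume "z \<in> {z \<in> space M. \<forall>j\<in>?I. nested_ring K u j (f z) <= e - t}" "j \<in> ?I"
   hence "nested_ring K u j (f z) <= e - t" "snd j \<in> {0..<int K}" by (blast, simp only: mem_Times_iff)
   thus "nested_ring K u j (f z) <= mean (%z. nested_ring K u j (f z)) - t"
    using E[of j] by linarith
  qed auto
  show "{z \<in> space M. \<forall>j\<in>?I. nested_ring K u j (f z) <= mean (%z. nested_ring K u j (f z)) - t} \<in> sets M"
   using I by measurable
 qed
 also have "... <= exp (- card ?I * t\<^sup>2 / (2 * lattice_sum))"
 proof (rule maxmin_concentration[OF I T, where c=lattice_cov])
  show "bf_cov v w <= lattice_cov i j" if "i \<in> ?I" "j \<in> ?I" "v \<in> nested_annulus K u i" "w \<in> nested_annulus K u j" for i j v w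
   by (rule nested_annulus_cov[OF K u _ _ Z(2)]) (use that in auto)
 qed (use I t lattice_cov_sum lattice_sum_pos in \<open>auto simp: lattice_cov_def\<close>)
 finally show ?thesis by (simp add: card_cartesian_product)
qed

text \<open>Pigeonhole over the 25 classes of cells modulo 5: distinct cells of one class differ by
  at least 5 in some coordinate.\<close>

lemma spaced_subset:
 assumes X: "finite X"
 obtains Z where "Z \<subseteq> X" "spaced Z" "card X <= 25 * card Z"
proof -
 define C where "C r = {z \<in> X. (fst z mod 5, snd z mod 5) = r}" for r
 let ?R = "{0..<5} \<times> {0..<5} :: (int \<times> int) set"
 have "X = (\<Union>r\<in>?R. C r)" by (auto simp: C_def)
 hence le: "card X <= (\<Sum>r\<in>?R. card (C r))" using card_UN_le[of ?R C] by simp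
 have "\<exists>r\<in>?R. card X <= 25 * card (C r)"
 proof (rule ccontr)
  assume "\<not> ?thesis"
  hence "(\<Sum>r\<in>?R. 25 * card (C r)) < (\<Sum>r\<in>?R. card X)" by (intro sum_strict_mono) (auto simp: not_le)
  thus False using le by (simp add: sum_distrib_left[symmetric])
 qed
 then obtain r where r: "card X <= 25 * card (C r)" by blast
 have "spaced (C r)" unfolding spaced_def
 proof (intro ballI impI)
  fix z z' assume z: "z \<in> C r" "z' \<in> C r" "z \<noteq> z'"
  have d: "5 <= \<bar>x - y\<bar>" if "x mod 5 = y mod 5" "x \<noteq> y" for x y :: int
  proof -
   have "5 dvd (x - y)" using that(1) by (simp add: mod_eq_dvd_iff)
   thus ?thesis using dvd_imp_le_int[of "x - y" 5] that(2) by simp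
  qed
  have "fst z mod 5 = fst z' mod 5" "snd z mod 5 = snd z' mod 5" using z by (auto simp: C_def)
  thus "5 <= max \<bar>fst z - fst z'\<bar> \<bar>snd z - snd z'\<bar>" using d z(3) by (cases "fst z = fst z'") (auto simp: prod_eq_iff le_max_iff_disj)
 qed
 thus ?thesis by (rule that[rotated]) (use r in \<open>auto simp: C_def\<close>)
qed

section \<open>Walks of cells along a crossing\<close>

fun walks :: "nat => int \<times> int => (int \<times> int) list set" where
 "walks 0 z = {[z]}"
| "walks (Suc n) z = (\<Union>d\<in>{-1..1} \<times> {-1..1}. (#) z ` walks n (z + d))"

lemma walks: "finite (walks n z)" "card (walks n z) <= 9 ^ n" "zs \<in> walks n z ==> length zs = Suc n"
proof -
 have "finite (walks n z) \<and> card (walks n z) <= 9 ^ n \<and> (\<forall>zs\<in>walks n z. length zs = Suc n)"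
 proof (induction n arbitrary: z)
  case (Suc n)
  let ?D = "{-1..1} \<times> {-1..1} :: (int \<times> int) set"
  have "card (walks (Suc n) z) <= (\<Sum>d\<in>?D. card ((#) z ` walks n (z + d)))" unfolding walks.simps by (rule card_UN_le) simp
  also have "... <= (\<Sum>d\<in>?D. 9 ^ n)" using Suc by (intro sum_mono order_trans[OF card_image_le]) auto
  finally have "card (walks (Suc n) z) <= 9 ^ Suc n" by simp
  thus ?case using Suc by auto
 qed simp
 thus "finite (walks n z)" "card (walks n z) <= 9 ^ n" "zs \<in> walks n z ==> length zs = Suc n" by auto
qed

lemma map_in_walks: "(!!j. j < n ==> h (Suc j) - h j \<in> {-1..1} \<times> {-1..1}) ==> map h [0..<Suc n] \<in> walks n (h 0)"
proof (induction n arbitrary: h)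
 case (Suc n)
 have 1: "h 1 = h 0 + (h 1 - h 0)" "h 1 - h 0 \<in> {-1..1} \<times> {-1..1}" using Suc.prems[of 0] by auto
 have "map (%j. h (Suc j)) [0..<Suc n] \<in> walks n (h 1)" using Suc.IH[of "%j. h (Suc j)"] Suc.prems by simp
 hence "h 0 # map (%j. h (Suc j)) [0..<Suc n] \<in> (#) (h 0) ` walks n (h 0 + (h 1 - h 0))" by simp
 hence "h 0 # map (%j. h (Suc j)) [0..<Suc n] \<in> walks (Suc n) (h 0)" unfolding walks.simps by (rule UN_I[OF 1(2)])
 thus ?case by (simp only: map_upt_Suc)
qed simp

definition cell_of :: "real => plane => int \<times> int" where
 "cell_of a v = (round (fst v / a), round (snd v / a))"

lemma cell_of_dist: "0 < a ==> sup_dist (cell_center a (cell_of a v)) v <= a / 2"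
proof -
 assume a: "0 < a"
 have c: "\<bar>x - a * of_int (round (x / a))\<bar> <= a / 2" for x
 proof -
  have "x - a * of_int (round (x / a)) = a * (x / a - of_int (round (x / a)))" using a by (simp add: right_diff_distrib)
  also have "\<bar>...\<bar> = a * \<bar>of_int (round (x / a)) - x / a\<bar>" using a by (simp add: abs_mult abs_minus_commute)
  also have "... <= a * (1 / 2)" using a of_int_round_abs_le by (intro mult_left_mono) auto
  finally show ?thesis by simp
 qed
 show ?thesis unfolding sup_dist_def cell_center_def cell_of_def fst_conv snd_conv by (intro max.boundedI c)
qed

text \<open>A shortest chain of adjacent visited cells is a self-avoiding walk.\<close>

lemma crossing_walk:
 assumes a: "0 < a" and K: "path_connected K" "x \<in> K" "snd x = 0" "y \<in> K" "snd y = R" and n: "int n <= round (R / a)"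
 obtains zs z where "z \<in> K" "snd z = 0" "zs \<in> walks n (cell_of a z)" "distinct zs" "set zs \<subseteq> cell_of a ` K"
proof -
 obtain g where g: "path g" "path_image g \<subseteq> K" "pathstart g = x" "pathfinish g = y" using K unfolding path_connected_def by blast
 have "uniformly_continuous_on {0..1} g" using g(1) by (intro compact_uniformly_continuous) (auto simp: path_def)
 then obtain e where e: "e > 0" "!!s t. s \<in> {0..1} ==> t \<in> {0..1} ==> dist s t < e ==> dist (g s) (g t) < a / 2"
  using a unfolding uniformly_continuous_on_def by (metis half_gt_zero)
 obtain N where N: "0 < N" "1 / real N < e" using real_arch_inverse[of e] e by (auto simp: inverse_eq_divide)
 define t where "t i = min 1 (real i / real N)" for i
 have t: "t i \<in> {0..1}" for i by (auto simp: t_def)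
 let ?Z = "cell_of a ` K" and ?D = "{-1..1} \<times> {-1..1} :: (int \<times> int) set"
 define E where "E = {(z, w). z \<in> ?Z \<and> w \<in> ?Z \<and> w - z \<in> ?D}"
 define c where "c i = cell_of a (g (t i))" for i
 have gK: "g (t i) \<in> K" for i using g(2) t[of i] by (auto simp: path_image_def)
 have rd: "round p - round q \<in> {-1..1}" if "\<bar>p - q\<bar> < 1" for p q :: real
 proof -
  have "real_of_int (round p - round q) < 2" "- 2 < real_of_int (round p - round q)"
   unfolding of_int_diff using that of_int_round_le[of p] of_int_round_le[of q] of_int_round_gt[of p] of_int_round_gt[of q] by linarith+
  thus ?thesis by simp
 qed
 have step: "(c i, c (Suc i)) \<in> E" for i
 proof -
  have "dist (t (Suc i)) (t i) <= 1 / real N" using N(1) by (auto simp: t_def dist_real_def min_def field_simps)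
  hence d: "dist (g (t (Suc i))) (g (t i)) < a / 2" using N(2) by (intro e(2) t) auto
  have "\<bar>h (g (t (Suc i))) / a - h (g (t i)) / a\<bar> < 1" if "h = fst \<or> h = snd" for h :: "plane => real"
  proof -
   have "\<bar>h (g (t (Suc i))) - h (g (t i))\<bar> <= dist (g (t (Suc i))) (g (t i))"
    using that dist_fst_le[of "g (t (Suc i))" "g (t i)"] dist_snd_le[of "g (t (Suc i))" "g (t i)"] by (auto simp: dist_real_def)
   thus ?thesis using d a by (simp add: diff_divide_distrib[symmetric] abs_divide pos_divide_less_eq)
  qed
  from rd[OF this[of fst]] rd[OF this[of snd]] have "c (Suc i) - c i \<in> ?D" by (auto simp: c_def cell_of_def)
  thus ?thesis unfolding E_def c_def using gK by blast
 qed
 have ex: "(c 0, c N) \<in> E ^^ N" unfolding relpow_fun_conv using step by (intro exI[of _ c]) auto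
 define m where "m = (LEAST m. (c 0, c N) \<in> E ^^ m)"
 have m: "(c 0, c N) \<in> E ^^ m" unfolding m_def using ex by (rule LeastI)
 have least: "m <= k" if "(c 0, c N) \<in> E ^^ k" for k unfolding m_def using that by (rule Least_le)
 obtain h where h: "h 0 = c 0" "h m = c N" "!!i. i < m ==> (h i, h (Suc i)) \<in> E" using m unfolding relpow_fun_conv by blast
 \<comment> \<open>Between two visits to the same cell the chain could be shortened, against
   minimality.\<close>
 have inj: "h i \<noteq> h j" if "i < j" "j <= m" for i j
 proof
  assume eq: "h i = h j"
  have "(c 0, h i) \<in> E ^^ i" unfolding relpow_fun_conv using h that by (intro exI[of _ h]) auto
  moreover have "(h j, c N) \<in> E ^^ (m - j)" unfolding relpow_fun_conv using h that by (intro exI[of _ "%k. h (k + j)"]) auto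
  ultimately have "(c 0, c N) \<in> E ^^ (i + (m - j))" unfolding relpow_add using eq by auto
  from least[OF this] show False using that by simp
 qed
 have t0: "g (t 0) = x" "g (t N) = y" using N(1) g(3,4) by (auto simp: t_def pathstart_def pathfinish_def)
 \<comment> \<open>The chain starts in row 0 and rises by at most one row per step, so it has at
   least \<open>round (R / a)\<close> steps; the first \<open>n\<close> of them are kept.\<close>
 have "snd (h i) <= int i" if "i <= m" for i using that
 proof (induction i)
  case 0 thus ?case using h(1) t0 K(3) by (simp add: c_def cell_of_def)
 next
  case (Suc i)
  hence "h (Suc i) - h i \<in> ?D" using h(3)[of i] by (simp add: E_def)
  hence "snd (h (Suc i)) - snd (h i) <= 1" by (auto simp: mem_Times_iff)
  thus ?case using Suc by simp
 qed
 from this[of m] have "round (R / a) <= int m" using h(2) t0 K(5) by (simp add: c_def cell_of_def)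
 hence nm: "n <= m" using n by simp
 have "map h [0..<Suc n] \<in> walks n (h 0)" by (rule map_in_walks) (use h(3) nm in \<open>auto simp: E_def\<close>)
 moreover have "distinct (map h [0..<Suc n])"
 proof -
  have "inj_on h {0..<Suc n}"
  proof (rule inj_onI, rule ccontr)
   fix i j assume ij: "i \<in> {0..<Suc n}" "j \<in> {0..<Suc n}" "h i = h j" "i \<noteq> j"
   show False using inj[of i j] inj[of j i] ij nm by (cases "i < j") auto
  qed
  thus ?thesis by (simp only: distinct_map distinct_upt set_upt)
 qed
 moreover have "h i \<in> ?Z" if "i <= n" for i
 proof (cases i)
  case 0 thus ?thesis using gK[of 0] h(1) by (simp add: c_def)
 next
  case (Suc j) thus ?thesis using h(3)[of j] nm that by (auto simp: E_def)
 qed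
 hence "set (map h [0..<Suc n]) \<subseteq> ?Z" by auto
 moreover have "h 0 = cell_of a x" using h(1) t0 by (simp add: c_def)
 ultimately show ?thesis using K by (intro that[of x "map h [0..<Suc n]"]) auto
qed

section \<open>The union bound over walks and the conclusion\<close>

context planar_field
begin

text \<open>The order of the choices matters: \<open>K\<close> comes from the concentration constant
  alone, then the aspect ratio \<open>A\<close> from \<open>K\<close>, the crossing probability
  \<open>c\<close> from \<open>A\<close>, the number \<open>m\<close> of translates from
  \<open>c\<close>, and last a scale \<open>h >= m\<close> at which long rectangles are
  crossed.\<close>

lemma ring_parameters:
 assumes p: "0 < p"
 obtains K :: nat and u where "1 <= K" "5 <= u" "200 * lattice_sum <= K * (p / 4)\<^sup>2"
  "!!j. snd j \<in> {0..<int K} ==> - (p / 2) <= mean (%z. nested_ring K u j (f z))"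
proof -
 define K where "K = nat \<lceil>200 * lattice_sum / (p / 4)\<^sup>2\<rceil> + 1"
 have "200 * lattice_sum / (p / 4)\<^sup>2 <= K" unfolding K_def by linarith
 hence K2: "200 * lattice_sum <= K * (p / 4)\<^sup>2" using p by (simp add: pos_divide_le_eq)
 have K1: "1 <= K" by (simp add: K_def)
 \<comment> \<open>The outer radius \<open>b\<close> of a ring is at most
   \<open>3 * K * (2 * h)\<close>, so the length \<open>2 * b + h\<close> required by
   \<open>ring_expectation\<close> is at most \<open>(12 * K + 1) * h\<close>.\<close>
 define A where "A = 12 * real K + 1"
 have l: "- (p / 4) < 0" and A: "0 < A" using p by (auto simp: A_def add_pos_pos)
 obtain c where c: "0 < c" "!!h0. \<exists>h\<ge>h0. h > 0 \<and> likely (- (p / 4)) (hcross 0 (A * h) 0 h) c"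
  using rsw[OF l A] by blast
 obtain m :: nat where m: "!!p' i b h w. real m <= h ==> 0 < h ==> 0 <= i ==> b = i + 2 * h ==> 2 * b + h <= w ==>
  likely (- (p / 4)) (hcross 0 w 0 h) c ==> - (p / 4) - p / 4 <= mean (%z. ring p' i b (f z))"
  by (rule ring_expectation[OF c(1), of "p / 4"]) (use p in \<open>simp, blast\<close>)
 obtain h where h: "max 3 (real m) <= h" "0 < h" "likely (- (p / 4)) (hcross 0 (A * h) 0 h) c" using c(2)[of "max 3 (real m)"] by blast
 show ?thesis
 proof (rule that[OF K1 _ K2, of "2 * h"])
  fix j :: "(int \<times> int) \<times> int" assume j: "snd j \<in> {0..<int K}"
  have "(real K + 2 * real_of_int (snd j) + 1) * (2 * h) <= (3 * real K) * (2 * h)" using j h by (intro mult_right_mono) auto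
  hence "2 * ((real K + 2 * real_of_int (snd j) + 1) * (2 * h)) + h <= A * h" by (simp add: A_def algebra_simps)
  moreover have "(real K + 2 * real_of_int (snd j) + 1) * (2 * h) = (real K + 2 * real_of_int (snd j)) * (2 * h) + 2 * h" by (simp add: algebra_simps)
  moreover have "0 <= (real K + 2 * real_of_int (snd j)) * (2 * h)" using j h by (intro mult_nonneg_nonneg) auto
  ultimately show "- (p / 2) <= mean (%z. nested_ring K (2 * h) j (f z))"
   using m[of h, OF _ h(2) _ _ _ h(3)] h(1) unfolding nested_ring_def by simp
 qed (use h in auto)
qed

text \<open>The union is over at most \<open>r * R / a0 + 2\<close> starting cells in row 0 and over
  \<open>9 ^ n <= exp (3 * n)\<close> walks. Each walk has probability at most
  \<open>exp (- 4 * (n + 1))\<close>, so a factor \<open>exp (- n)\<close> with \<open>n\<close>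
  close to \<open>R / a0\<close> remains.\<close>

lemma no_crossing_bound:
 assumes p: "0 < p" and K: "1 <= K" and u: "5 <= u" and K2: "200 * lattice_sum <= real K * (p / 4)\<^sup>2"
  and E: "!!j. snd j \<in> {0..<int K} ==> - (p / 2) <= mean (%s. nested_ring K u j (f s))"
  and R: "6 * real K * u <= R" and r: "0 < r" and a_def: "a0 = 2 * real K * u"
 shows "\<P>(s in M. \<not> - p < hcross 0 (r * R) 0 R (f s)) <= (r * R / a0 + 2) * exp (1 - R / a0)"
proof -
 have a0: "0 < a0" using K u by (simp add: a_def)
 have Ku: "0 < real K * u" using K u by simp
 have R0: "0 < R" using R Ku by linarith
 define n where "n = nat \<lfloor>R / a0\<rfloor>"
 define X where "X = round (r * R / a0)"
 define t where "t = p / 4"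
 have n: "int n <= round (R / a0)" "R / a0 - 1 <= real n"
 proof -
  have "0 <= R / a0" using R0 a0 by simp
  hence "int n = \<lfloor>R / a0\<rfloor>" unfolding n_def by simp
  thus "int n <= round (R / a0)" using floor_le_round[of "R / a0"] by simp
  show "R / a0 - 1 <= real n" unfolding n_def by linarith
 qed
 \<comment> \<open>One well-spaced subset is fixed for each list of cells, so that the event
   attached to a walk is determined by the walk.\<close>
 define Z where "Z zs = (SOME Z. Z \<subseteq> set zs \<and> spaced Z \<and> card (set zs) <= 25 * card Z)" for zs
 have Z: "Z zs \<subseteq> set zs" "spaced (Z zs)" "card (set zs) <= 25 * card (Z zs)" for zs
 proof -
  have "\<exists>Z. Z \<subseteq> set zs \<and> spaced Z \<and> card (set zs) <= 25 * card Z" by (rule spaced_subset[of "set zs"]) auto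
  from someI_ex[OF this] show "Z zs \<subseteq> set zs" "spaced (Z zs)" "card (set zs) <= 25 * card (Z zs)" unfolding Z_def by auto
 qed
 define W where "W = (SIGMA x:{0..X}. {zs \<in> walks n (x, 0). distinct zs})"
 define Ev where "Ev w = {s \<in> space M. \<forall>j\<in>Z (snd w) \<times> {0..<int K}. nested_ring K u j (f s) <= - (p / 2) - t}" for w :: "int \<times> (int \<times> int) list"
 have W: "finite W" unfolding W_def using walks(1) by (intro finite_SigmaI) auto
 have finZ: "finite (Z zs)" for zs using Z(1) finite_subset by blast
 have Evm: "Ev w \<in> sets M" for w
 proof -
  have "(%s. nested_ring K u j (f s)) \<in> rv M" if "j \<in> Z (snd w) \<times> {0..<int K}" for j
   unfolding nested_ring_def using that u by (intro maxmin_measurable[OF maxmin_ring]) (auto intro!: mult_nonneg_nonneg mult_right_mono)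
  thus ?thesis unfolding Ev_def using finZ[of "snd w"] by measurable
 qed
 \<comment> \<open>Spacing keeps at least \<open>(n + 1) / 25\<close> cells, and
   \<open>200 = 25 * 2 * 4\<close> leaves \<open>4 * (n + 1)\<close> in the exponent.\<close>
 have Evb: "prob (Ev w) <= exp (- 4 * (real n + 1))" if "w \<in> W" for w
 proof -
  have w: "snd w \<in> walks n (fst w, 0)" "distinct (snd w)" using that by (auto simp: W_def)
  have "card (set (snd w)) = Suc n" using walks(3)[OF w(1)] distinct_card[OF w(2)] by simp
  hence "real n + 1 <= 25 * real (card (Z (snd w)))" using Z(3)[of "snd w"] by simp
  hence "(real n + 1) * (200 * lattice_sum) <= 25 * real (card (Z (snd w))) * (real K * t\<^sup>2)"
   unfolding t_def using lattice_sum_pos by (intro mult_mono[OF _ K2]) auto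
  hence "4 * (real n + 1) <= card (Z (snd w)) * K * t\<^sup>2 / (2 * lattice_sum)" using lattice_sum_pos by (simp add: field_simps)
  moreover have "prob (Ev w) <= exp (- (card (Z (snd w)) * K) * t\<^sup>2 / (2 * lattice_sum))"
   unfolding Ev_def by (rule spaced_rings_bound[OF K u finZ Z(2) _ E]) (use p in \<open>auto simp: t_def\<close>)
  ultimately show ?thesis by (elim order_trans) simp
 qed
 have incl: "{s \<in> space M. \<not> - p < hcross 0 (r * R) 0 R (f s)} \<subseteq> (\<Union>w\<in>W. Ev w)"
 proof
  fix s assume "s \<in> {s \<in> space M. \<not> - p < hcross 0 (r * R) 0 R (f s)}"
  hence s: "s \<in> space M" and no: "\<not> - p < hcross 0 (r * R) 0 R (f s)" by auto
  have o: "0 <= r * R" "0 <= R" using R0 r by auto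
  have "\<not> linked ({0..r * R} \<times> {0..R} \<inter> {x. - p < f s x}) ({0} \<times> UNIV) ({r * R} \<times> UNIV)"
  proof
   assume "linked ({0..r * R} \<times> {0..R} \<inter> {x. - p < f s x}) ({0} \<times> UNIV) ({r * R} \<times> UNIV)"
   then obtain L x y where "path_connected L" "L \<subseteq> {0..r * R} \<times> {0..R} \<inter> {x. - p < f s x}" "x \<in> L" "x \<in> {0} \<times> UNIV" "y \<in> L" "y \<in> {r * R} \<times> UNIV"
    by (rule linkedE) blast
   hence "- p < hcross 0 (r * R) 0 R (f s)" by (intro hcrossI[where K=L and x=x and y=y, OF _ _ _ _ _ _ _ cont]) (use o in auto)
   thus False using no by simp
  qed
  \<comment> \<open>The vertical crossing lies below \<open>- (3 * p / 4)\<close>, which is the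
    level \<open>- (p / 2) - t\<close> that concentration makes unlikely for the rings.\<close>
  from crossing_duality[OF o continuous_on_subset[OF cont] _ this, of "- (3 * p / 4)"]
  have "linked ({0..r * R} \<times> {0..R} \<inter> {x. f s x < - (3 * p / 4)}) (UNIV \<times> {0}) (UNIV \<times> {R})" using p by simp
  then obtain L x y where L: "path_connected L" "L \<subseteq> {0..r * R} \<times> {0..R} \<inter> {x. f s x < - (3 * p / 4)}" "x \<in> L" "x \<in> UNIV \<times> {0}" "y \<in> L" "y \<in> UNIV \<times> {R}"
   by (rule linkedE) blast
  have xy: "snd x = 0" "snd y = R" using L by auto
  obtain zs z where z: "z \<in> L" "snd z = 0" "zs \<in> walks n (cell_of a0 z)" "distinct zs" "set zs \<subseteq> cell_of a0 ` L"
   by (rule crossing_walk[OF a0 L(1,3) xy(1) L(5) xy(2) n(1)]) blast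
  have "z \<in> {0..r * R} \<times> {0..R}" using z(1) L(2) by blast
  hence "0 <= fst z / a0" "fst z / a0 <= r * R / a0" using a0 by (auto simp: mem_Times_iff divide_right_mono)
  hence "0 <= round (fst z / a0)" "round (fst z / a0) <= X" unfolding X_def using round_mono[of 0 "fst z / a0"] round_mono by auto
  moreover have "cell_of a0 z = (round (fst z / a0), 0)" using z(2) by (simp add: cell_of_def)
  ultimately have w: "(round (fst z / a0), zs) \<in> W" unfolding W_def using z by auto
  have "nested_ring K u j (f s) <= - (p / 2) - t" if j: "j \<in> Z zs \<times> {0..<int K}" for j
  proof (rule ccontr)
   assume "\<not> ?thesis"
   hence gt: "- (3 * p / 4) < nested_ring K u j (f s)" by (simp add: t_def)
   define P where "P = cell_center a0 (fst j)"
   obtain v where v: "v \<in> L" "cell_of a0 v = fst j" using j Z(1) z(5) by (force simp: mem_Times_iff)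
   have k: "0 <= real_of_int (snd j)" "real_of_int (snd j) + 1 <= K" using j by auto
   have i: "sup_dist P v <= (real K + 2 * real_of_int (snd j)) * u"
   proof -
    have "sup_dist P v <= real K * u" using cell_of_dist[OF a0, of v] v(2) by (simp add: P_def a_def)
    also have "... <= (real K + 2 * real_of_int (snd j)) * u" using k u by (intro mult_right_mono) auto
    finally show ?thesis .
   qed
   have "(real K + 2 * real_of_int (snd j) + 1) * u <= (3 * real K) * u" using k u by (intro mult_right_mono) auto
   \<comment> \<open>The outer square of the ring is at most \<open>R\<close> high, so a set that
     reaches both height 0 and height \<open>R\<close> cannot stay in its interior.\<close>
   hence bR: "2 * ((real K + 2 * real_of_int (snd j) + 1) * u) <= R" using R by linarith
   have far: "\<exists>y\<in>L. (real K + 2 * real_of_int (snd j) + 1) * u <= sup_dist P y"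
   proof (rule ccontr)
    assume "\<not> ?thesis"
    hence "sup_dist P x < (real K + 2 * real_of_int (snd j) + 1) * u" "sup_dist P y < (real K + 2 * real_of_int (snd j) + 1) * u" using L by auto
    hence "\<bar>snd P\<bar> < (real K + 2 * real_of_int (snd j) + 1) * u" "\<bar>R - snd P\<bar> < (real K + 2 * real_of_int (snd j) + 1) * u"
     unfolding sup_dist_def xy by auto
    thus False using bR by linarith
   qed
   then obtain y' where y': "y' \<in> L" "(real K + 2 * real_of_int (snd j) + 1) * u <= sup_dist P y'" by blast
   show False
    by (rule ring_blocks[OF gt[unfolded nested_ring_def a_def[symmetric] P_def[symmetric]] cont _ _ L(1) _ v(1) i y'])
     (use k u L(2) in \<open>auto intro!: mult_nonneg_nonneg mult_strict_right_mono\<close>)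
  qed
  hence "s \<in> Ev (round (fst z / a0), zs)" unfolding Ev_def using s by simp
  thus "s \<in> (\<Union>w\<in>W. Ev w)" using w by blast
 qed
 have "\<P>(s in M. \<not> - p < hcross 0 (r * R) 0 R (f s)) <= prob (\<Union>w\<in>W. Ev w)"
  by (rule finite_measure_mono[OF incl]) (use W Evm in auto)
 also have "... <= (\<Sum>w\<in>W. prob (Ev w))" by (rule measure_UNION_le[OF W Evm])
 also have "... <= card W * exp (- 4 * (real n + 1))" by (rule sum_bounded_above[OF Evb])
 also have "... <= ((r * R / a0 + 2) * 9 ^ n) * exp (- 4 * (real n + 1))"
 proof (intro mult_right_mono)
  have "card W = (\<Sum>x\<in>{0..X}. card {zs \<in> walks n (x, 0). distinct zs})" unfolding W_def using walks(1) by (intro card_SigmaI) auto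
  also have "... <= (\<Sum>x\<in>{0..X}. 9 ^ n)" using walks(1,2) by (intro sum_mono order_trans[OF card_mono walks(2)]) auto
  finally have "real (card W) <= real (nat (X + 1)) * 9 ^ n" by (simp flip: of_nat_le_iff[where 'a=real])
  also have "... <= (r * R / a0 + 2) * 9 ^ n"
  proof (rule mult_right_mono)
   have "real_of_int X <= r * R / a0 + 1 / 2" unfolding X_def by (rule of_int_round_le)
   moreover have "0 <= X" unfolding X_def using round_mono[of 0 "r * R / a0"] r R0 a0 by simp
   ultimately show "real (nat (X + 1)) <= r * R / a0 + 2" by simp
  qed simp
  finally show "real (card W) <= (r * R / a0 + 2) * 9 ^ n" .
 qed simp
 also have "... <= ((r * R / a0 + 2) * exp (3 * real n)) * exp (- 4 * (real n + 1))"
 proof (intro mult_right_mono mult_left_mono)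
  have "(9 :: real) <= (7 / 4) ^ 4" by (simp add: power_numeral_reduce)
  also have "... <= exp (3 / 4) ^ 4" using exp_ge_add_one_self[of "3 / 4 :: real"] by (intro power_mono) auto
  also have "... = exp 3" by (simp flip: exp_of_nat_mult)
  finally have "(9 :: real) ^ n <= exp 3 ^ n" by (intro power_mono) auto
  thus "9 ^ n <= exp (3 * real n)" by (simp add: exp_of_nat_mult[symmetric] mult.commute)
 qed (use r R0 a0 in auto)
 also have "... = (r * R / a0 + 2) * exp (- real n - 4)" by (simp add: mult.assoc algebra_simps flip: exp_add)
 also have "... <= (r * R / a0 + 2) * exp (1 - R / a0)" using n(2) r R0 a0 by (intro mult_left_mono) auto
 finally show ?thesis .
qed

text \<open>It serves bounded \<open>R\<close>, where any positive lower bound suffices. At height 0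
  a crossing means that \<open>f > l\<close> on the whole segment. For a short segment this has
  positive probability, since \<open>f > l\<close> at the origin with probability at least
  \<open>1 / 2\<close> and \<open>f\<close> is continuous; positive association chains short
  segments.\<close>

lemma segment_likely:
 assumes l: "l < 0" and L: "0 <= L"
 obtains u where "0 < u" "likely l (hcross 0 L 0 0) u"
proof -
 define d where "d n = 1 / real (Suc n)" for n
 have d: "0 < d n" for n by (simp add: d_def)
 define E where "E n = {s \<in> space M. hcross 0 (d n) 0 0 (f s) > l}" for n
 have mE: "maxmin (hcross 0 x 0 0) (rect 0 x 0 0)" if "0 <= x" for x using that by (intro maxmin_hcross) auto
 have Em: "E n \<in> sets M" for n unfolding E_def using maxmin_measurable[OF mE[of "d n"]] d[of n] by auto
 have sub: "{s \<in> space M. hcross 0 0 0 0 (f s) > l} \<subseteq> (\<Union>n. E n)"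
 proof
  fix s assume "s \<in> {s \<in> space M. hcross 0 0 0 0 (f s) > l}"
  hence s: "s \<in> space M" and h: "hcross 0 0 0 0 (f s) > l" by auto
  obtain X x y where X: "X \<subseteq> {x. l < f s x}" "X \<subseteq> rect 0 0 0 0" "x \<in> X" by (rule hcrossE[OF h cont]) auto
  have "x \<in> rect 0 0 0 0" "x \<in> {x. l < f s x}" using X by blast+
  moreover from this have "x = 0" by (simp add: mem_rect prod_eq_iff)
  ultimately have "l < f s 0" by simp
  moreover have "open {x. l < f s x}" by (intro open_Collect_less continuous_intros cont)
  ultimately obtain e where e: "e > 0" "ball 0 e \<subseteq> {x. l < f s x}" unfolding open_contains_ball by blast
  obtain n where "inverse (real (Suc n)) < e" using reals_Archimedean[OF e(1)] by blast
  hence n: "d n < e" by (simp add: d_def inverse_eq_divide)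
  have "rect 0 (d n) 0 0 \<subseteq> ball 0 e"
  proof
   fix z assume "z \<in> rect 0 (d n) 0 0"
   hence "snd z = 0" "0 <= fst z" "fst z <= d n" by (auto simp: mem_rect)
   hence "norm z = fst z" by (simp add: norm_prod_def)
   thus "z \<in> ball 0 e" using n \<open>fst z <= d n\<close> by simp
  qed
  hence "hcross 0 (d n) 0 0 (f s) > l"
   using e(2) d[of n] by (intro hcrossI[where K="rect 0 (d n) 0 0" and x="(0, 0)" and y="(d n, 0)", OF _ _ _ _ _ _ _ cont])
    (auto simp: rect_def intro!: convex_imp_path_connected convex_Times)
  thus "s \<in> (\<Union>n. E n)" using s by (auto simp: E_def)
 qed
 have "\<exists>n. prob (E n) \<noteq> 0"
 proof (rule ccontr)
  assume "\<not> ?thesis"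
  hence "E n \<in> null_sets M" for n using Em by (auto simp: null_sets_def emeasure_eq_measure)
  hence "prob (\<Union>n. E n) = 0" by (intro measure_eq_0_null_sets null_sets_UN) auto
  moreover have "\<P>(s in M. hcross 0 0 0 0 (f s) > l) <= prob (\<Union>n. E n)" using sub Em by (intro finite_measure_mono) auto
  moreover have "1 / 2 <= \<P>(s in M. hcross 0 0 0 0 (f s) > l)" using likely_square[OF l, of 0] by (simp add: likely_def)
  ultimately show False by simp
 qed
 then obtain n where n: "0 < prob (E n)" by (metis measure_nonneg order_le_less)
 define q where "q = prob (E n)"
 have base: "likely l (hcross 0 (d n) 0 0) q" unfolding likely_def q_def E_def using mE[of "d n"] d[of n] by auto
 have chain: "likely l (hcross 0 (real (Suc k) * d n) 0 0) (q ^ Suc k)" for k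
 proof (induction k)
  case (Suc k)
  define w where "w = real (Suc k) * d n"
  have w: "0 <= w" using d[of n] by (simp add: w_def)
  have eq: "real (Suc (Suc k)) * d n = d n + w" by (simp add: w_def algebra_simps)
  have T: "likely l (%g. min (hcross 0 w 0 0 g) (hcross (0 + w) (d n + w) (0 + 0) (0 + 0) g)) (q ^ Suc k * q)"
   using Suc n d[of n] unfolding w_def[symmetric] by (intro likely_min likely_hcross_image(1) base) (auto simp: q_def)
  have "likely l (hcross 0 (d n + w) 0 0) (q ^ Suc k * q)"
  proof (rule likely_mono[OF T mE])
   fix g :: "plane => real" assume g: "continuous_on UNIV g" and h: "min (hcross 0 w 0 0 g) (hcross (0 + w) (d n + w) (0 + 0) (0 + 0) g) > l"
   have h1: "hcross 0 w 0 0 g > l" and h2: "hcross w (d n + w) 0 0 g > l" using h by auto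
   have o: "w <= d n + w" using d[of n] by simp
   obtain K1 x1 y1 where 1: "path_connected K1" "K1 \<subseteq> {x. l < g x}" "K1 \<subseteq> rect 0 w 0 0" "x1 \<in> K1" "fst x1 = 0" "y1 \<in> K1" "fst y1 = w"
    using hcrossE[OF h1 g w] by blast
   obtain K2 x2 y2 where 2: "path_connected K2" "K2 \<subseteq> {x. l < g x}" "K2 \<subseteq> rect w (d n + w) 0 0" "x2 \<in> K2" "fst x2 = w" "y2 \<in> K2" "fst y2 = d n + w"
    using hcrossE[OF h2 g o] by blast
   have "y1 \<in> rect 0 w 0 0" "x2 \<in> rect w (d n + w) 0 0" using 1 2 by blast+
   hence "y1 = x2" using 1(7) 2(5) by (simp add: mem_rect prod_eq_iff)
   hence pc: "path_connected (K1 \<union> K2)" using 1(1,6) 2(1,4) by (intro path_connected_Un) auto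
   have su: "K1 \<union> K2 \<subseteq> {x. l < g x}" using 1(2) 2(2) by blast
   have sn: "K1 \<union> K2 \<subseteq> {z. 0 <= snd z \<and> snd z <= 0}" by (intro Un_least subset_rect_snd[OF 1(3)] subset_rect_snd[OF 2(3)]) auto
   show "hcross 0 (d n + w) 0 0 g > l"
    by (rule hcrossI[where x=x1 and y=y2, OF pc su _ _ _ _ sn g]) (use 1(4,5) 2(6,7) w d[of n] in auto)
  qed (use w d[of n] in auto)
  thus ?case unfolding eq by (simp add: mult.commute)
 qed (use base in simp)
 obtain k :: nat where k: "L / d n <= real k" using real_arch_simple by blast
 have "L <= real k * d n" using k d[of n] by (simp add: pos_divide_le_eq)
 also have "... <= real (Suc k) * d n" using d[of n] by (intro mult_right_mono) auto
 finally have kL: "L <= real (Suc k) * d n" .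
 have "likely l (hcross 0 L 0 0) (q ^ Suc k)"
  by (rule likely_mono[OF chain mE[OF L]]) (rule hcross_narrow[OF _ _ L kL], auto)
 moreover have "0 < q ^ Suc k" using n by (simp add: q_def)
 ultimately show ?thesis by (intro that)
qed

text \<open>For large \<open>R\<close> half of the exponential decay in
  \<open>no_crossing_bound\<close> absorbs its linear factor. For \<open>R <= R1\<close> a crossing
  along the bottom side has probability at least \<open>d\<close>, and \<open>c\<close> is small
  enough for \<open>1 - exp (- c * R) <= d\<close> on this range.\<close>

lemma crossing_lower_bound:
 assumes p: "0 < p" and r: "0 < r"
 shows "\<exists>c>0. \<forall>R>0. 1 - exp (- c * R) <= \<P>(w in M. - p < hcross 0 (r * R) 0 R (f w))"
proof -
 obtain K :: nat and u where K: "1 <= K" "5 <= u" "200 * lattice_sum <= K * (p / 4)\<^sup>2"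
  "!!j. snd j \<in> {0..<int K} ==> - (p / 2) <= mean (%w. nested_ring K u j (f w))" by (rule ring_parameters[OF p]) blast
 define a0 where "a0 = 2 * real K * u"
 have a0: "0 < a0" using K by (simp add: a0_def)
 \<comment> \<open>With \<open>y = R / (4 * a0)\<close> the second term gives
   \<open>y >= 12 * r + 6\<close>, enough for the linear factor times \<open>exp 1\<close> to be at
   most \<open>(1 + y) ^ 2 <= exp (2 * y)\<close>.\<close>
 define R1 where "R1 = max (6 * real K * u) (4 * a0 * (12 * r + 6))"
 have R1: "0 < R1" using a0 r by (simp add: R1_def less_max_iff_disj)
 have pm: "\<P>(w in M. - p < hcross 0 (r * R) 0 R (f w)) = 1 - \<P>(w in M. \<not> - p < hcross 0 (r * R) 0 R (f w))" if "0 < R" for R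
  using maxmin_measurable[OF maxmin_hcross[of 0 "r * R" 0 R]] that r by (subst prob_neg) auto
 have big: "1 - exp (- (1 / (2 * a0)) * R) <= \<P>(w in M. - p < hcross 0 (r * R) 0 R (f w))" if R: "R1 <= R" for R
 proof -
  define y where "y = R / (4 * a0)"
  have "4 * a0 * (12 * r + 6) <= R" using R by (simp add: R1_def)
  hence y: "12 * r + 6 <= y" using a0 by (simp add: y_def pos_le_divide_eq mult.commute)
  have Ra: "R / a0 = 4 * y" "r * R / a0 = 4 * r * y" "- (1 / (2 * a0)) * R = - (2 * y)" using a0 by (simp_all add: y_def)
  have y0: "0 < y" using y r by linarith
  have "(4 * r * y + 2) * exp 1 <= (4 * r * y + 2) * 3" using exp_le r y0 by (intro mult_left_mono) auto
  also have "... = 12 * r * y + 6" by simp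
  also have "... <= (1 + y)\<^sup>2"
  proof -
   have "(12 * r + 6) * y <= y * y" using y y0 by (intro mult_right_mono) auto
   moreover have "6 * 1 <= 6 * y" using y r by simp
   ultimately show ?thesis using y0 by (simp add: power2_eq_square algebra_simps)
  qed
  also have "... <= (exp y)\<^sup>2" using exp_ge_add_one_self[of y] y0 by (intro power_mono) auto
  also have "... = exp (2 * y)" by (simp add: power2_eq_square flip: exp_add)
  finally have "(4 * r * y + 2) * exp 1 * exp (- (4 * y)) <= exp (2 * y) * exp (- (4 * y))" by (intro mult_right_mono) auto
  moreover have "exp (1 - 4 * y) = exp 1 * exp (- (4 * y))" "exp (- (2 * y)) = exp (2 * y) * exp (- (4 * y))" by (simp_all flip: exp_add)
  ultimately have "(r * R / a0 + 2) * exp (1 - R / a0) <= exp (- (1 / (2 * a0)) * R)" unfolding Ra by (simp only: mult.assoc)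
  moreover have "\<P>(w in M. \<not> - p < hcross 0 (r * R) 0 R (f w)) <= (r * R / a0 + 2) * exp (1 - R / a0)"
   by (rule no_crossing_bound[OF p K _ r a0_def]) (use R in \<open>auto simp: R1_def\<close>)
  ultimately show ?thesis using pm[of R] R R1 by linarith
 qed
 have mp: "- p < 0" and L0: "0 <= r * R1" using p r R1 by auto
 obtain d0 where d0: "0 < d0" "likely (- p) (hcross 0 (r * R1) 0 0) d0" by (rule segment_likely[OF mp L0]) blast
 \<comment> \<open>Kept below 1, so that \<open>ln (1 - d)\<close> is meaningful and
   negative.\<close>
 define d where "d = min d0 (1 / 2)"
 have d: "0 < d" "d < 1" using d0 by (auto simp: d_def)
 have small: "d <= \<P>(w in M. - p < hcross 0 (r * R) 0 R (f w))" if R: "0 < R" "R <= R1" for R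
 proof -
  have RR: "0 <= r * R" "r * R <= r * R1" using R r by auto
  have "likely (- p) (hcross 0 (r * R) 0 R) d0"
  proof (rule likely_mono[OF d0(2) maxmin_hcross])
   fix g :: "plane => real" assume g: "continuous_on UNIV g" and h: "- p < hcross 0 (r * R1) 0 0 g"
   obtain X x y where X: "path_connected X" "X \<subseteq> {x. - p < g x}" "X \<subseteq> rect 0 (r * R1) 0 0" "x \<in> X" "fst x = 0" "y \<in> X" "fst y = r * R1"
    using hcrossE[OF h g L0] by blast
   show "- p < hcross 0 (r * R) 0 R g"
    by (rule hcrossI[OF X(1,2,4) _ X(6) _ subset_rect_snd[OF X(3)] g RR(1)]) (use X R RR in auto)
  qed (use R RR in auto)
  thus ?thesis unfolding likely_def using min.cobounded1[of d0 "1 / 2"] unfolding d_def by linarith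
 qed
 define c where "c = min (1 / (2 * a0)) (- ln (1 - d) / R1)"
 have "ln (1 - d) < 0" using d by (subst ln_less_zero_iff) auto
 hence c: "0 < c" using a0 R1 by (simp add: c_def divide_neg_pos)
 have "1 - exp (- c * R) <= \<P>(w in M. - p < hcross 0 (r * R) 0 R (f w))" if R: "0 < R" for R
 proof (cases "R1 <= R")
  case True
  have "c * R <= (1 / (2 * a0)) * R" using R by (intro mult_right_mono) (auto simp: c_def)
  hence "exp (- (1 / (2 * a0)) * R) <= exp (- c * R)" by simp
  thus ?thesis using big[OF True] by linarith
 next
  case False
  have "c * R <= (- ln (1 - d) / R1) * R1" using R False c by (intro mult_mono) (auto simp: c_def)
  hence "exp (ln (1 - d)) <= exp (- c * R)" using R1 by simp
  hence "1 - d <= exp (- c * R)" using d by simp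
  thus ?thesis using small[OF R] False by linarith
 qed
 thus ?thesis using c by blast
qed

text \<open>A crossing by the closed set \<open>f >= - p\<close> is implied by
  \<open>- p < ?T z\<close> and implies \<open>- p <= ?T z\<close>. The two conditions differ by an
  event that is null by \<open>maxmin_no_atom\<close>, which also places the crossing event in the
  completion.\<close>

lemma crossed_left_right_AE:
 assumes p: "0 < p" and w: "0 <= w" "0 <= h" and g: "AE z in M. f z = g z"
 shows "crossing_prob M g p w h = \<P>(z in M. - p < hcross 0 w 0 h (f z))"
proof -
 let ?T = "%z. hcross 0 w 0 h (f z)"
 have T: "maxmin (hcross 0 w 0 h) (rect 0 w 0 h)" using w by (intro maxmin_hcross)
 note [measurable] = maxmin_measurable[OF T]
 have low: "crossed_left_right (f z -` {- p..}) w h" if gt: "- p < ?T z" for z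
 proof -
  obtain X x y where X: "path_connected X" "X \<subseteq> {x. - p < f z x}" "X \<subseteq> rect 0 w 0 h" "x \<in> X" "fst x = 0" "y \<in> X" "fst y = w"
   using hcrossE[OF gt cont w] by blast
  obtain c where c: "path c" "path_image c \<subseteq> X" "pathstart c = x" "pathfinish c = y" using X unfolding path_connected_def by blast
  have "x \<in> rect 0 w 0 h" "y \<in> rect 0 w 0 h" using X by auto
  hence "x \<in> {0} \<times> {0..h}" "y \<in> {w} \<times> {0..h}" using X(5,7) by (auto simp: rect_def mem_Times_iff)
  moreover have "path_image c \<subseteq> f z -` {- p..}" using c(2) X(2) by fastforce
  moreover have "path_image c \<subseteq> {0..w} \<times> {0..h}" using c(2) X(3) unfolding rect_def by blast
  ultimately show ?thesis unfolding crossed_left_right_def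
   using c(1,3,4) by (intro exI[of _ c]) simp
 qed
 have up: "- p <= ?T z" if cr: "crossed_left_right (f z -` {- p..}) w h" for z
 proof (rule dense_le)
  fix l assume l: "l < - p"
  obtain c where c: "path c" "path_image c \<subseteq> (f z -` {- p..}) \<inter> ({0..w} \<times> {0..h})" "pathstart c \<in> {0} \<times> {0..h}" "pathfinish c \<in> {w} \<times> {0..h}"
   using cr unfolding crossed_left_right_def by metis
  have "l < ?T z"
   by (rule hcrossI[OF path_connected_path_image[OF c(1)] _ pathstart_in_path_image _ pathfinish_in_path_image _ _ cont w(1)])
    (use c l in \<open>force simp: mem_Times_iff\<close>)+
  thus "l <= ?T z" by simp
 qed
 let ?A = "{z \<in> space M. crossed_left_right (g z -` {- p..}) w h}" and ?B = "{z \<in> space M. - p < ?T z}"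
 have "{z \<in> space M. ?T z = - p} \<in> null_sets M" using maxmin_no_atom[OF T, of "- p"] by (auto simp: null_sets_def emeasure_eq_measure)
 hence "AE z in M. ?T z \<noteq> - p" by (auto intro: AE_I' )
 hence eq: "AE z in M. z \<in> ?A \<longleftrightarrow> z \<in> ?B" using g AE_space
 proof eventually_elim
  fix z assume *: "?T z \<noteq> - p" "f z = g z" "z \<in> space M"
  show "z \<in> ?A \<longleftrightarrow> z \<in> ?B" using low[of z] up[of z] * by auto
 qed
 have B: "?B \<in> sets M" by measurable
 obtain N where N: "N \<in> null_sets M" "{z \<in> space M. \<not> (z \<in> ?A \<longleftrightarrow> z \<in> ?B)} \<subseteq> N" using eq by (auto elim: AE_E3 simp: eventually_ae_filter)
 have "?A \<in> sets (completion M)"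
 proof (rule sets_completionI[of _ "?B - N" "?A \<inter> N" N])
  show "?A = ?B - N \<union> ?A \<inter> N" using N(2) by blast
 qed (use N B in auto)
 hence "measure (completion M) ?A = measure (completion M) ?B"
  using B AE_completion[OF eq] by (intro measure_eq_AE) (auto intro: sets_completionI_sets)
 thus ?thesis unfolding crossing_prob_def using B by simp
qed

end

theorem theorem1p8:
 fixes M :: "'w measure" and a :: "nat \<times> nat \<Rightarrow> 'w \<Rightarrow> real" and p :: real
 assumes "iid_std_normal M a" and "p > 0"
 shows "\<forall>\<rho>>0. \<exists>c>0. \<forall>R>0.
      crossing_prob M (bargmann_fock a) p (\<rho> * R) R \<ge> 1 - exp (- c * R)"
proof (intro allI impI)
 fix \<rho> :: real assume \<rho>: "\<rho> > 0"
 obtain f where f: "planar_field M f a bf_coeff" "AE \<omega> in M. f \<omega> = bargmann_fock a \<omega>"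
  by (rule bargmann_fock_planar_field[OF assms(1)]) blast
 interpret planar_field M f a bf_coeff by (rule f(1))
 obtain c where c: "c > 0" "\<And>R. R > 0 \<Longrightarrow> 1 - exp (- c * R) \<le> \<P>(\<omega> in M. - p < hcross 0 (\<rho> * R) 0 R (f \<omega>))"
  using crossing_lower_bound[OF assms(2) \<rho>] by blast
 show "\<exists>c>0. \<forall>R>0. crossing_prob M (bargmann_fock a) p (\<rho> * R) R \<ge> 1 - exp (- c * R)"
 proof (intro exI[of _ c] conjI allI impI c(1))
  fix R :: real assume R: "R > 0"
  have "crossing_prob M (bargmann_fock a) p (\<rho> * R) R = \<P>(\<omega> in M. - p < hcross 0 (\<rho> * R) 0 R (f \<omega>))"
   by (rule crossed_left_right_AE[OF assms(2) _ _ f(2)]) (use \<rho> R in auto)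
  thus "crossing_prob M (bargmann_fock a) p (\<rho> * R) R \<ge> 1 - exp (- c * R)" using c(2)[OF R] by simp
 qed
qed

end
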